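(* For every $\epsilon>0$ and every $T\in[0,\infty)$ there exists $c=c(\epsilon,T)>0$ such that for all integers $N\geq 1$, $$\mathbb E\big(\langle \sigma_o\rangle_{\mu^{\Lambda_N,+}}-\langle \sigma_o\rangle_{\mu^{\Lambda_N,-}}\big)\leq c^{-1}e^{-cN}.$$
   Context: Let $\{h_v:v\in\mathbb Z^2\}$ be i.i.d. Gaussian random variables with mean zero and variance $\epsilon^2>0$; $\mathbb P$ and $\mathbb E$ denote probability and expectation with respect to this field. Write $u\sim v$ if $|u-v|_1=1$. For $A\subset\mathbb Z^2$, $\partial A=\{v\in\mathbb Z^2\setminus A: u\sim v \text{ for some } u\in A\}$. For $N\geq1$, $\Lambda_N=\{v\in\mathbb Z^2:|v|_\infty\leq N\}$ and $o$ is the origin. The Hamiltonian with plus (resp. minus) boundary condition is, for $\sigma\in\{-1,1\}^{\Lambda_N}$, $$H^{\Lambda_N,\pm}(\sigma)=-\Big(\sum_{u\sim v,\,u,v\in\Lambda_N}\sigma_u\sigma_v\pm\sum_{u\sim v,\,u\in\Lambda_N,\,v\in\partial\Lambda_N}\sigma_u+\sum_{u\in\Lambda_N}\sigma_uh_u\Big),$$ each unordered pair $u\sim v$ counted once. For temperature $T=1/\beta>0$, quenched on $\{h_v\}$, $\mu^{\Lambda_N,\pm}(\sigma)=e^{-\beta H^{\Lambda_N,\pm}(\sigma)}/Z^{\Lambda_N,\pm}$ with $Z^{\Lambda_N,\pm}$ the normalizing constant. For $T=0$, $\mu^{\Lambda_N,\pm}$ is the point mass on the minimizer (ground state) of $H^{\Lambda_N,\pm}$,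 which is unique with probability 1. $\langle\cdot\rangle_{\mu}$ denotes expectation under $\mu$. *)

theory Defs
  imports "HOL-Probability.Probability"
begin

type_synonym site = "int \<times> int"

definition adj :: "site \<Rightarrow> site \<Rightarrow> bool" where
  "adj u v \<longleftrightarrow> \<bar>fst u - fst v\<bar> + \<bar>snd u - snd v\<bar> = 1"

definition box :: "nat \<Rightarrow> site set" where
  "box N = {v. \<bar>fst v\<bar> \<le> int N \<and> \<bar>snd v\<bar> \<le> int N}"

definition outer_boundary :: "site set \<Rightarrow> site set" where
  "outer_boundary A = {v. v \<notin> A \<and> (\<exists>u\<in>A. adj u v)}"

definition origin :: site where "origin = (0, 0)"

text \<open>Spin configurations on the box: spins in {-1,1} on the box, fixed to 0 outside
  (so that configurations on the box correspond bijectively to these functions).\<close>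
definition configs :: "nat \<Rightarrow> (site \<Rightarrow> real) set" where
  "configs N = {\<sigma>. (\<forall>v\<in>box N. \<sigma> v \<in> {-1, 1}) \<and> (\<forall>v. v \<notin> box N \<longrightarrow> \<sigma> v = 0)}"

text \<open>Hamiltonian with boundary condition b (b = 1 for plus, b = -1 for minus).
  Each unordered nearest-neighbour pair inside the box is counted once
  (ordered pairs counted, divided by 2).\<close>
definition hamiltonian :: "nat \<Rightarrow> real \<Rightarrow> (site \<Rightarrow> real) \<Rightarrow> (site \<Rightarrow> real) \<Rightarrow> real" where
  "hamiltonian N b h \<sigma> =
     - ((1/2) * (\<Sum>(u,v)\<in>{(u,v). u \<in> box N \<and> v \<in> box N \<and> adj u v}. \<sigma> u * \<sigma> v)
        + b * (\<Sum>(u,v)\<in>{(u,v). u \<in> box N \<and> v \<in> outer_boundary (box N) \<and> adj u v}. \<sigma> u)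
        + (\<Sum>u\<in>box N. \<sigma> u * h u))"

text \<open>Quenched expectation of the spin at the origin under the Gibbs measure at
  temperature T > 0; at T = 0 the average over the minimisers of the Hamiltonian
  (the ground state, which is a.s. unique, so this equals its spin at the origin a.s.).\<close>
definition spin_avg :: "real \<Rightarrow> nat \<Rightarrow> real \<Rightarrow> (site \<Rightarrow> real) \<Rightarrow> real" where
  "spin_avg T N b h =
     (if T > 0 then
        (\<Sum>\<sigma>\<in>configs N. \<sigma> origin * exp (- (1/T) * hamiltonian N b h \<sigma>)) /
        (\<Sum>\<sigma>\<in>configs N. exp (- (1/T) * hamiltonian N b h \<sigma>))
      else
        (let G = {\<sigma>\<in>configs N. \<forall>\<tau>\<in>configs N. hamiltonian N b h \<sigma> \<le> hamiltonian N b h \<tau>}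
         in (\<Sum>\<sigma>\<in>G. \<sigma> origin) / real (card G)))"

definition field_measure :: "real \<Rightarrow> (site \<Rightarrow> real) measure" where
  "field_measure eps = (\<Pi>\<^sub>M v\<in>UNIV. density lborel (normal_density 0 eps))"

end

theory Submission
  imports Defs
begin

text \<open>
 Condition on the field \<open>h\<close>. Take two independent copies of the system, with plus and with minus boundary condition, described
 by the sets \<open>M\<close>, \<open>M'\<close> of spins that disagree with their own boundary, and close every edge independently with probability
 \<open>exp (- 4 * be)\<close>. Let \<open>K\<close> be the cluster of sites joined to the boundary by open edges off \<open>M Un M'\<close>. Exchanging the two copies off
 \<open>K\<close> preserves the measure, so the difference of the magnetisations at \<open>v\<close> is twice the probability that \<open>v\<close> belongs to \<open>K\<close>.
 Applied with shifted fields, the same exchange bounds the mean size of \<open>K\<close> inside a region, integrated over a uniform shift \<open>u\<close> of the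
 field there, by the number of edges of any cut that surrounds the region inside \<open>K\<close>.

 On a tiling, this inequality and the planarity of \<open>K\<close>-circuits contradict the exchangeability of far away tiles unless tubes of fixed
 shape are, uniformly in scale, crossed by \<open>K\<close> with probability bounded away from one. By the argument of Aizenman and Burchard, paths in
 \<open>K\<close> across distance \<open>r\<close> then have at least \<open>r powr (1 + a)\<close> sites outside an event of tiny probability, so that one of the
 intrinsic layers of \<open>K\<close> in an annulus is a cut with few edges. With the Gaussian bound for the influence of the shift this gives a
 recursion for the order parameter that improves polynomial decay until its exponent exceeds one, after which a finite-size criterion
 yields exponential decay. All bounds are uniform in the temperature, and zero temperature is obtained as a limit.
\<close>

text \<open>In two dimensions boundary cost and field fluctuation balance. A field shift of order 1
  / r on a tile of side r involves about r^2 Gaussian variables and leaves their joint law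
  absolutely continuous with a density of bounded second moment; the energy inequality, averaged
  over about r disjoint cuts, is just able to see such a shift. Scale-invariant arguments therefore
  give bounded probabilities and no decay. Decay needs a gain by a power of r. It comes from the
  geometry of \<open>K\<close>: if crossings of an annulus have at least r powr (1 + a) sites, the
  annulus contains that many disjoint intrinsic layers, so a typical layer has far fewer edges than
  a cut chosen geometrically, and a shift somewhat weaker than 1 / r suffices. The temperature
  disappears because closing probability and partition functions carry the same factor
  \<open>be\<close> in their exponents; after Jensen and a logarithm it cancels. No mixing estimate
  occurs: in a smaller box the cluster is stochastically larger, so increasing events in separated
  boxes are bounded by products.\<close>

section \<open>Correlation inequalities on finite lattices of sets\<close>

lemma four_functions_point:
 fixes a0 a1 b0 b1 c0 c1 d0 d1 :: real
 assumes "0 <= a0" "0 <= a1" "0 <= b0" "0 <= b1" "0 <= c0" "0 <= c1" "0 <= d0" "0 <= d1"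
  and "a0 * b0 <= c0 * d0" "a0 * b1 <= c1 * d0" "a1 * b0 <= c1 * d0" "a1 * b1 <= c1 * d1"
 shows "(a0 + a1) * (b0 + b1) <= (c0 + c1) * (d0 + d1)"
proof -
 define P Q R where "P = a0 * b1" and "Q = a1 * b0" and "R = c1 * d0"
 have nn: "0 <= P" "0 <= Q" "P <= R" "Q <= R" "0 <= c0 * d1"
  using assms unfolding P_def Q_def R_def by (auto intro: mult_nonneg_nonneg)
 have "P * Q = (a0 * b0) * (a1 * b1)" unfolding P_def Q_def by (simp add: algebra_simps)
 also have "... <= (c0 * d0) * (c1 * d1)" by (rule mult_mono) (use assms in auto)
 also have "... = R * (c0 * d1)" unfolding R_def by (simp add: algebra_simps)
 finally have PQ: "P * Q <= R * (c0 * d1)" .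
 \<comment> \<open>Two of the four cross products are compared with the same \<open>R\<close>, so
   their sum has to be controlled through their product, by expanding (R - P) * (R - Q) >=
   0.\<close>
 have "P + Q <= R + c0 * d1"
 proof (cases "R = 0")
  case True
  thus ?thesis using nn by auto
 next
  case False
  hence R: "R > 0" using nn by linarith
  have "0 <= (R - P) * (R - Q)" using nn by auto
  hence "R * (P + Q) <= R * R + P * Q" by (simp add: algebra_simps)
  also have "... <= R * (R + c0 * d1)" using PQ by (simp add: algebra_simps)
  finally show ?thesis using R by simp
 qed
 thus ?thesis using assms unfolding P_def Q_def R_def by (simp add: algebra_simps)
qed

lemma sum_Pow_insert:
 fixes f :: "'a set => 'b::comm_monoid_add"
 assumes "finite X" "x ~: X"
 shows "(SUM A:Pow (insert x X). f A) = (SUM A:Pow X. f A + f (insert x A))"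
proof -
 have "inj_on (insert x) (Pow X)" using assms by (auto simp: inj_on_def)
 moreover have "Pow X Int insert x ` Pow X = {}" using assms by auto
 ultimately show ?thesis
  using assms by (simp add: Pow_insert sum.union_disjoint sum.reindex sum.distrib)
qed

text \<open>The Ahlswede-Daykin inequality. In the induction, summing each function over the state
  of the new element \<open>x\<close> preserves the hypothesis; this is the one-element case
  \<open>four_functions_point\<close>, applied with \<open>A\<close> and \<open>B\<close> fixed off
  \<open>x\<close>.\<close>

theorem four_functions:
 fixes af be \<gamma> de :: "'a set => real"
 assumes "finite X"
  and "!!A. A \<subseteq> X ==> 0 <= af A" "!!A. A \<subseteq> X ==> 0 <= be A"
    "!!A. A \<subseteq> X ==> 0 <= \<gamma> A" "!!A. A \<subseteq> X ==> 0 <= de A"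
  and "!!A B. A \<subseteq> X ==> B \<subseteq> X ==> af A * be B <= \<gamma> (A Un B) * de (A Int B)"
 shows "(SUM A:Pow X. af A) * (SUM A:Pow X. be A) <= (SUM A:Pow X. \<gamma> A) * (SUM A:Pow X. de A)"
 using assms
proof (induction X arbitrary: af be \<gamma> de rule: finite_induct)
 case empty
 thus ?case by force
next
 case (insert x X)
 let ?e = "%f::'a set => real. %A. f A + f (insert x A)"
 have "(SUM A:Pow X. ?e af A) * (SUM A:Pow X. ?e be A) <= (SUM A:Pow X. ?e \<gamma> A) * (SUM A:Pow X. ?e de A)"
 proof (rule insert.IH)
  fix A B assume AB: "A \<subseteq> X" "B \<subseteq> X"
  hence x: "x ~: A" "x ~: B" using insert.hyps by auto
  have AB': "A \<subseteq> insert x X" "B \<subseteq> insert x X" "insert x A \<subseteq> insert x X" "insert x B \<subseteq> insert x X"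
   using AB by auto
  have e: "insert x A Un B = insert x (A Un B)" "A Un insert x B = insert x (A Un B)"
   "insert x A Un insert x B = insert x (A Un B)"
   "insert x A Int B = A Int B" "A Int insert x B = A Int B" "insert x A Int insert x B = insert x (A Int B)"
   using x by auto
  have u: "A Un B \<subseteq> insert x X" "insert x (A Un B) \<subseteq> insert x X" "A Int B \<subseteq> insert x X"
   "insert x (A Int B) \<subseteq> insert x X" using AB by auto
  show "?e af A * ?e be B <= ?e \<gamma> (A Un B) * ?e de (A Int B)"
  proof (rule four_functions_point)
   show "af A * be B <= \<gamma> (A Un B) * de (A Int B)" using insert.prems(5) AB' by blast
   show "af A * be (insert x B) <= \<gamma> (insert x (A Un B)) * de (A Int B)"
    using insert.prems(5)[OF AB'(1) AB'(4)] e by simp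
   show "af (insert x A) * be B <= \<gamma> (insert x (A Un B)) * de (A Int B)"
    using insert.prems(5)[OF AB'(3) AB'(2)] e by simp
   show "af (insert x A) * be (insert x B) <= \<gamma> (insert x (A Un B)) * de (insert x (A Int B))"
    using insert.prems(5)[OF AB'(3) AB'(4)] e by simp
  qed (use insert.prems AB' u in auto)
 qed (auto intro!: add_nonneg_nonneg insert.prems)
 thus ?case using insert.hyps by (simp add: sum_Pow_insert)
qed

text \<open>Weights stay unnormalised because conditioning on subsets of a smaller ground set is
  then simply a change of \<open>X\<close>.\<close>

definition avg :: "'a set => ('a set => real) => ('a set => real) => real" where
 "avg X w f = (SUM A:Pow X. w A * f A) / (SUM A:Pow X. w A)"

definition logsup :: "('a set => real) => 'a set => bool" where
 "logsup w X \<longleftrightarrow> (\<forall>A B. A \<subseteq> X --> B \<subseteq> X --> w A * w B <= w (A Un B) * w (A Int B))"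

definition decr :: "'a set => ('a set => real) => bool" where
 "decr X f \<longleftrightarrow> (\<forall>A B. A \<subseteq> B --> B \<subseteq> X --> f B <= f A)"

lemma decrD: "decr X f ==> A \<subseteq> B ==> B \<subseteq> X ==> f B <= f A"
 by (simp add: decr_def)

lemma logsupD: "logsup w X ==> A \<subseteq> X ==> B \<subseteq> X ==> w A * w B <= w (A Un B) * w (A Int B)"
 by (simp add: logsup_def)

lemma sum_Pow_pos:
 assumes "finite X" "!!A. (w A :: real) > 0"
 shows "(SUM A:Pow X. w A) > 0"
 using assms by (intro sum_pos) auto

lemma avg_cong:
 assumes "!!A. A \<subseteq> X ==> w A = w' A" "!!A. A \<subseteq> X ==> f A = f' A"
 shows "avg X w f = avg X w' f'"
proof -
 have "(SUM A:Pow X. w A * f A) = (SUM A:Pow X. w' A * f' A)" "(SUM A:Pow X. w A) = (SUM A:Pow X. w' A)"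
  using assms by (auto intro!: sum.cong)
 thus ?thesis by (simp add: avg_def)
qed

lemma avg_mono:
 assumes "!!A. (w A :: real) > 0" "!!A. A \<subseteq> X ==> f A <= g A"
 shows "avg X w f <= avg X w g"
 unfolding avg_def by (intro divide_right_mono sum_mono mult_left_mono sum_nonneg)
  (use assms in \<open>auto intro: less_imp_le\<close>)

lemma avg_nonneg:
 assumes "!!A. (w A :: real) > 0" "!!A. A \<subseteq> X ==> 0 <= f A"
 shows "0 <= avg X w f"
 unfolding avg_def by (intro divide_nonneg_nonneg sum_nonneg mult_nonneg_nonneg)
  (use assms in \<open>auto intro: less_imp_le\<close>)

lemma avg_pos:
 assumes "finite X" "!!A. (w A :: real) > 0" "!!A. A \<subseteq> X ==> 0 <= f A" "A0 \<subseteq> X" "0 < f A0"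
 shows "0 < avg X w f"
 unfolding avg_def
proof (rule divide_pos_pos)
 show "0 < (SUM A:Pow X. w A * f A)"
  by (rule sum_pos2[of _ A0]) (use assms in \<open>auto intro!: mult_nonneg_nonneg mult_pos_pos less_imp_le[OF assms(2)]\<close>)
qed (rule sum_Pow_pos[OF assms(1,2)])

lemma avg_const [simp]:
 assumes "finite X" "!!A. (w A :: real) > 0"
 shows "avg X w (%_. c) = c"
 using sum_Pow_pos[of X w] assms unfolding avg_def by (simp add: sum_distrib_right[symmetric] less_imp_neq[THEN not_sym])

lemma avg_cmult: "avg X w (%A. c * f A) = c * avg X w f"
 unfolding avg_def by (simp add: sum_distrib_left mult_ac)

lemma avg_multc: "avg X w (%A. f A * c) = avg X w f * c"
 unfolding avg_def by (simp add: sum_distrib_left sum_distrib_right mult_ac)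

lemma avg_add: "avg X w (%A. f A + g A) = avg X w f + avg X w g"
 unfolding avg_def by (simp add: distrib_left sum.distrib add_divide_distrib)

lemma avg_diff: "avg X w (%A. f A - g A) = avg X w f - avg X w g"
 unfolding avg_def by (simp add: right_diff_distrib sum_subtractf diff_divide_distrib)

lemma avg_sum: "avg X w (%A. SUM i:I. f i A) = (SUM i:I. avg X w (f i))"
proof -
 have "(SUM A:Pow X. w A * (SUM i:I. f i A)) = (SUM A:Pow X. SUM i:I. w A * f i A)"
  by (simp add: sum_distrib_left)
 also have "... = (SUM i:I. SUM A:Pow X. w A * f i A)" by (rule sum.swap)
 finally show ?thesis unfolding avg_def by (simp add: sum_divide_distrib)
qed

lemma avg_le:
 assumes "finite X" "!!A. (w A :: real) > 0" "!!A. A \<subseteq> X ==> f A <= c"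
 shows "avg X w f <= c"
 using avg_mono[of w X f "%_. c"] assms by simp

text \<open>Holley's inequality: \<open>w1\<close> favours larger sets, hence gives decreasing
  functions the smaller mean. The weights are allowed to vanish, since
  \<open>avg_domain_mono\<close> inserts a conditioned weight.\<close>

lemma holley:
 assumes "finite X" "!!A. A \<subseteq> X ==> 0 <= w1 A" "!!A. A \<subseteq> X ==> 0 <= w2 A"
  and "(SUM A:Pow X. w1 A) > 0" "(SUM A:Pow X. w2 A) > 0"
  and H: "!!A B. A \<subseteq> X ==> B \<subseteq> X ==> w2 A * w1 B <= w1 (A Un B) * w2 (A Int B)"
  and f: "decr X f" "!!A. A \<subseteq> X ==> 0 <= f A"
 shows "avg X w1 f <= avg X w2 f"
proof -
 have "(SUM A:Pow X. w2 A) * (SUM A:Pow X. w1 A * f A) <= (SUM A:Pow X. w1 A) * (SUM A:Pow X. w2 A * f A)"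
 proof (rule four_functions[OF assms(1)])
  fix A B assume AB: "A \<subseteq> X" "B \<subseteq> X"
  have "f B <= f (A Int B)" by (rule decrD[OF f(1)]) (use AB in auto)
  moreover have "0 <= f B" using f AB by blast
  moreover have "0 <= w1 (A Un B) * w2 (A Int B)"
   using assms(2)[of "A Un B"] assms(3)[of "A Int B"] AB by (simp add: le_infI1)
  ultimately have "(w2 A * w1 B) * f B <= (w1 (A Un B) * w2 (A Int B)) * f (A Int B)"
   using H[OF AB] mult_mono[of "w2 A * w1 B" _ "f B"] by blast
  thus "w2 A * (w1 B * f B) <= w1 (A Un B) * (w2 (A Int B) * f (A Int B))"
   by (simp add: mult_ac)
 qed (simp_all add: assms)
 thus ?thesis unfolding avg_def using assms(4,5)
  by (simp add: divide_simps mult.commute)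
qed

lemma fkg:
 assumes "finite X" "!!A. (w A :: real) > 0" "logsup w X"
  and f: "decr X f" "!!A. A \<subseteq> X ==> 0 <= f A" and g: "decr X g" "!!A. A \<subseteq> X ==> 0 <= g A"
 shows "avg X w f * avg X w g <= avg X w (%A. f A * g A)"
proof -
 have "(SUM A:Pow X. w A * f A) * (SUM A:Pow X. w A * g A) <= (SUM A:Pow X. w A) * (SUM A:Pow X. w A * (f A * g A))"
 proof (rule four_functions[OF assms(1)])
  fix A B assume AB: "A \<subseteq> X" "B \<subseteq> X"
  have "f A <= f (A Int B)" "g B <= g (A Int B)"
   by (rule decrD[OF f(1)] decrD[OF g(1)], use AB in auto)+
  moreover have "0 <= f A" "0 <= g B" using f g AB by blast+
  moreover have "0 <= w (A Un B) * w (A Int B)"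
   using assms(2)[of "A Un B"] assms(2)[of "A Int B"] by simp
  moreover have "w A * w B <= w (A Un B) * w (A Int B)"
   by (rule logsupD[OF assms(3) AB])
  ultimately have "(w A * w B) * (f A * g B) <= (w (A Un B) * w (A Int B)) * (f (A Int B) * g (A Int B))"
   by (intro mult_mono[of "w A * w B"] mult_mono[of "f A"]) auto
  thus "(w A * f A) * (w B * g B) <= w (A Un B) * (w (A Int B) * (f (A Int B) * g (A Int B)))"
   by (simp add: mult_ac)
 qed (simp_all add: less_imp_le[OF assms(2)] f g)
 hence "(SUM A:Pow X. w A * f A) * (SUM A:Pow X. w A * g A) / ((SUM A:Pow X. w A) * (SUM A:Pow X. w A))
   <= (SUM A:Pow X. w A) * (SUM A:Pow X. w A * (f A * g A)) / ((SUM A:Pow X. w A) * (SUM A:Pow X. w A))"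
  by (intro divide_right_mono) auto
 thus ?thesis unfolding avg_def using sum_Pow_pos[where w = w, OF assms(1,2)]
  by simp
qed

text \<open>Forbidding the elements off \<open>Y\<close> is conditioning on a decreasing event. The
  conditioned weight is \<open>w\<close> cut off outside \<open>Pow Y\<close>, and Holley's
  condition survives since \<open>A Int B\<close> lies in \<open>Y\<close> whenever \<open>A\<close>
  does.\<close>

lemma avg_domain_mono:
 assumes "finite X" "Y \<subseteq> X" "!!A. (w A :: real) > 0" "logsup w X" "decr X f" "!!A. A \<subseteq> X ==> 0 <= f A"
 shows "avg X w f <= avg Y w f"
proof -
 define w2 where "w2 A = (if A \<subseteq> Y then w A else 0)" for A
 have PX: "Pow X Int {A. A \<subseteq> Y} = Pow Y" using assms(2) by auto
 have s: "(SUM A:Pow X. w2 A * g A) = (SUM A:Pow Y. w A * g A)" for g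
 proof -
  have "(SUM A:Pow X. w2 A * g A) = (SUM A:Pow X. if A : {A. A \<subseteq> Y} then w A * g A else 0)"
   by (auto simp: w2_def intro!: sum.cong)
  also have "... = (SUM A:Pow X Int {A. A \<subseteq> Y}. w A * g A)"
   using assms(1) by (subst sum.inter_restrict) auto
  finally show ?thesis by (simp add: PX)
 qed
 have s1: "(SUM A:Pow X. w2 A) = (SUM A:Pow Y. w A)" using s[of "%_. 1"] by simp
 have fY: "finite Y" using assms(1,2) finite_subset by blast
 have "avg X w f <= avg X w2 f"
 proof (rule holley[OF assms(1)])
  fix A B assume AB: "A \<subseteq> X" "B \<subseteq> X"
  show "w2 A * w B <= w (A Un B) * w2 (A Int B)"
  proof (cases "A \<subseteq> Y")
   case True
   hence "A Int B \<subseteq> Y" by auto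
   thus ?thesis using True logsupD[OF assms(4) AB] by (simp add: w2_def)
  next
   case False
   thus ?thesis using assms(3)[of "A Un B"] assms(3)[of "A Int B"] by (simp add: w2_def)
  qed
  show "0 <= w A" using assms(3)[of A] by simp
  show "0 <= w2 A" using assms(3)[of A] by (simp add: w2_def)
 qed (simp_all add: assms s1 sum_Pow_pos fY)
 also have "avg X w2 f = avg Y w f" unfolding avg_def by (simp add: s s1)
 finally show ?thesis .
qed

lemma bij_betw_Pow_Un:
 assumes "X Int Y = {}"
 shows "bij_betw (%(A, B). A Un B) (Pow X \<times> Pow Y) (Pow (X Un Y))"
 by (rule bij_betwI[where g = "%C. (C Int X, C Int Y)"]) (use assms in auto)

lemma sum_Pow_Un:
 fixes f :: "'a set => 'b::comm_monoid_add"
 assumes "X Int Y = {}"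
 shows "(SUM C:Pow (X Un Y). f C) = (SUM A:Pow X. SUM B:Pow Y. f (A Un B))"
 using sum.reindex_bij_betw[OF bij_betw_Pow_Un[OF assms], of f]
 by (simp add: sum.cartesian_product split_beta)

lemma avg_Un:
 assumes "X Int Y = {}" "!!A B. A \<subseteq> X ==> B \<subseteq> Y ==> w (A Un B) = w1 A * w2 B"
 shows "avg (X Un Y) w f = avg X w1 (%A. avg Y w2 (%B. f (A Un B)))"
proof -
 have "(SUM C:Pow (X Un Y). w C * f C) = (SUM A:Pow X. w1 A * (SUM B:Pow Y. w2 B * f (A Un B)))"
  by (subst sum_Pow_Un[OF assms(1)])
   (auto intro!: sum.cong simp: assms(2) sum_distrib_left mult.assoc)
 moreover have "(SUM C:Pow (X Un Y). w C) = (SUM A:Pow X. w1 A) * (SUM B:Pow Y. w2 B)"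
  by (subst sum_Pow_Un[OF assms(1)], unfold sum_product) (auto intro!: sum.cong simp: assms(2))
 ultimately show ?thesis unfolding avg_def
  by (simp add: sum_divide_distrib[symmetric])
qed

declare split_paired_All [simp del] split_paired_Ex [simp del]

lemma adj_sym: "adj u v \<longleftrightarrow> adj v u"
 by (simp add: adj_def abs_minus_commute)

lemma adj_alt: "adj (x, y) w \<longleftrightarrow> w : {(x + 1, y), (x - 1, y), (x, y + 1), (x, y - 1)}"
 by (cases w) (auto simp: adj_def abs_if split: if_splits)

lemma nbr_eq: "{w. adj v w} = {(fst v + 1, snd v), (fst v - 1, snd v), (fst v, snd v + 1), (fst v, snd v - 1)}"
 by (cases v) (simp add: adj_alt set_eq_iff)

lemma finite_nbr: "finite {w. adj v w}"
 by (simp add: nbr_eq)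

lemma card_nbr_le: "card {w. adj v w} <= 4"
proof -
 have "card {w. adj v w} <= card (set [(fst v + 1, snd v), (fst v - 1, snd v), (fst v, snd v + 1), (fst v, snd v - 1)])"
  by (simp add: nbr_eq)
 also have "... <= 4" by (rule order_trans[OF card_length]) simp
 finally show ?thesis .
qed

section \<open>Two replicas and the boundary cluster\<close>

definition eds :: "site set => site set set" where
 "eds B = {{u, v} |u v. u : B & adj u v}"

text \<open>Edges to sites outside the box are counted too, so the boundary condition is contained
  in \<open>bd M\<close> and the box does not occur. One weight therefore serves all boxes, and
  shrinking a box is a restriction of the ground set.\<close>

definition bd :: "site set => site set set" where
 "bd M = {{u, v} |u v. u : M & v ~: M & adj u v}"

text \<open>Strong enough to make \<open>eds A\<close> and \<open>eds B\<close> disjoint, so that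
  neither contour weights nor closed edges interact across the two sets.\<close>

definition sep :: "site set => site set => bool" where
 "sep A B \<longleftrightarrow> A Int B = {} & (ALL a:A. ALL b:B. ~ adj a b)"

lemma finite_eds: "finite B ==> finite (eds B)"
proof -
 assume "finite B"
 moreover have "eds B = (\<Union>u\<in>B. (%v. {u, v}) ` {w. adj u w})"
  unfolding eds_def by auto
 ultimately show ?thesis using finite_nbr by simp
qed

lemma bd_subset_eds: "bd M \<subseteq> eds M"
 unfolding bd_def eds_def by auto

lemma eds_mono: "A \<subseteq> B ==> eds A \<subseteq> eds B"
 unfolding eds_def by blast

lemma eds_Un: "eds (A Un B) = eds A Un eds B"
 unfolding eds_def by blast

lemma finite_bd: "finite M ==> finite (bd M)"
 using bd_subset_eds finite_eds finite_subset by blast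

lemma in_bd_iff: "{u, v} : bd M \<longleftrightarrow> adj u v & (u : M) ~= (v : M)"
proof
 show "{u, v} : bd M ==> adj u v & (u : M) ~= (v : M)"
  unfolding bd_def mem_Collect_eq doubleton_eq_iff using adj_sym by blast
 show "adj u v & (u : M) ~= (v : M) ==> {u, v} : bd M"
  unfolding bd_def mem_Collect_eq doubleton_eq_iff using adj_sym by blast
qed

lemma bd_iff: "e : bd M \<longleftrightarrow> (\<exists>u v. e = {u, v} & adj u v & (u : M) ~= (v : M))"
proof
 show "e : bd M ==> \<exists>u v. e = {u, v} & adj u v & (u : M) ~= (v : M)"
  unfolding bd_def by blast
qed (use in_bd_iff in blast)

lemma in_eds_iff: "{u, v} : eds B \<longleftrightarrow> adj u v & (u : B \<or> v : B)"
proof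
 show "{u, v} : eds B ==> adj u v & (u : B \<or> v : B)"
  unfolding eds_def mem_Collect_eq doubleton_eq_iff using adj_sym by blast
 show "adj u v & (u : B \<or> v : B) ==> {u, v} : eds B"
  unfolding eds_def mem_Collect_eq doubleton_eq_iff using adj_sym by blast
qed

text \<open>Submodularity of the cut function, which is where ferromagnetism enters. An edge in
  either boundary on the left lies in one on the right, and an edge in both lies in both.\<close>

lemma bd_submodular:
 assumes "finite A" "finite B"
 shows "card (bd (A Un B)) + card (bd (A Int B)) <= card (bd A) + card (bd B)"
proof -
 have 1: "bd (A Un B) Un bd (A Int B) \<subseteq> bd A Un bd B" "bd (A Un B) Int bd (A Int B) \<subseteq> bd A Int bd B"
 proof -
  have "e : bd A Un bd B" if "e : bd (A Un B) Un bd (A Int B)" for e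
  proof -
   from that obtain u v where e: "e = {u, v}" unfolding bd_def by blast
   show ?thesis using that unfolding e Un_iff in_bd_iff by blast
  qed
  thus "bd (A Un B) Un bd (A Int B) \<subseteq> bd A Un bd B" by blast
  have "e : bd A Int bd B" if "e : bd (A Un B) Int bd (A Int B)" for e
  proof -
   from that obtain u v where e: "e = {u, v}" unfolding bd_def by blast
   show ?thesis using that unfolding e Int_iff in_bd_iff by blast
  qed
  thus "bd (A Un B) Int bd (A Int B) \<subseteq> bd A Int bd B" by blast
 qed
 have "card (bd (A Un B)) + card (bd (A Int B)) = card (bd (A Un B) Un bd (A Int B)) + card (bd (A Un B) Int bd (A Int B))"
  using assms by (intro card_Un_Int) (auto intro: finite_bd)
 also have "... <= card (bd A Un bd B) + card (bd A Int bd B)"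
  using 1 assms by (intro add_mono card_mono) (auto intro: finite_bd)
 also have "... = card (bd A) + card (bd B)"
  using assms by (intro card_Un_Int[symmetric]) (auto intro: finite_bd)
 finally show ?thesis .
qed

lemma bd_sep:
 assumes "sep A B"
 shows "bd (A Un B) = bd A Un bd B" "bd A Int bd B = {}" "eds A Int eds B = {}"
proof -
 have ad: "adj u v ==> u : A ==> v ~: B" "adj u v ==> u : B ==> v ~: A" "u : A ==> u ~: B" for u v
  using assms unfolding sep_def by (auto simp: adj_sym)
 have "e ~: eds B" if "e : eds A" for e
 proof -
  from that obtain u v where "e = {u, v}" "adj u v" unfolding eds_def by blast
  thus ?thesis using that ad by (metis in_eds_iff adj_sym)
 qed
 thus "eds A Int eds B = {}" by blast
 thus "bd A Int bd B = {}" using bd_subset_eds by blast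
 have "e : bd (A Un B) \<longleftrightarrow> e : bd A Un bd B" for e
 proof (cases "\<exists>u v. e = {u, v} & adj u v")
  case True
  then obtain u v where "e = {u, v}" "adj u v" by blast
  thus ?thesis using ad by (metis Un_iff in_bd_iff adj_sym)
 qed (auto simp: bd_iff)
 thus "bd (A Un B) = bd A Un bd B" by blast
qed

lemma sep_sym: "sep A B ==> sep B A"
 unfolding sep_def by (auto simp: adj_sym)

lemma sep_mono: "sep A B ==> A' \<subseteq> A ==> B' \<subseteq> B ==> sep A' B'"
 unfolding sep_def by blast

text \<open>Contour weight of the set \<open>M\<close> of spins opposite to the boundary condition, in the field \<open>g\<close>.\<close>
definition wt :: "real => (site => real) => site set => real" where
 "wt be g M = exp (- 2 * be * (real (card (bd M)) + (SUM v:M. g v)))"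

text \<open>Normalised over sets of closed edges, this makes every edge closed independently with probability \<open>exp (- 4 * be)\<close>.\<close>
definition cw :: "real => 'a set => real" where
 "cw be C = (1 / (exp (4 * be) - 1)) ^ card C"

lemma wt_pos: "wt be g M > 0" by (simp add: wt_def)

lemma cw_pos: "be > 0 ==> cw be C > 0" by (simp add: cw_def)

lemma wt_logsup:
 assumes "finite X" "be > 0"
 shows "logsup (wt be g) X"
 unfolding logsup_def
proof (intro allI impI)
 fix A B assume "A \<subseteq> X" "B \<subseteq> X"
 hence f: "finite A" "finite B" using assms finite_subset by auto
 have s: "sum g (A Un B) + sum g (A Int B) = sum g A + sum g B"
  by (rule sum.union_inter[OF f])
 have c: "real (card (bd (A Un B))) + real (card (bd (A Int B))) <= real (card (bd A)) + real (card (bd B))"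
  using bd_submodular[OF f] by linarith
 have "be * (real (card (bd (A Un B))) + real (card (bd (A Int B))) + (sum g (A Un B) + sum g (A Int B)))
   <= be * (real (card (bd A)) + real (card (bd B)) + (sum g A + sum g B))"
  using c s assms by (intro mult_left_mono) auto
 thus "wt be g A * wt be g B <= wt be g (A Un B) * wt be g (A Int B)"
  unfolding wt_def exp_add[symmetric] exp_le_cancel_iff by (simp add: algebra_simps)
qed

lemma cw_logsup:
 assumes "finite X"
 shows "logsup (cw be) X"
 unfolding logsup_def cw_def power_add[symmetric]
 using assms by (auto simp: card_Un_Int[OF finite_subset finite_subset])

lemma wt_sep:
 assumes "sep A B" "finite A" "finite B"
 shows "wt be g (A Un B) = wt be g A * wt be g B"
proof -
 have "card (bd (A Un B)) = card (bd A) + card (bd B)"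
  using bd_sep[OF assms(1)] assms by (simp add: card_Un_disjoint finite_bd)
 moreover have "sum g (A Un B) = sum g A + sum g B"
  using assms unfolding sep_def by (intro sum.union_disjoint) auto
 ultimately show ?thesis unfolding wt_def exp_add[symmetric] by (simp add: algebra_simps)
qed

lemma cw_disj: "finite A ==> finite B ==> A Int B = {} ==> cw be (A Un B) = cw be A * cw be B"
 by (simp add: cw_def card_Un_disjoint power_add)

text \<open>\<open>C\<close> lists the closed edges. The edge to the outside of \<open>B\<close> has
  to be open as well, since the swap of the replicas treats edges to the cluster and edges to the
  outside alike.\<close>

inductive_set Kc :: "site set => site set => site set set => site set" for B Ob C where
 base: "v : B ==> v ~: Ob ==> w ~: B ==> adj v w ==> {v, w} ~: C ==> v : Kc B Ob C"
| step: "u : Kc B Ob C ==> v : B ==> v ~: Ob ==> adj u v ==> {u, v} ~: C ==> v : Kc B Ob C"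

lemma Kc_subset: "Kc B Ob C \<subseteq> B - Ob"
 by (auto elim: Kc.cases)

lemma Kc_mono:
 assumes "Ob' Int B \<subseteq> Ob" "C' Int eds B \<subseteq> C"
 shows "Kc B Ob C \<subseteq> Kc B Ob' C'"
proof
 fix v assume "v : Kc B Ob C"
 thus "v : Kc B Ob' C'"
 proof induction
  case (base v w)
  hence "{v, w} : eds B" by (simp add: in_eds_iff)
  thus ?case using base assms by (intro Kc.base[of v _ _ w]) auto
 next
  case (step u v)
  hence "{u, v} : eds B" by (simp add: in_eds_iff)
  thus ?case using step assms by (intro Kc.step[of u _ _ _ v]) auto
 qed
qed

lemma Kc_local: "Kc B Ob C = Kc B (Ob Int B) (C Int eds B)"
 by (intro equalityI Kc_mono) auto

text \<open>A connection to the outside of \<open>B\<close>, followed until it leaves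
  \<open>B'\<close>, is a connection to the outside of \<open>B'\<close>. In the induction an edge
  entering \<open>B'\<close> becomes a base case.\<close>

lemma Kc_restrict:
 assumes "B' \<subseteq> B"
 shows "Kc B Ob C Int B' \<subseteq> Kc B' Ob C"
proof
 fix v assume "v : Kc B Ob C Int B'"
 hence "v : Kc B Ob C" "v : B'" by auto
 thus "v : Kc B' Ob C"
 proof induction
  case (base v w)
  thus ?case using assms by (intro Kc.base[of v _ _ w]) auto
 next
  case (step u v)
  show ?case
  proof (cases "u : B'")
   case True
   thus ?thesis by (rule Kc.step[OF step.IH]) (use step.prems step.hyps in blast)+
  next
   case False
   thus ?thesis using step by (intro Kc.base[of v _ _ u]) (auto simp: adj_sym insert_commute)
  qed
 qed
qed

text \<open>The obstacles are the minus sets of two independent replicas, in the fields \<open>g1\<close> and \<open>g2\<close>; the case of interest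
 is \<open>g2 = - g1\<close>, where the second replica is the system with the opposite boundary condition.\<close>
definition kexp :: "real => site set => (site => real) => (site => real) =>
  (site set => site set => site set set => real) => real" where
 "kexp be B g1 g2 f = avg B (wt be g1) (%M. avg B (wt be g2) (%M'. avg (eds B) (cw be) (f M M')))"

definition kp :: "real => site set => (site => real) => (site => real) => (site set => bool) => real" where
 "kp be B g1 g2 Q = kexp be B g1 g2 (%M M' C. of_bool (Q (Kc B (M Un M') C)))"

definition tdecr :: "site set => (site set => site set => site set set => real) => bool" where
 "tdecr B f \<longleftrightarrow> (\<forall>M N M' N' C D. M \<subseteq> N --> M' \<subseteq> N' --> C \<subseteq> D --> N \<subseteq> B --> N' \<subseteq> B --> D \<subseteq> eds B
   --> f N N' D <= f M M' C)"

lemma tdecrD: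
 "tdecr B f ==> M \<subseteq> N ==> M' \<subseteq> N' ==> C \<subseteq> D ==> N \<subseteq> B ==> N' \<subseteq> B ==> D \<subseteq> eds B ==> f N N' D <= f M M' C"
 unfolding tdecr_def by simp

lemma kexp_field_cong:
 assumes "!!v. v : B ==> g1 v = g1' v" "!!v. v : B ==> g2 v = g2' v"
 shows "kexp be B g1 g2 f = kexp be B g1' g2' f"
proof -
 have "wt be g1 M = wt be g1' M" "wt be g2 M = wt be g2' M" if "M \<subseteq> B" for M
  unfolding wt_def using that assms by (metis (no_types, lifting) subsetD sum.cong)+
 thus ?thesis unfolding kexp_def by (intro avg_cong refl)
qed

lemma kp_field_cong:
 assumes "!!v. v : B ==> g1 v = g1' v" "!!v. v : B ==> g2 v = g2' v"
 shows "kp be B g1 g2 Q = kp be B g1' g2' Q"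
 unfolding kp_def by (rule kexp_field_cong[OF assms])

context
 fixes be :: real and B :: "site set"
 assumes b: "be > 0" and fB: "finite B"
begin

lemma kexp_mono:
 assumes "!!M M' C. M \<subseteq> B ==> M' \<subseteq> B ==> C \<subseteq> eds B ==> f M M' C <= f' M M' C"
 shows "kexp be B g1 g2 f <= kexp be B g1 g2 f'"
 unfolding kexp_def by (intro avg_mono wt_pos cw_pos b assms)

lemma kexp_nonneg:
 assumes "!!M M' C. M \<subseteq> B ==> M' \<subseteq> B ==> C \<subseteq> eds B ==> 0 <= f M M' C"
 shows "0 <= kexp be B g1 g2 f"
 unfolding kexp_def by (intro avg_nonneg wt_pos cw_pos b assms)

lemma kexp_const: "kexp be B g1 g2 (%_ _ _. c) = c"
 unfolding kexp_def using b fB finite_eds[OF fB] by (simp add: wt_pos cw_pos)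

lemma kexp_pos:
 assumes "!!M M' C. M \<subseteq> B ==> M' \<subseteq> B ==> C \<subseteq> eds B ==> 0 <= f M M' C" "0 < f {} {} {}"
 shows "0 < kexp be B g1 g2 f"
 unfolding kexp_def
 by (intro avg_pos[where ?A0.0 = "{}"] avg_nonneg wt_pos cw_pos b fB finite_eds empty_subsetI assms)

lemma kp_le1: "kp be B g1 g2 Q <= 1"
 unfolding kp_def by (subst kexp_const[symmetric, of _ g1 g2]) (rule kexp_mono, simp)

lemma kp_ge0: "0 <= kp be B g1 g2 Q"
 unfolding kp_def by (rule kexp_nonneg) simp

lemma kp_mono:
 assumes "!!K. K \<subseteq> B ==> Q K ==> Q' K"
 shows "kp be B g1 g2 Q <= kp be B g1 g2 Q'"
 unfolding kp_def by (rule kexp_mono) (use assms Kc_subset in \<open>simp; blast\<close>)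

end

lemma kexp_add: "kexp be B g1 g2 (%M M' C. f M M' C + f' M M' C) = kexp be B g1 g2 f + kexp be B g1 g2 f'"
 unfolding kexp_def by (simp add: avg_add)

lemma kexp_diff: "kexp be B g1 g2 (%M M' C. f M M' C - f' M M' C) = kexp be B g1 g2 f - kexp be B g1 g2 f'"
 unfolding kexp_def by (simp add: avg_diff)

lemma kexp_cmult: "kexp be B g1 g2 (%M M' C. c * f M M' C) = c * kexp be B g1 g2 f"
 unfolding kexp_def by (simp add: avg_cmult)

lemma kexp_sum: "kexp be B g1 g2 (%M M' C. SUM i:I. f i M M' C) = (SUM i:I. kexp be B g1 g2 (f i))"
 unfolding kexp_def by (simp add: avg_sum)

lemma kp_Ex_le:
 assumes "be > 0" "finite B" "finite I"
 shows "kp be B g1 g2 (%K. EX i:I. Q i K) <= (SUM i:I. kp be B g1 g2 (Q i))"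
proof -
 have "kp be B g1 g2 (%K. EX i:I. Q i K)
   <= kexp be B g1 g2 (%M M' C. SUM i:I. of_bool (Q i (Kc B (M Un M') C)))"
  unfolding kp_def
 proof (rule kexp_mono[OF assms(1,2)])
  fix M M' C
  show "of_bool (EX i:I. Q i (Kc B (M Un M') C)) <= (SUM i:I. of_bool (Q i (Kc B (M Un M') C)) :: real)"
  proof (cases "EX i:I. Q i (Kc B (M Un M') C)")
   case True
   then obtain i where "i : I" "Q i (Kc B (M Un M') C)" by blast
   thus ?thesis using member_le_sum[of i I "%i. of_bool (Q i (Kc B (M Un M') C)) :: real"] assms(3) by auto
  qed (simp add: sum_nonneg)
 qed
 thus ?thesis unfolding kp_def by (simp add: kexp_sum)
qed

text \<open>Domain monotonicity is applied to one average at a time, from the inside out: closed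
  edges, \<open>M'\<close>, \<open>M\<close>. The averages already restricted remain decreasing in
  the other sets.\<close>

lemma kexp_domain:
 assumes b: "be > 0" and fB: "finite B" and "B' \<subseteq> B" and f: "tdecr B f"
  and nn: "!!M M' C. M \<subseteq> B ==> M' \<subseteq> B ==> C \<subseteq> eds B ==> 0 <= f M M' C"
 shows "kexp be B g1 g2 f <= kexp be B' g1 g2 f"
proof -
 have fB': "finite B'" using assms finite_subset by blast
 have e: "eds B' \<subseteq> eds B" using assms eds_mono by blast
 note p = wt_pos cw_pos[OF b]
 have "kexp be B g1 g2 f <= avg B (wt be g1) (%M. avg B (wt be g2) (%M'. avg (eds B') (cw be) (f M M')))"
  unfolding kexp_def
 proof (intro avg_mono p)
  fix M M' assume "M \<subseteq> B" "M' \<subseteq> B"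
  thus "avg (eds B) (cw be) (f M M') <= avg (eds B') (cw be) (f M M')"
   by (intro avg_domain_mono finite_eds fB e p cw_logsup nn)
    (auto simp: decr_def intro!: tdecrD[OF f])
 qed
 also have "... <= avg B (wt be g1) (%M. avg B' (wt be g2) (%M'. avg (eds B') (cw be) (f M M')))"
 proof (intro avg_mono p)
  fix M assume "M \<subseteq> B"
  thus "avg B (wt be g2) (%M'. avg (eds B') (cw be) (f M M')) <= avg B' (wt be g2) (%M'. avg (eds B') (cw be) (f M M'))"
   using e by (intro avg_domain_mono fB assms p wt_logsup avg_nonneg nn)
    (auto simp: decr_def intro!: avg_mono p tdecrD[OF f] )
 qed
 also have "... <= kexp be B' g1 g2 f" unfolding kexp_def
  using e assms(3) by (intro avg_domain_mono fB assms p wt_logsup avg_nonneg nn)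
    (auto simp: decr_def intro!: avg_mono p tdecrD[OF f] )
 finally show ?thesis .
qed

lemma kexp_sep:
 assumes b: "be > 0" and "finite B1" "finite B2" "sep B1 B2"
  and f1: "!!M M' C. f1 M M' C = f1 (M Int B1) (M' Int B1) (C Int eds B1)"
  and f2: "!!M M' C. f2 M M' C = f2 (M Int B2) (M' Int B2) (C Int eds B2)"
 shows "kexp be (B1 Un B2) g1 g2 (%M M' C. f1 M M' C * f2 M M' C) = kexp be B1 g1 g2 f1 * kexp be B2 g1 g2 f2"
proof -
 have d: "B1 Int B2 = {}" "eds B1 Int eds B2 = {}" using assms bd_sep unfolding sep_def by auto
 have w: "wt be g (A Un A') = wt be g A * wt be g A'" if "A \<subseteq> B1" "A' \<subseteq> B2" for g A A'
  using that assms by (intro wt_sep) (auto intro: sep_mono finite_subset)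
 have c: "cw be (A Un A') = cw be A * cw be A'" if "A \<subseteq> eds B1" "A' \<subseteq> eds B2" for A A'
  using that assms d by (intro cw_disj) (auto intro: finite_subset finite_eds)
 have uw: "avg (B1 Un B2) (wt be g) F = avg B1 (wt be g) (%A. avg B2 (wt be g) (%A'. F (A Un A')))" for g F
  by (rule avg_Un[OF d(1)]) (rule w)
 have uc: "avg (eds B1 Un eds B2) (cw be) F = avg (eds B1) (cw be) (%A. avg (eds B2) (cw be) (%A'. F (A Un A')))" for F
  by (rule avg_Un[OF d(2)]) (rule c)
 have r1: "f1 (A Un A') (G Un G') (D Un D') = f1 A G D"
  if "A \<subseteq> B1" "A' \<subseteq> B2" "G \<subseteq> B1" "G' \<subseteq> B2" "D \<subseteq> eds B1" "D' \<subseteq> eds B2" for A A' G G' D D'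
 proof -
  have "(A Un A') Int B1 = A" "(G Un G') Int B1 = G" "(D Un D') Int eds B1 = D" using that d by auto
  thus ?thesis using f1[of "A Un A'" "G Un G'" "D Un D'"] by simp
 qed
 have r2: "f2 (A Un A') (G Un G') (D Un D') = f2 A' G' D'"
  if "A \<subseteq> B1" "A' \<subseteq> B2" "G \<subseteq> B1" "G' \<subseteq> B2" "D \<subseteq> eds B1" "D' \<subseteq> eds B2" for A A' G G' D D'
 proof -
  have "(A Un A') Int B2 = A'" "(G Un G') Int B2 = G'" "(D Un D') Int eds B2 = D'" using that d by auto
  thus ?thesis using f2[of "A Un A'" "G Un G'" "D Un D'"] by simp
 qed
 have "kexp be (B1 Un B2) g1 g2 (%M M' C. f1 M M' C * f2 M M' C) =
  avg B1 (wt be g1) (%A. avg B2 (wt be g1) (%A'. avg B1 (wt be g2) (%G. avg B2 (wt be g2) (%G'.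
   avg (eds B1) (cw be) (%D. avg (eds B2) (cw be) (%D'. f1 A G D * f2 A' G' D'))))))"
  unfolding kexp_def eds_Un uw uc
  by (intro avg_cong refl) (simp add: r1 r2)
 also have "... = kexp be B1 g1 g2 f1 * kexp be B2 g1 g2 f2"
  unfolding kexp_def by (simp add: avg_cmult avg_multc)
 finally show ?thesis .
qed

lemma kexp_sep_prod:
 assumes b: "be > 0" and "finite I" "!!i. i : I ==> finite (Bs i)"
  and "!!i j. i : I ==> j : I ==> i ~= j ==> sep (Bs i) (Bs j)"
  and f: "!!i M M' C. i : I ==> f i M M' C = f i (M Int Bs i) (M' Int Bs i) (C Int eds (Bs i))"
 shows "kexp be (\<Union>i\<in>I. Bs i) g1 g2 (%M M' C. \<Prod>i\<in>I. f i M M' C) = (\<Prod>i\<in>I. kexp be (Bs i) g1 g2 (f i))"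
 using assms(2-)
proof (induction I rule: finite_induct)
 case empty
 thus ?case by (simp add: kexp_const[OF b])
next
 case (insert i I)
 have 1: "(\<Prod>j\<in>I. f j M M' C) = (\<Prod>j\<in>I. f j (M Int (\<Union>i\<in>I. Bs i)) (M' Int (\<Union>i\<in>I. Bs i)) (C Int eds (\<Union>i\<in>I. Bs i)))" for M M' C
 proof (rule prod.cong[OF refl])
  fix j assume j: "j : I"
  hence e: "eds (Bs j) \<subseteq> eds (\<Union>i\<in>I. Bs i)" by (intro eds_mono) auto
  have "f j M M' C = f j (M Int Bs j) (M' Int Bs j) (C Int eds (Bs j))" using j by (intro insert.prems) auto
  also have "... = f j (M Int (\<Union>i\<in>I. Bs i) Int Bs j) (M' Int (\<Union>i\<in>I. Bs i) Int Bs j) (C Int eds (\<Union>i\<in>I. Bs i) Int eds (Bs j))"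
   using j e by (intro arg_cong3[where f = "f j"]) auto
  also have "... = f j (M Int (\<Union>i\<in>I. Bs i)) (M' Int (\<Union>i\<in>I. Bs i)) (C Int eds (\<Union>i\<in>I. Bs i))"
   using j by (intro insert.prems(3)[symmetric]) auto
  finally show "f j M M' C = f j (M Int (\<Union>i\<in>I. Bs i)) (M' Int (\<Union>i\<in>I. Bs i)) (C Int eds (\<Union>i\<in>I. Bs i))" .
 qed
 have 2: "sep (Bs i) (\<Union>i\<in>I. Bs i)"
 proof -
  have "sep (Bs i) (Bs j)" if "j : I" for j
   by (rule insert.prems(2)) (use insert.hyps that in auto)
  thus ?thesis by (simp add: sep_def Int_UN_distrib)
 qed
 have "kexp be (\<Union>i\<in>insert i I. Bs i) g1 g2 (%M M' C. \<Prod>i\<in>insert i I. f i M M' C) =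
   kexp be (Bs i Un (\<Union>i\<in>I. Bs i)) g1 g2 (%M M' C. f i M M' C * (\<Prod>j\<in>I. f j M M' C))"
  using insert.hyps by simp
 also have "... = kexp be (Bs i) g1 g2 (f i) * kexp be (\<Union>i\<in>I. Bs i) g1 g2 (%M M' C. \<Prod>j\<in>I. f j M M' C)"
 proof (rule kexp_sep[OF b _ _ 2])
  show "finite (Bs i)" using insert.prems(1) by simp
  show "finite (\<Union>i\<in>I. Bs i)" using insert.prems(1) insert.hyps(1) by simp
  show "f i M M' C = f i (M Int Bs i) (M' Int Bs i) (C Int eds (Bs i))" for M M' C
   by (rule insert.prems(3)) simp
 qed (rule 1)
 also have "kexp be (\<Union>i\<in>I. Bs i) g1 g2 (%M M' C. \<Prod>j\<in>I. f j M M' C) = (\<Prod>i\<in>I. kexp be (Bs i) g1 g2 (f i))"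
  by (rule insert.IH) (rule insert.prems; simp)+
 finally show ?case using insert.hyps by simp
qed

definition upred :: "(site set => bool) => bool" where
 "upred Q \<longleftrightarrow> (\<forall>K K'. K \<subseteq> K' --> Q K --> Q K')"

lemma tdecr_Kc: "upred Q ==> tdecr A (%M M' C. of_bool (Q (Kc B (M Un M') C)))"
 unfolding tdecr_def upred_def
proof (intro allI impI)
 fix M N M' N' :: "site set" and C D :: "site set set"
 assume "\<forall>K K'. K \<subseteq> K' --> Q K --> Q K'" "M \<subseteq> N" "M' \<subseteq> N'" "C \<subseteq> D"
 moreover have "Kc B (N Un N') D \<subseteq> Kc B (M Un M') C"
  by (rule Kc_mono) (use \<open>M \<subseteq> N\<close> \<open>M' \<subseteq> N'\<close> \<open>C \<subseteq> D\<close> in auto)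
 ultimately show "(of_bool (Q (Kc B (N Un N') D)) :: real) <= of_bool (Q (Kc B (M Un M') C))"
  by (metis of_bool_less_eq_iff)
qed

text \<open>The decoupling inequality behind the union bounds. \<open>Kc_restrict\<close> replaces
  the cluster of \<open>L\<close> by those of the boxes \<open>Bs i\<close>, which can only help
  increasing events; \<open>kexp_domain\<close> removes everything outside the union of the boxes;
  on separated boxes the weights factor. The fields are arbitrary, so it holds before any
  averaging.\<close>

theorem kp_prod:
 assumes b: "be > 0" and "finite L" "finite I" "!!i. i : I ==> Bs i \<subseteq> L"
  and "!!i j. i : I ==> j : I ==> i ~= j ==> sep (Bs i) (Bs j)"
  and "!!i. i : I ==> upred (Q i)"
 shows "kp be L g1 g2 (%K. ALL i:I. Q i (K Int Bs i)) <= (\<Prod>i\<in>I. kp be (Bs i) g1 g2 (Q i))"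
proof -
 have fin: "finite (Bs i)" if "i : I" for i using assms that finite_subset by blast
 let ?f = "%i M M' C. of_bool (Q i (Kc (Bs i) (M Un M') C)) :: real"
 have "kp be L g1 g2 (%K. ALL i:I. Q i (K Int Bs i)) <= kexp be L g1 g2 (%M M' C. \<Prod>i\<in>I. ?f i M M' C)"
  unfolding kp_def
 proof (rule kexp_mono[OF b assms(2)])
  fix M M' C
  have "Q i (Kc L (M Un M') C Int Bs i) ==> i : I ==> Q i (Kc (Bs i) (M Un M') C)" for i
   using Kc_restrict[of "Bs i" L "M Un M'" C] assms(4,6) unfolding upred_def by blast
  thus "of_bool (ALL i:I. Q i (Kc L (M Un M') C Int Bs i)) <= (\<Prod>i\<in>I. ?f i M M' C)"
   by (cases "ALL i:I. Q i (Kc L (M Un M') C Int Bs i)") (auto intro!: prod_nonneg)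
 qed
 also have "... <= kexp be (\<Union>i\<in>I. Bs i) g1 g2 (%M M' C. \<Prod>i\<in>I. ?f i M M' C)"
 proof (rule kexp_domain[OF b assms(2)])
  show "tdecr L (%M M' C. \<Prod>i\<in>I. ?f i M M' C)"
   unfolding tdecr_def
  proof (intro allI impI prod_mono conjI)
   fix M N M' N' :: "site set" and C D :: "site set set" and i
   assume "M \<subseteq> N" "M' \<subseteq> N'" "C \<subseteq> D" "N \<subseteq> L" "N' \<subseteq> L" "D \<subseteq> eds L" "i : I"
   thus "?f i N N' D <= ?f i M M' C"
    using tdecrD[OF tdecr_Kc[OF assms(6)], of i M N M' N' C D L "Bs i"] by blast
  qed simp
 qed (use assms in \<open>auto intro!: prod_nonneg\<close>)
 also have "... = (\<Prod>i\<in>I. kexp be (Bs i) g1 g2 (?f i))"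
 proof (rule kexp_sep_prod[OF b])
  fix i M M' C assume "i : I"
  show "?f i M M' C = ?f i (M Int Bs i) (M' Int Bs i) (C Int eds (Bs i))"
   by (subst Kc_local) (simp add: Int_Un_distrib2)
 qed (use assms fin in auto)
 finally show ?thesis unfolding kp_def .
qed

lemma kp_domain:
 assumes b: "be > 0" and "finite L" "B \<subseteq> L" "upred Q"
 shows "kp be L g1 g2 (%K. Q (K Int B)) <= kp be B g1 g2 Q"
 using kp_prod[OF b assms(2), of "{()}" "%_. B" "%_. Q" g1 g2] assms by simp

lemma sum_Pow_power:
 fixes r :: real
 assumes "finite E"
 shows "(SUM C:Pow E. r ^ card C) = (1 + r) ^ card E"
 using assms
proof (induction E rule: finite_induct)
 case (insert x E)
 have "(SUM C:Pow (insert x E). r ^ card C) = (SUM C:Pow E. r ^ card C + r ^ card (insert x C))"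
  by (rule sum_Pow_insert[OF insert.hyps])
 also have "... = (SUM C:Pow E. (1 + r) * r ^ card C)"
 proof (rule sum.cong[OF refl])
  fix C assume "C : Pow E"
  hence "finite C" "x ~: C" using insert.hyps finite_subset by auto
  thus "r ^ card C + r ^ card (insert x C) = (1 + r) * r ^ card C" by (simp add: algebra_simps)
 qed
 finally show ?case using insert by (simp add: sum_distrib_left[symmetric])
qed simp

lemma avg_all_closed:
 assumes "be > 0" "finite E"
 shows "avg E (cw be) (%C. of_bool (E \<subseteq> C)) = exp (- 4 * be) ^ card E"
proof -
 let ?r = "1 / (exp (4 * be) - 1)"
 have e: "exp (4 * be) - 1 > 0" using assms by simp
 have "(SUM C:Pow E. cw be C * of_bool (E \<subseteq> C)) = (SUM C:{E}. cw be C)"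
  using assms by (intro sum.mono_neutral_cong_right) auto
 hence "avg E (cw be) (%C. of_bool (E \<subseteq> C)) = ?r ^ card E / (1 + ?r) ^ card E"
  unfolding avg_def using sum_Pow_power[OF assms(2), of ?r] by (simp add: cw_def)
 also have "... = (?r / (1 + ?r)) ^ card E" by (rule power_divide[symmetric])
 also have "?r / (1 + ?r) = exp (- 4 * be)" using e by (simp add: field_simps exp_minus)
 finally show ?thesis .
qed

lemma avg_closed_part:
 assumes "be > 0" "finite E" "E' \<subseteq> E" and f: "!!C. C \<subseteq> E ==> f C = f (C - E')"
 shows "avg E (cw be) (%C. f C * of_bool (E' \<subseteq> C)) = avg E (cw be) f * exp (- 4 * be) ^ card E'"
proof -
 have d: "(E - E') Int E' = {}" by auto
 have E: "(E - E') Un E' = E" using assms by auto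
 have fin: "finite (E - E')" "finite E'" using assms finite_subset by auto
 have u: "avg E (cw be) F = avg (E - E') (cw be) (%A. avg E' (cw be) (%B. F (A Un B)))" for F
 proof -
  have "avg ((E - E') Un E') (cw be) F = avg (E - E') (cw be) (%A. avg E' (cw be) (%B. F (A Un B)))"
  proof (rule avg_Un[OF d])
   fix A B assume "A \<subseteq> E - E'" "B \<subseteq> E'"
   moreover from this have "finite A" "finite B" using fin finite_subset by blast+
   ultimately show "cw be (A Un B) = cw be A * cw be B" by (intro cw_disj) auto
  qed
  thus ?thesis unfolding E .
 qed
 have f1: "f (A Un B) = f A" if "A \<subseteq> E - E'" "B \<subseteq> E'" for A B
 proof -
  have "(A Un B) - E' = A" "A - E' = A" "A Un B \<subseteq> E" "A \<subseteq> E" using that assms(3) by auto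
  thus ?thesis using f[of "A Un B"] by metis
 qed
 have "avg E (cw be) (%C. f C * of_bool (E' \<subseteq> C)) =
   avg (E - E') (cw be) (%A. avg E' (cw be) (%B. f A * of_bool (E' \<subseteq> B)))"
  unfolding u
 proof (intro avg_cong refl)
  fix A B assume "A \<subseteq> E - E'" "B \<subseteq> E'"
  moreover from this have "E' \<subseteq> A Un B \<longleftrightarrow> E' \<subseteq> B" by blast
  ultimately show "f (A Un B) * of_bool (E' \<subseteq> A Un B) = f A * of_bool (E' \<subseteq> B)"
   using f1 by simp
 qed
 also have "... = avg (E - E') (cw be) f * exp (- 4 * be) ^ card E'"
  by (simp only: avg_cmult avg_all_closed[OF assms(1) fin(2)] avg_multc)
 also have "avg (E - E') (cw be) f = avg E (cw be) f"
 proof -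
  have "avg (E - E') (cw be) f = avg (E - E') (cw be) (%A. avg E' (cw be) (%B. f A))"
   by (simp only: avg_const[OF fin(2) cw_pos[OF assms(1)]])
  also have "... = avg E (cw be) f" unfolding u
   by (intro avg_cong refl) (simp add: f1)
  finally show ?thesis .
 qed
 finally show ?thesis .
qed

text \<open>The set \<open>\<E> C\<close> plays the role of a stopping set: it does not depend on the states of its own edges.\<close>
lemma avg_stopping:
 assumes b: "be > 0" and fin: "finite E" and "!!C. C \<subseteq> E ==> \<E> C \<subseteq> E"
  and st: "!!C C'. C \<subseteq> E ==> C' \<subseteq> E ==> C' - \<E> C = C - \<E> C ==> \<E> C' = \<E> C"
 shows "avg E (cw be) (%C. of_bool (\<E> C \<subseteq> C)) = avg E (cw be) (%C. exp (- 4 * be * real (card (\<E> C))))"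
proof -
 have "avg E (cw be) (%C. of_bool (\<E> C \<subseteq> C)) = avg E (cw be) (%C. SUM e:Pow E. of_bool (\<E> C = e) * of_bool (e \<subseteq> C))"
 proof (rule avg_cong[OF refl])
  fix C assume C: "C \<subseteq> E"
  have "(SUM e:Pow E. of_bool (\<E> C = e) * of_bool (e \<subseteq> C) :: real) = (SUM e:Pow E. if e = \<E> C then of_bool (\<E> C \<subseteq> C) else 0)"
   by (intro sum.cong) auto
  thus "(of_bool (\<E> C \<subseteq> C) :: real) = (SUM e:Pow E. of_bool (\<E> C = e) * of_bool (e \<subseteq> C))"
   using assms(3)[OF C] fin by simp
 qed
 also have "... = (SUM e:Pow E. avg E (cw be) (%C. of_bool (\<E> C = e) * of_bool (e \<subseteq> C)))"
  by (rule avg_sum)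
 \<comment> \<open>By stability the event \<open>\<E> C = e\<close> is unaffected by opening the
   edges of \<open>e\<close>, so it is independent of their being closed.\<close>
 also have "... = (SUM e:Pow E. avg E (cw be) (%C. of_bool (\<E> C = e)) * exp (- 4 * be) ^ card e)"
 proof (intro sum.cong refl avg_closed_part b fin)
  fix e C assume e: "e : Pow E" and C: "C \<subseteq> E"
  have "\<E> C = e \<longleftrightarrow> \<E> (C - e) = e"
   using st[of C "C - e"] st[of "C - e" C] C by auto
  thus "(of_bool (\<E> C = e) :: real) = of_bool (\<E> (C - e) = e)" by simp
 qed auto
 also have "... = avg E (cw be) (%C. SUM e:Pow E. of_bool (\<E> C = e) * exp (- 4 * be) ^ card e)"
  by (simp only: avg_sum avg_multc)
 also have "... = avg E (cw be) (%C. exp (- 4 * be * real (card (\<E> C))))"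
 proof (rule avg_cong[OF refl])
  fix C assume C: "C \<subseteq> E"
  have "(SUM e:Pow E. of_bool (\<E> C = e) * exp (- 4 * be) ^ card e) =
    (SUM e:Pow E. if e = \<E> C then exp (- 4 * be) ^ card (\<E> C) else 0)"
   by (intro sum.cong) auto
  thus "(SUM e:Pow E. of_bool (\<E> C = e) * exp (- 4 * be) ^ card e) = exp (- 4 * be * real (card (\<E> C)))"
   using assms(3)[OF C] fin by (simp add: exp_of_nat_mult[symmetric] mult.commute)
 qed
 finally show ?thesis .
qed

section \<open>The swapping identity and the energy inequality\<close>

text \<open>The edges that must be closed for the cluster to be no larger than \<open>ka\<close>:
  they join a free site of \<open>B - ka\<close> to \<open>ka\<close> or to the outside of
  \<open>B\<close>.\<close>

definition Eout :: "site set => site set => site set => site set set" where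
 "Eout B ka Ob = {{u, v} |u v. u : B - ka - Ob & v ~: B - ka & adj u v}"

lemma Eout_subset: "Eout B ka Ob \<subseteq> eds B"
 unfolding Eout_def eds_def by blast

lemma in_Eout_iff:
 assumes "Ob \<subseteq> B - ka"
 shows "{u, v} : Eout B ka Ob \<longleftrightarrow> adj u v &
  (u : B - ka & v ~: B - ka & u ~: Ob \<or> v : B - ka & u ~: B - ka & v ~: Ob)"
 unfolding Eout_def mem_Collect_eq doubleton_eq_iff using adj_sym by blast

text \<open>Splits the event into a part in which all of \<open>B - ka\<close> is declared an
  obstacle, hence independent of the true obstacles, and the closure of \<open>Eout\<close>. The two
  parts involve different edges, which gives the product in \<open>PK_eq\<close>.\<close>

lemma Kc_eq_iff:
 assumes "ka \<subseteq> B - Ob"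
 shows "Kc B Ob C = ka \<longleftrightarrow> Kc B (B - ka) C = ka & Eout B ka Ob \<subseteq> C"
proof
 assume K: "Kc B Ob C = ka"
 have "v : Kc B (B - ka) C" if "v : Kc B Ob C" for v
  using that
 proof induction
  case (base v w)
  hence "v : ka" using K Kc.base by blast
  thus ?case using base by (intro Kc.base[of v _ _ w]) auto
 next
  case (step u v)
  hence "v : ka" using K Kc.step by blast
  thus ?case using step by (intro Kc.step[OF step.IH]) auto
 qed
 hence "Kc B (B - ka) C = ka" using K Kc_subset[of B "B - ka" C] by blast
 moreover have "Eout B ka Ob \<subseteq> C"
 proof
  fix e assume "e : Eout B ka Ob"
  then obtain u v where e: "e = {u, v}" "u : B - ka - Ob" "v ~: B - ka" "adj u v"
   unfolding Eout_def by blast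
  show "e : C"
  proof (rule ccontr)
   assume n: "e ~: C"
   have "u : Kc B Ob C"
   proof (cases "v : B")
    case True
    hence "v : Kc B Ob C" using e K by blast
    thus ?thesis by (rule Kc.step) (use e n in \<open>auto simp: adj_sym insert_commute\<close>)
   next
    case False
    thus ?thesis by (intro Kc.base[of u _ _ v]) (use e n in auto)
   qed
   thus False using K e by blast
  qed
 qed
 ultimately show "Kc B (B - ka) C = ka & Eout B ka Ob \<subseteq> C" ..
next
 assume A: "Kc B (B - ka) C = ka & Eout B ka Ob \<subseteq> C"
 have "ka \<subseteq> Kc B Ob C"
  using A Kc_mono[of Ob B "B - ka" C C] assms by blast
 moreover have "v : ka" if "v : Kc B Ob C" for v
  using that
 proof induction
  case (base v w)
  show ?case
  proof (rule ccontr)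
   assume "v ~: ka"
   hence "{v, w} : Eout B ka Ob" unfolding Eout_def using base by blast
   thus False using A base by blast
  qed
 next
  case (step u v)
  show ?case
  proof (rule ccontr)
   assume "v ~: ka"
   hence "{v, u} : Eout B ka Ob" unfolding Eout_def using step adj_sym by blast
   thus False using A step by (metis insert_commute subsetD)
  qed
 qed
 ultimately show "Kc B Ob C = ka" by blast
qed

definition PK :: "real => site set => site set => site set => real" where
 "PK be B ka Ob = avg (eds B) (cw be) (%C. of_bool (Kc B Ob C = ka))"

lemma PK_eq:
 assumes b: "be > 0" and fB: "finite B" and "ka \<subseteq> B - Ob"
 shows "PK be B ka Ob = PK be B ka (B - ka) * exp (- 4 * be * real (card (Eout B ka Ob)))"
proof -
 have "PK be B ka Ob = avg (eds B) (cw be) (%C. of_bool (Kc B (B - ka) C = ka) * of_bool (Eout B ka Ob \<subseteq> C))"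
  unfolding PK_def Kc_eq_iff[OF assms(3)] of_bool_conj ..
 also have "... = PK be B ka (B - ka) * exp (- 4 * be) ^ card (Eout B ka Ob)"
  unfolding PK_def
 proof (rule avg_closed_part[OF b finite_eds[OF fB] Eout_subset])
  fix C :: "site set set"
  let ?E = "Eout B ka Ob"
  have "Kc B (B - ka) (C - ?E) \<subseteq> Kc B (B - ka) C"
  proof
   fix v assume "v : Kc B (B - ka) (C - ?E)"
   thus "v : Kc B (B - ka) C"
   proof induction
    case (base v w)
    hence "v ~: B - ka" "w ~: B - ka" by auto
    hence "{v, w} ~: ?E" unfolding Eout_def by (auto simp: doubleton_eq_iff)
    thus ?case using base by (intro Kc.base[of v _ _ w]) auto
   next
    case (step u v)
    hence "u ~: B - ka" "v ~: B - ka" using Kc_subset by blast+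
    hence "{u, v} ~: ?E" unfolding Eout_def by (auto simp: doubleton_eq_iff)
    thus ?case using step by (intro Kc.step[OF step.IH]) auto
   qed
  qed
  moreover have "Kc B (B - ka) C \<subseteq> Kc B (B - ka) (C - ?E)" by (rule Kc_mono) auto
  ultimately show "(of_bool (Kc B (B - ka) C = ka) :: real) = of_bool (Kc B (B - ka) (C - ?E) = ka)"
   by (metis subset_antisym)
 qed
 finally show ?thesis by (simp add: exp_of_nat_mult[symmetric] mult.commute)
qed

lemma PK_zero:
 assumes "~ ka \<subseteq> B - Ob"
 shows "PK be B ka Ob = 0"
proof -
 have "Kc B Ob C ~= ka" for C using assms Kc_subset by blast
 thus ?thesis unfolding PK_def avg_def by simp
qed

lemma card_eq_sum: "finite A ==> X \<subseteq> A ==> real (card X) = (SUM a:A. of_bool (a : X))"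
 by (simp add: Int_absorb1 Int_def[symmetric] sum_of_bool_eq Collect_mem_eq flip: Int_def)

lemma swap_cost:
 assumes fB: "finite B" and "M \<subseteq> B - ka" "M' \<subseteq> B - ka" and S: "S = B - ka"
 shows "real (card (bd (S - M'))) + real (card (bd (S - M))) + 2 * real (card (Eout B ka ((S - M') Un (S - M))))
    = real (card (bd M)) + real (card (bd M')) + 2 * real (card (Eout B ka (M Un M')))"
proof -
 have fe: "finite (eds B)" by (rule finite_eds[OF fB])
 have sub: "bd A \<subseteq> eds B" if "A \<subseteq> B" for A using that bd_subset_eds eds_mono by blast
 let ?c = "%M M' e. of_bool (e : bd M) + of_bool (e : bd M') + 2 * of_bool (e : Eout B ka (M Un M')) :: real"
 have cost: "real (card (bd M)) + real (card (bd M')) + 2 * real (card (Eout B ka (M Un M'))) = (SUM e:eds B. ?c M M' e)"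
  if "M \<subseteq> B" "M' \<subseteq> B" for M M'
  using card_eq_sum[OF fe sub[OF that(1)]] card_eq_sum[OF fe sub[OF that(2)]] card_eq_sum[OF fe, of "Eout B ka (M Un M')"] Eout_subset[of B ka "M Un M'"]
  by (simp add: sum.distrib sum_distrib_left)
 \<comment> \<open>Inside \<open>S\<close>, complementing both ends leaves disagreement unchanged.
   An edge leaving \<open>S\<close> costs 2 if its end in \<open>S\<close> lies in both or in
   neither of \<open>M\<close> and \<open>M'\<close>, and 1 otherwise; the swap exchanges "both"
   with "neither". This fixes the coefficient 2 of \<open>Eout\<close>.\<close>
 have "?c (S - M') (S - M) e = ?c M M' e" if "e : eds B" for e
 proof -
  from that obtain u v where e: "e = {u, v}" "adj u v" unfolding eds_def by blast
  have s1: "(S - M') Un (S - M) \<subseteq> B - ka" and s2: "M Un M' \<subseteq> B - ka" using S assms by auto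
  consider "u : S" "v : S" | "u : S" "v ~: S" | "u ~: S" "v : S" | "u ~: S" "v ~: S" by blast
  thus ?thesis
  proof cases
   case 1
   thus ?thesis unfolding e in_bd_iff in_Eout_iff[OF s1] in_Eout_iff[OF s2] using e S by auto
  next
   case 2
   hence "v ~: M" "v ~: M'" using assms by auto
   thus ?thesis unfolding e in_bd_iff in_Eout_iff[OF s1] in_Eout_iff[OF s2] using 2 e S by auto
  next
   case 3
   hence "u ~: M" "u ~: M'" using assms by auto
   thus ?thesis unfolding e in_bd_iff in_Eout_iff[OF s1] in_Eout_iff[OF s2] using 3 e S by auto
  next
   case 4
   hence "v ~: M" "v ~: M'" "u ~: M" "u ~: M'" using assms by auto
   thus ?thesis unfolding e in_bd_iff in_Eout_iff[OF s1] in_Eout_iff[OF s2] using 4 e S by auto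
  qed
 qed
 hence "(SUM e:eds B. ?c (S - M') (S - M) e) = (SUM e:eds B. ?c M M' e)" by (rule sum.cong[OF refl])
 thus ?thesis using cost[of M M'] cost[of "S - M'" "S - M"] assms by (simp add: Diff_subset subset_trans[of _ "B - ka"] le_supI1)
qed

definition TK :: "real => site set => site set => (site => real) => (site => real) => (site set => site set => real) => real" where
 "TK be B ka g1 g2 F = (SUM M:Pow B. SUM M':Pow B. wt be g1 M * wt be g2 M' * PK be B ka (M Un M') * F M M')"

lemma TK_eq:
 assumes b: "be > 0" and fB: "finite B" and k: "ka \<subseteq> B"
 shows "TK be B ka g1 g2 F = PK be B ka (B - ka) * (SUM M:Pow (B - ka). SUM M':Pow (B - ka).
   exp (- 2 * be * (real (card (bd M)) + real (card (bd M')) + 2 * real (card (Eout B ka (M Un M')))))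
   * exp (- 2 * be * (sum g1 M + sum g2 M')) * F M M')"
proof -
 have z: "PK be B ka (M Un M') = 0" if "~ (M \<subseteq> B - ka & M' \<subseteq> B - ka)" "M \<subseteq> B" "M' \<subseteq> B" for M M'
  using that k by (intro PK_zero) blast
 have sub: "Pow (B - ka) \<subseteq> Pow B" by auto
 have "TK be B ka g1 g2 F = (SUM M:Pow (B - ka). SUM M':Pow B. wt be g1 M * wt be g2 M' * PK be B ka (M Un M') * F M M')"
  unfolding TK_def by (rule sum.mono_neutral_right) (use fB sub z in auto)
 also have "... = (SUM M:Pow (B - ka). SUM M':Pow (B - ka). wt be g1 M * wt be g2 M' * PK be B ka (M Un M') * F M M')"
 proof (rule sum.cong[OF refl])
  fix M assume M: "M : Pow (B - ka)"
  show "(SUM M':Pow B. wt be g1 M * wt be g2 M' * PK be B ka (M Un M') * F M M') =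
    (SUM M':Pow (B - ka). wt be g1 M * wt be g2 M' * PK be B ka (M Un M') * F M M')"
  proof (rule sum.mono_neutral_right)
   show "ALL M':Pow B - Pow (B - ka). wt be g1 M * wt be g2 M' * PK be B ka (M Un M') * F M M' = 0"
   proof
    fix M' assume "M' : Pow B - Pow (B - ka)"
    hence "PK be B ka (M Un M') = 0" using M by (intro z) auto
    thus "wt be g1 M * wt be g2 M' * PK be B ka (M Un M') * F M M' = 0" by simp
   qed
  qed (use fB sub in auto)
 qed
 also have "... = (SUM M:Pow (B - ka). SUM M':Pow (B - ka). PK be B ka (B - ka) *
   (exp (- 2 * be * (real (card (bd M)) + real (card (bd M')) + 2 * real (card (Eout B ka (M Un M')))))
   * exp (- 2 * be * (sum g1 M + sum g2 M')) * F M M'))"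
 proof (intro sum.cong refl)
  fix M M' assume "M : Pow (B - ka)" "M' : Pow (B - ka)"
  hence "ka \<subseteq> B - (M Un M')" using k by auto
  hence P: "PK be B ka (M Un M') = PK be B ka (B - ka) * exp (- 4 * be * real (card (Eout B ka (M Un M'))))"
   by (rule PK_eq[OF b fB])
  have "wt be g1 M * wt be g2 M' * exp (- 4 * be * real (card (Eout B ka (M Un M')))) =
   exp (- 2 * be * (real (card (bd M)) + real (card (bd M')) + 2 * real (card (Eout B ka (M Un M')))))
   * exp (- 2 * be * (sum g1 M + sum g2 M'))"
   unfolding wt_def exp_add[symmetric] by (simp add: algebra_simps)
  thus "wt be g1 M * wt be g2 M' * PK be B ka (M Un M') * F M M' = PK be B ka (B - ka) *
   (exp (- 2 * be * (real (card (bd M)) + real (card (bd M')) + 2 * real (card (Eout B ka (M Un M')))))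
   * exp (- 2 * be * (sum g1 M + sum g2 M')) * F M M')"
   unfolding P by (simp only: mult_ac)
 qed
 finally show ?thesis by (simp only: sum_distrib_left)
qed

text \<open>Exchange of the two replicas off the cluster \<open>ka\<close>; since they have opposite boundary conditions, minus sets are
 also complemented. The closing probability \<open>exp (- 4 * be)\<close> is the one for which the cluster boundary pays the same before and after.\<close>
lemma TK_swap:
 assumes b: "be > 0" and fB: "finite B" and k: "ka \<subseteq> B" and S: "S = B - ka"
 shows "TK be B ka g1 g2 F = exp (- 2 * be * (sum g1 S + sum g2 S)) *
   TK be B ka (%v. - g2 v) (%v. - g1 v) (%M M'. F (S - M') (S - M))"
proof -
 let ?c = "%M M'. exp (- 2 * be * (real (card (bd M)) + real (card (bd M')) + 2 * real (card (Eout B ka (M Un M')))))"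
 have fS: "finite S" using fB S by auto
 have bij: "bij_betw (%(M, M'). (S - M', S - M)) (Pow S \<times> Pow S) (Pow S \<times> Pow S)"
  by (rule bij_betwI[where g = "%(M, M'). (S - M', S - M)"]) auto
 have "(SUM M:Pow S. SUM M':Pow S. ?c M M' * exp (- 2 * be * (sum g1 M + sum g2 M')) * F M M')
   = (\<Sum>(M, M')\<in>Pow S \<times> Pow S. ?c M M' * exp (- 2 * be * (sum g1 M + sum g2 M')) * F M M')"
  by (simp add: sum.cartesian_product)
 also have "... = (\<Sum>(M, M')\<in>Pow S \<times> Pow S. ?c (S - M') (S - M) * exp (- 2 * be * (sum g1 (S - M') + sum g2 (S - M))) * F (S - M') (S - M))"
  by (subst sum.reindex_bij_betw[OF bij, symmetric]) (simp add: split_beta)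
 also have "... = (\<Sum>(M, M')\<in>Pow S \<times> Pow S. exp (- 2 * be * (sum g1 S + sum g2 S)) * (?c M M' *
   exp (- 2 * be * (sum (%v. - g2 v) M + sum (%v. - g1 v) M')) * F (S - M') (S - M)))"
 proof (rule sum.cong[OF refl], clarify)
  fix M M' assume M: "M \<subseteq> S" "M' \<subseteq> S"
  have c: "?c (S - M') (S - M) = ?c M M'"
   using swap_cost[OF fB _ _ S, of M M'] M S by simp
  have sd: "sum g1 (S - M') = sum g1 S - sum g1 M'" "sum g2 (S - M) = sum g2 S - sum g2 M"
   using M fS by (simp_all add: sum_diff)
  have "exp (- 2 * be * (sum g1 (S - M') + sum g2 (S - M))) =
    exp (- 2 * be * (sum g1 S + sum g2 S)) * exp (- 2 * be * (sum (%v. - g2 v) M + sum (%v. - g1 v) M'))"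
   unfolding exp_add[symmetric] sd sum_negf by (simp add: algebra_simps)
  thus "?c (S - M') (S - M) * exp (- 2 * be * (sum g1 (S - M') + sum g2 (S - M))) * F (S - M') (S - M) =
   exp (- 2 * be * (sum g1 S + sum g2 S)) * (?c M M' *
   exp (- 2 * be * (sum (%v. - g2 v) M + sum (%v. - g1 v) M')) * F (S - M') (S - M))"
   unfolding c by (simp only: mult_ac)
 qed
 also have "... = exp (- 2 * be * (sum g1 S + sum g2 S)) * (SUM M:Pow S. SUM M':Pow S. ?c M M' *
   exp (- 2 * be * (sum (%v. - g2 v) M + sum (%v. - g1 v) M')) * F (S - M') (S - M))"
  unfolding sum.cartesian_product sum_distrib_left by (simp add: split_beta)
 finally show ?thesis unfolding TK_eq[OF b fB k] S[symmetric]
  by (simp only: mult_ac)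
qed

definition Zs :: "real => site set => (site => real) => real" where
 "Zs be B g = (SUM M:Pow B. wt be g M)"

lemma Zs_pos: "finite B ==> Zs be B g > 0"
 unfolding Zs_def by (rule sum_Pow_pos) (auto simp: wt_pos)

lemma kexp_TK:
 assumes b: "be > 0" and fB: "finite B" and X: "X \<subseteq> Pow B"
 shows "kexp be B g1 g2 (%M M' C. of_bool (Kc B (M Un M') C : X) * F M M') =
  (SUM ka:X. TK be B ka g1 g2 F) / (Zs be B g1 * Zs be B g2)"
proof -
 have fX: "finite X" using X fB finite_subset by auto
 have 1: "(of_bool (Kc B (M Un M') C : X) :: real) = (SUM ka:X. of_bool (Kc B (M Un M') C = ka))" for M M' C
  using fX by (simp add: of_bool_def)
 have "kexp be B g1 g2 (%M M' C. of_bool (Kc B (M Un M') C : X) * F M M') =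
   kexp be B g1 g2 (%M M' C. SUM ka:X. of_bool (Kc B (M Un M') C = ka) * F M M')"
  by (simp only: 1 sum_distrib_right)
 also have "... = (SUM ka:X. kexp be B g1 g2 (%M M' C. of_bool (Kc B (M Un M') C = ka) * F M M'))"
  by (rule kexp_sum)
 also have "... = (SUM ka:X. TK be B ka g1 g2 F / (Zs be B g1 * Zs be B g2))"
 proof (rule sum.cong[OF refl])
  fix ka
  have "kexp be B g1 g2 (%M M' C. of_bool (Kc B (M Un M') C = ka) * F M M') =
    avg B (wt be g1) (%M. avg B (wt be g2) (%M'. PK be B ka (M Un M') * F M M'))"
   unfolding kexp_def PK_def avg_multc ..
  also have "... = (SUM M:Pow B. wt be g1 M * (SUM M':Pow B. wt be g2 M' * (PK be B ka (M Un M') * F M M'))) / (Zs be B g1 * Zs be B g2)"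
   unfolding avg_def Zs_def times_divide_eq_right sum_divide_distrib[symmetric] by (simp add: mult.commute)
  also have "... = TK be B ka g1 g2 F / (Zs be B g1 * Zs be B g2)"
   unfolding TK_def sum_distrib_left by (simp only: mult.assoc)
  finally show "kexp be B g1 g2 (%M M' C. of_bool (Kc B (M Un M') C = ka) * F M M') = TK be B ka g1 g2 F / (Zs be B g1 * Zs be B g2)" .
 qed
 finally show ?thesis by (simp only: sum_divide_distrib)
qed

definition pm :: "real => site set => (site => real) => site => real" where
 "pm be B g v = avg B (wt be g) (%M. of_bool (v : M))"

text \<open>Half the difference of the spin averages at \<open>v\<close> under plus and minus boundary conditions.\<close>
definition dd :: "real => site set => (site => real) => site => real" where
 "dd be B h v = 1 - pm be B h v - pm be B (%x. - h x) v"

text \<open>The observable \<open>?F\<close> has mean \<open>dd\<close>. It is odd under the swap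
  when \<open>v\<close> is off the cluster, so those clusters contribute zero, and it equals 1 when
  \<open>v\<close> is in the cluster, which avoids both minus sets.\<close>

theorem dd_eq_kp:
 assumes b: "be > 0" and fB: "finite B" and v: "v : B"
 shows "dd be B h v = kp be B h (%x. - h x) (%K. v : K)"
proof -
 let ?h' = "%x. - h x"
 let ?F = "%M M'. 1 - of_bool (v : M) - of_bool (v : M') :: real"
 let ?Z = "Zs be B h * Zs be B ?h'"
 have Ksub: "Kc B Ob C : Pow B" for Ob C using Kc_subset by blast
 have "dd be B h v = kexp be B h ?h' (%M M' C. ?F M M')"
  unfolding kexp_def avg_diff pm_def dd_def using fB finite_eds[OF fB] by (simp add: cw_pos[OF b] wt_pos)
 also have "... = kexp be B h ?h' (%M M' C. of_bool (Kc B (M Un M') C : Pow B) * ?F M M')"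
  by (simp only: Ksub of_bool_eq mult_1)
 also have "... = (SUM ka:Pow B. TK be B ka h ?h' ?F) / ?Z" by (rule kexp_TK[OF b fB subset_refl])
 also have "(SUM ka:Pow B. TK be B ka h ?h' ?F) = (SUM ka:{ka:Pow B. v : ka}. TK be B ka h ?h' (%_ _. 1))"
 proof (rule sum.mono_neutral_cong_right)
  show "ALL ka:Pow B - {ka : Pow B. v : ka}. TK be B ka h ?h' ?F = 0"
  proof
   fix ka assume "ka : Pow B - {ka : Pow B. v : ka}"
   hence k: "ka \<subseteq> B" and vS: "v : B - ka" using v by auto
   have "TK be B ka h ?h' ?F = TK be B ka h ?h' (%M M'. ?F ((B - ka) - M') ((B - ka) - M))"
    using TK_swap[OF b fB k refl, of h ?h' ?F] by (simp add: sum_negf)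
   also have "... = - TK be B ka h ?h' ?F"
    unfolding TK_def sum_negf[symmetric] using vS by (intro sum.cong refl) (auto simp: algebra_simps)
   finally show "TK be B ka h ?h' ?F = 0" by simp
  qed
  fix ka assume "ka : {ka : Pow B. v : ka}"
  hence "v : ka" by auto
  hence z: "PK be B ka (M Un M') = 0" if "v : M \<or> v : M'" for M M'
   using that by (intro PK_zero) auto
  show "TK be B ka h ?h' ?F = TK be B ka h ?h' (%_ _. 1)"
   unfolding TK_def by (intro sum.cong refl) (use z in auto)
 qed (use fB in auto)
 also have "... / ?Z = kexp be B h ?h' (%M M' C. of_bool (Kc B (M Un M') C : {ka:Pow B. v : ka}) * 1)"
  by (rule kexp_TK[OF b fB, symmetric]) auto
 also have "... = kp be B h ?h' (%K. v : K)"
  unfolding kp_def using Ksub by simp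
 finally show ?thesis .
qed

text \<open>The two fields fail to be opposite by exactly \<open>s\<close> on \<open>D\<close>. If
  the cluster misses \<open>D\<close>, the swap yields a factor for every site of \<open>D\<close>
  and turns the fields (h + s, -h) into (h, -(h + s)); bounding the swapped probability by 1 leaves
  a ratio of partition functions.\<close>

lemma kp_avoid_le:
 assumes b: "be > 0" and fB: "finite B" and D: "D \<subseteq> B"
 shows "kp be B (%x. h x + s * of_bool (x : D)) (%x. - h x) (%K. K Int D = {}) <=
  exp (- 2 * be * s * real (card D)) * (Zs be B h * Zs be B (%x. - (h x + s * of_bool (x : D))))
   / (Zs be B (%x. h x + s * of_bool (x : D)) * Zs be B (%x. - h x))"
proof -
 let ?h1 = "%x. h x + s * of_bool (x : D)" and ?h2 = "%x. - h x"
 let ?h1' = "%x. - (h x + s * of_bool (x : D))"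
 let ?X = "{ka:Pow B. ka Int D = {}}"
 have Ksub: "Kc B Ob C : Pow B" for Ob C using Kc_subset by blast
 have fD: "finite D" using D fB finite_subset by blast
 have "kp be B ?h1 ?h2 (%K. K Int D = {}) = kexp be B ?h1 ?h2 (%M M' C. of_bool (Kc B (M Un M') C : ?X) * 1)"
  unfolding kp_def using Ksub by simp
 also have "... = (SUM ka:?X. TK be B ka ?h1 ?h2 (%_ _. 1)) / (Zs be B ?h1 * Zs be B ?h2)"
  by (rule kexp_TK[OF b fB]) auto
 also have "(SUM ka:?X. TK be B ka ?h1 ?h2 (%_ _. 1)) = (SUM ka:?X. exp (- 2 * be * s * real (card D)) * TK be B ka h ?h1' (%_ _. 1))"
 proof (rule sum.cong[OF refl])
  fix ka assume "ka : ?X"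
  hence k: "ka \<subseteq> B" and kd: "D \<subseteq> B - ka" using D by auto
  have "sum ?h1 (B - ka) + sum ?h2 (B - ka) = s * real (card D)"
  proof -
   have "sum ?h1 (B - ka) + sum ?h2 (B - ka) = (SUM x:B - ka. s * of_bool (x : D))"
    by (simp add: sum.distrib[symmetric])
   also have "... = s * real (card D)"
    using card_eq_sum[OF _ kd] fB by (simp add: sum_distrib_left)
   finally show ?thesis .
  qed
  thus "TK be B ka ?h1 ?h2 (%_ _. 1) = exp (- 2 * be * s * real (card D)) * TK be B ka h ?h1' (%_ _. 1)"
   using TK_swap[OF b fB k refl, of ?h1 ?h2 "%_ _. 1"] by (simp add: mult.assoc)
 qed
 also have "... = exp (- 2 * be * s * real (card D)) * (SUM ka:?X. TK be B ka h ?h1' (%_ _. 1))"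
  by (simp only: sum_distrib_left)
 also have "(SUM ka:?X. TK be B ka h ?h1' (%_ _. 1)) <= Zs be B h * Zs be B ?h1'"
 proof -
  have "(SUM ka:?X. TK be B ka h ?h1' (%_ _. 1)) / (Zs be B h * Zs be B ?h1') =
   kexp be B h ?h1' (%M M' C. of_bool (Kc B (M Un M') C : ?X) * 1)"
   by (rule kexp_TK[OF b fB, symmetric]) auto
  also have "... <= 1" by (subst kexp_const[OF b fB, symmetric, of _ h ?h1']) (rule kexp_mono[OF b fB], simp)
  finally have "(SUM ka:?X. TK be B ka h ?h1' (%_ _. 1)) / (Zs be B h * Zs be B ?h1') <= 1" .
  moreover have "0 < Zs be B h * Zs be B ?h1'" by (intro mult_pos_pos Zs_pos fB)
  ultimately show ?thesis by (simp only: divide_le_eq_1_pos)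
 qed
 finally show ?thesis using mult_pos_pos[OF Zs_pos[OF fB, of be ?h1] Zs_pos[OF fB, of be ?h2]]
  by (simp add: divide_right_mono mult_left_mono less_imp_le)
qed

lemma avg_card_Int:
 assumes "finite D"
 shows "avg B (wt be g) (%M. real (card (M Int D))) = (SUM v:D. pm be B g v)"
proof -
 have "real (card (M Int D)) = (SUM v:D. of_bool (v : M))" for M
 proof -
  have "real (card (M Int D)) = (SUM v:D. of_bool (v : M Int D))" by (rule card_eq_sum[OF assms]) auto
  also have "... = (SUM v:D. of_bool (v : M))" by (rule sum.cong) auto
  finally show ?thesis .
 qed
 thus ?thesis unfolding pm_def by (simp only: avg_sum)
qed

lemma ln_Zs_deriv:
 assumes fB: "finite B" and D: "finite D"
 shows "((%u. ln (Zs be B (%x. ep * (h x + u * of_bool (x : D))))) has_real_derivative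
  (- 2 * be * ep * (SUM v:D. pm be B (%x. ep * (h x + u * of_bool (x : D))) v))) (at u)"
proof -
 define g where "g u x = ep * (h x + u * of_bool (x : D))" for u x
 have w: "wt be (g u) M = exp (- 2 * be * (real (card (bd M)) + ep * (SUM x:M. h x) + ep * u * real (card (M Int D))))"
  if "M : Pow B" for M u
 proof -
  have fM: "finite M" using that fB finite_subset by auto
  have "(SUM x:M. u * of_bool (x : D)) = u * real (card (M Int D))"
   using card_eq_sum[OF fM, of "M Int D"] by (simp add: sum_distrib_left)
  hence "sum (g u) M = ep * (SUM x:M. h x) + ep * u * real (card (M Int D))"
   unfolding g_def by (simp add: sum_distrib_left[symmetric] sum.distrib algebra_simps)
  thus ?thesis unfolding wt_def by (simp add: algebra_simps)
 qed
 have Z: "Zs be B (g u) = (SUM M:Pow B. exp (- 2 * be * (real (card (bd M)) + ep * (SUM x:M. h x) + ep * u * real (card (M Int D)))))" for u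
  unfolding Zs_def by (intro sum.cong refl w)
 have "((%u. Zs be B (g u)) has_real_derivative (SUM M:Pow B. wt be (g u) M * (- 2 * be * ep * real (card (M Int D))))) (at u)"
  unfolding Z
 proof (rule DERIV_sum)
  fix M assume M: "M : Pow B"
  show "((%u. exp (- 2 * be * (real (card (bd M)) + ep * (SUM x:M. h x) + ep * u * real (card (M Int D))))) has_real_derivative
    wt be (g u) M * (- 2 * be * ep * real (card (M Int D)))) (at u)"
   unfolding w[OF M] by (auto intro!: derivative_eq_intros)
 qed
 hence "((%u. ln (Zs be B (g u))) has_real_derivative
   (SUM M:Pow B. wt be (g u) M * (- 2 * be * ep * real (card (M Int D)))) / Zs be B (g u)) (at u)"
  using Zs_pos[OF fB] by (auto intro!: derivative_eq_intros)
 also have "(SUM M:Pow B. wt be (g u) M * (- 2 * be * ep * real (card (M Int D)))) / Zs be B (g u)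
   = avg B (wt be (g u)) (%M. (- 2 * be * ep) * real (card (M Int D)))"
  unfolding avg_def Zs_def ..
 also have "... = - 2 * be * ep * (SUM v:D. pm be B (g u) v)"
  unfolding avg_cmult avg_card_Int[OF D] ..
 finally show ?thesis unfolding g_def .
qed

text \<open>Differentiating the logarithm of a partition function in a uniform shift on
  \<open>D\<close> gives the expected number of minus sites there. So the logarithm of the bound in
  \<open>kp_avoid_le\<close> is -2 * be times the integral of \<open>dd\<close> over the
  shift.\<close>

lemma dd_integral:
 assumes b: "be > 0" and fB: "finite B" and D: "D \<subseteq> B" and s: "s >= 0"
 shows "((%u. SUM v:D. dd be B (%x. h x + u * of_bool (x : D)) v) has_integral
  (s * real (card D) + (ln (Zs be B (%x. h x + s * of_bool (x : D))) - ln (Zs be B (%x. - (h x + s * of_bool (x : D))))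
    - ln (Zs be B h) + ln (Zs be B (%x. - h x))) / (2 * be))) {0..s}"
proof -
 have fD: "finite D" using D fB finite_subset by blast
 define G where "G u = u * real (card D) + (ln (Zs be B (%x. h x + u * of_bool (x : D))) - ln (Zs be B (%x. - (h x + u * of_bool (x : D))))) / (2 * be)" for u
 have "(G has_real_derivative (SUM v:D. dd be B (%x. h x + u * of_bool (x : D)) v)) (at u)" for u
 proof -
  have d1: "((%u. ln (Zs be B (%x. h x + u * of_bool (x : D)))) has_real_derivative
    - (2 * be * (SUM v:D. pm be B (%x. h x + u * of_bool (x : D)) v))) (at u)"
   using ln_Zs_deriv[OF fB fD, of be 1 h u] by simp
  have d2: "((%u. ln (Zs be B (%x. - (h x + u * of_bool (x : D))))) has_real_derivative
    2 * be * (SUM v:D. pm be B (%x. - (h x + u * of_bool (x : D))) v)) (at u)"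
   using ln_Zs_deriv[OF fB fD, of be "-1" h u] by simp
  have d0: "((%u. u * real (card D)) has_real_derivative real (card D)) (at u)"
   by (auto intro!: derivative_eq_intros)
  have "(G has_real_derivative real (card D) + (- (2 * be * (SUM v:D. pm be B (%x. h x + u * of_bool (x : D)) v))
    - 2 * be * (SUM v:D. pm be B (%x. - (h x + u * of_bool (x : D))) v)) / (2 * be)) (at u)"
   unfolding G_def by (rule DERIV_add[OF d0 DERIV_cdivide[OF DERIV_diff[OF d1 d2]]])
  also have "real (card D) + (- (2 * be * (SUM v:D. pm be B (%x. h x + u * of_bool (x : D)) v))
    - 2 * be * (SUM v:D. pm be B (%x. - (h x + u * of_bool (x : D))) v)) / (2 * be)
    = (SUM v:D. dd be B (%x. h x + u * of_bool (x : D)) v)"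
   using b unfolding dd_def sum_subtractf by (simp add: field_simps)
  finally show ?thesis .
 qed
 hence "((%u. SUM v:D. dd be B (%x. h x + u * of_bool (x : D)) v) has_integral (G s - G 0)) {0..s}"
  using s by (intro fundamental_theorem_of_calculus)
   (auto simp: has_real_derivative_iff_has_vector_derivative[symmetric] intro: DERIV_subset)
 thus ?thesis unfolding G_def by (simp add: diff_divide_distrib add_divide_distrib algebra_simps)
qed

lemma avg_exp_ge:
 assumes "finite X" "!!A. (w A :: real) > 0"
 shows "exp (avg X w f) <= avg X w (%A. exp (f A))"
proof -
 let ?m = "avg X w f"
 have "exp ?m = avg X w (%A. exp ?m * (1 + (f A - ?m)))"
  unfolding avg_cmult avg_add avg_diff using assms by simp
 also have "... <= avg X w (%A. exp (f A))"
 proof (rule avg_mono[OF assms(2)])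
  fix A
  have "exp ?m * (1 + (f A - ?m)) <= exp ?m * exp (f A - ?m)"
   by (intro mult_left_mono exp_ge_add_one_self) auto
  thus "exp ?m * (1 + (f A - ?m)) <= exp (f A)" by (simp add: exp_add[symmetric])
 qed
 finally show ?thesis .
qed

lemma kexp_exp_ge:
 assumes b: "be > 0" and fB: "finite B"
 shows "exp (kexp be B g1 g2 f) <= kexp be B g1 g2 (%M M' C. exp (f M M' C))"
proof -
 let ?A = "%M M'. avg (eds B) (cw be) (f M M')"
 have "exp (kexp be B g1 g2 f) <= avg B (wt be g1) (%M. exp (avg B (wt be g2) (?A M)))"
  unfolding kexp_def by (rule avg_exp_ge[OF fB wt_pos])
 also have "... <= avg B (wt be g1) (%M. avg B (wt be g2) (%M'. exp (?A M M')))"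
  by (intro avg_mono wt_pos avg_exp_ge[OF fB wt_pos])
 also have "... <= kexp be B g1 g2 (%M M' C. exp (f M M' C))"
  unfolding kexp_def by (intro avg_mono wt_pos avg_exp_ge[OF finite_eds[OF fB] cw_pos[OF b]])
 finally show ?thesis .
qed

text \<open>Closing the random cut \<open>\<E>\<close> is one way to keep the cluster off
  \<open>D\<close>. Its probability is the mean of exp (-4 * be * card), hence by Jensen at least
  the exponential of the mean, while \<open>kp_avoid_le\<close> bounds it by exp (-2 * be *
  integral). Taking logarithms cancels \<open>be\<close>.\<close>

lemma energy_general:
 assumes b: "be > 0" and fB: "finite B" and D: "D \<subseteq> B" and s: "s >= 0"
  and sub: "!!Ob C. C \<subseteq> eds B ==> \<E> Ob C \<subseteq> eds B"
  and st: "!!Ob C C'. C \<subseteq> eds B ==> C' \<subseteq> eds B ==> C' - \<E> Ob C = C - \<E> Ob C ==> \<E> Ob C' = \<E> Ob C"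
  and cut: "!!Ob C. C \<subseteq> eds B ==> \<E> Ob C \<subseteq> C ==> Kc B Ob C Int D = {}"
 shows "integral {0..s} (%u. SUM v:D. dd be B (%x. h x + u * of_bool (x : D)) v)
  <= 2 * kexp be B (%x. h x + s * of_bool (x : D)) (%x. - h x) (%M M' C. real (card (\<E> (M Un M') C)))"
proof -
 let ?h1 = "%x. h x + s * of_bool (x : D)" and ?h2 = "%x. - h x"
 let ?h1' = "%x. - (h x + s * of_bool (x : D))"
 let ?P = "kp be B ?h1 ?h2 (%K. K Int D = {})"
 let ?n = "%M M' C. real (card (\<E> (M Un M') C))"
 let ?e = "kexp be B ?h1 ?h2 ?n"
 have "exp (- 4 * be * ?e) = exp (kexp be B ?h1 ?h2 (%M M' C. (- 4 * be) * ?n M M' C))"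
  unfolding kexp_cmult ..
 also have "... <= kexp be B ?h1 ?h2 (%M M' C. exp (- 4 * be * ?n M M' C))"
  by (rule kexp_exp_ge[OF b fB])
 also have "... = kexp be B ?h1 ?h2 (%M M' C. of_bool (\<E> (M Un M') C \<subseteq> C))"
  unfolding kexp_def
 proof (rule avg_cong[OF refl], rule avg_cong[OF refl])
  fix M M'
  show "avg (eds B) (cw be) (%C. exp (- 4 * be * ?n M M' C)) = avg (eds B) (cw be) (%C. of_bool (\<E> (M Un M') C \<subseteq> C))"
   by (rule avg_stopping[symmetric, OF b finite_eds[OF fB] sub st])
 qed
 also have "... <= ?P" unfolding kp_def
  by (rule kexp_mono[OF b fB]) (use cut in auto)
 finally have P: "exp (- 4 * be * ?e) <= ?P" .
 let ?Z = "%g. Zs be B g"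
 have Zp: "?Z g > 0" for g by (rule Zs_pos[OF fB])
 have "exp (- 4 * be * ?e) <= exp (- 2 * be * s * real (card D)) * (?Z h * ?Z ?h1') / (?Z ?h1 * ?Z ?h2)"
  using P kp_avoid_le[OF b fB D, of h s] by linarith
 hence "ln (exp (- 4 * be * ?e)) <= ln (exp (- 2 * be * s * real (card D)) * (?Z h * ?Z ?h1') / (?Z ?h1 * ?Z ?h2))"
  by (subst ln_le_cancel_iff) (auto intro!: divide_pos_pos mult_pos_pos Zp)
 also have "... = - 2 * be * s * real (card D) + ln (?Z h) + ln (?Z ?h1') - ln (?Z ?h1) - ln (?Z ?h2)"
 proof -
  have "ln (exp a * (x * y) / (z * t)) = a + ln x + ln y - ln z - ln t" if "x > 0" "y > 0" "z > 0" "t > 0" for a x y z t :: real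
   using that by (simp add: ln_div ln_mult)
  from this[OF Zp Zp Zp Zp] show ?thesis .
 qed
 finally have L: "2 * be * (s * real (card D)) + (ln (?Z ?h1) - ln (?Z ?h1') - ln (?Z h) + ln (?Z ?h2)) <= 4 * be * ?e"
  by (simp add: algebra_simps)
 have "integral {0..s} (%u. SUM v:D. dd be B (%x. h x + u * of_bool (x : D)) v) =
   s * real (card D) + (ln (?Z ?h1) - ln (?Z ?h1') - ln (?Z h) + ln (?Z ?h2)) / (2 * be)"
  by (rule integral_unique[OF dd_integral[OF b fB D s]])
 also have "... = (2 * be * (s * real (card D)) + (ln (?Z ?h1) - ln (?Z ?h1') - ln (?Z h) + ln (?Z ?h2))) / (2 * be)"
  using b by (simp add: field_simps)
 also have "... <= 4 * be * ?e / (2 * be)" using L b by (intro divide_right_mono) auto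
 finally show ?thesis using b by simp
qed

text \<open>\<open>Lv B U W Ob C n v\<close>: the site \<open>v\<close> can be reached from outside \<open>B\<close>, avoiding \<open>U\<close>, the obstacles and the
 closed edges, while visiting \<open>n\<close> sites of \<open>W\<close> (with multiplicity).\<close>
inductive Lv :: "site set => site set => site set => site set => site set set => nat => site => bool"
 for B U W Ob C where
 base: "v : B - U ==> v ~: Ob ==> w ~: B ==> adj v w ==> {v, w} ~: C ==> Lv B U W Ob C (of_bool (v : W)) v"
| step: "Lv B U W Ob C n u ==> v : B - U ==> v ~: Ob ==> adj u v ==> {u, v} ~: C ==> Lv B U W Ob C (n + of_bool (v : W)) v"

text \<open>The \<open>k\<close>-th intrinsic layer: edges from the part reached with at most
  \<open>k\<close> visits to \<open>W\<close> into \<open>U\<close> or into a new site of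
  \<open>W\<close>. Demanding that \<open>x\<close> be not reached with fewer than \<open>k\<close>
  visits excludes edges already known to be closed, which a stopping set must not contain.\<close>

definition cutE :: "site set => site set => site set => nat => site set => site set set => site set set" where
 "cutE B U W k Ob C = {{x, y} |x y. (\<exists>n\<le>k. Lv B U W Ob C n x) & y : B - Ob & adj x y &
   (y : U \<or> (y : W & ~ (\<exists>n\<le>k. Lv B U W Ob C n y) & ~ (\<exists>n<k. Lv B U W Ob C n x)))}"

lemma Lv_in: "Lv B U W Ob C n v ==> v : B - U - Ob"
 by (induction rule: Lv.induct) auto

lemma Lv_Kc: "Lv B U W Ob C n v ==> v : Kc B Ob C"
proof (induction rule: Lv.induct)
 case (base v w)
 thus ?case by (intro Kc.base[of v _ _ w]) auto
next
 case (step n u v)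
 thus ?case by (intro Kc.step[OF step.IH]) auto
qed

lemma cutE_subset: "cutE B U W k Ob C \<subseteq> eds B"
proof
 fix e assume "e : cutE B U W k Ob C"
 then obtain x y where "e = {x, y}" "y : B" "adj x y" unfolding cutE_def by blast
 thus "e : eds B" by (simp add: in_eds_iff)
qed

lemma cutE_Lv:
 assumes E: "C' - E = C - E" "E = cutE B U W k Ob C0"
  and L: "!!n v. n <= k ==> Lv B U W Ob C1 n v ==> Lv B U W Ob C0 n v" "C1 = C" "C2 = C'"
  and "Lv B U W Ob C1 n v" "n <= k"
 shows "Lv B U W Ob C2 n v"
 using assms(6,7)
proof (induction rule: Lv.induct)
 case (base v w)
 have "{v, w} ~: E"
 proof
  assume "{v, w} : E"
  then obtain x y where xy: "{v, w} = {x, y}" "\<exists>n\<le>k. Lv B U W Ob C0 n x" "y : B"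
   unfolding E(2) cutE_def by blast
  hence "x : B" using Lv_in by blast
  thus False using xy base by (auto simp: doubleton_eq_iff)
 qed
 hence "{v, w} ~: C2" using base E L by blast
 thus ?case using base by (intro Lv.base[of v _ _ _ w]) auto
next
 case (step m u v)
 have m: "m <= k" using step.prems by auto
 have Lu: "Lv B U W Ob C0 m u" using L(1)[OF m] step.hyps by blast
 have Lv': "Lv B U W Ob C0 (m + of_bool (v : W)) v"
  using L(1)[OF step.prems] Lv.step[OF step.hyps(1-5)] by blast
 have "{u, v} ~: E"
 proof
  assume "{u, v} : E"
  then obtain x y where xy: "{u, v} = {x, y}" "y : U \<or> (y : W & ~ (\<exists>n\<le>k. Lv B U W Ob C0 n y))"
   unfolding E(2) cutE_def by blast
  have "y = u \<or> y = v" using xy(1) by (auto simp: doubleton_eq_iff)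
  hence "(\<exists>n\<le>k. Lv B U W Ob C0 n y)" "y ~: U"
   using Lu Lv' m step.prems Lv_in by blast+
  thus False using xy(2) by blast
 qed
 hence "{u, v} ~: C2" using step.hyps E L by blast
 thus ?case by (intro Lv.step[OF step.IH[OF m]]) (use step.hyps in auto)
qed

text \<open>No connection with at most \<open>k\<close> visits uses an edge of the cut, so changing
  the states of cut edges alters none of the levels up to \<open>k\<close>, and the cut is defined
  from these.\<close>

lemma cutE_stable:
 assumes E: "C' - cutE B U W k Ob C = C - cutE B U W k Ob C"
 shows "cutE B U W k Ob C' = cutE B U W k Ob C"
proof -
 let ?E = "cutE B U W k Ob C"
 have 1: "Lv B U W Ob C' n v" if "Lv B U W Ob C n v" "n <= k" for n v
  by (rule cutE_Lv[OF E refl _ refl refl that])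
 have 2: "Lv B U W Ob C n v" if "Lv B U W Ob C' n v" "n <= k" for n v
  using that
 proof (induction rule: Lv.induct)
  case (base v w)
  have "{v, w} ~: ?E"
  proof
   assume "{v, w} : ?E"
   then obtain x y where xy: "{v, w} = {x, y}" "\<exists>n\<le>k. Lv B U W Ob C n x" "y : B"
    unfolding cutE_def by blast
   hence "x : B" using Lv_in by blast
   thus False using xy base by (auto simp: doubleton_eq_iff)
  qed
  hence "{v, w} ~: C" using base E by blast
  thus ?case using base by (intro Lv.base[of v _ _ _ w]) auto
 next
  case (step m u v)
  have m: "m <= k" using step.prems by auto
  have Lu: "Lv B U W Ob C m u" by (rule step.IH[OF m])
  have "{u, v} ~: ?E"
  proof
   assume "{u, v} : ?E"
   then obtain x y where xy: "{u, v} = {x, y}" "\<exists>n\<le>k. Lv B U W Ob C n x"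
    "y : U \<or> (y : W & ~ (\<exists>n\<le>k. Lv B U W Ob C n y) & ~ (\<exists>n<k. Lv B U W Ob C n x))"
    unfolding cutE_def by blast
   consider "x = u" "y = v" | "x = v" "y = u" using xy(1) by (auto simp: doubleton_eq_iff)
   thus False
   proof cases
    case 1
    hence "y ~: U" using step.hyps by auto
    hence "v : W" "~ (\<exists>n<k. Lv B U W Ob C n u)" using xy 1 by auto
    \<comment> \<open>A cut edge into \<open>W\<close> starts at minimal level \<open>k\<close>, so
      crossing it would raise the count to \<open>k + 1\<close>.\<close>
    hence "m = k" using Lu m by (metis le_neq_implies_less)
    thus False using step.prems \<open>v : W\<close> by simp
   next
    case 2
    hence "y ~: U" using Lv_in[OF Lu] by auto
    thus False using xy 2 Lu m by blast
   qed
  qed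
  hence "{u, v} ~: C" using step.hyps E by blast
  thus ?case by (intro Lv.step[OF Lu]) (use step.hyps in auto)
 qed
 have "Lv B U W Ob C' n v \<longleftrightarrow> Lv B U W Ob C n v" if "n <= k" for n v using 1 2 that by blast
 hence "(\<exists>n\<le>k. Lv B U W Ob C' n v) = (\<exists>n\<le>k. Lv B U W Ob C n v)"
  "(\<exists>n<k. Lv B U W Ob C' n v) = (\<exists>n<k. Lv B U W Ob C n v)" for v
  using less_imp_le by blast+
 thus ?thesis unfolding cutE_def by simp
qed

text \<open>With the cut closed, the exploration up to level \<open>k\<close> already exhausts the
  cluster. As all neighbours of \<open>U Un W\<close> lie in \<open>B\<close>, a connection to the
  outside of \<open>B\<close> cannot begin inside \<open>U Un W\<close>, so its count starts at
  0.\<close>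

lemma cutE_cut:
 assumes UW: "!!x y. x : U Un W ==> adj x y ==> y : B" and "cutE B U W k Ob C \<subseteq> C" "v : Kc B Ob C"
 shows "\<exists>n\<le>k. Lv B U W Ob C n v"
 using assms(3)
proof induction
 case (base v w)
 hence "v ~: U Un W" using UW by blast
 hence "Lv B U W Ob C (of_bool (v : W)) v" using base by (intro Lv.base[of v _ _ _ w]) auto
 thus ?case using \<open>v ~: U Un W\<close> by auto
next
 case (step u v)
 then obtain n where n: "n <= k" "Lv B U W Ob C n u" by blast
 have "v ~: U"
 proof
  assume "v : U"
  hence "{u, v} : cutE B U W k Ob C" unfolding cutE_def using step n by blast
  thus False using assms(2) step by blast
 qed
 hence L: "Lv B U W Ob C (m + of_bool (v : W)) v" if "Lv B U W Ob C m u" for m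
  using that step by (intro Lv.step[OF that]) auto
 show ?case
 proof (rule ccontr)
  assume N: "~ ?case"
  have "v : W" using L[OF n(2)] N n(1) by (cases "v : W") auto
  have "~ (\<exists>m<k. Lv B U W Ob C m u)"
  proof
   assume "\<exists>m<k. Lv B U W Ob C m u"
   then obtain m where "m < k" "Lv B U W Ob C m u" by blast
   thus False using N L[of m] \<open>v : W\<close> by auto
  qed
  hence "{u, v} : cutE B U W k Ob C" unfolding cutE_def using step n N \<open>v : W\<close> by blast
  thus False using assms(2) step by blast
 qed
qed

theorem energy:
 assumes b: "be > 0" and fB: "finite B" and "D \<subseteq> U" "U \<subseteq> B" and s: "s >= 0"
  and UW: "!!x y. x : U Un W ==> adj x y ==> y : B"
 shows "integral {0..s} (%u. SUM v:D. dd be B (%x. h x + u * of_bool (x : D)) v)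
  <= 2 * kexp be B (%x. h x + s * of_bool (x : D)) (%x. - h x) (%M M' C. real (card (cutE B U W k (M Un M') C)))"
proof (rule energy_general[OF b fB _ s cutE_subset cutE_stable])
 show "D \<subseteq> B" using assms by blast
 fix Ob C assume "cutE B U W k Ob C \<subseteq> C"
 hence "v ~: U" if "v : Kc B Ob C" for v
 proof -
  have "\<exists>n\<le>k. Lv B U W Ob C n v" by (rule cutE_cut[OF UW \<open>cutE B U W k Ob C \<subseteq> C\<close> that])
  thus ?thesis using Lv_in by blast
 qed
 thus "Kc B Ob C Int D = {}" using assms(3) by blast
qed

section \<open>Positive association and screening by minus components\<close>

lemma kexp_fkg:
 assumes b: "be > 0" and fB: "finite B" and f: "tdecr B f" and g: "tdecr B g"
  and f0: "!!M M' C. M \<subseteq> B ==> M' \<subseteq> B ==> C \<subseteq> eds B ==> 0 <= f M M' C"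
  and g0: "!!M M' C. M \<subseteq> B ==> M' \<subseteq> B ==> C \<subseteq> eds B ==> 0 <= g M M' C"
 shows "kexp be B g1 g2 f * kexp be B g1 g2 g <= kexp be B g1 g2 (%M M' C. f M M' C * g M M' C)"
proof -
 note p = wt_pos cw_pos[OF b]
 note fe = finite_eds[OF fB]
 have "kexp be B g1 g2 f * kexp be B g1 g2 g <= avg B (wt be g1) (%M.
   avg B (wt be g2) (%M'. avg (eds B) (cw be) (f M M')) * avg B (wt be g2) (%M'. avg (eds B) (cw be) (g M M')))"
  unfolding kexp_def
  by (rule fkg[OF fB p(1) wt_logsup[OF fB b]])
   (auto simp: decr_def intro!: avg_mono avg_nonneg p f0 g0 tdecrD[OF f] tdecrD[OF g])
 also have "... <= avg B (wt be g1) (%M. avg B (wt be g2) (%M'. avg (eds B) (cw be) (f M M') * avg (eds B) (cw be) (g M M')))"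
 proof (rule avg_mono[OF p(1)])
  fix M assume "M \<subseteq> B"
  thus "avg B (wt be g2) (%M'. avg (eds B) (cw be) (f M M')) * avg B (wt be g2) (%M'. avg (eds B) (cw be) (g M M'))
   <= avg B (wt be g2) (%M'. avg (eds B) (cw be) (f M M') * avg (eds B) (cw be) (g M M'))"
   by (intro fkg[OF fB p(1) wt_logsup[OF fB b]])
    (auto simp: decr_def intro!: avg_mono avg_nonneg p f0 g0 tdecrD[OF f] tdecrD[OF g])
 qed
 also have "... <= kexp be B g1 g2 (%M M' C. f M M' C * g M M' C)"
  unfolding kexp_def
 proof (intro avg_mono p)
  fix M M' assume "M \<subseteq> B" "M' \<subseteq> B"
  thus "avg (eds B) (cw be) (f M M') * avg (eds B) (cw be) (g M M') <= avg (eds B) (cw be) (%C. f M M' C * g M M' C)"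
   by (intro fkg[OF fe p(2) cw_logsup[OF fe]])
    (auto simp: decr_def intro!: f0 g0 tdecrD[OF f] tdecrD[OF g])
 qed
 finally show ?thesis .
qed

text \<open>The entire connected components of \<open>M\<close> that are not contained in
  \<open>G\<close>. They carry all influence that enters \<open>G\<close> from outside; given them,
  the rest of \<open>M\<close> is a free contour system in the remaining part of
  \<open>G\<close>.\<close>

inductive_set Outc :: "site set => site set => site set" for G M where
 base: "v : M ==> v ~: G ==> v : Outc G M"
| step: "u : Outc G M ==> v : M ==> adj u v ==> v : Outc G M"

lemma Outc_subset: "Outc G M \<subseteq> M"
 by (auto elim: Outc.cases)

lemma Outc_idem: "Outc G (Outc G M) = Outc G M"
proof
 show "Outc G (Outc G M) \<subseteq> Outc G M" by (rule Outc_subset)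
 show "Outc G M \<subseteq> Outc G (Outc G M)"
 proof
  fix v assume "v : Outc G M"
  thus "v : Outc G (Outc G M)"
  proof induction
   case (base v)
   thus ?case by (intro Outc.base) (auto intro: Outc.base)
  next
   case (step u v)
   thus ?case by (intro Outc.step[OF step.IH]) (auto intro: Outc.step)
  qed
 qed
qed

lemma Outc_Un:
 assumes V: "Outc G V = V" and N: "N \<subseteq> G" "!!n v. n : N ==> v : V ==> ~ adj n v"
 shows "Outc G (V Un N) = V"
proof
 show "Outc G (V Un N) \<subseteq> V"
 proof
  fix v assume "v : Outc G (V Un N)"
  thus "v : V"
  proof induction
   case (base v)
   thus ?case using N by auto
  next
   case (step u v)
   thus ?case using N(2) adj_sym by blast
  qed
 qed
 show "V \<subseteq> Outc G (V Un N)"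
 proof
  fix v assume "v : V"
  hence "v : Outc G V" using V by simp
  thus "v : Outc G (V Un N)"
  proof induction
   case (base v)
   thus ?case by (intro Outc.base) auto
  next
   case (step u v)
   thus ?case by (intro Outc.step[OF step.IH]) auto
  qed
 qed
qed

text \<open>A minus set is split into the components that leave \<open>G\<close> and the rest.\<close>
lemma sum_Pow_Outc:
 assumes fB: "finite B" and "G \<subseteq> B"
 shows "(SUM M:Pow B. wt be g M * F M) = (SUM V:{V:Pow B. Outc G V = V}.
   wt be g V * (SUM N:Pow {v:G - V. ALL w:V. ~ adj v w}. wt be g N * F (V Un N)))"
proof -
 let ?R = "%V. {v:G - V. ALL w:V. ~ adj v w}"
 let ?VV = "{V:Pow B. Outc G V = V}"
 have bij: "bij_betw (%(V, N). V Un N) (SIGMA V:?VV. Pow (?R V)) (Pow B)"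
 proof (rule bij_betwI[where g = "%M. (Outc G M, M - Outc G M)"])
  show "(%(V, N). V Un N) : (SIGMA V:?VV. Pow (?R V)) \<rightarrow> Pow B" using assms by auto
  show "(%M. (Outc G M, M - Outc G M)) : Pow B \<rightarrow> (SIGMA V:?VV. Pow (?R V))"
  proof
   fix M assume M: "M : Pow B"
   have "M - Outc G M \<subseteq> ?R (Outc G M)"
   proof
    fix v assume v: "v : M - Outc G M"
    hence "v : G" using Outc.base by blast
    moreover have "~ adj v w" if "w : Outc G M" for w
     using that v Outc.step[of w G M v] adj_sym by blast
    ultimately show "v : ?R (Outc G M)" using v by blast
   qed
   thus "(Outc G M, M - Outc G M) : (SIGMA V:?VV. Pow (?R V))"
    using M Outc_subset[of G M] Outc_idem[of G M] by blast
  qed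
  fix x assume "x : (SIGMA V:?VV. Pow (?R V))"
  then obtain V N where x: "x = (V, N)" "Outc G V = V" "N \<subseteq> ?R V" by blast
  hence "Outc G (V Un N) = V" by (intro Outc_Un) blast+
  moreover have "V Int N = {}" using x by blast
  ultimately show "(case (case x of (V, N) => V Un N) of M => (Outc G M, M - Outc G M)) = x" using x by auto
 next
  fix M assume "M : Pow B"
  thus "(case (Outc G M, M - Outc G M) of (V, N) => V Un N) = M" using Outc_subset by auto
 qed
 have fG: "finite G" using assms finite_subset by blast
 have fin: "finite ?VV" "finite (Pow (?R V))" for V using fB fG by simp_all
 have "(SUM M:Pow B. wt be g M * F M) = (\<Sum>(V, N)\<in>(SIGMA V:?VV. Pow (?R V)). wt be g (V Un N) * F (V Un N))"
  by (subst sum.reindex_bij_betw[OF bij, symmetric]) (simp add: split_beta)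
 also have "... = (SUM V:?VV. SUM N:Pow (?R V). wt be g (V Un N) * F (V Un N))"
  using fin by (subst sum.Sigma) auto
 also have "... = (SUM V:?VV. SUM N:Pow (?R V). wt be g V * (wt be g N * F (V Un N)))"
 proof (intro sum.cong refl)
  fix V N assume V: "V : ?VV" and N: "N : Pow (?R V)"
  have "sep V N" unfolding sep_def using N adj_sym by blast
  moreover have "finite V" using V fB finite_subset by blast
  moreover have "finite N" using N fG finite_subset[of N G] by blast
  ultimately show "wt be g (V Un N) * F (V Un N) = wt be g V * (wt be g N * F (V Un N))"
   by (simp add: wt_sep)
 qed
 finally show ?thesis by (simp only: sum_distrib_left)
qed

text \<open>A converse to domain monotonicity. Given the components \<open>V\<close> that leave
  \<open>G\<close>, the rest of \<open>M\<close> lives in \<open>G\<close> off \<open>V\<close> and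
  its neighbours, a region smaller than \<open>G\<close>, so a decreasing function has at least its
  mean in \<open>G\<close>, provided \<open>V\<close> misses the set \<open>H\<close> on which the
  function depends.\<close>

lemma avg_screen:
 assumes b: "be > 0" and fB: "finite B" and G: "G \<subseteq> B" and f: "decr B f" "!!A. A \<subseteq> B ==> 0 <= f A"
  and loc: "!!M. M \<subseteq> B ==> f M = f (M Int H)"
 shows "avg B (wt be g) (%M. of_bool (Outc G M Int H = {})) * avg G (wt be g) f <= avg B (wt be g) f"
proof -
 let ?R = "%V. {v:G - V. ALL w:V. ~ adj v w}"
 let ?VV = "{V:Pow B. Outc G V = V}"
 let ?a = "avg G (wt be g) f"
 have "(SUM M:Pow B. wt be g M * (of_bool (Outc G M Int H = {}) * ?a)) <= (SUM M:Pow B. wt be g M * (of_bool (Outc G M Int H = {}) * f M))"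
  unfolding sum_Pow_Outc[OF fB G]
 proof (rule sum_mono, rule mult_left_mono[OF _ less_imp_le[OF wt_pos]])
  fix V assume V: "V : ?VV"
  have O: "Outc G (V Un N) = V" if "N : Pow (?R V)" for N
   by (rule Outc_Un) (use V that in blast)+
  show "(SUM N:Pow (?R V). wt be g N * (of_bool (Outc G (V Un N) Int H = {}) * ?a))
    <= (SUM N:Pow (?R V). wt be g N * (of_bool (Outc G (V Un N) Int H = {}) * f (V Un N)))"
  proof (cases "V Int H = {}")
   case True
   have RB: "?R V \<subseteq> G" by blast
   have fG: "finite G" using G fB finite_subset by blast
   have "f (V Un N) = f N" if "N : Pow (?R V)" for N
   proof -
    have "(V Un N) Int H = N Int H" "V Un N \<subseteq> B" "N \<subseteq> B" using True that V G by blast+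
    thus ?thesis using loc[of "V Un N"] loc[of N] by simp
   qed
   hence e: "(SUM N:Pow (?R V). wt be g N * (of_bool (Outc G (V Un N) Int H = {}) * f (V Un N))) = (SUM N:Pow (?R V). wt be g N * f N)"
    using O True by (intro sum.cong) auto
   have e': "(SUM N:Pow (?R V). wt be g N * (of_bool (Outc G (V Un N) Int H = {}) * ?a)) = (SUM N:Pow (?R V). wt be g N) * ?a"
    unfolding sum_distrib_right using O True by (intro sum.cong) auto
   have "?a <= avg (?R V) (wt be g) f"
    by (rule avg_domain_mono[OF fG RB wt_pos wt_logsup[OF fG b]])
     (use f G in \<open>auto simp: decr_def\<close>)
   thus ?thesis unfolding e e' using sum_Pow_pos[OF finite_subset[OF RB fG], of "wt be g"] wt_pos
    by (simp add: avg_def pos_le_divide_eq mult.commute)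
  next
   case False
   hence "(of_bool (Outc G (V Un N) Int H = {}) :: real) = 0" if "N : Pow (?R V)" for N
    using O[OF that] by simp
   thus ?thesis by (intro sum_mono) simp
  qed
 qed
 also have "... <= (SUM M:Pow B. wt be g M * f M)"
  by (intro sum_mono mult_left_mono less_imp_le[OF wt_pos]) (use f in auto)
 finally have "(SUM M:Pow B. wt be g M * (of_bool (Outc G M Int H = {}) * ?a)) <= (SUM M:Pow B. wt be g M * f M)" .
 hence "avg B (wt be g) (%M. of_bool (Outc G M Int H = {}) * ?a) <= avg B (wt be g) f"
  unfolding avg_def using sum_Pow_pos[OF fB, of "wt be g"] wt_pos by (simp add: divide_right_mono)
 thus ?thesis by (simp only: avg_multc)
qed

section \<open>Product measures and Gaussian shifts\<close>

definition iid :: "real measure => ('i => real) measure" where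
 "iid N = (\<Pi>\<^sub>M i\<in>UNIV. N)"

definition dep :: "'i set => (('i => real) => 'b) => bool" where
 "dep K f \<longleftrightarrow> (\<forall>et et'. (ALL i:K. et i = et' i) --> f et = f et')"

lemma depD: "dep K f ==> (!!i. i : K ==> et i = et' i) ==> f et = f et'"
 unfolding dep_def by blast

text \<open>The index type stays arbitrary, since both fields over sites and fields over sites and
  tiles occur.\<close>

locale iid_space =
 fixes N :: "real measure"
 assumes prob_N: "prob_space N" and sets_N [measurable_cong]: "sets N = sets borel"
begin

sublocale N: prob_space N by (rule prob_N)

lemma space_N: "space N = UNIV"
 using sets_eq_imp_space_eq[OF sets_N] by simp

lemma prob_iid: "prob_space (iid N :: ('i => real) measure)"
 unfolding iid_def by (intro prob_space_PiM prob_N)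

lemma coord_measurable: "(%et. et i) : borel_measurable (iid N)"
 unfolding iid_def by measurable

lemma iid_measurableI:
 assumes "!!i. (%x. f x i) : borel_measurable L"
 shows "f : L \<rightarrow>\<^sub>M iid N"
proof -
 have "f : L \<rightarrow>\<^sub>M (\<Pi>\<^sub>M i\<in>UNIV. N)"
  by (rule measurable_PiM_single') (use assms measurable_cong_sets[OF refl sets_N] in \<open>auto simp: space_N\<close>)
 thus ?thesis by (simp add: iid_def)
qed

lemma upd_measurable: "(%(x, et). et(i := x)) : N \<Otimes>\<^sub>M iid N \<rightarrow>\<^sub>M iid N"
proof (rule iid_measurableI)
 fix j
 have [measurable]: "(%p. fst p) : borel_measurable (N \<Otimes>\<^sub>M iid N)"
  by (rule measurable_compose[OF measurable_fst]) (simp add: measurable_ident_sets[OF sets_N])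
 have [measurable]: "(%p. snd p j) : borel_measurable (N \<Otimes>\<^sub>M (iid N :: ('a => real) measure))"
  by (rule measurable_compose[OF measurable_snd coord_measurable])
 show "(%p. (case p of (x, et) => et(i := x)) j) : borel_measurable (N \<Otimes>\<^sub>M iid N)"
  by (cases "i = j") (simp_all add: split_beta)
qed

lemma distr_upd: "distr (N \<Otimes>\<^sub>M iid N) (iid N) (%(x, et). et(i := x)) = iid N"
 using distr_pair_PiM_eq_PiM[of UNIV "%_. N" i] prob_N unfolding iid_def by simp

lemma nn_resample:
 fixes f :: "('i => real) => ennreal"
 assumes f: "f : borel_measurable (iid N)"
 shows "(\<integral>\<^sup>+et. f et \<partial>iid N) = (\<integral>\<^sup>+et. \<integral>\<^sup>+x. f (et(i := x)) \<partial>N \<partial>iid N)"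
proof -
 interpret I: prob_space "iid N :: ('i => real) measure" by (rule prob_iid)
 interpret pair_sigma_finite N "iid N :: ('i => real) measure" ..
 have m: "(%(x, et). f (et(i := x))) : borel_measurable (N \<Otimes>\<^sub>M iid N)"
  using measurable_compose[OF upd_measurable f] by (simp add: split_beta)
 have "(\<integral>\<^sup>+et. f et \<partial>iid N) = (\<integral>\<^sup>+et. f et \<partial>distr (N \<Otimes>\<^sub>M iid N) (iid N) (%(x, et). et(i := x)))"
  by (simp only: distr_upd)
 also have "... = (\<integral>\<^sup>+p. f ((%(x, et). et(i := x)) p) \<partial>(N \<Otimes>\<^sub>M iid N))"
  by (rule nn_integral_distr[OF upd_measurable]) (use f in simp)
 also have "... = (\<integral>\<^sup>+p. (%(x, et). f (et(i := x))) p \<partial>(N \<Otimes>\<^sub>M iid N))"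
  by (simp add: split_beta)
 also have "... = (\<integral>\<^sup>+et. \<integral>\<^sup>+x. f (et(i := x)) \<partial>N \<partial>iid N)"
  by (subst nn_integral_snd[OF m, symmetric]) simp
 finally show ?thesis .
qed

lemma integrable_bounded:
 fixes f :: "('i => real) => real"
 assumes "f : borel_measurable (iid N)" "!!et. \<bar>f et\<bar> <= c"
 shows "integrable (iid N) f"
proof -
 interpret I: prob_space "iid N :: ('i => real) measure" by (rule prob_iid)
 show ?thesis by (rule I.integrable_const_bound[of _ c]) (use assms in auto)
qed

lemma resample:
 fixes f :: "('i => real) => real"
 assumes f: "f : borel_measurable (iid N)" "!!et. \<bar>f et\<bar> <= c"
 shows "(\<integral>et. f et \<partial>iid N) = (\<integral>et. (\<integral>x. f (et(i := x)) \<partial>N) \<partial>iid N)"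
  and "(%et. \<integral>x. f (et(i := x)) \<partial>N) : borel_measurable (iid N)"
proof -
 interpret I: prob_space "iid N :: ('i => real) measure" by (rule prob_iid)
 interpret pair_prob_space N "iid N :: ('i => real) measure" ..
 interpret Q: pair_sigma_finite "iid N :: ('i => real) measure" N ..
 have m: "(%(x, et). f (et(i := x))) : borel_measurable (N \<Otimes>\<^sub>M iid N)"
  using measurable_compose[OF upd_measurable f(1)] by (simp add: split_beta)
 have m': "(%(et, x). f (et(i := x))) : borel_measurable (iid N \<Otimes>\<^sub>M N)"
  using measurable_compose[OF measurable_pair_swap' m] by (simp add: split_beta)
 show "(%et. \<integral>x. f (et(i := x)) \<partial>N) : borel_measurable (iid N)"
  by (rule N.borel_measurable_lebesgue_integral[OF m'])
 have int: "integrable (N \<Otimes>\<^sub>M iid N) (%(x, et). f (et(i := x)))"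
  by (rule P.integrable_const_bound[of _ c]) (use f m in auto)
 have "(\<integral>et. f et \<partial>iid N) = (\<integral>et. f et \<partial>distr (N \<Otimes>\<^sub>M iid N) (iid N) (%(x, et). et(i := x)))"
  by (simp only: distr_upd)
 also have "... = (\<integral>p. f ((%(x, et). et(i := x)) p) \<partial>(N \<Otimes>\<^sub>M iid N))"
  by (rule integral_distr[OF upd_measurable f(1)])
 also have "... = (\<integral>p. (%(x, et). f (et(i := x))) p \<partial>(N \<Otimes>\<^sub>M iid N))"
  by (simp add: split_beta)
 also have "... = (\<integral>et. (\<integral>x. f (et(i := x)) \<partial>N) \<partial>iid N)"
  using integral_snd[OF int] by simp
 finally show "(\<integral>et. f et \<partial>iid N) = (\<integral>et. (\<integral>x. f (et(i := x)) \<partial>N) \<partial>iid N)" .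
qed

lemma reindex_measurable: "(%et n. et (ph n)) : iid N \<rightarrow>\<^sub>M iid N"
 by (rule iid_measurableI) (rule coord_measurable)

lemma reindex:
 fixes f :: "('i => real) => real"
 assumes "inj ph" "f : borel_measurable (iid N)"
 shows "(\<integral>et. f (%n. et (ph n)) \<partial>(iid N :: ('j => real) measure)) = (\<integral>et. f et \<partial>iid N)"
proof -
 have "distr (iid N) (iid N) (%et n. et (ph n)) = iid N"
  using distr_PiM_reindex[of UNIV "%_. N" ph UNIV] prob_N assms(1) unfolding iid_def by (simp add: restrict_UNIV[abs_def] restrict_def)
 hence "(\<integral>et. f et \<partial>iid N) = (\<integral>et. f et \<partial>distr (iid N :: ('j => real) measure) (iid N) (%et n. et (ph n)))" by simp
 also have "... = (\<integral>et. f (%n. et (ph n)) \<partial>iid N)"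
  by (rule integral_distr[OF reindex_measurable assms(2)])
 finally show ?thesis by simp
qed

lemma indep_coords: "prob_space.indep_vars (iid N) (%_. N) (%i et. et i) (UNIV :: 'i set)"
proof -
 interpret I: prob_space "iid N :: ('i => real) measure" by (rule prob_iid)
 have c: "distr (iid N :: ('i => real) measure) N (%et. et i) = N" for i
  unfolding iid_def by (rule distr_PiM_component) (auto simp: prob_N)
 show ?thesis
 proof (subst I.indep_vars_iff_distr_eq_PiM)
  show "I.random_variable N (%et. et i)" for i
   unfolding iid_def by measurable
  show "distr (iid N) (\<Pi>\<^sub>M i\<in>UNIV. N) (%x. \<lambda>i\<in>UNIV. x i) = (\<Pi>\<^sub>M i\<in>(UNIV :: 'i set). distr (iid N) N (%et. et i))"
   unfolding c by (simp add: iid_def distr_id2 restrict_def)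
 qed simp
qed

lemma integral_prod_dep:
 fixes f :: "'k => ('i => real) => real"
 assumes "finite L" and K: "disjoint_family_on K L"
  and f: "!!j. j : L ==> f j : borel_measurable (iid N)" "!!j et. j : L ==> \<bar>f j et\<bar> <= c" "!!j. j : L ==> dep (K j) (f j)"
 shows "(\<integral>et. (\<Prod>j\<in>L. f j et) \<partial>iid N) = (\<Prod>j\<in>L. \<integral>et. f j et \<partial>iid N)"
proof -
 interpret I: prob_space "iid N :: ('i => real) measure" by (rule prob_iid)
 define e where "e j x = (%i. if i : K j then x i else (0::real))" for j and x :: "'i => real"
 have ind: "I.indep_vars (%j. PiM (K j) (%_. N)) (%j et. restrict (%i. et i) (K j)) L"
  by (rule I.indep_vars_restrict[OF indep_coords _ K]) auto
 have e_m: "e j : PiM (K j) (%_. N) \<rightarrow>\<^sub>M iid N" for j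
 proof (rule iid_measurableI)
  fix i
  have "(%x. x i) : borel_measurable (PiM (K j) (%_. N))" if "i : K j"
   using measurable_component_singleton[OF that, of "%_. N"] measurable_cong_sets[OF refl sets_N] by blast
  thus "(%x. e j x i) : borel_measurable (PiM (K j) (%_. N))" unfolding e_def by (cases "i : K j") simp_all
 qed
 have "I.indep_vars (%_. borel) (%j et. (%x. f j (e j x)) (restrict (%i. et i) (K j))) L"
  by (rule I.indep_vars_compose2[OF ind]) (rule measurable_compose[OF e_m f(1)])
 moreover have "f j (e j (restrict (%i. et i) (K j))) = f j et" if "j : L" for j et
  by (rule depD[OF f(3)[OF that]]) (simp add: e_def)
 ultimately have "I.indep_vars (%_. borel) f L"
  by (subst (asm) I.indep_vars_cong[OF refl, where Y = f and N' = "%_. borel"]) auto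
 thus ?thesis
  using f by (intro I.indep_vars_lebesgue_integral assms(1) integrable_bounded[where c = c]) auto
qed

end

lemma kexp_measurable:
 assumes [measurable]: "!!v. (%et. G1 et v) : borel_measurable L" "!!v. (%et. G2 et v) : borel_measurable L"
 shows "(%et. kexp be B (G1 et) (G2 et) f) : borel_measurable L"
 unfolding kexp_def avg_def wt_def by measurable

lemma pm_measurable:
 assumes [measurable]: "!!v. (%et. G et v) : borel_measurable L"
 shows "(%et. pm be B (G et) v) : borel_measurable L"
 unfolding pm_def avg_def wt_def by measurable

definition gm :: "real => real measure" where
 "gm ep = density lborel (normal_density 0 ep)"

lemma field_measure_iid: "field_measure ep = iid (gm ep)"
 by (simp add: field_measure_def iid_def gm_def)

lemma iid_space_gm: "ep > 0 ==> iid_space (gm ep)"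
 unfolding gm_def by (rule iid_space.intro) (simp_all add: prob_space_normal_density)

lemma nn_gm_shift:
 assumes e: "ep > 0" and f: "f : borel_measurable borel"
 shows "(\<integral>\<^sup>+x. f (x + a) \<partial>gm ep) = (\<integral>\<^sup>+x. f x * ennreal (exp ((a * x - a\<^sup>2 / 2) / ep\<^sup>2)) \<partial>gm ep)"
proof -
 note f [measurable]
 have "(\<integral>\<^sup>+x. f (x + a) \<partial>gm ep) = (\<integral>\<^sup>+x. ennreal (normal_density 0 ep x) * f (x + a) \<partial>lborel)"
  unfolding gm_def by (subst nn_integral_density) auto
 also have "... = (\<integral>\<^sup>+x. ennreal (normal_density 0 ep (- a + 1 * x)) * f (- a + 1 * x + a) \<partial>lborel)"
  by (subst nn_integral_real_affine[where c = 1 and t = "- a"]) auto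
 also have "... = (\<integral>\<^sup>+x. ennreal (normal_density 0 ep x) * (f x * ennreal (exp ((a * x - a\<^sup>2 / 2) / ep\<^sup>2))) \<partial>lborel)"
 proof (rule nn_integral_cong)
  fix x
  have "normal_density 0 ep (- a + 1 * x) = normal_density 0 ep x * exp ((a * x - a\<^sup>2 / 2) / ep\<^sup>2)"
  proof -
   have "- (x - a)\<^sup>2 / (2 * ep\<^sup>2) = - x\<^sup>2 / (2 * ep\<^sup>2) + (a * x - a\<^sup>2 / 2) / ep\<^sup>2"
    using e by (simp add: power2_diff field_simps)
   thus ?thesis unfolding normal_density_def by (simp add: exp_add[symmetric])
  qed
  thus "ennreal (normal_density 0 ep (- a + 1 * x)) * f (- a + 1 * x + a) =
    ennreal (normal_density 0 ep x) * (f x * ennreal (exp ((a * x - a\<^sup>2 / 2) / ep\<^sup>2)))"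
   by (simp add: ennreal_mult' mult_ac)
 qed
 also have "... = (\<integral>\<^sup>+x. f x * ennreal (exp ((a * x - a\<^sup>2 / 2) / ep\<^sup>2)) \<partial>gm ep)"
  unfolding gm_def by (subst nn_integral_density) auto
 finally show ?thesis .
qed

locale gauss =
 fixes ep :: real
 assumes eps: "ep > 0"
begin

abbreviation Gm :: "('i => real) measure" where "Gm == iid (gm ep)"

sublocale iid_space "gm ep" by (rule iid_space_gm[OF eps])

text \<open>The Cameron-Martin formula, one coordinate at a time: \<open>nn_resample\<close>
  isolates coordinate \<open>j\<close>, where it is the substitution of
  \<open>nn_gm_shift\<close>.\<close>

lemma nn_shift:
 fixes F :: "('i => real) => ennreal"
 assumes "finite I" "F : borel_measurable Gm"
 shows "(\<integral>\<^sup>+et. F (%i. et i + (if i : I then a i else 0)) \<partial>Gm) =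
  (\<integral>\<^sup>+et. F et * ennreal (exp (SUM i:I. (a i * et i - (a i)\<^sup>2 / 2) / ep\<^sup>2)) \<partial>Gm)"
 using assms
proof (induction I arbitrary: F rule: finite_induct)
 case empty
 thus ?case by simp
next
 case (insert j I)
 note F [measurable] = insert.prems
 note coord_measurable [measurable]
 let ?sh = "%I et i. et i + (if i : I then a i else 0)"
 define R where "R et = ennreal (exp (SUM i:I. (a i * et i - (a i)\<^sup>2 / 2) / ep\<^sup>2))" for et :: "'i => real"
 let ?r = "%x. ennreal (exp ((a j * x - (a j)\<^sup>2 / 2) / ep\<^sup>2))"
 have R_m [measurable]: "R : borel_measurable Gm" unfolding R_def by measurable
 have upd_m: "(%et. et(j := et j + a j)) : Gm \<rightarrow>\<^sub>M Gm"
 proof (rule iid_measurableI)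
  fix i show "(%x. (x(j := x j + a j)) i) : borel_measurable Gm" by (cases "i = j") auto
 qed
 have updx_m: "(%x. et(j := x)) : borel \<rightarrow>\<^sub>M Gm" for et
 proof (rule iid_measurableI)
  fix i show "(%x. (et(j := x)) i) : borel_measurable borel" by (cases "i = j") auto
 qed
 have F': "(%et. F (et(j := et j + a j))) : borel_measurable Gm"
  by (rule measurable_compose[OF upd_m F])
 have e: "?sh (insert j I) et = (?sh I et)(j := (?sh I et) j + a j)" for et
  using insert.hyps by (auto simp: fun_eq_iff)
 have Rj: "R (et(j := x)) = R et" for et x
  unfolding R_def using insert.hyps by (intro arg_cong[where f = "%z. ennreal (exp z)"] sum.cong) auto
 have "(\<integral>\<^sup>+et. F (?sh (insert j I) et) \<partial>Gm) = (\<integral>\<^sup>+et. F (et(j := et j + a j)) * R et \<partial>Gm)"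
  unfolding e R_def by (rule insert.IH[OF F'])
 also have "... = (\<integral>\<^sup>+et. \<integral>\<^sup>+x. F (et(j := x + a j)) * R et \<partial>gm ep \<partial>Gm)"
  by (subst nn_resample[where i = j]) (use F' in measurable, simp only: Rj fun_upd_same fun_upd_upd)
 also have "... = (\<integral>\<^sup>+et. \<integral>\<^sup>+x. (F (et(j := x)) * R et) * ?r x \<partial>gm ep \<partial>Gm)"
 proof (rule nn_integral_cong)
  fix et :: "'i => real"
  have "(%x. F (et(j := x)) * R et) : borel_measurable borel"
   by (intro borel_measurable_times_ennreal measurable_compose[OF updx_m F]) auto
  from nn_gm_shift[OF eps this, of "a j"]
  show "(\<integral>\<^sup>+x. F (et(j := x + a j)) * R et \<partial>gm ep) = (\<integral>\<^sup>+x. (F (et(j := x)) * R et) * ?r x \<partial>gm ep)" .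
 qed
 also have "... = (\<integral>\<^sup>+et. F et * R et * ?r (et j) \<partial>Gm)"
  by (subst (2) nn_resample[where i = j]) (measurable, simp only: Rj fun_upd_same)
 also have "... = (\<integral>\<^sup>+et. F et * ennreal (exp (SUM i:insert j I. (a i * et i - (a i)\<^sup>2 / 2) / ep\<^sup>2)) \<partial>Gm)"
  unfolding R_def using insert.hyps by (intro nn_integral_cong) (simp add: exp_add ennreal_mult' mult_ac)
 finally show ?case .
qed

text \<open>The logarithm of the Cameron-Martin density of the shift \<open>a\<close> is
  \<open>lin I a - var I a / 2\<close>, where \<open>var I a\<close> is both the variance of
  \<open>lin I a\<close> and the squared norm of the shift.\<close>

definition lin :: "'i set => ('i => real) => ('i => real) => real" where
 "lin I a et = (SUM i:I. a i * et i) / ep\<^sup>2"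

definition var :: "'i set => ('i => real) => real" where
 "var I a = (SUM i:I. (a i)\<^sup>2) / ep\<^sup>2"

lemma lin_measurable [measurable]: "lin I a : borel_measurable Gm"
 unfolding lin_def using coord_measurable by measurable

lemma sum_lin_var: "(SUM i:I. (a i * et i - (a i)\<^sup>2 / 2) / ep\<^sup>2) = lin I a et - var I a / 2"
 unfolding lin_def var_def
 by (simp add: diff_divide_distrib sum_subtractf sum_divide_distrib[symmetric])

lemma mgf:
 fixes a :: "'i => real"
 assumes "finite I"
 shows "has_bochner_integral Gm (%et. exp (c * lin I a et)) (exp (c\<^sup>2 * var I a / 2))"
proof -
 have "(\<integral>\<^sup>+et. ennreal (exp (SUM i:I. ((c * a i) * et i - (c * a i)\<^sup>2 / 2) / ep\<^sup>2)) \<partial>Gm) = 1"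
  using nn_shift[OF assms, of "%_. 1" "%i. c * a i"] prob_space.emeasure_space_1[OF prob_iid[where ?'i = 'i]] by simp
 also have "(%et. SUM i:I. ((c * a i) * et i - (c * a i)\<^sup>2 / 2) / ep\<^sup>2) = (%et. c * lin I a et - c\<^sup>2 * var I a / 2)"
  unfolding sum_lin_var by (simp add: lin_def var_def power_mult_distrib sum_distrib_left mult_ac)
 finally have "(\<integral>\<^sup>+et. ennreal (exp (c * lin I a et - c\<^sup>2 * var I a / 2)) \<partial>Gm) = ennreal 1" by simp
 hence "has_bochner_integral Gm (%et. exp (c * lin I a et - c\<^sup>2 * var I a / 2)) 1"
  by (intro has_bochner_integral_nn_integral) auto
 hence "has_bochner_integral Gm (%et. exp (c\<^sup>2 * var I a / 2) * exp (c * lin I a et - c\<^sup>2 * var I a / 2)) (exp (c\<^sup>2 * var I a / 2) * 1)"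
  by (rule has_bochner_integral_mult_right)
 thus ?thesis by (simp add: exp_add[symmetric])
qed

lemma shift:
 fixes F :: "('i => real) => real"
 assumes I: "finite I" and F: "F : borel_measurable Gm" "!!et. 0 <= F et" "!!et. F et <= 1"
 shows "(LINT et|Gm. F (%i. et i + (if i : I then a i else 0))) = (LINT et|Gm. F et * exp (lin I a et - var I a / 2))"
  and "integrable Gm (%et. F et * exp (lin I a et - var I a / 2))"
  and "(%et. F (%i. et i + (if i : I then a i else 0))) : borel_measurable Gm"
proof -
 note F(1) [measurable]
 let ?R = "%et. exp (lin I a et - var I a / 2)"
 have sm: "(%et i. et i + (if i : I then a i else 0)) : Gm \<rightarrow>\<^sub>M Gm"
  by (intro iid_measurableI borel_measurable_add coord_measurable borel_measurable_const)
 show Fm: "(%et. F (%i. et i + (if i : I then a i else 0))) : borel_measurable Gm"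
  by (rule measurable_compose[OF sm F(1)])
 have "integrable Gm (%et. exp (1 * lin I a et) * exp (- var I a / 2))"
  using mgf[OF I, of 1 a] by (intro integrable_mult_left) (auto simp: has_bochner_integral_iff)
 hence R: "integrable Gm ?R" by (simp add: exp_add[symmetric])
 show int: "integrable Gm (%et. F et * ?R et)"
  by (rule Bochner_Integration.integrable_bound[OF R]) (use F in \<open>auto simp: mult_le_cancel_right1\<close>)
 have int2: "integrable Gm (%et. F (%i. et i + (if i : I then a i else 0)))"
  by (rule integrable_bounded[OF Fm, of 1]) (use F in auto)
 have "ennreal (LINT et|Gm. F (%i. et i + (if i : I then a i else 0))) =
  (\<integral>\<^sup>+et. ennreal (F (%i. et i + (if i : I then a i else 0))) \<partial>Gm)"
  by (rule nn_integral_eq_integral[symmetric, OF int2]) (use F in auto)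
 also have "... = (\<integral>\<^sup>+et. ennreal (F et) * ennreal (?R et) \<partial>Gm)"
  unfolding sum_lin_var[symmetric] by (rule nn_shift[OF I]) measurable
 also have "... = (\<integral>\<^sup>+et. ennreal (F et * ?R et) \<partial>Gm)"
  using F by (simp add: ennreal_mult)
 also have "... = ennreal (LINT et|Gm. F et * ?R et)"
  by (rule nn_integral_eq_integral[OF int]) (use F in auto)
 finally show "(LINT et|Gm. F (%i. et i + (if i : I then a i else 0))) = (LINT et|Gm. F et * ?R et)"
  using F by (simp add: ennreal_inj Bochner_Integration.integral_nonneg)
qed

text \<open>The density is cut at height \<open>T\<close>. Where it exceeds \<open>T\<close> it is
  at most its square over \<open>T\<close>, and its second moment is exp (var I a). This is of use
  even for shifts that are not small.\<close>

lemma shift_abs_cont: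
 fixes F :: "('i => real) => real"
 assumes I: "finite I" and F: "F : borel_measurable Gm" "!!et. 0 <= F et" "!!et. F et <= 1" and T: "T > 0"
 shows "(LINT et|Gm. F (%i. et i + (if i : I then a i else 0))) <= T * (LINT et|Gm. F et) + exp (var I a) / T"
proof -
 let ?R = "%et. exp (lin I a et - var I a / 2)"
 have F_int: "integrable Gm F" by (rule integrable_bounded[OF F(1), of 1]) (use F in auto)
 have m2: "has_bochner_integral Gm (%et. exp (2 * lin I a et) * (exp (- var I a) / T)) (exp (2\<^sup>2 * var I a / 2) * (exp (- var I a) / T))"
  by (rule has_bochner_integral_mult_left[OF mgf[OF I]])
 have e1: "exp (2 * lin I a et) * (exp (- var I a) / T) = (?R et)\<^sup>2 / T" for et
  by (simp add: power2_eq_square exp_add[symmetric] mult_ac)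
 have e2: "exp (2\<^sup>2 * var I a / 2) * (exp (- var I a) / T) = exp (var I a) / T"
  by (simp add: exp_add[symmetric] power2_eq_square)
 have m3: "has_bochner_integral Gm (%et. (?R et)\<^sup>2 / T) (exp (var I a) / T)"
  using m2 unfolding e1 e2 .
 have "(LINT et|Gm. F (%i. et i + (if i : I then a i else 0))) = (LINT et|Gm. F et * ?R et)"
  by (rule shift(1)[OF I F])
 also have "... <= (LINT et|Gm. T * F et + (?R et)\<^sup>2 / T)"
 proof (rule integral_mono[OF shift(2)[OF I F]])
  show "integrable Gm (%et. T * F et + (?R et)\<^sup>2 / T)"
   using F_int m3 by (auto simp: has_bochner_integral_iff)
  fix et :: "'i => real"
  show "F et * ?R et <= T * F et + (?R et)\<^sup>2 / T"
  proof (cases "?R et <= T")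
   case True
   hence "F et * ?R et <= F et * T" using F by (intro mult_left_mono) auto
   moreover have "0 <= (?R et)\<^sup>2 / T" using T by simp
   ultimately show ?thesis by (simp add: mult.commute)
  next
   case False
   have "F et * ?R et <= ?R et" using F by (simp add: mult_le_cancel_right1)
   also have "... <= (?R et)\<^sup>2 / T" using False T by (simp add: power2_eq_square pos_le_divide_eq)
   finally show ?thesis using F T by (simp add: add_increasing)
  qed
 qed
 also have "... = T * (LINT et|Gm. F et) + exp (var I a) / T"
  using F_int m3 by (simp add: has_bochner_integral_iff)
 finally show ?thesis .
qed

lemma exp_minus1_le: "0 <= (x::real) ==> x <= 1 ==> exp x - 1 <= 2 * x"
 using exp_bound[of x] by (simp add: power2_eq_square) (smt (verit) mult_left_le)

text \<open>For small shifts the error has to be relative to the mean of \<open>F\<close>. Where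
  \<open>lin\<close> is at most A * ta, the density is below 1 + 2 * A * ta. Elsewhere it is
  multiplied by exp (lin / ta - A), which is then at least 1; the result is again an exponential
  moment, at most exp (2 - A).\<close>

lemma shift_influence:
 fixes F :: "('i => real) => real"
 assumes I: "finite I" and F: "F : borel_measurable Gm" "!!et. 0 <= F et" "!!et. F et <= 1"
  and t: "ta > 0" "ta <= 1" "var I a <= ta\<^sup>2" and A: "A >= 0" "A * ta <= 1"
 shows "(LINT et|Gm. F (%i. et i + (if i : I then a i else 0))) <= (1 + 2 * A * ta) * (LINT et|Gm. F et) + exp (2 - A)"
proof -
 let ?Y = "lin I a" and ?v = "var I a"
 let ?R = "%et. exp (?Y et - ?v / 2)"
 have v0: "0 <= ?v" unfolding var_def by (simp add: sum_nonneg)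
 have F_int: "integrable Gm F" by (rule integrable_bounded[OF F(1), of 1]) (use F in auto)
 let ?T = "%et. exp ((1 + 1 / ta) * ?Y et) * exp (- ?v / 2 - A)"
 have m: "has_bochner_integral Gm ?T (exp ((1 + 1 / ta)\<^sup>2 * ?v / 2) * exp (- ?v / 2 - A))"
  by (rule has_bochner_integral_mult_left[OF mgf[OF I]])
 have T_eq: "?T et = ?R et * exp (?Y et / ta - A)" for et
  by (simp add: exp_add[symmetric] algebra_simps)
 have "(1 + 1 / ta)\<^sup>2 * ?v / 2 - ?v / 2 - A <= 2 - A"
 proof -
  have "(1 + 1 / ta)\<^sup>2 * ?v / 2 - ?v / 2 = ?v * ((1 + 1 / ta)\<^sup>2 - 1) / 2" by (simp add: algebra_simps)
  also have "... <= ta\<^sup>2 * ((1 + 1 / ta)\<^sup>2 - 1) / 2"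
   using t by (intro divide_right_mono mult_right_mono) (auto simp: power2_eq_square algebra_simps)
  also have "... = ta + 1 / 2" using t by (simp add: power2_eq_square field_simps)
  finally show ?thesis using t by simp
 qed
 hence T_le: "exp ((1 + 1 / ta)\<^sup>2 * ?v / 2) * exp (- ?v / 2 - A) <= exp (2 - A)"
  unfolding exp_add[symmetric] by simp
 have "(LINT et|Gm. F (%i. et i + (if i : I then a i else 0))) = (LINT et|Gm. F et * ?R et)"
  by (rule shift(1)[OF I F])
 also have "... <= (LINT et|Gm. (1 + 2 * A * ta) * F et + ?T et)"
 proof (rule integral_mono[OF shift(2)[OF I F]])
  show "integrable Gm (%et. (1 + 2 * A * ta) * F et + ?T et)"
   using F_int m by (auto simp: has_bochner_integral_iff)
  fix et :: "'i => real"
  show "F et * ?R et <= (1 + 2 * A * ta) * F et + ?T et"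
  proof (cases "?Y et <= A * ta")
   case True
   have "?R et <= exp (A * ta)" using True v0 by simp
   also have "... <= 1 + 2 * A * ta" using exp_minus1_le[of "A * ta"] A t by simp
   finally have "F et * ?R et <= F et * (1 + 2 * A * ta)" using F by (intro mult_left_mono) auto
   thus ?thesis by (simp add: mult.commute add_increasing2)
  next
   case False
   hence "1 <= exp (?Y et / ta - A)" using t by (simp add: pos_le_divide_eq)
   hence "?R et * 1 <= ?T et" unfolding T_eq by (intro mult_left_mono) auto
   moreover have "F et * ?R et <= ?R et" using F by (simp add: mult_le_cancel_right1)
   moreover have "0 <= (1 + 2 * A * ta) * F et" using A t F by simp
   ultimately show ?thesis by linarith
  qed
 qed
 also have "... = (1 + 2 * A * ta) * (LINT et|Gm. F et) + exp ((1 + 1 / ta)\<^sup>2 * ?v / 2) * exp (- ?v / 2 - A)"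
  using F_int m by (simp add: has_bochner_integral_iff)
 finally show ?thesis using T_le by linarith
qed

end

section \<open>Planarity\<close>

definition spath :: "(nat => site) => nat => bool" where
 "spath p n \<longleftrightarrow> (\<forall>i<n. adj (p i) (p (Suc i)))"

text \<open>Coordinates along \<open>f\<close> and along \<open>f\<close> turned by a right angle, both scaled by the length of \<open>f\<close>.\<close>
definition Xc :: "site => site => int" where
 "Xc f v = fst f * fst v + snd f * snd v"

definition Yc :: "site => site => int" where
 "Yc f v = fst f * snd v - snd f * fst v"

definition emb :: "site => real^2" where
 "emb v = vector [of_int (fst v), of_int (snd v)]"

lemma emb_nth [simp]: "emb v $ 1 = of_int (fst v)" "emb v $ 2 = of_int (snd v)"
 by (simp_all add: emb_def)

primrec poly_path :: "(nat => site) => nat => real => real^2" where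
 "poly_path p 0 = linepath (emb (p 0)) (emb (p 0))"
| "poly_path p (Suc n) = poly_path p n +++ linepath (emb (p n)) (emb (p (Suc n)))"

lemma poly_path_props:
 "path (poly_path p n) & pathstart (poly_path p n) = emb (p 0) & pathfinish (poly_path p n) = emb (p n) &
  path_image (poly_path p n) \<subseteq> insert (emb (p 0)) (\<Union>i<n. closed_segment (emb (p i)) (emb (p (Suc i))))"
proof (induction n)
 case (Suc n)
 thus ?case by (auto simp: path_image_join lessThan_Suc)
qed (simp add: path_def pathstart_def pathfinish_def)

lemma poly_path_image:
 assumes "n > 0" "z : path_image (poly_path p n)"
 shows "\<exists>i<n. z : closed_segment (emb (p i)) (emb (p (Suc i)))"
proof -
 have "z = emb (p 0) \<or> (\<exists>i<n. z : closed_segment (emb (p i)) (emb (p (Suc i))))"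
  using poly_path_props[of p n] assms(2) by auto
 thus ?thesis using assms(1) by auto
qed

lemma seg_coord:
 assumes "z : closed_segment (emb u) (emb v)"
 obtains t where "0 <= t" "t <= 1"
  "z $ 1 = (1 - t) * of_int (fst u) + t * of_int (fst v)" "z $ 2 = (1 - t) * of_int (snd u) + t * of_int (snd v)"
proof -
 from assms obtain t where t: "0 <= t" "t <= 1" "z = (1 - t) *\<^sub>R emb u + t *\<^sub>R emb v"
  unfolding closed_segment_def by auto
 show thesis by (rule that[of t]) (use t in auto)
qed

lemma unit_edge:
 assumes "adj u v" "z : closed_segment (emb u) (emb v)"
 obtains (vert) k where "z $ 1 = of_int (fst u)" "{u, v} = {(fst u, k), (fst u, k + 1)}" "of_int k <= z $ 2" "z $ 2 <= of_int k + 1"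
 | (horiz) k where "z $ 2 = of_int (snd u)" "{u, v} = {(k, snd u), (k + 1, snd u)}" "of_int k <= z $ 1" "z $ 1 <= of_int k + 1"
proof -
 obtain x y where u: "u = (x, y)" by (cases u)
 from assms(2) obtain t where t: "0 <= t" "t <= 1"
  "z $ 1 = (1 - t) * of_int (fst u) + t * of_int (fst v)" "z $ 2 = (1 - t) * of_int (snd u) + t * of_int (snd v)"
  by (rule seg_coord)
 have "v = (x + 1, y) \<or> v = (x - 1, y) \<or> v = (x, y + 1) \<or> v = (x, y - 1)"
  using assms(1) u adj_alt by auto
 then consider "v = (x + 1, y)" | "v = (x - 1, y)" | "v = (x, y + 1)" | "v = (x, y - 1)" by blast
 thus thesis
 proof cases
  case 1
  show thesis by (rule horiz[of x]) (use 1 u t in \<open>auto simp: algebra_simps\<close>)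
 next
  case 2
  show thesis by (rule horiz[of "x - 1"]) (use 2 u t in \<open>auto simp: algebra_simps\<close>)
 next
  case 3
  show thesis by (rule vert[of y]) (use 3 u t in \<open>auto simp: algebra_simps\<close>)
 next
  case 4
  show thesis by (rule vert[of "y - 1"]) (use 4 u t in \<open>auto simp: algebra_simps\<close>)
 qed
qed

lemma unit_edges_meet:
 assumes "adj u v" "z : closed_segment (emb u) (emb v)" "adj u' v'" "z : closed_segment (emb u') (emb v')"
 shows "{u, v} Int {u', v'} ~= {}"
 using assms(1,2)
proof (cases rule: unit_edge)
 case (vert k)
 note V = vert
 show ?thesis using assms(3,4)
 proof (cases rule: unit_edge)
  case (vert l)
  have "fst u = fst u'" using V vert by linarith
  moreover have "real_of_int k <= of_int l + 1" "real_of_int l <= of_int k + 1" using V vert by linarith+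
  hence "k = l \<or> k = l + 1 \<or> l = k + 1" by linarith
  ultimately show ?thesis unfolding V(2) vert(2) by auto
 next
  case (horiz l)
  have "real_of_int k <= of_int (snd u')" "real_of_int (snd u') <= of_int k + 1"
   "real_of_int l <= of_int (fst u)" "real_of_int (fst u) <= of_int l + 1" using V horiz by linarith+
  hence "snd u' = k \<or> snd u' = k + 1" "fst u = l \<or> fst u = l + 1" by linarith+
  thus ?thesis unfolding V(2) horiz(2) by auto
 qed
next
 case (horiz k)
 note V = horiz
 show ?thesis using assms(3,4)
 proof (cases rule: unit_edge)
  case (horiz l)
  have "snd u = snd u'" using V horiz by linarith
  moreover have "real_of_int k <= of_int l + 1" "real_of_int l <= of_int k + 1" using V horiz by linarith+
  hence "k = l \<or> k = l + 1 \<or> l = k + 1" by linarith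
  ultimately show ?thesis unfolding V(2) horiz(2) by auto
 next
  case (vert l)
  have "real_of_int k <= of_int (fst u')" "real_of_int (fst u') <= of_int k + 1"
   "real_of_int l <= of_int (snd u)" "real_of_int (snd u) <= of_int l + 1" using V vert by linarith+
  hence "fst u' = k \<or> fst u' = k + 1" "snd u = l \<or> snd u = l + 1" by linarith+
  thus ?thesis unfolding V(2) vert(2) by auto
 qed
qed

lemma convex_comb_bounds:
 fixes t a b x y :: real
 assumes "0 <= t" "t <= 1" "a <= x" "a <= y" "x <= b" "y <= b"
 shows "a <= (1 - t) * x + t * y" "(1 - t) * x + t * y <= b"
proof -
 have "(1 - t) * a + t * a <= (1 - t) * x + t * y" by (intro add_mono mult_left_mono) (use assms in auto)
 thus "a <= (1 - t) * x + t * y" by (simp add: algebra_simps)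
 have "(1 - t) * x + t * y <= (1 - t) * b + t * b" by (intro add_mono mult_left_mono) (use assms in auto)
 thus "(1 - t) * x + t * y <= b" by (simp add: algebra_simps)
qed

text \<open>Planarity, deduced from the Fashoda meet theorem applied to the polygonal paths, which are clamped to
 the rectangle; clamping does not create intersections because each path stays strictly inside the
 rectangle in one of the two coordinates.\<close>
theorem lattice_paths_meet:
 assumes f: "f ~= (0, 0)" and p: "spath p m" and p': "spath p' n"
  and X: "!!i. i <= m ==> a <= Xc f (p i) & Xc f (p i) < b" and Y: "Yc f (p 0) < c" "d <= Yc f (p m)"
  and Y': "!!j. j <= n ==> c <= Yc f (p' j) & Yc f (p' j) < d" and X': "Xc f (p' 0) < a" "b <= Xc f (p' n)"
 shows "\<exists>i\<le>m. \<exists>j\<le>n. p i = p' j"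
proof -
 have ab: "a < b" "c < d" using X[of 0] Y'[of 0] by auto
 have m: "m > 0" using Y ab by (cases m) auto
 have n: "n > 0" using X' ab by (cases n) auto
 define f1 f2 where "f1 = real_of_int (fst f)" and "f2 = real_of_int (snd f)"
 define XX where "XX z = f1 * z $ 1 + f2 * z $ 2" for z :: "real^2"
 define YY where "YY z = f1 * z $ 2 - f2 * z $ 1" for z :: "real^2"
 have ff: "f1\<^sup>2 + f2\<^sup>2 ~= 0" using f by (cases f) (auto simp: f1_def f2_def sum_power2_eq_zero_iff)
 have XXe: "XX (emb v) = of_int (Xc f v)" "YY (emb v) = of_int (Yc f v)" for v
  by (simp_all add: XX_def YY_def Xc_def Yc_def f1_def f2_def)
 have XXseg: "XX z = (1 - t) * of_int (Xc f u) + t * of_int (Xc f v)" "YY z = (1 - t) * of_int (Yc f u) + t * of_int (Yc f v)"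
  if "z $ 1 = (1 - t) * of_int (fst u) + t * of_int (fst v)" "z $ 2 = (1 - t) * of_int (snd u) + t * of_int (snd v)" for z t u v
  by (simp_all add: that XX_def YY_def Xc_def Yc_def f1_def f2_def algebra_simps)
 \<comment> \<open>Half-integer sides turn the integer bounds on \<open>Xc\<close> and
   \<open>Yc\<close> into strict ones: clamping leaves one coordinate of each path untouched while
   its ends are still pushed onto the sides.\<close>
 define lo hi :: "real^2" where "lo = vector [of_int a - 1/2, of_int c - 1/2]" and "hi = vector [of_int b - 1/2, of_int d - 1/2]"
 have lohi: "lo $ 1 = of_int a - 1/2" "lo $ 2 = of_int c - 1/2" "hi $ 1 = of_int b - 1/2" "hi $ 2 = of_int d - 1/2"
  unfolding lo_def hi_def by simp_all
 have le: "lo $ 1 <= hi $ 1" "lo $ 2 <= hi $ 2" using ab unfolding lohi by linarith+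
 define \<Phi> :: "real^2 => real^2" where
  "\<Phi> z = vector [max (lo $ 1) (min (hi $ 1) (XX z)), max (lo $ 2) (min (hi $ 2) (YY z))]" for z
 have \<Phi>n: "\<Phi> z $ 1 = max (lo $ 1) (min (hi $ 1) (XX z))" "\<Phi> z $ 2 = max (lo $ 2) (min (hi $ 2) (YY z))" for z
  unfolding \<Phi>_def by simp_all
 have cont: "continuous_on S \<Phi>" for S
 proof -
  have "continuous_on S (%z. \<Phi> z $ i)" for i
  proof -
   have "i = 1 \<or> i = 2" by (rule exhaust_2)
   moreover have "continuous_on S (%z::real^2. max (lo $ 1) (min (hi $ 1) (f1 * z $ 1 + f2 * z $ 2)))"
    "continuous_on S (%z::real^2. max (lo $ 2) (min (hi $ 2) (f1 * z $ 2 - f2 * z $ 1)))"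
    by (intro continuous_intros)+
   ultimately show ?thesis by (elim disjE) (simp_all only: \<Phi>n XX_def YY_def)
  qed
  hence "continuous_on S (%z. \<chi> i. \<Phi> z $ i)" by (rule continuous_on_vec_lambda)
  thus ?thesis by (simp add: vec_lambda_eta)
 qed
 have box: "\<Phi> z : cbox lo hi" for z
  using le by (auto simp: mem_box_cart forall_2 \<Phi>n)
 let ?g = "\<Phi> \<circ> poly_path p m" and ?f = "\<Phi> \<circ> poly_path p' n"
 have X0: "of_int a <= XX z & XX z <= of_int b - 1" if "z : path_image (poly_path p m)" for z
 proof -
  obtain i where i: "i < m" "z : closed_segment (emb (p i)) (emb (p (Suc i)))" using poly_path_image[OF m \<open>z : _\<close>] by blast
  from i(2) obtain t where t: "0 <= t" "t <= 1" "z $ 1 = (1 - t) * of_int (fst (p i)) + t * of_int (fst (p (Suc i)))"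
   "z $ 2 = (1 - t) * of_int (snd (p i)) + t * of_int (snd (p (Suc i)))" by (rule seg_coord)
  have "of_int a <= real_of_int (Xc f (p i))" "of_int a <= real_of_int (Xc f (p (Suc i)))"
   "real_of_int (Xc f (p i)) <= of_int b - 1" "real_of_int (Xc f (p (Suc i))) <= of_int b - 1"
   using X[of i] X[of "Suc i"] i(1) by linarith+
  thus ?thesis unfolding XXseg[OF t(3,4)] using convex_comb_bounds[OF t(1,2)] by blast
 qed
 have Y0: "of_int c <= YY z & YY z <= of_int d - 1" if "z : path_image (poly_path p' n)" for z
 proof -
  obtain i where i: "i < n" "z : closed_segment (emb (p' i)) (emb (p' (Suc i)))" using poly_path_image[OF n \<open>z : _\<close>] by blast
  from i(2) obtain t where t: "0 <= t" "t <= 1" "z $ 1 = (1 - t) * of_int (fst (p' i)) + t * of_int (fst (p' (Suc i)))"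
   "z $ 2 = (1 - t) * of_int (snd (p' i)) + t * of_int (snd (p' (Suc i)))" by (rule seg_coord)
  have "of_int c <= real_of_int (Yc f (p' i))" "of_int c <= real_of_int (Yc f (p' (Suc i)))"
   "real_of_int (Yc f (p' i)) <= of_int d - 1" "real_of_int (Yc f (p' (Suc i))) <= of_int d - 1"
   using Y'[of i] Y'[of "Suc i"] i(1) by linarith+
  thus ?thesis unfolding XXseg[OF t(3,4)] using convex_comb_bounds[OF t(1,2)] by blast
 qed
 obtain z where z: "z : path_image ?f" "z : path_image ?g"
 proof (rule fashoda[of ?f ?g lo hi])
  show "path ?f" "path ?g" using poly_path_props by (auto intro!: path_continuous_image cont)
  show "path_image ?f \<subseteq> cbox lo hi" "path_image ?g \<subseteq> cbox lo hi"
   using box by (auto simp: path_image_def)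
  show "pathstart ?f $ 1 = lo $ 1"
   using X' ab le by (simp add: pathstart_compose poly_path_props \<Phi>n XXe lohi)
  show "pathfinish ?f $ 1 = hi $ 1"
   using X' ab le by (simp add: pathfinish_compose poly_path_props \<Phi>n XXe lohi)
  show "pathstart ?g $ 2 = lo $ 2"
   using Y ab le by (simp add: pathstart_compose poly_path_props \<Phi>n XXe lohi)
  show "pathfinish ?g $ 2 = hi $ 2"
   using Y ab le by (simp add: pathfinish_compose poly_path_props \<Phi>n XXe lohi)
 qed
 from z obtain z1 z2 where z1: "z1 : path_image (poly_path p' n)" "z = \<Phi> z1"
  and z2: "z2 : path_image (poly_path p m)" "z = \<Phi> z2"
  by (auto simp: path_image_compose)
 have "XX z1 = XX z2"
 proof -
  have "max (lo $ 1) (min (hi $ 1) (XX z1)) = max (lo $ 1) (min (hi $ 1) (XX z2))"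
   using z1(2) z2(2) \<Phi>n by metis
  thus ?thesis using X0[OF z2(1)] unfolding lohi by linarith
 qed
 moreover have "YY z1 = YY z2"
 proof -
  have "max (lo $ 2) (min (hi $ 2) (YY z1)) = max (lo $ 2) (min (hi $ 2) (YY z2))"
   using z1(2) z2(2) \<Phi>n by metis
  thus ?thesis using Y0[OF z1(1)] unfolding lohi by linarith
 qed
 ultimately have "z1 = z2"
 proof -
  assume a: "XX z1 = XX z2" "YY z1 = YY z2"
  have "(f1\<^sup>2 + f2\<^sup>2) * z $ 1 = f1 * XX z - f2 * YY z" "(f1\<^sup>2 + f2\<^sup>2) * z $ 2 = f2 * XX z + f1 * YY z" for z
   by (simp_all add: XX_def YY_def power2_eq_square algebra_simps)
  hence "(f1\<^sup>2 + f2\<^sup>2) * z1 $ 1 = (f1\<^sup>2 + f2\<^sup>2) * z2 $ 1" "(f1\<^sup>2 + f2\<^sup>2) * z1 $ 2 = (f1\<^sup>2 + f2\<^sup>2) * z2 $ 2"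
   using a by simp_all
  thus "z1 = z2" using ff by (auto simp: vec_eq_iff forall_2)
 qed
 moreover obtain j where j: "j < n" "z1 : closed_segment (emb (p' j)) (emb (p' (Suc j)))"
  using poly_path_image[OF n z1(1)] by blast
 moreover obtain i where i: "i < m" "z2 : closed_segment (emb (p i)) (emb (p (Suc i)))"
  using poly_path_image[OF m z2(1)] by blast
 ultimately have "{p i, p (Suc i)} Int {p' j, p' (Suc j)} ~= {}"
  using p p' unfolding spath_def by (intro unit_edges_meet) auto
 hence "p i = p' j \<or> p i = p' (Suc j) \<or> p (Suc i) = p' j \<or> p (Suc i) = p' (Suc j)" by auto
 moreover have "i <= m" "Suc i <= m" "j <= n" "Suc j <= n" using i(1) j(1) by auto
 ultimately show ?thesis by metis
qed

section \<open>Lattice symmetries and annealed probabilities\<close>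

definition autom :: "(site => site) => bool" where
 "autom ph \<longleftrightarrow> bij ph & (\<forall>u v. adj (ph u) (ph v) \<longleftrightarrow> adj u v)"

lemma avg_image:
 assumes "inj ph"
 shows "avg (ph ` B) w f = avg B (%A. w (ph ` A)) (%A. f (ph ` A))"
proof -
 have bij: "bij_betw ((`) ph) (Pow B) (Pow (ph ` B))"
  using assms by (intro bij_betw_Pow) (auto simp: bij_betw_def intro: inj_on_subset)
 show ?thesis unfolding avg_def
  using sum.reindex_bij_betw[OF bij, of w] sum.reindex_bij_betw[OF bij, of "%A. w A * f A"] by simp
qed

lemma autom_edge: "inj ph ==> inj ((`) (ph :: site => site))"
 by (simp add: inj_image_eq_iff inj_def)

lemma autom_bd:
 assumes "autom ph"
 shows "bd (ph ` M) = (`) ph ` bd M" "eds (ph ` M) = (`) ph ` eds M"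
proof -
 have b: "bij ph" and a: "!!u v. adj (ph u) (ph v) \<longleftrightarrow> adj u v" using assms unfolding autom_def by auto
 have s: "\<exists>u. v = ph u" for v using b by (metis bij_pointE)
 have i: "ph u : ph ` M \<longleftrightarrow> u : M" for u using b by (auto simp: bij_def inj_image_mem_iff)
 show "bd (ph ` M) = (`) ph ` bd M"
 proof (intro equalityI subsetI)
  fix e assume "e : bd (ph ` M)"
  then obtain u v where "e = {u, v}" "u : ph ` M" "v ~: ph ` M" "adj u v" unfolding bd_def by blast
  moreover obtain u' v' where "u = ph u'" "v = ph v'" using s by metis
  ultimately have "e = ph ` {u', v'}" "{u', v'} : bd M" by (auto simp: in_bd_iff i a)
  thus "e : (`) ph ` bd M" by blast
 next
  fix e assume "e : (`) ph ` bd M"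
  then obtain u v where "e = {ph u, ph v}" "u : M" "v ~: M" "adj u v" unfolding bd_def by auto
  thus "e : bd (ph ` M)" by (simp add: in_bd_iff i a)
 qed
 show "eds (ph ` M) = (`) ph ` eds M"
 proof (intro equalityI subsetI)
  fix e assume "e : eds (ph ` M)"
  then obtain u v where "e = {u, v}" "u : ph ` M" "adj u v" unfolding eds_def by blast
  moreover obtain u' v' where "u = ph u'" "v = ph v'" using s by metis
  ultimately have "e = ph ` {u', v'}" "{u', v'} : eds M" by (auto simp: in_eds_iff i a)
  thus "e : (`) ph ` eds M" by blast
 next
  fix e assume "e : (`) ph ` eds M"
  then obtain u v where "e = {ph u, ph v}" "u : M" "adj u v" unfolding eds_def by auto
  thus "e : eds (ph ` M)" by (simp add: in_eds_iff i a)
 qed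
qed

lemma autom_wt:
 assumes "autom ph"
 shows "wt be g (ph ` M) = wt be (%v. g (ph v)) M" "cw be ((`) ph ` C) = cw be C"
proof -
 have inj: "inj ph" using assms unfolding autom_def by (auto simp: bij_def)
 show "wt be g (ph ` M) = wt be (%v. g (ph v)) M"
  unfolding wt_def autom_bd[OF assms]
  using card_image[OF inj_on_subset[OF autom_edge[OF inj]]] sum.reindex[OF inj_on_subset[OF inj], of M g] by simp
 show "cw be ((`) ph ` C) = cw be C"
  unfolding cw_def using card_image[OF inj_on_subset[OF autom_edge[OF inj]], of C] by simp
qed

lemma autom_Kc:
 assumes "autom ph"
 shows "Kc (ph ` B) (ph ` Ob) ((`) ph ` C) = ph ` Kc B Ob C"
proof -
 have b: "bij ph" and a: "!!u v. adj (ph u) (ph v) \<longleftrightarrow> adj u v" using assms unfolding autom_def by auto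
 have inj: "inj ph" using b by (simp add: bij_def)
 have s: "\<exists>u. v = ph u" for v using b by (metis bij_pointE)
 have i: "ph u : ph ` M \<longleftrightarrow> u : M" for u M using b by (auto simp: bij_def inj_image_mem_iff)
 have e: "{ph u, ph v} : (`) ph ` C \<longleftrightarrow> {u, v} : C" for u v
  using inj_image_mem_iff[OF autom_edge[OF inj], of "{u, v}" C] by simp
 show ?thesis
 proof (intro equalityI subsetI)
  fix v assume "v : Kc (ph ` B) (ph ` Ob) ((`) ph ` C)"
  thus "v : ph ` Kc B Ob C"
  proof induction
   case (base v w)
   obtain v' w' where vw: "v = ph v'" "w = ph w'" using s by metis
   have "v' : Kc B Ob C" by (rule Kc.base[of v' _ _ w']) (use base in \<open>simp_all add: vw i a e\<close>)
   thus ?case using vw by blast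
  next
   case (step u v)
   obtain v' u' where vw: "v = ph v'" "u = ph u'" using s by metis
   have u': "u' : Kc B Ob C" using step.IH vw i by simp
   have "v' : Kc B Ob C" by (rule Kc.step[OF u']) (use step in \<open>simp_all add: vw i a e\<close>)
   thus ?case using vw by blast
  qed
 next
  fix v assume "v : ph ` Kc B Ob C"
  then obtain v' where v: "v = ph v'" "v' : Kc B Ob C" by blast
  from v(2) have "ph v' : Kc (ph ` B) (ph ` Ob) ((`) ph ` C)"
  proof induction
   case (base v w)
   show ?case by (rule Kc.base[of _ _ _ "ph w"]) (use base in \<open>simp_all add: i a e\<close>)
  next
   case (step u v)
   show ?case by (rule Kc.step[OF step.IH]) (use step in \<open>simp_all add: i a e\<close>)
  qed
  thus "v : Kc (ph ` B) (ph ` Ob) ((`) ph ` C)" using v by simp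
 qed
qed

lemma autom_kp:
 assumes "autom ph"
 shows "kp be (ph ` B) g1 g2 Q = kp be B (%v. g1 (ph v)) (%v. g2 (ph v)) (%K. Q (ph ` K))"
proof -
 have inj: "inj ph" using assms unfolding autom_def by (auto simp: bij_def)
 show ?thesis
  unfolding kp_def kexp_def autom_bd[OF assms] avg_image[OF inj] avg_image[OF autom_edge[OF inj]]
   autom_wt[OF assms] image_Un[symmetric] autom_Kc[OF assms] ..
qed

definition trl :: "site => site => site" where
 "trl a v = (fst v + fst a, snd v + snd a)"

lemma trl_autom: "autom (trl a)"
 unfolding autom_def
proof
 show "bij (trl a)"
  by (rule bij_betw_byWitness[where f' = "trl (- fst a, - snd a)"]) (auto simp: trl_def)
qed (simp add: trl_def adj_def)

definition rot :: "site => site" where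
 "rot v = (- snd v, fst v)"

lemma rot_autom: "autom rot"
 unfolding autom_def
proof
 show "bij rot"
  by (rule bij_betw_byWitness[where f' = "%v. (snd v, - fst v)"]) (auto simp: rot_def)
qed (auto simp: rot_def adj_def)

lemma autom_comp: "autom ph ==> autom \<psi> ==> autom (%v. ph (\<psi> v))"
 unfolding autom_def using bij_comp[of \<psi> ph] by (simp add: comp_def)

context gauss
begin

definition ap :: "real => site set => (site set => bool) => real" where
 "ap be B Q = (LINT h|Gm. kp be B h (%v. - h v) Q)"

lemma kp_measurable [measurable]: "(%h. kp be B h (%v. - h v) Q) : borel_measurable Gm"
 unfolding kp_def by (intro kexp_measurable borel_measurable_uminus coord_measurable)

lemma kp_bounds:
 assumes "be > 0" "finite B"
 shows "\<bar>kp be B g1 g2 Q\<bar> <= 1"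
 using kp_le1[OF assms] kp_ge0[OF assms] by (simp add: abs_le_iff order_trans[of _ 0])

lemma kp_integrable:
 assumes "be > 0" "finite B"
 shows "integrable Gm (%h. kp be B h (%v. - h v) Q)"
 by (rule integrable_bounded[OF kp_measurable kp_bounds[OF assms]])

lemma ap_ge0: "be > 0 ==> finite B ==> 0 <= ap be B Q"
 unfolding ap_def by (intro Bochner_Integration.integral_nonneg kp_ge0)

lemma prob_iid_one: "(\<integral>h. c \<partial>(Gm :: ('i => real) measure)) = (c :: real)"
 using prob_space.prob_space[OF prob_iid[where ?'i = 'i]] by simp

lemma ap_le1: assumes "be > 0" "finite B" shows "ap be B Q <= 1"
proof -
 have "ap be B Q <= (\<integral>h. 1 \<partial>(Gm :: (site => real) measure))"
  unfolding ap_def by (intro integral_mono kp_integrable kp_le1 assms integrable_bounded[where c = 1]) auto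
 thus ?thesis by (simp only: prob_iid_one)
qed

lemma ap_mono:
 assumes "be > 0" "finite B" "!!K. K \<subseteq> B ==> Q K ==> Q' K"
 shows "ap be B Q <= ap be B Q'"
 unfolding ap_def by (intro integral_mono kp_integrable kp_mono assms)

lemma ap_domain:
 assumes "be > 0" "finite L" "B \<subseteq> L" "upred Q"
 shows "ap be L (%K. Q (K Int B)) <= ap be B Q"
 unfolding ap_def using finite_subset[OF assms(3,2)] by (intro integral_mono kp_integrable kp_domain assms)

lemma ap_autom:
 assumes "autom ph"
 shows "ap be (ph ` B) Q = ap be B (%K. Q (ph ` K))"
proof -
 have "inj ph" using assms unfolding autom_def by (auto simp: bij_def)
 from reindex[OF this kp_measurable, of be B "%K. Q (ph ` K)"]
 show ?thesis unfolding ap_def autom_kp[OF assms] by simp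
qed

lemma kp_dep: "dep B (%h. kp be B h (%v. - h v) Q)"
 unfolding dep_def by (intro allI impI kp_field_cong) auto

lemma ap_prod:
 assumes b: "be > 0" and "finite I" "!!i. i : I ==> finite (Bs i)"
  and "!!i j. i : I ==> j : I ==> i ~= j ==> sep (Bs i) (Bs j)"
 shows "(LINT h|Gm. (\<Prod>i\<in>I. kp be (Bs i) h (%v. - h v) (Q i))) = (\<Prod>i\<in>I. ap be (Bs i) (Q i))"
 unfolding ap_def
proof (rule integral_prod_dep[OF assms(2), where K = Bs and c = 1])
 show "disjoint_family_on Bs I" using assms(4) unfolding disjoint_family_on_def sep_def by blast
qed (auto intro: kp_dep kp_bounds b assms(3))

end

section \<open>The tube bound\<close>

definition qq :: "site => int" where
 "qq f = (fst f)\<^sup>2 + (snd f)\<^sup>2"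

text \<open>The plane is tiled by squares with sides \<open>f\<close> and \<open>f\<close> turned by a right angle; \<open>Dk f k t\<close> is the block of tiles within
 \<open>k\<close> of tile \<open>t\<close>.\<close>
definition Dk :: "site => int => site => site set" where
 "Dk f k t = {v. (fst t - k) * qq f <= Xc f v & Xc f v < (fst t + k + 1) * qq f &
         (snd t - k) * qq f <= Yc f v & Yc f v < (snd t + k + 1) * qq f}"

text \<open>The largest change of \<open>Xc f\<close> or \<open>Yc f\<close> along a lattice step. A
  tile has side \<open>qq f\<close> in these scaled coordinates, so shells of width
  \<open>mx f\<close> across it are about as many as its Euclidean side length.\<close>

definition mx :: "site => int" where
 "mx f = max \<bar>fst f\<bar> \<bar>snd f\<bar>"

lemma qq_pos: "f ~= (0, 0) ==> qq f > 0"
 by (cases f) (auto simp: qq_def sum_power2_gt_zero_iff)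

lemma mx_le_qq: "mx f <= qq f"
proof -
 have "\<bar>x\<bar> <= x\<^sup>2" for x :: int
 proof -
  have "\<bar>x\<bar> * 1 <= \<bar>x\<bar> * \<bar>x\<bar>" if "x ~= 0" using that by (intro mult_left_mono) auto
  thus ?thesis by (cases "x = 0") (auto simp: power2_eq_square)
 qed
 thus ?thesis unfolding mx_def qq_def by (smt (verit) zero_le_power2)
qed

lemma mx_sq_le_qq: "(mx f)\<^sup>2 <= qq f"
 unfolding mx_def qq_def by (cases "\<bar>fst f\<bar> <= \<bar>snd f\<bar>") (auto simp: max_def)

lemma step_XY:
 assumes "adj u v"
 shows "\<bar>Xc f u - Xc f v\<bar> <= mx f" "\<bar>Yc f u - Yc f v\<bar> <= mx f"
proof -
 obtain x y where u: "u = (x, y)" by (cases u)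
 have "v = (x + 1, y) \<or> v = (x - 1, y) \<or> v = (x, y + 1) \<or> v = (x, y - 1)"
  using assms u adj_alt by auto
 thus "\<bar>Xc f u - Xc f v\<bar> <= mx f" "\<bar>Yc f u - Yc f v\<bar> <= mx f"
  unfolding u Xc_def Yc_def mx_def by (auto simp: algebra_simps)
qed

lemma XY_norm: "(Xc f v)\<^sup>2 + (Yc f v)\<^sup>2 = qq f * qq v"
 by (simp add: Xc_def Yc_def qq_def power2_eq_square algebra_simps)

lemma Dk_mono: "k <= l ==> Dk f k t \<subseteq> Dk f l t"
proof -
 assume kl: "k <= l"
 have q: "0 <= qq f" by (simp add: qq_def)
 have "(fst t - l) * qq f <= (fst t - k) * qq f" "(fst t + k + 1) * qq f <= (fst t + l + 1) * qq f"
  "(snd t - l) * qq f <= (snd t - k) * qq f" "(snd t + k + 1) * qq f <= (snd t + l + 1) * qq f"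
  by (intro mult_right_mono; use kl q in simp)+
 thus ?thesis unfolding Dk_def by auto
qed

definition lat :: "site => site => site" where
 "lat f t = (fst t * fst f - snd t * snd f, fst t * snd f + snd t * fst f)"

lemma XY_lat: "Xc f (trl (lat f t) v) = Xc f v + fst t * qq f" "Yc f (trl (lat f t) v) = Yc f v + snd t * qq f"
 by (simp_all add: Xc_def Yc_def lat_def trl_def qq_def power2_eq_square algebra_simps)

lemma Dk_trl: "trl (lat f s) ` Dk f k t = Dk f k (fst t + fst s, snd t + snd s)"
proof -
 have b: "bij (trl (lat f s))" using trl_autom unfolding autom_def by blast
 have e: "(fst t + fst s - k) * qq f = (fst t - k) * qq f + fst s * qq f"
  "(fst t + fst s + k + 1) * qq f = (fst t + k + 1) * qq f + fst s * qq f"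
  "(snd t + snd s - k) * qq f = (snd t - k) * qq f + snd s * qq f"
  "(snd t + snd s + k + 1) * qq f = (snd t + k + 1) * qq f + snd s * qq f"
  by (simp_all only: ring_distribs)
 have *: "trl (lat f s) v : Dk f k (fst t + fst s, snd t + snd s) \<longleftrightarrow> v : Dk f k t" for v
  unfolding Dk_def mem_Collect_eq XY_lat fst_conv snd_conv e by (simp only: add_le_cancel_right add_less_cancel_right)
 show ?thesis
 proof (intro equalityI subsetI)
  fix v assume "v : Dk f k (fst t + fst s, snd t + snd s)"
  moreover obtain u where "v = trl (lat f s) u" using b by (metis bij_pointE)
  ultimately show "v : trl (lat f s) ` Dk f k t" using * by blast
 qed (use * in blast)
qed

lemma finite_Dk: assumes "f ~= (0, 0)" shows "finite (Dk f k t)"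
proof -
 let ?h = "%v. (Xc f v, Yc f v)"
 have "inj ?h"
 proof (rule injI)
  fix u v assume "?h u = ?h v"
  hence "Xc f (u - v) = 0" "Yc f (u - v) = 0" by (simp_all add: Xc_def Yc_def algebra_simps)
  hence "qq f * qq (u - v) = 0" using XY_norm[of f "u - v"] by simp
  hence "qq (u - v) = 0" using qq_pos[OF assms] by simp
  thus "u = v" by (simp add: qq_def sum_power2_eq_zero_iff prod_eq_iff)
 qed
 moreover have "?h ` Dk f k t \<subseteq> {(fst t - k) * qq f..(fst t + k + 1) * qq f} \<times> {(snd t - k) * qq f..(snd t + k + 1) * qq f}"
  by (auto simp: Dk_def)
 hence "finite (?h ` Dk f k t)" by (rule finite_subset) simp
 ultimately show ?thesis using finite_imageD inj_on_subset by blast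
qed

definition vcross :: "site => site set => int => int => int => int => bool" where
 "vcross f K a b c d \<longleftrightarrow> (\<exists>p n. spath p n & (\<forall>k\<le>n. p k : K & a <= Xc f (p k) & Xc f (p k) < b) & Yc f (p 0) < c & d <= Yc f (p n))"

definition hcross :: "site => site set => int => int => int => int => bool" where
 "hcross f K a b c d \<longleftrightarrow> (\<exists>p n. spath p n & (\<forall>k\<le>n. p k : K & a <= Yc f (p k) & Yc f (p k) < b) & Xc f (p 0) < c & d <= Xc f (p n))"

text \<open>Eight crossed tubes around tile \<open>t\<close>, which together contain two circuits around it.\<close>
definition Tub :: "site => site => site set => bool" where
 "Tub f t K \<longleftrightarrow> (ALL c:{-2, -1, 1, 2}.
   vcross f K ((fst t + c) * qq f) ((fst t + c + 1) * qq f) ((snd t - 3) * qq f) ((snd t + 4) * qq f) &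
   hcross f K ((snd t + c) * qq f) ((snd t + c + 1) * qq f) ((fst t - 3) * qq f) ((fst t + 4) * qq f))"

lemma spath_shift: "spath r n ==> k + m <= n ==> spath (%i. r (k + i)) m"
 unfolding spath_def by auto

lemma spath_rev: "spath r n ==> m <= n ==> spath (%i. r (n - i)) m"
 unfolding spath_def
proof (intro allI impI)
 fix i assume "\<forall>i<n. adj (r i) (r (Suc i))" "m <= n" "i < m"
 hence "adj (r (n - Suc i)) (r (Suc (n - Suc i)))" by auto
 moreover have "Suc (n - Suc i) = n - i" using \<open>m <= n\<close> \<open>i < m\<close> by auto
 ultimately show "adj (r (n - i)) (r (n - Suc i))" by (simp add: adj_sym)
qed

lemma vcross_meet:
 assumes f: "f ~= (0, 0)" and V: "vcross f K a b c d" and r: "spath r n"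
  and Y: "!!j. j <= n ==> c <= Yc f (r j) & Yc f (r j) < d"
  and X: "(Xc f (r 0) < a & b <= Xc f (r n)) \<or> (Xc f (r n) < a & b <= Xc f (r 0))"
 shows "\<exists>k\<le>n. r k : K"
proof -
 from V obtain p m where p: "spath p m" "!!k. k <= m ==> p k : K" "!!k. k <= m ==> a <= Xc f (p k) & Xc f (p k) < b"
  "Yc f (p 0) < c" "d <= Yc f (p m)" unfolding vcross_def by blast
 from X show ?thesis
 proof
  assume "Xc f (r 0) < a & b <= Xc f (r n)"
  hence "\<exists>i\<le>m. \<exists>j\<le>n. p i = r j" by (intro lattice_paths_meet[OF f p(1) r p(3) p(4,5) Y]) auto
  thus ?thesis using p(2) by metis
 next
  assume "Xc f (r n) < a & b <= Xc f (r 0)"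
  hence "\<exists>i\<le>m. \<exists>j\<le>n. p i = r (n - j)"
   by (intro lattice_paths_meet[OF f p(1) spath_rev[OF r order_refl] p(3) p(4,5)]) (use Y in auto)
  thus ?thesis using p(2) by (metis diff_le_self)
 qed
qed

lemma hcross_meet:
 assumes f: "f ~= (0, 0)" and V: "hcross f K a b c d" and r: "spath r n"
  and Y: "!!j. j <= n ==> c <= Xc f (r j) & Xc f (r j) < d"
  and X: "(Yc f (r 0) < a & b <= Yc f (r n)) \<or> (Yc f (r n) < a & b <= Yc f (r 0))"
 shows "\<exists>k\<le>n. r k : K"
proof -
 from V obtain p m where p: "spath p m" "!!k. k <= m ==> p k : K" "!!k. k <= m ==> a <= Yc f (p k) & Yc f (p k) < b"
  "Xc f (p 0) < c" "d <= Xc f (p m)" unfolding hcross_def by blast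
 from X show ?thesis
 proof
  assume a: "Yc f (r 0) < a & b <= Yc f (r n)"
  have "\<exists>j\<le>n. \<exists>i\<le>m. r j = p i"
   by (rule lattice_paths_meet[OF f r p(1) Y _ _ p(3)]) (use p a in auto)
  thus ?thesis using p(2) by metis
 next
  assume a: "Yc f (r n) < a & b <= Yc f (r 0)"
  have "\<exists>j\<le>n. \<exists>i\<le>m. r (n - j) = p i"
   by (rule lattice_paths_meet[OF f spath_rev[OF r order_refl] p(1) _ _ _ p(3)]) (use p a Y in auto)
  thus ?thesis using p(2) by (metis diff_le_self)
 qed
qed

text \<open>Stopped when it leaves the block, the path is still within the length of the tubes and
  has traversed the width of one of the four tubes at distance \<open>c\<close>; by planarity it
  meets the crossing of that tube.\<close>

lemma ring_meet:
 assumes f: "f ~= (0, 0)" and T: "Tub f t K" and c: "c : {1, 2}" and r: "spath r n"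
  and r0: "r 0 : Dk f (c - 1) t" and rn: "r n ~: Dk f c t"
 shows "\<exists>k\<le>n. r k : K"
proof -
 let ?q = "qq f"
 have q: "?q > 0" by (rule qq_pos[OF f])
 define N where "N = (LEAST k. r k ~: Dk f c t)"
 have N: "r N ~: Dk f c t" "N <= n" "!!k. k < N ==> r k : Dk f c t"
  unfolding N_def using LeastI[of "%k. r k ~: Dk f c t", OF rn] Least_le[of "%k. r k ~: Dk f c t", OF rn]
   not_less_Least[of _ "%k. r k ~: Dk f c t"] by blast+
 have N0: "N > 0" using N(1) r0 Dk_mono[of "c - 1" c f t] by (metis bot_nat_0.not_eq_extremum diff_le_self subsetD zle_diff1_eq less_add_one diff_add_cancel order_less_imp_le)
 have rN: "spath r N" using r N(2) unfolding spath_def by auto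
 have st: "\<bar>Xc f (r (N - 1)) - Xc f (r N)\<bar> <= ?q" "\<bar>Yc f (r (N - 1)) - Yc f (r N)\<bar> <= ?q"
 proof -
  have "adj (r (N - 1)) (r N)" using rN N0 unfolding spath_def by (metis Suc_diff_1 diff_less zero_less_one)
  thus "\<bar>Xc f (r (N - 1)) - Xc f (r N)\<bar> <= ?q" "\<bar>Yc f (r (N - 1)) - Yc f (r N)\<bar> <= ?q"
   using step_XY mx_le_qq[of f] order_trans by blast+
 qed
 have XYc: "(fst t - 3) * ?q <= Xc f (r k) & Xc f (r k) < (fst t + 4) * ?q & (snd t - 3) * ?q <= Yc f (r k) & Yc f (r k) < (snd t + 4) * ?q"
  if "k <= N" for k
 proof -
  have D: "Dk f c t \<subseteq> Dk f 2 t" using c by (intro Dk_mono) auto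
  have 1: "(fst t - 2) * ?q <= Xc f (r k) & Xc f (r k) < (fst t + 3) * ?q & (snd t - 2) * ?q <= Yc f (r k) & Yc f (r k) < (snd t + 3) * ?q" if "k < N" for k
  proof -
   have "r k : Dk f 2 t" using N(3)[OF that] D by blast
   thus ?thesis unfolding Dk_def by (simp add: algebra_simps)
  qed
  show ?thesis
  proof (cases "k < N")
   case True
   thus ?thesis using 1[OF True] q by (simp add: algebra_simps)
  next
   case False
   hence "k = N" using that by simp
   moreover have "N - 1 < N" using N0 by simp
   ultimately show ?thesis using 1[of "N - 1"] st by (simp add: algebra_simps) linarith
  qed
 qed
 have c2: "c : {-2, -1, 1, 2}" "- c : {-2, -1, 1, 2}" using c by auto
 have V: "vcross f K ((fst t + c) * ?q) ((fst t + c + 1) * ?q) ((snd t - 3) * ?q) ((snd t + 4) * ?q)"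
  "vcross f K ((fst t + - c) * ?q) ((fst t + - c + 1) * ?q) ((snd t - 3) * ?q) ((snd t + 4) * ?q)"
  "hcross f K ((snd t + c) * ?q) ((snd t + c + 1) * ?q) ((fst t - 3) * ?q) ((fst t + 4) * ?q)"
  "hcross f K ((snd t + - c) * ?q) ((snd t + - c + 1) * ?q) ((fst t - 3) * ?q) ((fst t + 4) * ?q)"
  using T c2 unfolding Tub_def by blast+
 have r0': "(fst t - c + 1) * ?q <= Xc f (r 0)" "Xc f (r 0) < (fst t + c) * ?q" "(snd t - c + 1) * ?q <= Yc f (r 0)" "Yc f (r 0) < (snd t + c) * ?q"
  using r0 unfolding Dk_def by (auto simp: algebra_simps)
 consider "(fst t + c + 1) * ?q <= Xc f (r N)" | "Xc f (r N) < (fst t - c) * ?q"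
  | "(snd t + c + 1) * ?q <= Yc f (r N)" | "Yc f (r N) < (snd t - c) * ?q"
  using N(1) unfolding Dk_def by fastforce
 hence "\<exists>k\<le>N. r k : K"
 proof cases
  case 1
  thus ?thesis using r0' XYc by (intro vcross_meet[OF f V(1) rN]) auto
 next
  case 2
  thus ?thesis using r0' XYc by (intro vcross_meet[OF f V(2) rN]) auto
 next
  case 3
  thus ?thesis using r0' XYc by (intro hcross_meet[OF f V(3) rN]) auto
 next
  case 4
  thus ?thesis using r0' XYc by (intro hcross_meet[OF f V(4) rN]) auto
 qed
 thus ?thesis using N(2) order_trans by blast
qed

lemma Kc_path:
 assumes "v : Kc B Ob C"
 shows "\<exists>r n. r 0 = v & (\<forall>k\<le>n. r k : B - Ob & adj (r k) (r (Suc k)) & {r k, r (Suc k)} ~: C) & r (Suc n) ~: B"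
 using assms
proof induction
 case (base v w)
 show ?case by (rule exI[of _ "%i. if i = 0 then v else w"], rule exI[of _ 0]) (use base in auto)
next
 case (step u v)
 then obtain r n where r: "r 0 = u" "!!k. k <= n ==> r k : B - Ob & adj (r k) (r (Suc k)) & {r k, r (Suc k)} ~: C" "r (Suc n) ~: B"
  by blast
 let ?r = "%i. case i of 0 => v | Suc j => r j"
 have "?r k : B - Ob & adj (?r k) (?r (Suc k)) & {?r k, ?r (Suc k)} ~: C" if "k <= Suc n" for k
 proof (cases k)
  case 0
  thus ?thesis using step r(1) by (simp add: adj_sym insert_commute)
 next
  case (Suc j)
  thus ?thesis using r(2)[of j] that by simp
 qed
 thus ?case using r(3) by (intro exI[of _ ?r] exI[of _ "Suc n"]) simp
qed

lemma Outc_path: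
 assumes "v : Outc G M"
 shows "\<exists>r n. r 0 = v & (\<forall>k\<le>n. r k : M) & spath r n & r n ~: G"
 using assms
proof induction
 case (base v)
 show ?case by (rule exI[of _ "%_. v"], rule exI[of _ 0]) (use base in \<open>auto simp: spath_def\<close>)
next
 case (step u v)
 then obtain r n where r: "r 0 = u" "!!k. k <= n ==> r k : M" "spath r n" "r n ~: G" by blast
 let ?r = "%i. case i of 0 => v | Suc j => r j"
 have "spath ?r (Suc n)" unfolding spath_def
 proof (intro allI impI)
  fix i assume "i < Suc n"
  thus "adj (?r i) (?r (Suc i))"
   using r(1,3) step.hyps adj_sym unfolding spath_def by (cases i) auto
 qed
 moreover have "\<forall>k\<le>Suc n. ?r k : M" using r(2) step.hyps by (auto split: nat.splits)
 ultimately show ?case using r(4) by (intro exI[of _ ?r] exI[of _ "Suc n"]) simp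
qed

lemma avg_cw_local:
 assumes b: "be > 0" and "finite X" "Y \<subseteq> X" and f: "!!C. f C = f (C Int Y)"
 shows "avg X (cw be) f = avg Y (cw be) f"
proof -
 have d: "Y Int (X - Y) = {}" by auto
 have fin: "finite Y" "finite (X - Y)" using assms finite_subset by auto
 have "avg (Y Un (X - Y)) (cw be) f = avg Y (cw be) (%A. avg (X - Y) (cw be) (%B. f (A Un B)))"
 proof (rule avg_Un[OF d])
  fix A B assume "A \<subseteq> Y" "B \<subseteq> X - Y"
  moreover from this have "finite A" "finite B" using fin finite_subset by blast+
  ultimately show "cw be (A Un B) = cw be A * cw be B" by (intro cw_disj) auto
 qed
 also have "... = avg Y (cw be) (%A. avg (X - Y) (cw be) (%B. f A))"
 proof (intro avg_cong refl)
  fix A B assume "A \<subseteq> Y" "B \<subseteq> X - Y"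
  hence "(A Un B) Int Y = A Int Y" by auto
  thus "f (A Un B) = f A" using f[of "A Un B"] f[of A] by metis
 qed
 also have "... = avg Y (cw be) f" by (simp only: avg_const[OF fin(2) cw_pos[OF b]])
 finally show ?thesis using assms(3) by (simp add: Un_absorb1)
qed

text \<open>\<open>avg_screen\<close> is applied to each replica in turn. Closed edges are
  independent, so restricting them to \<open>eds H\<close> is exact and costs no factor.\<close>

lemma kexp_screen:
 assumes b: "be > 0" and fB: "finite B" and HG: "H \<subseteq> G" "G \<subseteq> B" and F: "tdecr B F" and F0: "!!M M' C. 0 <= F M M' C"
  and loc: "!!M M' C. F M M' C = F (M Int H) (M' Int H) (C Int eds H)"
 shows "avg B (wt be g1) (%M. of_bool (Outc G M Int H = {})) * avg B (wt be g2) (%M. of_bool (Outc G M Int H = {})) * kexp be G g1 g2 F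
  <= kexp be B g1 g2 F"
proof -
 let ?N = "%g. avg B (wt be g) (%M. of_bool (Outc G M Int H = {})) :: real"
 let ?A = "%M M'. avg (eds H) (cw be) (F M M')"
 have fG: "finite G" using HG fB finite_subset by blast
 note p = wt_pos cw_pos[OF b]
 have C: "avg (eds X) (cw be) (F M M') = ?A M M'" if "H \<subseteq> X" "finite X" for X M M'
 proof (rule avg_cw_local[OF b finite_eds[OF that(2)] eds_mono[OF that(1)]])
  fix C
  show "F M M' C = F M M' (C Int eds H)" using loc[of M M' C] loc[of M M' "C Int eds H"] by simp
 qed
 have HB: "H \<subseteq> B" using HG by blast
 have eHB: "eds H \<subseteq> eds B" by (rule eds_mono[OF HB])
 have dec: "decr B (%M'. ?A M M')" if "M \<subseteq> B" for M
  using that eHB by (auto simp: decr_def intro!: avg_mono p tdecrD[OF F])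
 have loc2: "?A M M' = ?A (M Int H) (M' Int H)" for M M'
 proof (rule avg_cong[OF refl])
  fix C show "F M M' C = F (M Int H) (M' Int H) C" using loc[of M M' C] loc[of "M Int H" "M' Int H" C] by simp
 qed
 have locM': "?A M M' = ?A M (M' Int H)" for M M' using loc2[of M M'] loc2[of M "M' Int H"] by simp
 have locM: "?A M M' = ?A (M Int H) M'" for M M' using loc2[of M M'] loc2[of "M Int H" M'] by simp
 have A0: "0 <= ?A M M'" for M M' by (intro avg_nonneg p F0)
 have "?N g2 * avg G (wt be g2) (?A M) <= avg B (wt be g2) (?A M)" if "M \<subseteq> B" for M
  by (rule avg_screen[OF b fB HG(2) dec[OF that] A0 locM'])
 hence "avg B (wt be g1) (%M. ?N g2 * avg G (wt be g2) (?A M)) <= avg B (wt be g1) (%M. avg B (wt be g2) (?A M))"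
  by (intro avg_mono p)
 moreover have "?N g1 * avg G (wt be g1) (%M. avg G (wt be g2) (?A M)) <= avg B (wt be g1) (%M. avg G (wt be g2) (?A M))"
 proof (rule avg_screen[OF b fB HG(2)])
  show "decr B (%M. avg G (wt be g2) (?A M))"
   using eHB HG(2) by (auto simp: decr_def intro!: avg_mono p tdecrD[OF F])
  show "0 <= avg G (wt be g2) (?A M)" for M by (intro avg_nonneg p F0)
  show "avg G (wt be g2) (?A M) = avg G (wt be g2) (?A (M Int H))" for M
   by (rule avg_cong[OF refl]) (rule locM)
 qed
 moreover have "0 <= ?N g2" by (intro avg_nonneg p) simp
 ultimately have "?N g2 * (?N g1 * avg G (wt be g1) (%M. avg G (wt be g2) (?A M))) <= avg B (wt be g1) (%M. avg B (wt be g2) (?A M))"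
  unfolding avg_cmult by (meson mult_left_mono order_trans)
 thus ?thesis unfolding kexp_def C[OF HB fB] C[OF HG(1) fG] by (simp add: mult_ac)
qed

lemma upred_Tub: "upred (Tub f t)"
proof -
 have "vcross f K a b c d ==> K \<subseteq> K' ==> vcross f K' a b c d" "hcross f K a b c d ==> K \<subseteq> K' ==> hcross f K' a b c d" for K K' a b c d
  unfolding vcross_def hcross_def by blast+
 thus ?thesis unfolding upred_def Tub_def by blast
qed

text \<open>The outer circuit (\<open>c = 2\<close>): a minus component reaching from outside the
  block into its centre would have to meet the cluster, which contains no minus spins.\<close>

lemma Tub_no_Outc:
 assumes f: "f ~= (0, 0)" and T: "Tub f t (Kc B Ob C)" and M: "M \<subseteq> Ob"
 shows "Outc (Dk f 2 t) M Int Dk f 1 t = {}"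
proof (rule ccontr)
 assume "~ ?thesis"
 then obtain v where v: "v : Outc (Dk f 2 t) M" "v : Dk f 1 t" by blast
 from Outc_path[OF v(1)] obtain r n where r: "r 0 = v" "!!k. k <= n ==> r k : M" "spath r n" "r n ~: Dk f 2 t" by blast
 have "\<exists>k\<le>n. r k : Kc B Ob C"
  by (rule ring_meet[OF f T _ r(3), of 2]) (use r v in auto)
 thus False using r(2) M Kc_subset by blast
qed

text \<open>The inner circuit (\<open>c = 1\<close>): an open connection from the tile to the
  outside of the small block hits the cluster of \<open>B\<close>, and the part before the hit is
  absorbed into it.\<close>

lemma Tub_connect:
 assumes f: "f ~= (0, 0)" and T: "Tub f t (Kc B Ob C)" and v: "v : Kc (Dk f 1 t) Ob C" "v : Dk f 0 t" and B: "Dk f 1 t \<subseteq> B"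
 shows "v : Kc B Ob C"
proof -
 from Kc_path[OF v(1)] obtain r n where r: "r 0 = v"
  "!!k. k <= n ==> r k : Dk f 1 t - Ob & adj (r k) (r (Suc k)) & {r k, r (Suc k)} ~: C" "r (Suc n) ~: Dk f 1 t" by blast
 have "spath r (Suc n)" unfolding spath_def using r(2) by simp
 hence "\<exists>k\<le>Suc n. r k : Kc B Ob C"
  by (intro ring_meet[OF f T, of 1]) (use r v in auto)
 then obtain k where k: "k <= Suc n" "r k : Kc B Ob C" by blast
 have "r (k - j) : Kc B Ob C" if "j <= k" for j
  using that
 proof (induction j)
  case 0
  thus ?case using k by simp
 next
  case (Suc j)
  hence IH: "r (Suc (k - Suc j)) : Kc B Ob C" by (simp add: Suc_diff_Suc)
  have "k - Suc j <= n" using Suc.prems k by linarith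
  from r(2)[OF this] show ?case
   by (intro Kc.step[OF IH]) (use B in \<open>auto simp: adj_sym insert_commute\<close>)
 qed
 from this[of k] show ?thesis using r(1) by simp
qed

text \<open>Three factors 3/4 occur: one for screening each replica by the outer circuit, and one,
  by positive association, for joining the local to the global cluster through the inner circuit.
  Their product 27/64 exceeds 1/4. So enlarging the block, which decreases \<open>dd\<close>, loses
  only a constant.\<close>

lemma dd_screen:
 assumes f: "f ~= (0, 0)" and b: "be > 0" and T: "3/4 <= kp be (Dk f 6 t) h (%x. - h x) (Tub f t)" and v: "v : Dk f 0 t"
 shows "dd be (Dk f 2 t) h v / 4 <= dd be (Dk f 6 t) h v"
proof -
 let ?L = "Dk f 6 t" and ?G = "Dk f 2 t" and ?H = "Dk f 1 t" and ?h' = "%x. - h x"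
 have fL: "finite ?L" and fG: "finite ?G" using finite_Dk[OF f] by auto
 have sub: "?H \<subseteq> ?G" "?G \<subseteq> ?L" "?H \<subseteq> ?L" "Dk f 0 t \<subseteq> ?G" by (intro Dk_mono; simp)+
 have v2: "v : ?G" "v : ?L" using v sub by auto
 let ?F = "%M M' C. of_bool (v : Kc ?H (M Un M') C) :: real"
 let ?T = "%M M' C. of_bool (Tub f t (Kc ?L (M Un M') C)) :: real"
 let ?N = "%g. avg ?L (wt be g) (%M. of_bool (Outc ?G M Int ?H = {})) :: real"
 have up: "upred (%K. v : K)" unfolding upred_def by blast
 have tF: "tdecr ?L ?F" by (rule tdecr_Kc[OF up])
 have N1: "3/4 <= ?N h"
 proof -
  have "3/4 <= kexp be ?L h ?h' (%M M' C. of_bool (Outc ?G M Int ?H = {}))"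
   by (rule order_trans[OF T], unfold kp_def, rule kexp_mono[OF b fL]) (use Tub_no_Outc[OF f] in auto)
  also have "... = ?N h" unfolding kexp_def
   by (simp only: avg_const[OF finite_eds[OF fL] cw_pos[OF b]] avg_const[OF fL wt_pos])
  finally show ?thesis .
 qed
 have N2: "3/4 <= ?N ?h'"
 proof -
  have "3/4 <= kexp be ?L h ?h' (%M M' C. of_bool (Outc ?G M' Int ?H = {}))"
   by (rule order_trans[OF T], unfold kp_def, rule kexp_mono[OF b fL]) (use Tub_no_Outc[OF f] in auto)
  also have "... = ?N ?h'" unfolding kexp_def
   by (simp only: avg_const[OF finite_eds[OF fL] cw_pos[OF b]] avg_const[OF fL wt_pos])
  finally show ?thesis .
 qed
 have "dd be ?G h v = kp be ?G h ?h' (%K. v : K)" by (rule dd_eq_kp[OF b fG v2(1)])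
 also have "... <= kexp be ?G h ?h' ?F"
  unfolding kp_def
 proof (rule kexp_mono[OF b fG])
  fix M M' C
  have "v : ?H" using v Dk_mono[of 0 1 f t] by auto
  thus "of_bool (v : Kc ?G (M Un M') C) <= ?F M M' C"
   using Kc_restrict[OF sub(1), of "M Un M'" C] by auto
 qed
 finally have 1: "dd be ?G h v <= kexp be ?G h ?h' ?F" .
 have "?N h * ?N ?h' * kexp be ?G h ?h' ?F <= kexp be ?L h ?h' ?F"
 proof (rule kexp_screen[OF b fL sub(1,2) tF])
  fix M M' :: "site set" and C
  show "?F M M' C = ?F (M Int ?H) (M' Int ?H) (C Int eds ?H)"
   by (subst Kc_local) (simp add: Int_Un_distrib2)
 qed simp
 moreover have g0: "0 <= dd be ?G h v" unfolding dd_eq_kp[OF b fG v2(1)] by (rule kp_ge0[OF b fG])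
 moreover have "(3/4) * (3/4) * dd be ?G h v <= ?N h * ?N ?h' * kexp be ?G h ?h' ?F"
  by (intro mult_mono N1 N2 1) (use N1 N2 g0 in auto)
 ultimately have 2: "(3/4) * (3/4) * dd be ?G h v <= kexp be ?L h ?h' ?F" by linarith
 have "(9/16) * dd be ?G h v * (3/4) <= kexp be ?L h ?h' ?F * kp be ?L h ?h' (Tub f t)"
  by (intro mult_mono T) (use 2 g0 in auto)
 also have "... <= kexp be ?L h ?h' (%M M' C. ?F M M' C * ?T M M' C)"
  unfolding kp_def by (rule kexp_fkg[OF b fL tF tdecr_Kc[OF upred_Tub]]) auto
 also have "... <= kp be ?L h ?h' (%K. v : K)"
  unfolding kp_def
  by (rule kexp_mono[OF b fL]) (use Tub_connect[OF f _ _ v sub(3)] in auto)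
 also have "... = dd be ?L h v" by (rule dd_eq_kp[OF b fL v2(2), symmetric])
 finally show ?thesis using g0 by simp
qed

lemma sum_UN_le:
 fixes g :: "'a => real"
 assumes "finite I" and "!!i. i : I ==> finite (A i)" and "!!x. 0 <= g x"
 shows "sum g (\<Union>i\<in>I. A i) <= (SUM i:I. sum g (A i))"
 using assms(1,2)
proof (induction I)
 case (insert i I)
 have "sum g (\<Union>j\<in>insert i I. A j) = sum g (A i Un (\<Union>j\<in>I. A j))" by simp
 also have "... <= sum g (A i) + sum g (\<Union>j\<in>I. A j)"
  using insert sum.union_inter[of "A i" "\<Union>j\<in>I. A j" g] sum_nonneg[of "A i Int (\<Union>j\<in>I. A j)" g] assms(3) by simp
 finally show ?case using insert by simp
qed simp

definition wtile :: "real => site => site => (site => real) => real" where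
 "wtile be f t h = (SUM v:Dk f 0 t. dd be (Dk f 2 t) h v)"

text \<open>At distance 4 the blocks \<open>Dk f 2 t'\<close> stay inside \<open>Dk f 6 t\<close>
  and miss the tile \<open>t\<close>, so a shift of the field on \<open>t\<close> leaves
  \<open>wtile\<close> unchanged on the whole ring.\<close>

definition ring :: "site => site set" where
 "ring t = {t'. max \<bar>fst t' - fst t\<bar> \<bar>snd t' - snd t\<bar> = 4}"

lemma finite_ring: "finite (ring t)" and card_ring: "card (ring t) <= 81"
proof -
 have s: "ring t \<subseteq> {fst t - 4..fst t + 4} \<times> {snd t - 4..snd t + 4}"
 proof
  fix x assume "x : ring t"
  hence "\<bar>fst x - fst t\<bar> <= 4" "\<bar>snd x - snd t\<bar> <= 4" unfolding ring_def by auto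
  thus "x : {fst t - 4..fst t + 4} \<times> {snd t - 4..snd t + 4}" by (simp add: mem_Times_iff abs_le_iff)
 qed
 thus "finite (ring t)" by (rule finite_subset) simp
 have "card (ring t) <= card ({fst t - 4..fst t + 4} \<times> {snd t - 4..snd t + 4})" by (rule card_mono[OF _ s]) simp
 thus "card (ring t) <= 81" by (simp add: card_cartesian_product)
qed

text \<open>Nested blocks between \<open>Dk f 3 t\<close> and \<open>Dk f 4 t\<close>, spaced so
  that no edge enters two of them.\<close>

definition Ush :: "site => site => int => site set" where
 "Ush f t r = {v. (fst t - 3) * qq f - r * mx f <= Xc f v & Xc f v < (fst t + 4) * qq f + r * mx f &
          (snd t - 3) * qq f - r * mx f <= Yc f v & Yc f v < (snd t + 4) * qq f + r * mx f}"

text \<open>The energy inequality is summed over \<open>R\<close> nested cuts. An oriented edge is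
  counted by at most one of them and a site has at most 4 edges, so the total is at most 4 times the
  size of the cluster in the surrounding ring of tiles; the factor 2 of \<open>energy\<close> makes
  this 8.\<close>

lemma energy_tile:
 assumes f: "f ~= (0, 0)" and b: "be > 0" and s: "s >= 0" and R: "(int R + 1) * mx f <= qq f"
 shows "real R * integral {0..s} (%u. SUM v:Dk f 0 t. dd be (Dk f 6 t) (%x. h x + u * of_bool (x : Dk f 0 t)) v)
   <= 8 * (SUM t':ring t. wtile be f t' h)"
proof -
 let ?L = "Dk f 6 t" and ?D = "Dk f 0 t" and ?q = "qq f" and ?m = "mx f"
 let ?h1 = "%x. h x + s * of_bool (x : ?D)" and ?h2 = "%x. - h x"
 let ?I = "integral {0..s} (%u. SUM v:?D. dd be ?L (%x. h x + u * of_bool (x : ?D)) v)"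
 let ?RR = "{v. v : Dk f 4 t & v ~: Dk f 3 t}"
 have q: "?q > 0" by (rule qq_pos[OF f])
 have m0: "?m >= 0" by (simp add: mx_def)
 have fL: "finite ?L" using finite_Dk[OF f] by auto
 have rm: "0 <= int r * ?m" "int r * ?m + ?m <= ?q" if "r : {1..R}" for r
 proof -
  have "(int r + 1) * ?m <= (int R + 1) * ?m" using that m0 by (intro mult_right_mono) auto
  thus "int r * ?m + ?m <= ?q" using R by (simp add: algebra_simps)
 qed (use m0 in simp)
 have UL: "Ush f t (int r) \<subseteq> Dk f 4 t" if "r : {1..R}" for r
  using rm[OF that] m0 unfolding Ush_def Dk_def by (auto simp: algebra_simps)
 have DU: "Dk f 3 t \<subseteq> Ush f t (int r)" if "r : {1..R}" for r
  using rm[OF that] unfolding Ush_def Dk_def by (auto simp: algebra_simps)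
 have near: "y : Dk f (k + 1) t" if "x : Dk f k t" "adj x y" for x y k
 proof -
  have "\<bar>Xc f x - Xc f y\<bar> <= ?q" "\<bar>Yc f x - Yc f y\<bar> <= ?q"
   using step_XY[OF that(2), of f] mx_le_qq[of f] by auto
  thus ?thesis using that(1) unfolding Dk_def by (auto simp: algebra_simps)
 qed
 have D0: "?D \<subseteq> Dk f 3 t" "Dk f 4 t \<subseteq> ?L" "Dk f 5 t \<subseteq> ?L" by (intro Dk_mono; simp)+
 let ?S = "%K r. {(x, y). x : K Int ?RR & adj x y & y : Ush f t (int r) & x ~: Ush f t (int r)}"
 have e1: "?I <= 2 * kexp be ?L ?h1 ?h2 (%M M' C. real (card (cutE ?L (Ush f t (int r)) {} 0 (M Un M') C)))" if r: "r : {1..R}" for r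
 proof (rule energy[OF b fL _ _ s])
  show "?D \<subseteq> Ush f t (int r)" using D0 DU[OF r] by blast
  show "Ush f t (int r) \<subseteq> ?L" using UL[OF r] D0 by blast
  fix x y assume "x : Ush f t (int r) Un {}" "adj x y"
  hence "y : Dk f (4 + 1) t" using UL[OF r] near by blast
  thus "y : ?L" using D0 by auto
 qed
 have cut: "real (card (cutE ?L (Ush f t (int r)) {} 0 Ob C)) <= real (card (?S (Kc ?L Ob C) r))" if r: "r : {1..R}" for r Ob C
 proof -
  have fS: "finite (?S (Kc ?L Ob C) r)"
  proof (rule finite_subset)
   show "?S (Kc ?L Ob C) r \<subseteq> ?L \<times> ?L" using Kc_subset[of ?L Ob C] UL[OF r] D0 by blast
  qed (use fL in simp)
  have "cutE ?L (Ush f t (int r)) {} 0 Ob C \<subseteq> (%(x, y). {x, y}) ` ?S (Kc ?L Ob C) r"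
  proof
   fix e assume "e : cutE ?L (Ush f t (int r)) {} 0 Ob C"
   then obtain x y n where e: "e = {x, y}" "Lv ?L (Ush f t (int r)) {} Ob C n x" "adj x y" "y : Ush f t (int r)"
    unfolding cutE_def by blast
   have x: "x : Kc ?L Ob C" "x ~: Ush f t (int r)" using Lv_Kc[OF e(2)] Lv_in[OF e(2)] by auto
   have st: "\<bar>Xc f x - Xc f y\<bar> <= ?m" "\<bar>Yc f x - Yc f y\<bar> <= ?m" by (rule step_XY[OF e(3)])+
   have "x : Dk f 4 t" using e(4) st rm[OF r] unfolding Ush_def Dk_def by (auto simp: algebra_simps)
   moreover have "x ~: Dk f 3 t" using x(2) DU[OF r] by blast
   ultimately have "(x, y) : ?S (Kc ?L Ob C) r" using x e by blast
   thus "e : (%(x, y). {x, y}) ` ?S (Kc ?L Ob C) r" using e(1) by (metis (mono_tags, lifting) case_prod_conv image_iff)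
  qed
  hence "card (cutE ?L (Ush f t (int r)) {} 0 Ob C) <= card ((%(x, y). {x, y}) ` ?S (Kc ?L Ob C) r)"
   using fS by (intro card_mono) auto
  also have "... <= card (?S (Kc ?L Ob C) r)" by (rule card_image_le[OF fS])
  finally show ?thesis by simp
 qed
 have sumS: "(SUM r:{1..R}. real (card (?S (Kc ?L Ob C) r))) <= 4 * (SUM v:?RR. of_bool (v : Kc ?L Ob C))" for Ob C
 proof -
  let ?K = "Kc ?L Ob C"
  have fK: "finite (?K Int ?RR)" using fL Kc_subset[of ?L Ob C] finite_subset by blast
  have fS: "finite (SIGMA x:?K Int ?RR. {y. adj x y})" using fK finite_nbr by blast
  have sub: "?S ?K r \<subseteq> (SIGMA x:?K Int ?RR. {y. adj x y})" for r by blast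
  have dis: "?S ?K r Int ?S ?K r' = {}" if "r : {1..R}" "r' : {1..R}" "r ~= r'" for r r'
  proof -
   have no: False if rr: "r < r'" "(x, y) : ?S ?K r" "(x, y) : ?S ?K r'" for r r' x y
   proof -
    have st: "\<bar>Xc f x - Xc f y\<bar> <= ?m" "\<bar>Yc f x - Yc f y\<bar> <= ?m" using step_XY rr by blast+
    have "(int r + 1) * ?m <= int r' * ?m" using rr(1) m0 by (intro mult_right_mono) auto
    moreover have "y : Ush f t (int r)" "x ~: Ush f t (int r')" using rr by auto
    ultimately show False using st unfolding Ush_def by (auto simp: algebra_simps)
   qed
   show ?thesis
   proof (cases "r < r'")
    case True
    thus ?thesis using no[of r r'] by auto
   next
    case False
    hence "r' < r" using that by auto
    thus ?thesis using no[of r' r] by auto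
   qed
  qed
  have "(SUM r:{1..R}. card (?S ?K r)) = card (\<Union>r\<in>{1..R}. ?S ?K r)"
   using dis finite_subset[OF sub fS] by (intro card_UN_disjoint[symmetric]) auto
  also have "... <= card (SIGMA x:?K Int ?RR. {y. adj x y})" using sub by (intro card_mono fS) blast
  also have "... = (SUM x:?K Int ?RR. card {y. adj x y})" using fK finite_nbr by (intro card_SigmaI) auto
  also have "... <= (SUM x:?K Int ?RR. 4)" by (intro sum_mono card_nbr_le)
  finally have "(SUM r:{1..R}. card (?S ?K r)) <= 4 * card (?K Int ?RR)" by simp
  moreover have "real (card (?K Int ?RR)) = (SUM v:?RR. of_bool (v : ?K))"
  proof -
   have fR: "finite ?RR" using finite_Dk[OF f] by simp
   have "real (card (?K Int ?RR)) = (SUM v:?RR. of_bool (v : ?K Int ?RR))" by (rule card_eq_sum[OF fR]) blast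
   also have "... = (SUM v:?RR. of_bool (v : ?K))" by (rule sum.cong) auto
   finally show ?thesis .
  qed
  ultimately show ?thesis by (simp flip: of_nat_sum add: of_nat_le_iff)
 qed
 have "real R * ?I = (SUM r:{1..R}. ?I)" by simp
 also have "... <= (SUM r:{1..R}. 2 * kexp be ?L ?h1 ?h2 (%M M' C. real (card (cutE ?L (Ush f t (int r)) {} 0 (M Un M') C))))"
  by (rule sum_mono) (rule e1)
 also have "... = 2 * kexp be ?L ?h1 ?h2 (%M M' C. SUM r:{1..R}. real (card (cutE ?L (Ush f t (int r)) {} 0 (M Un M') C)))"
  by (simp only: kexp_sum sum_distrib_left)
 also have "... <= 2 * kexp be ?L ?h1 ?h2 (%M M' C. 4 * (SUM v:?RR. of_bool (v : Kc ?L (M Un M') C)))"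
 proof (intro mult_left_mono kexp_mono[OF b fL])
  fix M M' C
  show "(SUM r:{1..R}. real (card (cutE ?L (Ush f t (int r)) {} 0 (M Un M') C))) <= 4 * (SUM v:?RR. of_bool (v : Kc ?L (M Un M') C))"
   by (rule order_trans[OF sum_mono sumS]) (rule cut)
 qed simp
 also have "... = 8 * (SUM v:?RR. kp be ?L ?h1 ?h2 (%K. v : K))"
  unfolding kexp_cmult kexp_sum kp_def by simp
 also have "(SUM v:?RR. kp be ?L ?h1 ?h2 (%K. v : K)) <= (SUM v:(\<Union>t'\<in>ring t. Dk f 0 t'). kp be ?L ?h1 ?h2 (%K. v : K))"
 proof (rule sum_mono2)
  show "finite (\<Union>t'\<in>ring t. Dk f 0 t')" using finite_ring finite_Dk[OF f] by simp
  show "?RR \<subseteq> (\<Union>t'\<in>ring t. Dk f 0 t')"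
  proof
   fix v assume v: "v : ?RR"
   define i j where "i = Xc f v div ?q" and "j = Yc f v div ?q"
   have le: "a <= x div ?q \<longleftrightarrow> a * ?q <= x" for a x
   proof
    assume "a <= x div ?q"
    hence "a * ?q <= (x div ?q) * ?q" using q by (intro mult_right_mono) auto
    also have "... <= x" using pos_mod_sign[OF q, of x] div_mult_mod_eq[of x ?q] by linarith
    finally show "a * ?q <= x" .
   next
    assume "a * ?q <= x"
    from zdiv_mono1[OF this q] show "a <= x div ?q" using q by simp
   qed
   have bnd: "a <= i \<longleftrightarrow> a * ?q <= Xc f v" "i < a \<longleftrightarrow> Xc f v < a * ?q" "a <= j \<longleftrightarrow> a * ?q <= Yc f v" "j < a \<longleftrightarrow> Yc f v < a * ?q" for a
    unfolding i_def j_def not_le[symmetric] by (simp_all only: le)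
   have ij: "i * ?q <= Xc f v" "Xc f v < (i + 1) * ?q" "j * ?q <= Yc f v" "Yc f v < (j + 1) * ?q"
    unfolding bnd[symmetric] by simp_all
   have "v : Dk f 0 (i, j)" using ij unfolding Dk_def by simp
   moreover have "(i, j) : ring t"
   proof -
    have "fst t - 4 <= i" "i < fst t + 5" "snd t - 4 <= j" "j < snd t + 5"
     using v unfolding Dk_def bnd by (auto simp: algebra_simps)
    moreover have "~ (fst t - 3 <= i & i < fst t + 4 & snd t - 3 <= j & j < snd t + 4)"
     using v unfolding Dk_def bnd by (auto simp: algebra_simps)
    ultimately show ?thesis unfolding ring_def by (auto simp: max_def abs_if)
   qed
   ultimately show "v : (\<Union>t'\<in>ring t. Dk f 0 t')" by blast
  qed
 qed (rule kp_ge0[OF b fL])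
 also have "... <= (SUM t':ring t. SUM v:Dk f 0 t'. kp be ?L ?h1 ?h2 (%K. v : K))"
  using finite_ring finite_Dk[OF f] by (intro sum_UN_le kp_ge0[OF b fL])
 also have "... <= (SUM t':ring t. wtile be f t' h)"
  unfolding wtile_def
 proof (intro sum_mono)
  fix t' v assume t': "t' : ring t" and v: "v : Dk f 0 t'"
  have i: "\<bar>fst t' - fst t\<bar> <= 4" "\<bar>snd t' - snd t\<bar> <= 4" "\<bar>fst t' - fst t\<bar> = 4 \<or> \<bar>snd t' - snd t\<bar> = 4"
   using t' unfolding ring_def by (auto simp: max_def split: if_splits)
  have sub: "Dk f 2 t' \<subseteq> ?L"
  proof -
   have "(fst t - 6) * ?q <= (fst t' - 2) * ?q" "(fst t' + 2 + 1) * ?q <= (fst t + 6 + 1) * ?q"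
    "(snd t - 6) * ?q <= (snd t' - 2) * ?q" "(snd t' + 2 + 1) * ?q <= (snd t + 6 + 1) * ?q"
    by (intro mult_right_mono; use i q in linarith)+
   thus ?thesis unfolding Dk_def by auto
  qed
  have dis: "x ~: ?D" if "x : Dk f 2 t'" for x
  proof
   assume "x : ?D"
   hence "(fst t' - 2) * ?q < (fst t + 1) * ?q" "fst t * ?q < (fst t' + 3) * ?q"
    "(snd t' - 2) * ?q < (snd t + 1) * ?q" "snd t * ?q < (snd t' + 3) * ?q"
    using that unfolding Dk_def by (auto simp: algebra_simps)
   hence "fst t' - 2 < fst t + 1" "fst t < fst t' + 3" "snd t' - 2 < snd t + 1" "snd t < snd t' + 3"
    using q by (simp_all add: mult_less_cancel_right)
   thus False using i by linarith
  qed
  have v2: "v : Dk f 2 t'" using v Dk_mono[of 0 2 f t'] by auto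
  have up: "upred (%K. v : K)" unfolding upred_def by blast
  have "kp be ?L ?h1 ?h2 (%K. v : K) = kp be ?L ?h1 ?h2 (%K. v : K Int Dk f 2 t')" using v2 by simp
  also have "... <= kp be (Dk f 2 t') ?h1 ?h2 (%K. v : K)" by (rule kp_domain[OF b fL sub up])
  also have "... = kp be (Dk f 2 t') h ?h2 (%K. v : K)" by (rule kp_field_cong) (use dis in auto)
  also have "... = dd be (Dk f 2 t') h v" by (rule dd_eq_kp[OF b finite_Dk[OF f] v2, symmetric])
  finally show "kp be ?L ?h1 ?h2 (%K. v : K) <= dd be (Dk f 2 t') h v" .
 qed
 finally show ?thesis by simp
qed

context iid_space
begin

text \<open>By exchangeability of distant tiles, the maximum over a large array is unlikely to be attained near its frame.\<close>
lemma exchange_max: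
 fixes W :: "('j => real) => real" and ph :: "'k => 'j => 'i"
 assumes fin: "finite I" and k0: "k0 : I" and W: "W : borel_measurable (iid N)" "dep K W"
  and inj: "!!k. k : I ==> inj (ph k)" and dis: "!!k l. k : I ==> l : I ==> k ~= l ==> ph k ` K Int ph l ` K = {}"
 shows "real (card I) * (\<integral>et. of_bool (ALL l:I - {k0}. W (%n. et (ph l n)) < W (%n. et (ph k0 n))) \<partial>iid N) <= 1"
proof -
 interpret I: prob_space "iid N :: ('i => real) measure" by (rule prob_iid)
 define w where "w k et = W (%n. et (ph k n))" for k and et :: "'i => real"
 define P where "P k et \<longleftrightarrow> (ALL l:I - {k}. w l et < w k et)" for k et
 have wm [measurable]: "w k : borel_measurable (iid N)" for k
  unfolding w_def by (rule measurable_compose[OF reindex_measurable W(1)])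
 have fI: "finite (I - {k})" for k using fin by simp
 have Pm: "(%et. of_bool (P k et) :: real) : borel_measurable (iid N)" for k
  unfolding P_def using fI[of k] by measurable
 have Pi: "integrable (iid N) (%et. of_bool (P k et) :: real)" for k
  by (rule integrable_bounded[OF Pm, of _ 1]) simp
 have sw: "(\<integral>et. of_bool (P k et) \<partial>iid N) = (\<integral>et. of_bool (P k0 et) \<partial>iid N :: real)" if k: "k : I" for k
 proof (cases "k = k0")
  case False
  \<comment> \<open>Exchanges the coordinates used by the copies \<open>k0\<close> and
    \<open>k\<close> and fixes the others; \<open>W\<close> sees only \<open>K\<close>, so the
    remaining copies do not notice.\<close>
  define \<pi> where "\<pi> x = (if x : ph k0 ` K then ph k (inv (ph k0) x) else if x : ph k ` K then ph k0 (inv (ph k) x) else x)" for x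
  have ik: "inv (ph k) (ph k n) = n" "inv (ph k0) (ph k0 n) = n" for n using inj k k0 by simp_all
  have d: "ph k0 ` K Int ph k ` K = {}" using dis k k0 False by blast
  have p0: "\<pi> (ph k0 n) = ph k n" if "n : K" for n using that by (simp add: \<pi>_def ik)
  have pk: "\<pi> (ph k n) = ph k0 n" if "n : K" for n
  proof -
   have "ph k n ~: ph k0 ` K" using that d by blast
   thus ?thesis using that by (simp add: \<pi>_def ik)
  qed
  have pe: "\<pi> x = x" if "x ~: ph k0 ` K" "x ~: ph k ` K" for x using that by (simp add: \<pi>_def)
  have "\<pi> (\<pi> x) = x" for x
  proof -
   consider n where "n : K" "x = ph k0 n" | n where "n : K" "x = ph k n" | "x ~: ph k0 ` K" "x ~: ph k ` K" by blast
   thus ?thesis by cases (simp_all add: p0 pk pe)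
  qed
  hence ip: "inj \<pi>" by (metis injI)
  have w0: "w k0 (%n. et (\<pi> n)) = w k et" "w k (%n. et (\<pi> n)) = w k0 et" for et
   unfolding w_def by (rule depD[OF W(2)]; simp add: p0 pk)+
  have wl: "w l (%n. et (\<pi> n)) = w l et" if "l : I" "l ~= k0" "l ~= k" for l et
   unfolding w_def
  proof (rule depD[OF W(2)])
   fix n assume "n : K"
   hence "ph l n ~: ph k0 ` K" "ph l n ~: ph k ` K" using dis[of l k0] dis[of l k] that k k0 by blast+
   thus "et (\<pi> (ph l n)) = et (ph l n)" by (simp add: pe)
  qed
  have "P k0 (%n. et (\<pi> n)) \<longleftrightarrow> P k et" for et
  proof
   assume a: "P k0 (%n. et (\<pi> n))"
   show "P k et" unfolding P_def
   proof
    fix l assume l: "l : I - {k}"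
    show "w l et < w k et"
     using a l k k0 False wl[of l et] unfolding P_def by (cases "l = k0") (auto simp: w0 dest: bspec[of _ _ k] bspec[of _ _ l])
   qed
  next
   assume a: "P k et"
   show "P k0 (%n. et (\<pi> n))" unfolding P_def
   proof
    fix l assume l: "l : I - {k0}"
    show "w l (%n. et (\<pi> n)) < w k0 (%n. et (\<pi> n))"
     using a l k k0 False wl[of l et] unfolding P_def by (cases "l = k") (auto simp: w0 dest: bspec[of _ _ k0] bspec[of _ _ l])
   qed
  qed
  thus ?thesis using reindex[OF ip Pm[of k0]] by simp
 qed simp
 have "real (card I) * (\<integral>et. of_bool (P k0 et) \<partial>iid N) = (SUM k:I. \<integral>et. of_bool (P k et) \<partial>iid N)" by (simp add: sw)
 also have "... = (\<integral>et. (SUM k:I. of_bool (P k et)) \<partial>iid N)" by (rule Bochner_Integration.integral_sum[symmetric, OF Pi])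
 also have "... <= (\<integral>et. 1 \<partial>(iid N :: ('i => real) measure))"
 proof (rule integral_mono)
  fix et :: "'i => real"
  show "(SUM k:I. of_bool (P k et)) <= (1 :: real)"
  proof (cases "EX k:I. P k et")
   case True
   then obtain k where k: "k : I" "P k et" by blast
   have "(SUM l:I. of_bool (P l et)) = (SUM l:I. if l = k then 1 else 0 :: real)"
   proof (rule sum.cong[OF refl])
    fix l assume "l : I"
    hence "~ P l et" if "l ~= k" using k that unfolding P_def by (metis DiffI insertE empty_iff less_asym)
    thus "of_bool (P l et) = (if l = k then 1 else 0 :: real)" using k by auto
   qed
   thus ?thesis using k fin by simp
  next
   case False
   hence "(SUM k:I. of_bool (P k et)) = (SUM k:I. 0 :: real)" by (intro sum.cong) auto
   thus ?thesis by simp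
  qed
 qed (use Pi in auto)
 finally show ?thesis using I.prob_space unfolding P_def w_def by simp
qed

end

lemma le_div_iff_mult: "0 < (q::int) ==> a <= x div q \<longleftrightarrow> a * q <= x"
proof
 assume q: "0 < q" and "a <= x div q"
 hence "a * q <= (x div q) * q" by (intro mult_right_mono) auto
 also have "... <= x" using pos_mod_sign[OF q, of x] div_mult_mod_eq[of x q] by linarith
 finally show "a * q <= x" .
next
 assume q: "0 < q" and "a * q <= x"
 from zdiv_mono1[OF this(2) q] show "a <= x div q" using q by simp
qed

definition tidx :: "site => site => site" where
 "tidx f v = (Xc f v div qq f, Yc f v div qq f)"

lemma Dk_tidx:
 assumes "f ~= (0, 0)"
 shows "v : Dk f k t \<longleftrightarrow> \<bar>fst (tidx f v) - fst t\<bar> <= k & \<bar>snd (tidx f v) - snd t\<bar> <= k"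
proof -
 note le = le_div_iff_mult[OF qq_pos[OF assms]]
 have "v : Dk f k t \<longleftrightarrow> fst t - k <= fst (tidx f v) & ~ fst t + k + 1 <= fst (tidx f v) & snd t - k <= snd (tidx f v) & ~ snd t + k + 1 <= snd (tidx f v)"
  unfolding tidx_def fst_conv snd_conv le Dk_def by (simp add: not_le)
 thus ?thesis by linarith
qed

lemma tidx_lat: "f ~= (0, 0) ==> tidx f (trl (lat f t) v) = (fst (tidx f v) + fst t, snd (tidx f v) + snd t)"
 using qq_pos[of f] unfolding tidx_def XY_lat by simp

lemma Kc_free:
 assumes "finite B" "v : B"
 shows "v : Kc B {} {}"
proof (rule ccontr)
 assume v: "v ~: Kc B {} {}"
 have "(fst v + int n, snd v) : B - Kc B {} {}" for n
 proof (induction n)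
  case (Suc n)
  let ?x = "(fst v + int n, snd v)" and ?y = "(fst v + int (Suc n), snd v)"
  have a: "adj ?x ?y" by (simp add: adj_def)
  have "?y : B" using Suc Kc.base[of ?x B "{}" ?y "{}"] a by blast
  moreover have "?y ~: Kc B {} {}" using Suc Kc.step[of ?y B "{}" "{}" ?x] a by (auto simp: adj_sym)
  ultimately show ?case by simp
 qed (use v assms in simp)
 hence "range (%n. (fst v + int n, snd v)) \<subseteq> B" by blast
 hence "finite (range (%n. (fst v + int n, snd v)))" using assms(1) finite_subset by blast
 moreover have "inj (%n. (fst v + int n, snd v))" by (simp add: inj_def)
 ultimately show False using finite_imageD by blast
qed

lemma dd_pos:
 assumes "be > 0" "finite B" "v : B"
 shows "0 < dd be B h v"
 unfolding dd_eq_kp[OF assms] kp_def by (rule kexp_pos[OF assms(1,2)]) (use Kc_free[OF assms(2,3)] in auto)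

lemma wtile_pos:
 assumes f: "f ~= (0, 0)" and b: "be > 0"
 shows "0 < wtile be f t h"
 unfolding wtile_def
proof (rule sum_pos[OF finite_Dk[OF f]])
 have "tidx f (0, 0) = (0, 0)" by (simp add: tidx_def Xc_def Yc_def)
 hence "trl (lat f t) (0, 0) : Dk f 0 t" using Dk_tidx[OF f] tidx_lat[OF f, of t "(0, 0)"] by simp
 thus "Dk f 0 t ~= {}" by blast
 fix v assume "v : Dk f 0 t"
 hence "v : Dk f 2 t" using Dk_mono[of 0 2 f t] by auto
 thus "0 < dd be (Dk f 2 t) h v" by (rule dd_pos[OF b finite_Dk[OF f]])
qed

lemma dd_cong:
 assumes "!!x. x : B ==> h x = h' x"
 shows "dd be B h v = dd be B h' v"
proof -
 have "wt be g A = wt be g' A" if "A \<subseteq> B" "!!x. x : B ==> g x = g' x" for g g' A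
 proof -
  have "sum g A = sum g' A" using that by (intro sum.cong) auto
  thus ?thesis unfolding wt_def by simp
 qed
 note w = this
 have "pm be B g v = pm be B g' v" if "!!x. x : B ==> g x = g' x" for g g'
  unfolding pm_def by (rule avg_cong[OF w refl]) (use that in auto)
 from this[of h h'] this[of "%x. - h x" "%x. - h' x"] show ?thesis unfolding dd_def using assms by simp
qed

lemma wtile_cong: "(!!x. x : Dk f 2 t ==> h x = h' x) ==> wtile be f t h = wtile be f t h'"
 unfolding wtile_def by (intro sum.cong refl dd_cong)

lemma dd_autom:
 assumes "autom ph" "be > 0" "finite B" "v : B"
 shows "dd be (ph ` B) h (ph v) = dd be B (%x. h (ph x)) v"
proof -
 have inj: "inj ph" using assms(1) unfolding autom_def by (simp add: bij_def)
 have "dd be (ph ` B) h (ph v) = kp be (ph ` B) h (%x. - h x) (%K. ph v : K)" by (rule dd_eq_kp) (use assms in auto)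
 also have "... = kp be B (%x. h (ph x)) (%x. - h (ph x)) (%K. ph v : ph ` K)" by (rule autom_kp[OF assms(1)])
 also have "... = dd be B (%x. h (ph x)) v" unfolding inj_image_mem_iff[OF inj] by (rule dd_eq_kp[symmetric]) (use assms in auto)
 finally show ?thesis .
qed

lemma wtile_trl:
 assumes f: "f ~= (0, 0)" and b: "be > 0"
 shows "wtile be f t h = wtile be f (0, 0) (%x. h (trl (lat f t) x))"
proof -
 let ?ph = "trl (lat f t)"
 have inj: "inj_on ?ph A" for A using trl_autom[of "lat f t"] unfolding autom_def by (auto simp: bij_def intro: inj_on_subset)
 have D: "Dk f k t = ?ph ` Dk f k (0, 0)" for k using Dk_trl[of f t k "(0, 0)"] by simp
 have "wtile be f t h = (SUM v:Dk f 0 (0, 0). dd be (Dk f 2 t) h (?ph v))"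
  unfolding wtile_def D[of 0] by (simp add: sum.reindex[OF inj])
 also have "... = (SUM v:Dk f 0 (0, 0). dd be (Dk f 2 (0, 0)) (%x. h (?ph x)) v)"
  unfolding D[of 2] using Dk_mono[of 0 2 f "(0, 0)"] by (intro sum.cong refl dd_autom[OF trl_autom b finite_Dk[OF f]]) auto
 finally show ?thesis by (simp add: wtile_def)
qed

lemma nn_integral_truncated:
 fixes g :: "real => ennreal"
 assumes [measurable]: "g : borel_measurable borel" and "!!n::nat. (\<integral>\<^sup>+x. g x * indicator {- real n..real n} x \<partial>lborel) <= c"
 shows "(\<integral>\<^sup>+x. g x \<partial>lborel) <= c"
proof -
 have "(SUP n::nat. g x * indicator {- real n..real n} x) = g x" for x
 proof (rule antisym)
  show "(SUP n::nat. g x * indicator {- real n..real n} x) <= g x" by (rule SUP_least) (simp add: indicator_def)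
  obtain n :: nat where "\<bar>x\<bar> <= real n" using real_arch_simple by blast
  hence "g x = g x * indicator {- real n..real n} x" by (simp add: indicator_def abs_le_iff)
  hence "g x <= g x * indicator {- real n..real n} x" by simp
  also have "... <= (SUP n::nat. g x * indicator {- real n..real n} x)" by (rule SUP_upper) simp
  finally show "g x <= (SUP n::nat. g x * indicator {- real n..real n} x)" .
 qed
 hence "(\<integral>\<^sup>+x. g x \<partial>lborel) = (\<integral>\<^sup>+x. (SUP n::nat. g x * indicator {- real n..real n} x) \<partial>lborel)" by simp
 also have "... = (SUP n::nat. \<integral>\<^sup>+x. g x * indicator {- real n..real n} x \<partial>lborel)"
  by (rule nn_integral_monotone_convergence_SUP) (auto intro!: monoI le_funI mult_left_mono simp: indicator_def)
 also have "... <= c" by (rule SUP_least) (rule assms)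
 finally show ?thesis .
qed

text \<open>An independent Gaussian of strength \<open>ta\<close> is added on every tile: by absolute continuity, what has probability bounded below
 under the perturbed field has so under the original one, and the shift of a single tile is what the energy inequality integrates over.\<close>
definition hl :: "site => real => (site + site => real) => site => real" where
 "hl f ta et v = et (Inl v) + ta * et (Inr (tidx f v))"

definition gdt :: "real => site => site => (site => real) => bool" where
 "gdt be f t h \<longleftrightarrow> 3/4 <= kp be (Dk f 6 t) h (%x. - h x) (Tub f t)"

lemma ring_disjoint:
 assumes f: "f ~= (0, 0)" and "t' : ring t" "x : Dk f 2 t'"
 shows "x ~: Dk f 0 t"
 using assms(2,3) unfolding Dk_tidx[OF f] ring_def by (auto simp: max_def split: if_splits)

lemma dd_measurable:
 assumes [measurable]: "!!v. (%et. G et v) : borel_measurable L"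
 shows "(%et. dd be B (G et) v) : borel_measurable L"
 unfolding dd_def by (intro borel_measurable_diff borel_measurable_const pm_measurable borel_measurable_uminus assms)

lemma wtile_measurable:
 assumes "!!v. (%et. G et v) : borel_measurable L"
 shows "(%et. wtile be f t (G et)) : borel_measurable L"
 unfolding wtile_def by (intro borel_measurable_sum dd_measurable assms)

lemma energy_line:
 assumes f: "f ~= (0, 0)" and b: "be > 0" and tau: "ta > 0" and R: "(int R + 1) * mx f <= qq f" "R > 0"
 shows "(\<integral>\<^sup>+x. ennreal (SUM v:Dk f 0 t. dd be (Dk f 6 t) (%y. h y + ta * x * of_bool (y : Dk f 0 t)) v) \<partial>lborel)
  <= ennreal (8 / (real R * ta) * (SUM t':ring t. wtile be f t' h))"
proof -
 let ?D = "Dk f 0 t" and ?L = "Dk f 6 t"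
 define S where "S = (SUM t':ring t. wtile be f t' h)"
 define g where "g h u = (SUM v:?D. dd be ?L (%y. h y + u * of_bool (y : ?D)) v)" for h u
 have fL: "finite ?L" by (rule finite_Dk[OF f])
 have DL: "?D \<subseteq> ?L" by (rule Dk_mono) simp
 have g0: "0 <= g h u" for h u
  unfolding g_def by (intro sum_nonneg less_imp_le dd_pos[OF b fL]) (use DL in blast)
 have gm [measurable]: "g h : borel_measurable borel" for h
  unfolding g_def by (intro borel_measurable_sum dd_measurable) measurable
 have bound: "(\<integral>\<^sup>+x. ennreal (g h (ta * x)) * indicator {- real n..real n} x \<partial>lborel) <= ennreal (8 / (real R * ta) * S)" for n :: nat
 proof -
  \<comment> \<open>Starting at the shift -ta * n moves the window [-n, n] of \<open>x\<close> to an
    interval {0..s} as required by \<open>energy_tile\<close>; the ring sum is unaffected.\<close>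
  define h' where "h' y = h y - ta * real n * of_bool (y : ?D)" for y
  define s where "s = 2 * (ta * real n)"
  have s0: "0 <= s" using tau by (simp add: s_def)
  have gh: "g h (ta * x) = g h' (ta * real n + ta * x)" for x
   unfolding g_def h'_def by (simp add: algebra_simps)
  have S': "(SUM t':ring t. wtile be f t' h') = S"
   unfolding S_def h'_def using ring_disjoint[OF f] by (intro sum.cong refl wtile_cong) auto
  have E: "real R * integral {0..s} (g h') <= 8 * S"
   using energy_tile[OF f b s0 R(1), of t h'] unfolding S' g_def .
  have I: "(g h' has_integral integral {0..s} (g h')) {0..s}"
   unfolding g_def by (rule integrable_integral[OF has_integral_integrable[OF dd_integral[OF b fL DL s0]]])
  have "(\<integral>\<^sup>+x. ennreal (g h (ta * x)) * indicator {- real n..real n} x \<partial>lborel)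
   = (\<integral>\<^sup>+x. (%u. ennreal (indicator {0..s} u * g h' u)) (ta * real n + ta * x) \<partial>lborel)"
  proof (rule nn_integral_cong)
   fix x :: real
   have "indicator {0..s} (ta * real n + ta * x) = (indicator {- real n..real n} x :: real)"
   proof -
    have "0 <= ta * real n + ta * x \<longleftrightarrow> - real n <= x"
     using tau zero_le_mult_iff[of ta "real n + x"] by (simp add: distrib_left[symmetric]) linarith
    moreover have "ta * real n + ta * x <= s \<longleftrightarrow> x <= real n"
     using tau unfolding s_def by simp
    ultimately show ?thesis by (simp add: indicator_def)
   qed
   thus "ennreal (g h (ta * x)) * indicator {- real n..real n} x = (%u. ennreal (indicator {0..s} u * g h' u)) (ta * real n + ta * x)"
    by (simp add: gh indicator_def)
  qed
  also have "... = (\<integral>\<^sup>+x. ennreal (indicator {0..s} x * g h' x) \<partial>lborel) / ennreal ta"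
  proof -
   have "(\<integral>\<^sup>+x. ennreal (indicator {0..s} x * g h' x) \<partial>lborel) =
    ennreal ta * (\<integral>\<^sup>+x. (%u. ennreal (indicator {0..s} u * g h' u)) (ta * real n + ta * x) \<partial>lborel)"
    by (subst nn_integral_real_affine[where c = ta and t = "ta * real n"]) (use tau in auto)
   thus ?thesis using tau by (simp add: ennreal_mult_divide_eq mult.commute[of "ennreal ta"])
  qed
  also have "(\<integral>\<^sup>+x. ennreal (indicator {0..s} x * g h' x) \<partial>lborel) = ennreal (integral {0..s} (g h'))"
   by (rule nn_integral_has_integral_lebesgue[OF g0 I])
  also have "ennreal (integral {0..s} (g h')) / ennreal ta = ennreal (integral {0..s} (g h') / ta)"
   using tau g0 by (intro divide_ennreal integral_nonneg has_integral_integrable[OF I]) auto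
  also have "... <= ennreal (8 / (real R * ta) * S)"
  proof (rule ennreal_leI)
   have "integral {0..s} (g h') <= 8 * S / real R" using E R(2) by (simp add: pos_le_divide_eq mult.commute)
   hence "integral {0..s} (g h') / ta <= 8 * S / real R / ta" using tau by (intro divide_right_mono) auto
   thus "integral {0..s} (g h') / ta <= 8 / (real R * ta) * S" by simp
  qed
  finally show ?thesis .
 qed
 have "(\<integral>\<^sup>+x. ennreal (g h (ta * x)) \<partial>lborel) <= ennreal (8 / (real R * ta) * S)"
  by (rule nn_integral_truncated[OF _ bound]) measurable
 thus ?thesis unfolding g_def S_def .
qed

context gauss
begin

lemma hl_measurable: "(%et. hl f ta et v) : borel_measurable Gm"
 unfolding hl_def using coord_measurable by measurable

lemma gdt_measurable:
 assumes "!!v. (%et. G et v) : borel_measurable L"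
 shows "Measurable.pred L (%et. gdt be f t (G et))"
proof -
 have [measurable]: "(%et. kp be (Dk f 6 t) (G et) (%x. - G et x) (Tub f t)) : borel_measurable L"
  unfolding kp_def by (intro kexp_measurable borel_measurable_uminus assms)
 show ?thesis unfolding gdt_def by measurable
qed

lemma tile_event_measurable:
 assumes G: "!!v. (%et. G et v) : borel_measurable L"
 shows "(%et. of_bool (gdt be f t (G et) & c * (SUM t':ring t. wtile be f t' (G et)) < wtile be f t (G et)) :: real) : borel_measurable L"
proof -
 have [measurable]: "(%et. wtile be f t (G et)) : borel_measurable L" for t by (rule wtile_measurable[OF G])
 note gdt_measurable[OF G, measurable]
 show ?thesis by measurable
qed

text \<open>All randomness but the Gaussian of the tile is frozen. The ring sum is then constant,
  \<open>dd_screen\<close> bounds \<open>wtile\<close> on a good tile by 4 times the integrand of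
  \<open>energy_line\<close>, and the Gaussian density is at most 1 / ep; Markov's inequality
  concludes. Hence 32 = 4 * 8 in \<open>ka\<close>.\<close>

lemma tile_markov:
 assumes f: "f ~= (0, 0)" and b: "be > 0" and tau: "ta > 0" and R: "(int R + 1) * mx f <= qq f" "R > 0" and M: "M > 0"
  and k: "ka = 32 / (real R * ta * ep)"
 shows "(LINT et|Gm. of_bool (gdt be f t (hl f ta et) & M * ka * (SUM t':ring t. wtile be f t' (hl f ta et)) < wtile be f t (hl f ta et))) <= 1 / M"
proof -
 let ?D = "Dk f 0 t" and ?L = "Dk f 6 t"
 define F where "F h = (of_bool (gdt be f t h & M * ka * (SUM t':ring t. wtile be f t' h) < wtile be f t h) :: real)" for h
 note Fm = tile_event_measurable[of _ _ be f t "M * ka", folded F_def]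
 have Fh: "(%et. F (hl f ta et)) : borel_measurable Gm" by (rule Fm[OF hl_measurable])
 have F01: "0 <= F h" "F h <= 1" "\<bar>F h\<bar> <= 1" for h by (auto simp: F_def)
 have kp: "ka > 0" using k R tau eps by simp
 have inner: "(\<integral>x. F (hl f ta (et(Inr t := x))) \<partial>gm ep) <= 1 / M" for et
 proof -
  define h0 where "h0 = hl f ta (et(Inr t := 0))"
  define H where "H x y = h0 y + ta * x * of_bool (y : ?D)" for x y
  define g where "g x = (SUM v:?D. dd be ?L (H x) v)" for x
  define S where "S = (SUM t':ring t. wtile be f t' h0)"
  have H: "hl f ta (et(Inr t := x)) = H x" for x
  proof
   fix y
   have "y : ?D \<longleftrightarrow> tidx f y = t" unfolding Dk_tidx[OF f] by (auto simp: prod_eq_iff)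
   thus "hl f ta (et(Inr t := x)) y = H x y" by (simp add: hl_def H_def h0_def)
  qed
  have S: "(SUM t':ring t. wtile be f t' (H x)) = S" for x
   unfolding S_def H_def using ring_disjoint[OF f] by (intro sum.cong refl wtile_cong) auto
  have "(fst t + 4, snd t) : ring t" by (simp add: ring_def)
  hence S0: "S > 0" unfolding S_def using wtile_pos[OF f b] finite_ring by (intro sum_pos) auto
  have Hm: "(%x. H x v) : borel_measurable (gm ep)" for v unfolding H_def by measurable
  have FHm [measurable]: "(%x. F (H x)) : borel_measurable (gm ep)" by (rule Fm[OF Hm])
  have Fi: "integrable (gm ep) (%x. F (H x))"
   by (rule N.integrable_const_bound[of _ 1]) (use F01 in auto)
  have g0: "0 <= g x" for x
   unfolding g_def using Dk_mono[of 0 6 f t] by (intro sum_nonneg less_imp_le dd_pos[OF b finite_Dk[OF f]]) auto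
  have gm' [measurable]: "g : borel_measurable borel"
   unfolding g_def H_def by (intro borel_measurable_sum dd_measurable) measurable
  have FM: "F (H x) * (M * ka * S) <= 4 * g x" for x
  proof (cases "gdt be f t (H x) & M * ka * S < wtile be f t (H x)")
   case True
   have "wtile be f t (H x) / 4 <= g x"
    unfolding g_def wtile_def sum_divide_distrib
    by (rule sum_mono, rule dd_screen[OF f b]) (use True in \<open>auto simp: gdt_def\<close>)
   thus ?thesis using True unfolding F_def S by simp
  next
   case False
   thus ?thesis using g0[of x] unfolding F_def S by auto
  qed
  have nd: "normal_density 0 ep x <= 1 / ep" for x
  proof -
   have "ep * 1 <= ep * sqrt (2 * pi)" using eps pi_ge_two by (intro mult_left_mono) auto
   hence "ep <= sqrt (2 * pi * ep\<^sup>2)" using eps by (simp add: real_sqrt_mult mult.commute)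
   hence "1 / sqrt (2 * pi * ep\<^sup>2) <= 1 / ep" using eps by (intro divide_left_mono) auto
   moreover have "1 / sqrt (2 * pi * ep\<^sup>2) * exp (- (x - 0)\<^sup>2 / (2 * ep\<^sup>2)) <= 1 / sqrt (2 * pi * ep\<^sup>2) * 1"
    using eps by (intro mult_left_mono) auto
   ultimately show ?thesis unfolding normal_density_def by linarith
  qed
  have "ennreal ((\<integral>x. F (H x) \<partial>gm ep) * (M * ka * S)) = ennreal (\<integral>x. F (H x) * (M * ka * S) \<partial>gm ep)" by simp
  also have "... = (\<integral>\<^sup>+x. ennreal (F (H x) * (M * ka * S)) \<partial>gm ep)"
   using Fi F01 M kp S0 by (intro nn_integral_eq_integral[symmetric] integrable_mult_left) auto
  also have "... <= (\<integral>\<^sup>+x. ennreal (4 * g x) \<partial>gm ep)" by (intro nn_integral_mono ennreal_leI FM)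
  also have "... = (\<integral>\<^sup>+x. ennreal (normal_density 0 ep x) * ennreal (4 * g x) \<partial>lborel)"
   unfolding gm_def by (rule nn_integral_density) auto
  also have "... <= (\<integral>\<^sup>+x. ennreal (4 / ep) * ennreal (g x) \<partial>lborel)"
  proof (rule nn_integral_mono)
   fix x
   have "normal_density 0 ep x * (4 * g x) <= (1 / ep) * (4 * g x)" using nd g0[of x] by (intro mult_right_mono) auto
   hence "normal_density 0 ep x * (4 * g x) <= 4 / ep * g x" by simp
   hence "ennreal (normal_density 0 ep x * (4 * g x)) <= ennreal (4 / ep * g x)" by (rule ennreal_leI)
   thus "ennreal (normal_density 0 ep x) * ennreal (4 * g x) <= ennreal (4 / ep) * ennreal (g x)"
    using g0[of x] eps by (simp add: ennreal_mult'[symmetric])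
  qed
  also have "... = ennreal (4 / ep) * (\<integral>\<^sup>+x. ennreal (g x) \<partial>lborel)" by (rule nn_integral_cmult) simp
  also have "... <= ennreal (4 / ep) * ennreal (8 / (real R * ta) * S)"
   unfolding g_def H_def S_def by (intro mult_left_mono energy_line[OF f b tau R]) simp
  also have "... = ennreal (4 / ep * (8 / (real R * ta) * S))" using eps by (intro ennreal_mult'[symmetric]) simp
  also have "4 / ep * (8 / (real R * ta) * S) = 1 * (ka * S)" by (simp add: k)
  finally have "(\<integral>x. F (H x) \<partial>gm ep) * (M * ka * S) <= 1 * (ka * S)"
   using kp S0 by (subst (asm) ennreal_le_iff) auto
  hence "((\<integral>x. F (H x) \<partial>gm ep) * M) * (ka * S) <= 1 * (ka * S)" by (simp add: mult_ac)
  hence "(\<integral>x. F (H x) \<partial>gm ep) * M <= 1" by (rule mult_right_le_imp_le) (use kp S0 in simp)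
  thus ?thesis unfolding H using M by (simp add: pos_le_divide_eq)
 qed
 have "(LINT et|Gm. F (hl f ta et)) = (LINT et|Gm. (\<integral>x. F (hl f ta (et(Inr t := x))) \<partial>gm ep))"
  by (rule resample(1)[OF Fh F01(3)])
 also have "... <= (\<integral>et. 1 / M \<partial>(Gm :: (site + site => real) measure))"
 proof (rule integral_mono[OF _ _ inner])
  show "integrable Gm (%et. \<integral>x. F (hl f ta (et(Inr t := x))) \<partial>gm ep)"
  proof (rule integrable_bounded[OF resample(2)[OF Fh F01(3)]])
   fix et :: "site + site => real"
   have "0 <= (\<integral>x. F (hl f ta (et(Inr t := x))) \<partial>gm ep)" by (intro Bochner_Integration.integral_nonneg F01)
   thus "\<bar>\<integral>x. F (hl f ta (et(Inr t := x))) \<partial>gm ep\<bar> <= 1 / M" using inner[of et] by simp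
  qed
  show "integrable Gm (%et :: site + site => real. 1 / M)" by (rule integrable_bounded[of _ "\<bar>1 / M\<bar>"]) simp_all
 qed
 finally show ?thesis unfolding F_def prob_iid_one .
qed

text \<open>Tiles five apart have disjoint data, because \<open>wtile\<close> depends on field and
  tile Gaussians within tile distance two; so \<open>exchange_max\<close> applies.\<close>

lemma frame_max_unlikely:
 assumes f: "f ~= (0, 0)" and b: "be > 0" and G: "finite G" "k0 ~: G"
  and far: "!!k l. k : insert k0 G ==> l : insert k0 G ==> k ~= l ==> 5 <= \<bar>fst k - fst l\<bar> \<or> 5 <= \<bar>snd k - snd l\<bar>"
 shows "(LINT et|Gm. of_bool (ALL t:G. wtile be f t (hl f ta et) < wtile be f k0 (hl f ta et))) <= 1 / real (Suc (card G))"
proof -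
 define ph where "ph t = case_sum (%v. Inl (trl (lat f t) v)) (%s. Inr (fst s + fst t, snd s + snd t) :: site + site)" for t :: site
 let ?K = "Inl ` Dk f 2 (0, 0) Un Inr ` ({-2..2} \<times> {-2..2}) :: (site + site) set"
 define W where "W et = wtile be f (0, 0) (hl f ta et)" for et
 have Wm: "W : borel_measurable Gm" unfolding W_def by (rule wtile_measurable[OF hl_measurable])
 have Wd: "dep ?K W" unfolding dep_def
 proof (intro allI impI)
  fix et et' :: "site + site => real" assume e: "ALL i:?K. et i = et' i"
  show "W et = W et'" unfolding W_def
  proof (rule wtile_cong)
   fix x assume x: "x : Dk f 2 (0, 0)"
   hence "\<bar>fst (tidx f x)\<bar> <= 2" "\<bar>snd (tidx f x)\<bar> <= 2" unfolding Dk_tidx[OF f] by auto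
   hence "tidx f x : {-2..2} \<times> {-2..2}" by (simp add: mem_Times_iff abs_le_iff)
   hence "et (Inl x) = et' (Inl x)" "et (Inr (tidx f x)) = et' (Inr (tidx f x))" using e x by blast+
   thus "hl f ta et x = hl f ta et' x" unfolding hl_def by simp
  qed
 qed
 have W: "W (%n. et (ph t n)) = wtile be f t (hl f ta et)" for et t
 proof -
  have "hl f ta (%n. et (ph t n)) = (%x. hl f ta et (trl (lat f t) x))"
   by (simp add: hl_def ph_def tidx_lat[OF f] fun_eq_iff)
  thus ?thesis unfolding W_def wtile_trl[OF f b, of t] by simp
 qed
 have inj: "inj (ph t)" for t
 proof (rule injI)
  fix x y assume a: "ph t x = ph t y"
  show "x = y"
   by (cases x; cases y; use a in \<open>simp add: ph_def trl_def prod_eq_iff\<close>)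
 qed
 have key: "\<bar>fst k - fst l\<bar> <= 4 & \<bar>snd k - snd l\<bar> <= 4" if x: "x : ph k ` ?K" "x : ph l ` ?K" for x k l
 proof -
  have A: "(case x of Inl v => v : Dk f 2 t | Inr s => \<bar>fst s - fst t\<bar> <= 2 & \<bar>snd s - snd t\<bar> <= 2)" if "x : ph t ` ?K" for t
  proof -
   from that consider v where "v : Dk f 2 (0, 0)" "x = ph t (Inl v)" | s where "s : {-2..2} \<times> {-2..2}" "x = ph t (Inr s)" by blast
   thus ?thesis
   proof cases
    case 1
    thus ?thesis using Dk_trl[of f t 2 "(0, 0)"] by (auto simp: ph_def)
   next
    case 2
    thus ?thesis by (auto simp: ph_def mem_Times_iff)
   qed
  qed
  show ?thesis using A[OF x(1)] A[OF x(2)] by (cases x) (auto simp: Dk_tidx[OF f])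
 qed
 have "real (card (insert k0 G)) * (LINT et|Gm. of_bool (ALL l:insert k0 G - {k0}. W (%n. et (ph l n)) < W (%n. et (ph k0 n)))) <= 1"
 proof (rule exchange_max[OF _ _ Wm Wd inj])
  fix k l assume kl: "k : insert k0 G" "l : insert k0 G" "k ~= l"
  show "ph k ` ?K Int ph l ` ?K = {}"
  proof (rule ccontr)
   assume "~ ?thesis"
   then obtain x where "x : ph k ` ?K" "x : ph l ` ?K" by blast
   from key[OF this] far[OF kl] show False by linarith
  qed
 qed (use G in auto)
 moreover have "insert k0 G - {k0} = G" using G by auto
 ultimately show ?thesis using G by (simp add: W pos_le_divide_eq mult.commute)
qed

text \<open>If all tiles were good with high probability, each inner tile would weigh at most half
  of the maximum over the array, since its ring sum is at most 81 maxima. The maximum would sit in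
  the frame, which exchangeability with the tiles of \<open>G\<close> makes unlikely. The factor 162
  is 2 * 81.\<close>

lemma some_tile_bad:
 assumes f: "f ~= (0, 0)" and b: "be > 0" and tau: "ta > 0" and R: "(int R + 1) * mx f <= qq f" "R > 0"
  and big: "32 * 162 * 4104676 <= real R * ta * ep"
 shows "\<exists>t. 1 / 4104676 <= (\<integral>et. of_bool (~ gdt be f t (hl f ta et)) \<partial>Gm :: real)"
proof (rule ccontr)
 assume no: "~ ?thesis"
 \<comment> \<open>Four times the number 1013 ^ 2 of tiles in \<open>T\<close>, so the two union
   bounds over \<open>J\<close> stay below 1/2 together; the frame adds 16144 / 40001, again below
   1/2.\<close>
 define M :: real where "M = 4104676"
 define ka where "ka = 32 / (real R * ta * ep)"
 have k0: "ka > 0" using R tau eps by (simp add: ka_def)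
 have Mk: "M * ka * 81 <= 1 / 2"
 proof -
  have "0 < real R * ta * ep" using R tau eps by simp
  thus ?thesis using big unfolding M_def ka_def by (simp add: divide_simps)
 qed
 define T where "T = ({0..<1013} \<times> {0..<1013} :: site set)"
 define J where "J = ({4..<1009} \<times> {4..<1009} :: site set)"
 \<comment> \<open>Spacing 5 and offset 9 keep the tiles of \<open>G\<close> at least five apart
   from one another and from the frame.\<close>
 define G where "G = (%p. (9 + 5 * fst p, 9 + 5 * snd p)) ` ({0..<200} \<times> {0..<200} :: site set)"
 have fin: "finite T" "finite J" "finite G" unfolding T_def J_def G_def by auto
 have JT: "J \<subseteq> T" unfolding T_def J_def by auto
 have GJ: "G \<subseteq> J" unfolding G_def J_def by auto
 have cG: "card G = 40000" unfolding G_def by (subst card_image) (auto simp: inj_on_def)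
 have cJ: "card J = 1010025" unfolding J_def by simp
 have cT: "card (T - J) = 16144" using fin JT cJ by (subst card_Diff_subset) (simp_all add: T_def)
 let ?w = "%et t. wtile be f t (hl f ta et)"
 define A where "A t et = (of_bool (~ gdt be f t (hl f ta et)) :: real)" for t et
 define B where "B t et = (of_bool (gdt be f t (hl f ta et) & M * ka * (SUM t':ring t. ?w et t') < ?w et t) :: real)" for t et
 define C where "C t et = (of_bool (ALL t':G. ?w et t' < ?w et t) :: real)" for t et
 have mA: "A t : borel_measurable Gm" for t
 proof -
  note gdt_measurable[OF hl_measurable, measurable]
  show ?thesis unfolding A_def by measurable
 qed
 have mB: "B t : borel_measurable Gm" for t unfolding B_def by (rule tile_event_measurable[OF hl_measurable])
 have mC: "C t : borel_measurable Gm" for t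
 proof -
  have [measurable]: "(%et. ?w et t) : borel_measurable Gm" for t by (rule wtile_measurable[OF hl_measurable])
  show ?thesis unfolding C_def using fin(3) by measurable
 qed
 have int: "integrable Gm (A t)" "integrable Gm (B t)" "integrable Gm (C t)" for t
  by (rule integrable_bounded[OF mA, of _ 1] integrable_bounded[OF mB, of _ 1] integrable_bounded[OF mC, of _ 1]; simp add: A_def B_def C_def)+
 have pt: "1 <= (SUM t:J. A t et) + (SUM t:J. B t et) + (SUM t:T - J. C t et)" for et
 proof (rule ccontr)
  assume "~ ?thesis"
  moreover have "0 <= (SUM t:J. A t et)" "0 <= (SUM t:J. B t et)" "0 <= (SUM t:T - J. C t et)"
   unfolding A_def B_def C_def by (auto intro: sum_nonneg)
  ultimately have lt: "(SUM t:J. A t et) < 1" "(SUM t:J. B t et) < 1" "(SUM t:T - J. C t et) < 1" by linarith+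
  have z: "~ P t" if "(SUM t:I. of_bool (P t)) < (1 :: real)" "finite I" "t : I" for P and I :: "site set" and t
   using that sum_nonneg_leq_bound[of I "%t. of_bool (P t)" "SUM t:I. of_bool (P t)" t]
    member_le_sum[of t I "%t. of_bool (P t) :: real"] by (cases "P t") auto
  have a: "gdt be f t (hl f ta et)" if "t : J" for t using z[OF lt(1)[unfolded A_def] fin(2) that] by blast
  have bb: "?w et t <= M * ka * (SUM t':ring t. ?w et t')" if "t : J" for t
   using z[OF lt(2)[unfolded B_def] fin(2) that] a[OF that] by linarith
  have c: "EX t':G. ?w et t <= ?w et t'" if "t : T - J" for t
   using z[OF lt(3)[unfolded C_def] _ that] fin(1) by (auto simp: not_less)
  have "(0, 0) : T" unfolding T_def by simp
  hence Tne: "?w et ` T ~= {}" by blast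
  from Max_in[OF _ this] obtain ts where ts: "ts : T" "?w et ts = Max (?w et ` T)" using fin(1) by auto
  have mxx: "?w et t <= ?w et ts" if "t : T" for t using ts(2) that fin(1) by simp
  obtain t where t: "t : J" "?w et ts <= ?w et t"
  proof (cases "ts : J")
   case False
   thus ?thesis using c[of ts] ts(1) GJ that by blast
  qed (use that in blast)
  have rT: "ring t \<subseteq> T"
  proof
   fix x assume "x : ring t"
   hence "\<bar>fst x - fst t\<bar> <= 4" "\<bar>snd x - snd t\<bar> <= 4" unfolding ring_def by auto
   thus "x : T" using t(1) unfolding T_def J_def by (auto simp: mem_Times_iff)
  qed
  have "(SUM t':ring t. ?w et t') <= (SUM t':ring t. ?w et ts)" using rT mxx by (intro sum_mono) auto
  also have "... <= 81 * ?w et ts" using card_ring[of t] wtile_pos[OF f b, of ts] by (simp add: mult_right_mono less_imp_le)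
  finally have "M * ka * (SUM t':ring t. ?w et t') <= M * ka * (81 * ?w et ts)" using k0 by (intro mult_left_mono) (auto simp: M_def)
  also have "... = (M * ka * 81) * ?w et ts" by simp
  also have "... <= 1 / 2 * ?w et ts" using Mk wtile_pos[OF f b, of ts] by (intro mult_right_mono) (auto simp: less_imp_le)
  finally have "?w et t <= ?w et ts / 2" using bb[OF t(1)] by linarith
  thus False using t(2) wtile_pos[OF f b, of ts "hl f ta et"] by linarith
 qed
 have iA: "(LINT et|Gm. A t et) <= 1 / M" for t
  using no unfolding A_def M_def by (auto simp: not_le less_imp_le)
 have iB: "(LINT et|Gm. B t et) <= 1 / M" for t
  unfolding B_def by (rule tile_markov[OF f b tau R _ ka_def]) (simp add: M_def)
 have iC: "(LINT et|Gm. C t et) <= 1 / 40001" if t: "t : T - J" for t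
 proof -
  have G1: "\<exists>i j. k = (9 + 5 * i, 9 + 5 * j) & 0 <= i & i < 200 & 0 <= j & j < 200" if "k : G" for k
   using that unfolding G_def by auto
  have t': "0 <= fst t" "fst t < 1013" "0 <= snd t" "snd t < 1013" "fst t < 4 \<or> 1009 <= fst t \<or> snd t < 4 \<or> 1009 <= snd t"
   using t unfolding T_def J_def by (auto simp: mem_Times_iff)
  have fG: "5 <= \<bar>fst t - fst k\<bar> \<or> 5 <= \<bar>snd t - snd k\<bar>" if "k : G" for k
  proof -
   from G1[OF that] obtain i j where k: "k = (9 + 5 * i, 9 + 5 * j)" "0 <= i" "i < 200" "0 <= j" "j < 200" by blast
   show ?thesis using k(2-5) t' unfolding k(1) fst_conv snd_conv by linarith
  qed
  have "(LINT et|Gm. C t et) <= 1 / real (Suc (card G))"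
   unfolding C_def
  proof (rule frame_max_unlikely[OF f b fin(3)])
   show "t ~: G" using fG[of t] by auto
   fix k l assume kl: "k : insert t G" "l : insert t G" "k ~= l"
   show "5 <= \<bar>fst k - fst l\<bar> \<or> 5 <= \<bar>snd k - snd l\<bar>"
   proof (cases "k = t \<or> l = t")
    case True
    thus ?thesis using kl fG[of k] fG[of l] by (auto simp: abs_minus_commute)
   next
    case False
    hence "k : G" "l : G" using kl by auto
    then obtain i j i' j' where e: "k = (9 + 5 * i, 9 + 5 * j)" "l = (9 + 5 * i', 9 + 5 * j')" using G1 by meson
    hence "i ~= i' \<or> j ~= j'" using kl(3) by auto
    thus ?thesis unfolding e fst_conv snd_conv by linarith
   qed
  qed
  thus ?thesis by (simp add: cG)
 qed
 have "(1 :: real) = (\<integral>et. 1 \<partial>(Gm :: (site + site => real) measure))" by (simp only: prob_iid_one)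
 also have "... <= (LINT et|Gm. (SUM t:J. A t et) + (SUM t:J. B t et) + (SUM t:T - J. C t et))"
  by (intro integral_mono pt Bochner_Integration.integrable_add Bochner_Integration.integrable_sum int integrable_bounded[of _ 1]) simp_all
 also have "... = (SUM t:J. \<integral>et. A t et \<partial>Gm) + (SUM t:J. \<integral>et. B t et \<partial>Gm) + (SUM t:T - J. \<integral>et. C t et \<partial>Gm)"
  by (simp add: int Bochner_Integration.integral_sum)
 also have "... <= (SUM t:J. 1 / M) + (SUM t:J. 1 / M) + (SUM t:T - J. 1 / 40001)"
  by (intro add_mono sum_mono iA iB iC)
 also have "... < 1" by (simp add: cJ cT M_def)
 finally show False by simp
qed

end

context iid_space
begin

lemma resample_swap:
 fixes f :: "('i => real) => real"
 assumes f: "f : borel_measurable (iid N)" "!!et. \<bar>f et\<bar> <= c"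
 shows "(\<integral>et. f et \<partial>iid N) = (\<integral>x. (\<integral>et. f (et(i := x)) \<partial>iid N) \<partial>N)"
  and "integrable N (%x. \<integral>et. f (et(i := x)) \<partial>iid N)"
proof -
 interpret I: prob_space "iid N :: ('i => real) measure" by (rule prob_iid)
 interpret pair_prob_space N "iid N :: ('i => real) measure" ..
 have m: "(%(x, et). f (et(i := x))) : borel_measurable (N \<Otimes>\<^sub>M iid N)"
  using measurable_compose[OF upd_measurable f(1)] by (simp add: split_beta)
 have int: "integrable (N \<Otimes>\<^sub>M iid N) (%(x, et). f (et(i := x)))"
  by (rule P.integrable_const_bound[of _ c]) (use f m in auto)
 show "integrable N (%x. \<integral>et. f (et(i := x)) \<partial>iid N)" using integrable_fst'[OF int] by simp
 have "(\<integral>et. f et \<partial>iid N) = (\<integral>et. (\<integral>x. f (et(i := x)) \<partial>N) \<partial>iid N)" by (rule resample(1)[OF f])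
 also have "... = (\<integral>x. (\<integral>et. f (et(i := x)) \<partial>iid N) \<partial>N)" by (rule Fubini_integral[OF int])
 finally show "(\<integral>et. f et \<partial>iid N) = (\<integral>x. (\<integral>et. f (et(i := x)) \<partial>iid N) \<partial>N)" .
qed

lemma tail_small:
 assumes "de > 0"
 shows "\<exists>L\<ge>0. (\<integral>x. of_bool (\<bar>x\<bar> > L) \<partial>N) <= (de :: real)"
proof -
 let ?A = "%n::nat. {x : space N. real n < \<bar>x\<bar>}"
 have "(%n. measure N (?A n)) \<longlonglongrightarrow> measure N (\<Inter>n. ?A n)"
  by (rule N.finite_Lim_measure_decseq) (auto simp: decseq_def sets_N)
 moreover have "(\<Inter>n. ?A n) = {}" by auto (metis reals_Archimedean2 less_asym)
 ultimately have "(%n. measure N (?A n)) \<longlonglongrightarrow> 0" by simp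
 hence "eventually (%n. measure N (?A n) < de) sequentially" using assms by (rule order_tendstoD)
 then obtain n where n: "measure N (?A n) < de" by (meson eventually_sequentially order_refl)
 have "(\<integral>x. of_bool (\<bar>x\<bar> > real n) \<partial>N) = (\<integral>x. indicator (?A n) x \<partial>N)"
  by (rule Bochner_Integration.integral_cong) (auto simp: space_N)
 also have "... = measure N (?A n)" by (simp add: space_N sets_N)
 finally show ?thesis using n by (intro exI[of _ "real n"]) simp
qed

end

lemma card_Dk0:
 assumes f: "f ~= (0, 0)"
 shows "real (card (Dk f 0 t)) <= 25 * real_of_int (qq f)"
proof -
 let ?m = "mx f" and ?q = "qq f"
 define c1 c2 where "c1 = fst t * fst f - snd t * snd f" and "c2 = fst t * snd f + snd t * fst f"
 have q: "?q > 0" by (rule qq_pos[OF f])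
 have m: "?m >= 1" using f unfolding mx_def by (cases f) auto
 have "Dk f 0 t \<subseteq> {c1 - 2 * ?m..c1 + 2 * ?m} \<times> {c2 - 2 * ?m..c2 + 2 * ?m}"
 proof
  fix v assume v: "v : Dk f 0 t"
  define a b where "a = Xc f v - fst t * ?q" and "b = Yc f v - snd t * ?q"
  have ab: "0 <= a" "a < ?q" "0 <= b" "b < ?q" using v unfolding Dk_def a_def b_def by (auto simp: algebra_simps)
  have e: "?q * (fst v - c1) = a * fst f - b * snd f" "?q * (snd v - c2) = a * snd f + b * fst f"
   unfolding a_def b_def c1_def c2_def Xc_def Yc_def qq_def by (simp_all add: power2_eq_square algebra_simps)
  have fm: "\<bar>fst f\<bar> <= ?m" "\<bar>snd f\<bar> <= ?m" unfolding mx_def by auto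
  have p: "\<bar>x * y\<bar> <= ?q * ?m" if "0 <= x" "x < ?q" "\<bar>y\<bar> <= ?m" for x y
   unfolding abs_mult using that by (intro mult_mono) auto
  have "?q * \<bar>fst v - c1\<bar> <= ?q * (2 * ?m)"
  proof -
   have "?q * \<bar>fst v - c1\<bar> = \<bar>a * fst f - b * snd f\<bar>" using q e(1) by (metis abs_mult abs_of_pos)
   also have "... <= ?q * (2 * ?m)" using p[OF ab(1,2) fm(1)] p[OF ab(3,4) fm(2)] by linarith
   finally show ?thesis .
  qed
  moreover have "?q * \<bar>snd v - c2\<bar> <= ?q * (2 * ?m)"
  proof -
   have "?q * \<bar>snd v - c2\<bar> = \<bar>a * snd f + b * fst f\<bar>" using q e(2) by (metis abs_mult abs_of_pos)
   also have "... <= ?q * (2 * ?m)" using p[OF ab(1,2) fm(2)] p[OF ab(3,4) fm(1)] by linarith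
   finally show ?thesis .
  qed
  ultimately have "\<bar>fst v - c1\<bar> <= 2 * ?m" "\<bar>snd v - c2\<bar> <= 2 * ?m" using q by simp_all
  thus "v : {c1 - 2 * ?m..c1 + 2 * ?m} \<times> {c2 - 2 * ?m..c2 + 2 * ?m}" by (simp add: mem_Times_iff abs_le_iff)
 qed
 hence "card (Dk f 0 t) <= card ({c1 - 2 * ?m..c1 + 2 * ?m} \<times> {c2 - 2 * ?m..c2 + 2 * ?m})" by (intro card_mono) auto
 also have "... = nat (4 * ?m + 1) * nat (4 * ?m + 1)" by (simp add: card_cartesian_product)
 finally have "int (card (Dk f 0 t)) <= int (nat (4 * ?m + 1) * nat (4 * ?m + 1))" by (simp only: of_nat_le_iff)
 also have "... = (4 * ?m + 1) * (4 * ?m + 1)" using m by simp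
 also have "... <= (5 * ?m) * (5 * ?m)" using m by (intro mult_mono) auto
 also have "... <= 25 * ?q" using mx_sq_le_qq[of f] by (simp add: power2_eq_square)
 finally show ?thesis by (metis of_int_le_iff of_int_mult of_int_numeral of_int_of_nat_eq)
qed

text \<open>Interpolates between the original field (\<open>J\<close> empty) and \<open>hl\<close>,
  so that the tile Gaussians can be removed one at a time.\<close>

definition hJ :: "site => real => site set => (site + site => real) => site => real" where
 "hJ f ta J et v = et (Inl v) + ta * et (Inr (tidx f v)) * of_bool (tidx f v : J)"

context gauss
begin

lemma hJ_measurable: "hJ f ta J : Gm \<rightarrow>\<^sub>M Gm"
 by (rule iid_measurableI) (use coord_measurable in \<open>unfold hJ_def, measurable\<close>)

text \<open>While the tile Gaussian is at most \<open>L\<close> in modulus, its effect is a field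
  shift on one tile with variance at most \<open>V\<close>, because ta^2 times the number of sites
  is bounded. The price of absolute continuity thus depends on neither \<open>f\<close> nor
  \<open>ta\<close>.\<close>

lemma remove_tile:
 fixes de ka :: real
 assumes "de > 0" "ka >= 0"
 shows "\<exists>de'>0. \<forall>f ta J t (F :: (site => real) => real). f ~= (0, 0) --> ta\<^sup>2 * real_of_int (qq f) <= ka --> t ~: J --> F : borel_measurable Gm -->
  (\<forall>h. 0 <= F h & F h <= 1) --> de <= (LINT et|Gm. F (hJ f ta (insert t J) et)) --> de' <= (LINT et|Gm. F (hJ f ta J et))"
proof -
 obtain L where L: "L >= 0" "(\<integral>x. of_bool (\<bar>x\<bar> > L) \<partial>gm ep) <= de / 4"
  using tail_small[of "de / 4"] assms by auto
 define V where "V = 25 * ka * L\<^sup>2 / ep\<^sup>2"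
 \<comment> \<open>Makes the term exp V / T equal to a quarter of \<open>de\<close>; the Gaussian
   tail takes another quarter, leaving half.\<close>
 define T where "T = 4 * exp V / de"
 have T: "T > 0" using assms by (simp add: T_def)
 have eT: "exp V / T = de / 4" using assms by (simp add: T_def)
 have "de / (2 * T) <= (LINT et|Gm. F (hJ f ta J et))"
  if f: "f ~= (0, 0)" and tau: "ta\<^sup>2 * real_of_int (qq f) <= ka" and t: "t ~: J" and Fm: "F : borel_measurable Gm"
   and F: "!!h. 0 <= F h" "!!h. F h <= 1" and d: "de <= (LINT et|Gm. F (hJ f ta (insert t J) et))" for f ta J t and F :: "(site => real) => real"
 proof -
  have m: "(%et. F (hJ f ta J' et)) : borel_measurable Gm" for J' by (rule measurable_compose[OF hJ_measurable Fm])
  have F1: "\<bar>F h\<bar> <= 1" for h using F[of h] by simp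
  define E where "E = (LINT et|Gm. F (hJ f ta J et))"
  define I where "I = (Inl ` Dk f 0 t :: (site + site) set)"
  have fI: "finite I" unfolding I_def using finite_Dk[OF f] by simp
  have cI: "card I = card (Dk f 0 t)" unfolding I_def by (rule card_image) (simp add: inj_on_def)
  have E0: "0 <= E" unfolding E_def by (intro Bochner_Integration.integral_nonneg F)
  have step: "(LINT et|Gm. F (hJ f ta (insert t J) (et(Inr t := x)))) <= T * E + de / 4 + of_bool (\<bar>x\<bar> > L)" for x
  proof (cases "\<bar>x\<bar> <= L")
   case True
   have sh: "hJ f ta (insert t J) (et(Inr t := x)) = hJ f ta J (%i. et i + (if i : I then ta * x else 0))" for et
   proof
    fix y
    have "y : Dk f 0 t \<longleftrightarrow> tidx f y = t" unfolding Dk_tidx[OF f] by (auto simp: prod_eq_iff)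
    hence "Inl y : I \<longleftrightarrow> tidx f y = t" "Inr z ~: I" for z unfolding I_def by auto
    thus "hJ f ta (insert t J) (et(Inr t := x)) y = hJ f ta J (%i. et i + (if i : I then ta * x else 0)) y"
     using t unfolding hJ_def by auto
   qed
   have "var I (%_. ta * x) = real (card (Dk f 0 t)) * (ta * x)\<^sup>2 / ep\<^sup>2" unfolding var_def by (simp add: cI)
   also have "... <= V"
   proof -
    have "real (card (Dk f 0 t)) * (ta * x)\<^sup>2 <= (25 * real_of_int (qq f)) * (ta * x)\<^sup>2" by (intro mult_right_mono card_Dk0[OF f]) simp
    also have "... = 25 * (ta\<^sup>2 * real_of_int (qq f)) * x\<^sup>2" by (simp add: power_mult_distrib)
    also have "... <= 25 * ka * L\<^sup>2"
     using tau True assms qq_pos[OF f] by (intro mult_mono) (auto simp: power2_le_iff_abs_le L(1) intro: mult_nonneg_nonneg)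
    finally show ?thesis unfolding V_def by (rule divide_right_mono) simp
   qed
   finally have v: "exp (var I (%_. ta * x)) / T <= de / 4" unfolding eT[symmetric] using T by (intro divide_right_mono) auto
   have "(LINT et|Gm. F (hJ f ta J (%i. et i + (if i : I then ta * x else 0)))) <= T * E + exp (var I (%_. ta * x)) / T"
    unfolding E_def by (rule shift_abs_cont[OF fI m F T])
   hence "(LINT et|Gm. F (hJ f ta J (%i. et i + (if i : I then ta * x else 0)))) <= T * E + de / 4"
    using v by linarith
   thus ?thesis unfolding sh using True by simp
  next
   case False
   have "(LINT et|Gm. F (hJ f ta (insert t J) (et(Inr t := x)))) <= (\<integral>et. 1 \<partial>(Gm :: (site + site => real) measure))"
    by (rule integral_mono') (use F in \<open>auto intro: integrable_bounded[of _ 1]\<close>)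
   hence "(LINT et|Gm. F (hJ f ta (insert t J) (et(Inr t := x)))) <= 1" by (simp only: prob_iid_one)
   thus ?thesis using False E0 T assms(1) by (simp add: add_increasing)
  qed
  have io: "integrable (gm ep) (%x. of_bool (\<bar>x\<bar> > L) :: real)"
   by (rule N.integrable_const_bound[of _ 1]) auto
  have "de <= (\<integral>x. (LINT et|Gm. F (hJ f ta (insert t J) (et(Inr t := x)))) \<partial>gm ep)"
   using d resample_swap(1)[OF m[of "insert t J"] F1, where i = "Inr t"] by simp
  also have "... <= (\<integral>x. (T * E + de / 4) + of_bool (\<bar>x\<bar> > L) \<partial>gm ep)"
   by (rule integral_mono[OF resample_swap(2)[OF m F1]]) (use io step in auto)
  also have "... = (T * E + de / 4) + (\<integral>x. of_bool (\<bar>x\<bar> > L) \<partial>gm ep)"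
   using io N.prob_space by simp
  finally have "de / 2 <= T * E" using L(2) by linarith
  thus ?thesis unfolding E_def[symmetric] using T by (simp add: field_simps)
 qed
 thus ?thesis using T assms(1) by (intro exI[of _ "de / (2 * T)"]) simp
qed

lemma remove_tiles:
 fixes de ka :: real
 assumes "ka >= 0" "de > 0"
 shows "\<exists>de'>0. \<forall>f ta J (F :: (site => real) => real). f ~= (0, 0) --> ta\<^sup>2 * real_of_int (qq f) <= ka --> finite J --> card J = n --> F : borel_measurable Gm -->
  (\<forall>h. 0 <= F h & F h <= 1) --> de <= (LINT et|Gm. F (hJ f ta J et)) --> de' <= (LINT h|Gm. F h)"
 using assms(2)
proof (induction n arbitrary: de)
 case 0
 have "(LINT et|Gm. F (hJ f ta {} et)) = (LINT h|Gm. F h)" if "F : borel_measurable Gm" for F :: "(site => real) => real" and f ta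
  using reindex[of "Inl :: site => site + site" F] that unfolding hJ_def by simp
 thus ?case using 0 by (intro exI[of _ de]) (auto simp: card_eq_0_iff)
next
 case (Suc n)
 from remove_tile[OF Suc.prems assms(1)] obtain de1 where d1: "de1 > 0" "!!f ta J t (F :: (site => real) => real). f ~= (0, 0) ==> ta\<^sup>2 * real_of_int (qq f) <= ka ==> t ~: J ==>
  F : borel_measurable Gm ==> (\<forall>h. 0 <= F h & F h <= 1) ==> de <= (LINT et|Gm. F (hJ f ta (insert t J) et)) ==> de1 <= (LINT et|Gm. F (hJ f ta J et))"
  by meson
 from Suc.IH[OF d1(1)] obtain de2 where d2: "de2 > 0" "!!f ta J (F :: (site => real) => real). f ~= (0, 0) ==> ta\<^sup>2 * real_of_int (qq f) <= ka ==> finite J ==> card J = n ==>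
  F : borel_measurable Gm ==> (\<forall>h. 0 <= F h & F h <= 1) ==> de1 <= (LINT et|Gm. F (hJ f ta J et)) ==> de2 <= (LINT h|Gm. F h)"
  by meson
 have "de2 <= (LINT h|Gm. F h)" if a: "f ~= (0, 0)" "ta\<^sup>2 * real_of_int (qq f) <= ka" "finite J" "card J = Suc n"
  "F : borel_measurable Gm" "\<forall>h. 0 <= F h & F h <= 1" "de <= (LINT et|Gm. F (hJ f ta J et))" for f ta J and F :: "(site => real) => real"
 proof -
  from card_eq_SucD[OF a(4)] obtain t J' where J: "J = insert t J'" "t ~: J'" "card J' = n" by blast
  show ?thesis
   by (rule d2(2)[OF a(1,2) _ J(3) a(5,6) d1(2)[OF a(1,2) J(2) a(5,6)]]) (use a J in auto)
 qed
 thus ?case using d2(1) by blast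
qed

text \<open>With \<open>ta\<close> of order 1 / sqrt (qq f), both requirements hold uniformly in the
  scale: R * ta is large enough for \<open>some_tile_bad\<close> and ta^2 * qq f is bounded for
  \<open>remove_tiles\<close>. Only the 13 * 13 = 169 tiles of \<open>Dk f 6 t\<close>
  matter.\<close>

lemma bad_tile_bound:
 "\<exists>de>0. \<forall>be f. be > 0 --> 16 <= qq f --> (\<exists>t. de <= (\<integral>h. of_bool (~ gdt be f t h) \<partial>Gm :: real))"
proof -
 define ka where "ka = 4 * (32 * 162 * 4104676) / ep"
 have k: "ka > 0" using eps by (simp add: ka_def)
 have "0 <= ka\<^sup>2" "0 < (1 / 4104676 :: real)" by auto
 from remove_tiles[OF this, of 169] obtain de where d: "de > 0" "!!f ta J (F :: (site => real) => real). f ~= (0, 0) ==> ta\<^sup>2 * real_of_int (qq f) <= ka\<^sup>2 ==> finite J ==> card J = 169 ==>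
  F : borel_measurable Gm ==> (\<forall>h. 0 <= F h & F h <= 1) ==> 1 / 4104676 <= (LINT et|Gm. F (hJ f ta J et)) ==> de <= (LINT h|Gm. F h)"
  by meson
 have "\<exists>t. de <= (\<integral>h. of_bool (~ gdt be f t h) \<partial>Gm :: real)" if b: "be > 0" and q: "16 <= qq f" for be f
 proof -
  let ?q = "real_of_int (qq f)" and ?m = "mx f"
  have f: "f ~= (0, 0)" using q by (auto simp: qq_def)
  define R where "R = nat (?m - 1)"
  define ta where "ta = ka / sqrt ?q"
  have q2: "qq f <= 2 * ?m\<^sup>2"
  proof -
   have "(fst f)\<^sup>2 <= ?m\<^sup>2" "(snd f)\<^sup>2 <= ?m\<^sup>2" unfolding mx_def by (auto intro!: abs_le_square_iff[THEN iffD1])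
   thus ?thesis unfolding qq_def by linarith
  qed
  have m: "?m >= 3"
  proof (rule ccontr)
   assume "~ ?m >= 3"
   moreover have "0 <= ?m" unfolding mx_def by simp
   ultimately have "?m\<^sup>2 <= 2\<^sup>2" by (intro power_mono) auto
   thus False using q q2 by simp
  qed
  have R: "int R + 1 = ?m" "R > 0" using m unfolding R_def by auto
  have Rq: "(int R + 1) * ?m <= qq f" unfolding R(1) using mx_sq_le_qq[of f] by (simp add: power2_eq_square)
  have R4: "sqrt ?q <= 4 * real R"
  proof -
   have "?m <= 2 * int R" using R(1) m by linarith
   hence "?m\<^sup>2 <= (2 * int R)\<^sup>2" using m by (intro power_mono) auto
   hence "?m\<^sup>2 <= 4 * (int R)\<^sup>2" by (simp add: power_mult_distrib)
   hence "qq f <= 16 * (int R)\<^sup>2" using q2 zero_le_power2[of "int R"] by linarith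
   hence "qq f <= (4 * int R)\<^sup>2" by (simp add: power_mult_distrib)
   hence "real_of_int (qq f) <= real_of_int ((4 * int R)\<^sup>2)" by (simp only: of_int_le_iff)
   hence "?q <= (4 * real R)\<^sup>2" by simp
   thus ?thesis by (intro real_le_lsqrt) auto
  qed
  have s: "sqrt ?q > 0" "?q > 0" using q by auto
  have tau: "ta > 0" using k s by (simp add: ta_def)
  have big: "32 * 162 * 4104676 <= real R * ta * ep"
  proof -
   have "ka * ep / 4 * 1 <= ka * ep / 4 * (4 * real R / sqrt ?q)"
    using k eps R4 s by (intro mult_left_mono) (auto simp: pos_le_divide_eq)
   thus ?thesis using eps unfolding ta_def by (simp add: ka_def mult.commute)
  qed
  from some_tile_bad[OF f b tau Rq R(2) big] obtain t where t: "1 / 4104676 <= (\<integral>et. of_bool (~ gdt be f t (hl f ta et)) \<partial>Gm :: real)" by blast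
  define J where "J = {fst t - 6..fst t + 6} \<times> {snd t - 6..snd t + 6}"
  have g: "gdt be f t (hl f ta et) \<longleftrightarrow> gdt be f t (hJ f ta J et)" for et
  proof -
   have e: "hl f ta et v = hJ f ta J et v" if "v : Dk f 6 t" for v
   proof -
    have "tidx f v : J" using that unfolding Dk_tidx[OF f] J_def by (simp add: mem_Times_iff abs_le_iff)
    thus ?thesis by (simp add: hl_def hJ_def)
   qed
   have "kp be (Dk f 6 t) (hl f ta et) (%x. - hl f ta et x) (Tub f t) = kp be (Dk f 6 t) (hJ f ta J et) (%x. - hJ f ta J et x) (Tub f t)"
    by (rule kp_field_cong) (simp_all add: e)
   thus ?thesis unfolding gdt_def by simp
  qed
  have "de <= (LINT h|Gm. (%h. of_bool (~ gdt be f t h) :: real) h)"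
  proof (rule d(2)[OF f, of ta J])
   show "ta\<^sup>2 * ?q <= ka\<^sup>2" using s unfolding ta_def by (simp add: power_divide)
   show "finite J" "card J = 169" unfolding J_def by (simp_all add: card_cartesian_product)
   show "(%h. of_bool (~ gdt be f t h) :: real) : borel_measurable Gm" unfolding gdt_def by measurable
   show "1 / 4104676 <= (LINT et|Gm. (%h. of_bool (~ gdt be f t h) :: real) (hJ f ta J et))" using t unfolding g .
  qed simp
  thus ?thesis by blast
 qed
 thus ?thesis using d(1) by blast
qed

end

text \<open>A normalised tube one tile wide. The crossing is longer than the seven tiles asked for
  in \<open>Tub\<close>, and the path is trimmed so that it lies in the block, whichever of the
  eight tubes it is mapped to.\<close>

definition Ecr :: "site => site set => bool" where
 "Ecr f K \<longleftrightarrow> (\<exists>p n. spath p n & (\<forall>k\<le>n. p k : K & 0 < Xc f (p k) & Xc f (p k) < qq f & - 2 * qq f <= Yc f (p k) & Yc f (p k) <= 9 * qq f)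
   & Yc f (p 0) < - qq f & 8 * qq f < Yc f (p n))"

definition Gf :: "site => site set" where
 "Gf f = {v. \<bar>Xc f v\<bar> <= 20 * qq f & \<bar>Yc f v\<bar> <= 20 * qq f}"

lemma upred_Ecr: "upred (Ecr f)"
 unfolding upred_def Ecr_def by blast

lemma autom_spath: "autom ph ==> spath (%i. ph (p i)) n \<longleftrightarrow> spath p n"
 unfolding autom_def spath_def by auto

lemma finite_Gf: assumes f: "f ~= (0, 0)" shows "finite (Gf f)"
proof (rule finite_subset[OF _ finite_Dk[OF f, of 20 "(0, 0)"]])
 show "Gf f \<subseteq> Dk f 20 (0, 0)" unfolding Gf_def Dk_def using qq_pos[OF f] by auto
qed

context gauss
begin

lemma kp_not: "be > 0 ==> finite B ==> kp be B g1 g2 (%K. ~ Q K) = 1 - kp be B g1 g2 Q"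
 using kexp_diff[of be B g1 g2 "%M M' C. 1" "%M M' C. of_bool (Q (Kc B (M Un M') C))"] kexp_const[of be B g1 g2 1]
 unfolding kp_def by (simp add: of_bool_not_iff)

lemma ap_not: "be > 0 ==> finite B ==> ap be B (%K. ~ Q K) = 1 - ap be B Q"
 unfolding ap_def kp_not by (subst Bochner_Integration.integral_diff) (auto intro: kp_integrable integrable_bounded[of _ 1] simp: prob_space.prob_space[OF prob_iid])

lemma ap_Ex_le:
 assumes "be > 0" "finite B" "finite I"
 shows "ap be B (%K. EX i:I. Q i K) <= (SUM i:I. ap be B (Q i))"
proof -
 have "ap be B (%K. EX i:I. Q i K) <= (LINT h|Gm. (SUM i:I. kp be B h (%v. - h v) (Q i)))"
  unfolding ap_def by (intro integral_mono kp_integrable Bochner_Integration.integrable_sum kp_Ex_le assms)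
 also have "... = (SUM i:I. ap be B (Q i))"
  unfolding ap_def by (rule Bochner_Integration.integral_sum) (rule kp_integrable[OF assms(1,2)])
 finally show ?thesis .
qed

lemma tube_transfer:
 assumes f: "f ~= (0, 0)" and b: "be > 0" and phi: "autom ph" "ph ` D = Dk f 6 t" and D: "D \<subseteq> Gf f"
  "!!v. 0 < Xc f v ==> Xc f v < qq f ==> - 2 * qq f <= Yc f v ==> Yc f v <= 9 * qq f ==> v : D"
  and Q: "!!K. Ecr f K ==> Q (ph ` K)"
 shows "ap be (Gf f) (Ecr f) <= ap be (Dk f 6 t) Q"
proof -
 have fG: "finite (Gf f)" by (rule finite_Gf[OF f])
 have fD: "finite D" using fG D(1) finite_subset by blast
 have "ap be (Gf f) (Ecr f) <= ap be (Gf f) (%K. Ecr f (K Int D))"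
  by (rule ap_mono[OF b fG]) (unfold Ecr_def, use D(2) in blast)
 also have "... <= ap be D (Ecr f)" by (rule ap_domain[OF b fG D(1) upred_Ecr])
 also have "... <= ap be D (%K. Q (ph ` K))" by (rule ap_mono[OF b fD]) (rule Q)
 also have "... = ap be (Dk f 6 t) Q" using ap_autom[OF phi(1), of be D Q] phi(2) by simp
 finally show ?thesis .
qed

text \<open>On a bad field \<open>Tub\<close> fails with probability above 1/4, so it fails with
  annealed probability at least de / 4, and one of its eight tubes accounts for an eighth of this.
  Increasing events are less likely in larger regions, so the bound carries over to the normalised
  tube in \<open>Gf f\<close>.\<close>

theorem tube_bound:
 "\<exists>rh<1. \<forall>be f. be > 0 --> 16 <= qq f --> ap be (Gf f) (Ecr f) <= rh"
proof -
 from bad_tile_bound obtain de where d: "de > 0" "!!be f. be > 0 ==> 16 <= qq f ==> \<exists>t. de <= (\<integral>h. of_bool (~ gdt be f t h) \<partial>Gm :: real)" by blast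
 have "ap be (Gf f) (Ecr f) <= 1 - de / 32" if b: "be > 0" and q16: "16 <= qq f" for be f
 proof -
  let ?q = "qq f"
  have f: "f ~= (0, 0)" using q16 by (auto simp: qq_def)
  from d(2)[OF b q16] obtain t where t: "de <= (\<integral>h. of_bool (~ gdt be f t h) \<partial>Gm :: real)" by blast
  let ?D = "Dk f 6 t"
  have fD: "finite ?D" by (rule finite_Dk[OF f])
  define Q where "Q i K = (if fst i then vcross f K ((fst t + snd i) * ?q) ((fst t + snd i + 1) * ?q) ((snd t - 3) * ?q) ((snd t + 4) * ?q)
   else hcross f K ((snd t + snd i) * ?q) ((snd t + snd i + 1) * ?q) ((fst t - 3) * ?q) ((fst t + 4) * ?q))" for i K
  define I where "I = (UNIV :: bool set) \<times> {-2, -1, 1, 2 :: int}"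
  have fI: "finite I" "card I = 8" unfolding I_def by (simp_all add: card_cartesian_product)
  have Tub: "Tub f t K \<longleftrightarrow> (ALL i:I. Q i K)" for K
   unfolding Tub_def I_def Q_def by auto
  have "de <= (LINT h|Gm. 4 * kp be ?D h (%v. - h v) (%K. ~ Tub f t K))"
  proof (rule order_trans[OF t], rule integral_mono)
   have "(%h. of_bool (~ gdt be f t h) :: real) : borel_measurable Gm" unfolding gdt_def by measurable
   thus "integrable Gm (%h. of_bool (~ gdt be f t h) :: real)" by (rule integrable_bounded[of _ 1]) simp
   show "integrable Gm (%h. 4 * kp be ?D h (%v. - h v) (%K. ~ Tub f t K))" using kp_integrable[OF b fD] by simp
   fix h
   show "of_bool (~ gdt be f t h) <= 4 * kp be ?D h (%v. - h v) (%K. ~ Tub f t K)"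
    using kp_not[OF b fD, of h "%v. - h v" "Tub f t"] kp_le1[OF b fD, of h "%v. - h v" "Tub f t"] unfolding gdt_def by auto
  qed
  also have "... = 4 * ap be ?D (%K. EX i:I. ~ Q i K)" unfolding ap_def Tub by simp
  also have "... <= 4 * (SUM i:I. ap be ?D (%K. ~ Q i K))" using ap_Ex_le[OF b fD fI(1)] by simp
  also have "... = (SUM i:I. 4 * (1 - ap be ?D (Q i)))" by (simp add: ap_not[OF b fD] sum_distrib_left)
  finally have "de <= (SUM i:I. 4 * (1 - ap be ?D (Q i)))" .
  then obtain i where i: "i : I" "de / 8 <= 4 * (1 - ap be ?D (Q i))"
  proof (rule_tac ccontr)
   assume a: "~ thesis" and le: "de <= (SUM i:I. 4 * (1 - ap be ?D (Q i)))"
   have "(SUM i:I. 4 * (1 - ap be ?D (Q i))) < (SUM i:I. de / 8)"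
    using a that by (intro sum_strict_mono fI) (auto simp: I_def not_le[symmetric])
   thus False using le fI by simp
  qed
  obtain o' c where ic: "i = (o', c)" "c : {-2, -1, 1, 2}" using i(1) unfolding I_def by auto
  have cq: "\<bar>c * ?q\<bar> <= 2 * ?q" using ic(2) q16 by auto
  have "ap be (Gf f) (Ecr f) <= ap be ?D (Q i)"
  proof (cases o')
   case True
   let ?ph = "trl (lat f (fst t + c, snd t - 3))"
   show ?thesis
   proof (rule tube_transfer[OF f b trl_autom, where D = "Dk f 6 (-c, 3)"])
    show "?ph ` Dk f 6 (- c, 3) = ?D" unfolding Dk_trl by simp
    show "Dk f 6 (- c, 3) \<subseteq> Gf f" using cq q16 unfolding Dk_def Gf_def by (auto simp: algebra_simps)
    show "v : Dk f 6 (- c, 3)" if "0 < Xc f v" "Xc f v < ?q" "- 2 * ?q <= Yc f v" "Yc f v <= 9 * ?q" for v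
     using that cq q16 unfolding Dk_def by (auto simp: algebra_simps)
    fix K assume "Ecr f K"
    then obtain p n where p: "spath p n" "!!k. k <= n ==> p k : K & 0 < Xc f (p k) & Xc f (p k) < ?q" "Yc f (p 0) < - ?q" "8 * ?q < Yc f (p n)"
     unfolding Ecr_def by blast
    show "Q i (?ph ` K)" unfolding Q_def ic using True
    proof (simp only: fst_conv snd_conv if_True vcross_def, intro exI conjI allI impI)
     show "spath (%k. ?ph (p k)) n" using p(1) autom_spath[OF trl_autom] by blast
     fix k assume "k <= n"
     thus "?ph (p k) : ?ph ` K" "(fst t + c) * ?q <= Xc f (?ph (p k))" "Xc f (?ph (p k)) < (fst t + c + 1) * ?q"
      using p(2)[of k] unfolding XY_lat by (auto simp: algebra_simps)
    next
     show "Yc f (?ph (p 0)) < (snd t - 3) * ?q" "(snd t + 4) * ?q <= Yc f (?ph (p n))"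
      using p(3,4) q16 unfolding XY_lat by (auto simp: algebra_simps)
    qed
   qed
  next
   case False
   let ?ph = "%v. trl (lat f (fst t + 4, snd t + c)) (rot v)"
   have XYr: "Xc f (rot v) = - Yc f v" "Yc f (rot v) = Xc f v" for v by (simp_all add: Xc_def Yc_def rot_def)
   have ph: "autom ?ph" by (rule autom_comp[OF trl_autom rot_autom])
   show ?thesis
   proof (rule tube_transfer[OF f b ph, where D = "{v. rot v : Dk f 6 (-4, -c)}"])
    have "rot ` {v. rot v : Dk f 6 (-4, -c)} = Dk f 6 (-4, -c)"
    proof (intro equalityI subsetI)
     fix v assume v: "v : Dk f 6 (-4, -c)"
     obtain u where "v = rot u" using rot_autom unfolding autom_def by (metis bij_pointE)
     thus "v : rot ` {v. rot v : Dk f 6 (-4, -c)}" using v by blast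
    qed blast
    hence "?ph ` {v. rot v : Dk f 6 (-4, -c)} = trl (lat f (fst t + 4, snd t + c)) ` Dk f 6 (-4, -c)"
     by (metis image_image)
    thus "?ph ` {v. rot v : Dk f 6 (-4, -c)} = ?D" unfolding Dk_trl by simp
    show "{v. rot v : Dk f 6 (-4, -c)} \<subseteq> Gf f" using cq q16 unfolding Dk_def Gf_def mem_Collect_eq XYr by (auto simp: algebra_simps)
    show "v : {v. rot v : Dk f 6 (-4, -c)}" if "0 < Xc f v" "Xc f v < ?q" "- 2 * ?q <= Yc f v" "Yc f v <= 9 * ?q" for v
     using that cq q16 unfolding Dk_def mem_Collect_eq XYr by (auto simp: algebra_simps)
    fix K assume "Ecr f K"
    then obtain p n where p: "spath p n" "!!k. k <= n ==> p k : K & 0 < Xc f (p k) & Xc f (p k) < ?q" "Yc f (p 0) < - ?q" "8 * ?q < Yc f (p n)"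
     unfolding Ecr_def by blast
    show "Q i (?ph ` K)" unfolding Q_def ic using False
    proof (simp only: fst_conv snd_conv if_False hcross_def, intro exI conjI allI impI)
     show "spath (%k. ?ph (p (n - k))) n" by (rule autom_spath[OF ph, THEN iffD2, OF spath_rev[OF p(1) order_refl]])
     fix k assume "k <= n"
     thus "?ph (p (n - k)) : ?ph ` K" "(snd t + c) * ?q <= Yc f (?ph (p (n - k)))" "Yc f (?ph (p (n - k))) < (snd t + c + 1) * ?q"
      using p(2)[of "n - k"] unfolding XY_lat XYr by (auto simp: algebra_simps)
    next
     show "Xc f (?ph (p (n - 0))) < (fst t - 3) * ?q" "(fst t + 4) * ?q <= Xc f (?ph (p (n - n)))"
      using p(3,4) q16 unfolding XY_lat XYr by (auto simp: algebra_simps)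
    qed
   qed
  qed
  also have "... <= 1 - de / 32" using i(2) by (simp add: field_simps)
  finally show ?thesis .
 qed
 thus ?thesis using d(1) by (intro exI[of _ "1 - de / 32"]) auto
qed

end

section \<open>Short paths are rare\<close>

definition bx :: "site => int => site set" where
 "bx x r = {v. \<bar>fst v - fst x\<bar> <= r & \<bar>snd v - snd x\<bar> <= r}"

definition dE :: "site => site => real" where
 "dE u v = cmod (Complex (of_int (fst u - fst v)) (of_int (snd u - snd v)))"

definition gr :: "int => site => site" where
 "gr l v = (l * (fst v div l), l * (snd v div l))"

text \<open>Distance is Euclidean because a path that is short without containing separated short
  pieces has to be forced into a thin ellipse. The box of radius 3 * l makes the event
  local.\<close>

definition Sh :: "int => real => site => site set => bool" where
 "Sh l La x K \<longleftrightarrow> (\<exists>p n. spath p n & (\<forall>k\<le>n. p k : K & p k : bx x (3 * l)) & p 0 : bx x l & of_int l <= dE (p 0) (p n) & real n < La)"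

lemma bx_eq: "bx x r = {fst x - r..fst x + r} \<times> {snd x - r..snd x + r}"
 unfolding bx_def by (auto simp: abs_le_iff)

lemma finite_bx: "finite (bx x r)" unfolding bx_eq by simp

lemma upred_Sh: "upred (Sh l La x)" unfolding upred_def Sh_def by blast

lemma dE_sym: "dE u v = dE v u"
 unfolding dE_def cmod_def by (simp add: power2_commute)

lemma dE_triangle: "dE u w <= dE u v + dE v w"
proof -
 have "Complex (of_int (fst u - fst w)) (of_int (snd u - snd w)) =
  Complex (of_int (fst u - fst v)) (of_int (snd u - snd v)) + Complex (of_int (fst v - fst w)) (of_int (snd v - snd w))"
  by (simp add: complex_eq_iff)
 thus ?thesis unfolding dE_def by (metis norm_triangle_ineq)
qed

lemma dE_self [simp]: "dE v v = 0" by (simp add: dE_def complex_eq_iff)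

lemma dE_ge0 [simp]: "0 <= dE u v" by (simp add: dE_def)

lemma dE_ge: "real_of_int \<bar>fst u - fst v\<bar> <= dE u v" "real_of_int \<bar>snd u - snd v\<bar> <= dE u v"
 using abs_Re_le_cmod[of "Complex (of_int (fst u - fst v)) (of_int (snd u - snd v))"]
  abs_Im_le_cmod[of "Complex (of_int (fst u - fst v)) (of_int (snd u - snd v))"] unfolding dE_def by simp_all

lemma dE_le: "dE u v <= of_int (\<bar>fst u - fst v\<bar> + \<bar>snd u - snd v\<bar>)"
 using cmod_le[of "Complex (of_int (fst u - fst v)) (of_int (snd u - snd v))"] unfolding dE_def by simp

lemma dE_adj: "adj u v ==> dE u v <= 1"
 using dE_le[of u v] unfolding adj_def by simp

lemma dE_sq: "(dE u v)\<^sup>2 = of_int (qq (u - v))"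
 unfolding dE_def qq_def by (simp add: cmod_power2)

lemma dE_spath:
 assumes "spath p n" "i <= j" "j <= n"
 shows "dE (p i) (p j) <= real (j - i)"
 using assms(2,3)
proof (induction j rule: dec_induct)
 case (step j)
 have "adj (p j) (p (Suc j))" using assms(1) step.prems unfolding spath_def by simp
 hence "dE (p j) (p (Suc j)) <= 1" by (rule dE_adj)
 thus ?case using step dE_triangle[of "p i" "p (Suc j)" "p j"] by (simp add: Suc_diff_le)
qed simp

lemma gr_bounds: "l > 0 ==> 0 <= fst v - fst (gr l v) & fst v - fst (gr l v) < l & 0 <= snd v - snd (gr l v) & snd v - snd (gr l v) < l"
 unfolding gr_def using pos_mod_sign[of l] pos_mod_bound[of l] by (simp add: minus_mult_div_eq_mod)

lemma gr_bx: "l > 0 ==> v : bx (gr l v) l"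
 using gr_bounds[of l v] unfolding bx_def by simp

lemma gr_dE: assumes "l > 0" shows "dE v (gr l v) <= 2 * of_int l"
proof -
 have "\<bar>fst v - fst (gr l v)\<bar> + \<bar>snd v - snd (gr l v)\<bar> <= 2 * l" using gr_bounds[OF assms, of v] by linarith
 hence "real_of_int (\<bar>fst v - fst (gr l v)\<bar> + \<bar>snd v - snd (gr l v)\<bar>) <= real_of_int (2 * l)" by (simp only: of_int_le_iff)
 thus ?thesis using dE_le[of v "gr l v"] by simp
qed

lemma first_exit:
 assumes p: "spath p n" and ij: "i <= j" "j <= n" "r <= dE (p i) (p j)" and r: "0 < r"
 obtains j' where "i < j'" "j' <= j" "r <= dE (p i) (p j')" "!!k. i <= k ==> k <= j' ==> dE (p i) (p k) <= r + 1"
proof -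
 define j' where "j' = (LEAST k. i <= k & r <= dE (p i) (p k))"
 have L: "i <= j' & r <= dE (p i) (p j')" unfolding j'_def by (rule LeastI[of _ j]) (use ij in simp)
 have le: "j' <= j" unfolding j'_def by (rule Least_le) (use ij in simp)
 have lt: "dE (p i) (p k) < r" if "i <= k" "k < j'" for k using not_less_Least[of k "%k. i <= k & r <= dE (p i) (p k)"] that unfolding j'_def by auto
 have ne: "i ~= j'" using L r by auto
 have last: "dE (p i) (p j') <= r + 1"
 proof -
  obtain m where m: "j' = Suc m" using L ne by (cases j') auto
  have "dE (p m) (p j') <= 1" using p le ij m unfolding spath_def by (intro dE_adj) simp
  moreover have "dE (p i) (p m) < r" by (rule lt) (use L ne m in auto)
  ultimately show ?thesis using dE_triangle[of "p i" "p j'" "p m"] by linarith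
 qed
 show ?thesis
 proof (rule that)
  show "dE (p i) (p k) <= r + 1" if "i <= k" "k <= j'" for k
   using lt[of k] last that by (cases "k = j'") auto
 qed (use L le ne in auto)
qed

lemma short_start:
 assumes p: "spath p n" "!!k. k <= n ==> p k : K" and ij: "i <= j" "j <= n" "of_int l <= dE (p i) (p j)" "real (j - i) < La"
  and l: "l > 0" and x: "p i : bx x l"
 shows "Sh l La x K"
proof -
 obtain j' where j': "i < j'" "j' <= j" "of_int l <= dE (p i) (p j')" "!!k. i <= k ==> k <= j' ==> dE (p i) (p k) <= of_int l + 1"
  using first_exit[OF p(1) ij(1-3)] l by auto
 show ?thesis unfolding Sh_def
 proof (intro exI conjI allI impI)
  show "spath (%k. p (i + k)) (j' - i)" by (rule spath_shift[OF p(1)]) (use j' ij in auto)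
  show "p (i + 0) : bx x l" using x by simp
  show "of_int l <= dE (p (i + 0)) (p (i + (j' - i)))" using j' by simp
  show "real (j' - i) < La" using ij(4) j'(2) by linarith
  fix k assume k: "k <= j' - i"
  thus "p (i + k) : K" using p(2) j' ij by simp
  have "dE (p i) (p (i + k)) <= of_int l + 1" by (rule j'(4)) (use k j' in auto)
  hence "real_of_int \<bar>fst (p i) - fst (p (i + k))\<bar> <= of_int (l + 1)" "real_of_int \<bar>snd (p i) - snd (p (i + k))\<bar> <= of_int (l + 1)"
   using dE_ge[of "p i" "p (i + k)"] by auto
  hence "\<bar>fst (p i) - fst (p (i + k))\<bar> <= l + 1" "\<bar>snd (p i) - snd (p (i + k))\<bar> <= l + 1" by linarith+
  thus "p (i + k) : bx x (3 * l)" using x l unfolding bx_def by auto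
 qed
qed

text \<open>Without short pieces every advance by about \<open>l\<close> costs at least
  \<open>La\<close> steps: the piece up to the first exit from radius \<open>l\<close> is removed,
  and the rest is treated by induction.\<close>

lemma no_short_dist:
 assumes p: "spath p n" and l: "(l::real) > 0" and L: "La > 0"
  and ns: "!!i j. i0 <= i ==> i <= j ==> j <= j0 ==> real (j - i) < La ==> dE (p i) (p j) < l"
  and ij: "i0 <= i" "i <= j" "j <= j0" "j0 <= n"
 shows "dE (p i) (p j) <= l + (l + 1) * real (j - i) / La"
 using ij
proof (induction "j - i" arbitrary: i rule: less_induct)
 case less
 show ?case
 proof (cases "dE (p i) (p j) < l")
  case True
  have "0 <= (l + 1) * real (j - i) / La" using l L by simp
  thus ?thesis using True by linarith
 next
  case False
  then obtain j' where j': "i < j'" "j' <= j" "l <= dE (p i) (p j')" "!!k. i <= k ==> k <= j' ==> dE (p i) (p k) <= l + 1"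
   using first_exit[OF p, of i j l] less.prems l by auto
  have "La <= real (j' - i)" using ns[of i j'] j' less.prems by (meson leI less_imp_le_nat not_less order_trans)
  hence "(l + 1) * La / La <= (l + 1) * real (j' - i) / La" using l L by (intro divide_right_mono mult_left_mono) auto
  hence a: "l + 1 <= (l + 1) * real (j' - i) / La" using L by simp
  have "dE (p j') (p j) <= l + (l + 1) * real (j - j') / La" by (rule less.hyps) (use j' less.prems in auto)
  moreover have "dE (p i) (p j') <= l + 1" using j' by simp
  moreover have "(l + 1) * real (j - i) / La = (l + 1) * real (j' - i) / La + (l + 1) * real (j - j') / La"
  proof -
   have "real (j - i) = real (j' - i) + real (j - j')" using j' by simp
   thus ?thesis by (simp add: distrib_left add_divide_distrib)
  qed
  ultimately show ?thesis using dE_triangle[of "p i" "p j" "p j'"] a by linarith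
 qed
qed

text \<open>Short pieces that all start close together help only once: before the earliest and after
  the latest start \<open>no_short_dist\<close> applies, and what lies between contributes at most
  16 * l.\<close>

lemma clustered_short_dist:
 assumes p: "spath p n" and l: "(l::real) >= 1" and L: "La > 0"
  and SI: "SI = {i. i <= n & (\<exists>j\<ge>i. j <= n & real (j - i) < La & l <= dE (p i) (p j))}"
  and cl: "!!i j. i : SI ==> j : SI ==> dE (p i) (p j) <= 16 * l" and ij: "i <= j" "j <= n"
 shows "dE (p i) (p j) <= 20 * l + (l + 1) * real (j - i) / La"
proof -
 have l0: "l > 0" using l by simp
 have step1: "dE (p k) (p (Suc k)) <= 1" if "k < n" for k using p that dE_adj unfolding spath_def by blast
 have nsd: "dE (p a) (p b) <= l + (l + 1) * real (b - a) / La" if ab: "a <= b" "b <= n" and no: "!!k. a <= k ==> k <= b ==> k ~: SI" for a b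
 proof (rule no_short_dist[OF p l0 L _ order_refl ab(1) order_refl ab(2)])
  fix i j assume h: "a <= i" "i <= j" "j <= b" "real (j - i) < La"
  show "dE (p i) (p j) < l"
  proof (rule ccontr)
   assume "~ ?thesis"
   hence "i : SI" unfolding SI using h ab by (intro CollectI conjI exI[of _ j]) auto
   thus False using no[of i] h by simp
  qed
 qed
 have pos: "0 <= (l + 1) * real k / La" for k using l0 L by simp
 have mono: "(l + 1) * real k / La <= (l + 1) * real k' / La" if "k <= k'" for k k'
  using that l0 L by (intro divide_right_mono mult_left_mono) auto
 show ?thesis
 proof (cases "\<exists>k. i <= k & k <= j & k : SI")
  case False
  thus ?thesis using nsd[OF ij] l by force
 next
  case True
  define S where "S = {k. i <= k & k <= j & k : SI}"
  have fS: "finite S" "S ~= {}" using True unfolding S_def by auto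
  define a b where "a = Min S" and "b = Max S"
  have ab: "a : S" "b : S" unfolding a_def b_def using fS by auto
  have aM: "a <= k" "k <= b" if "k : S" for k using that fS by (simp_all add: a_def b_def)
  have aS: "k ~: SI" if "i <= k" "k < a" for k
   using that ab(1) aM(1)[of k] by (auto simp: S_def)
  have bS: "k ~: SI" if "b < k" "k <= j" for k
   using that ab(2) aM(2)[of k] by (auto simp: S_def)
  have abb: "i <= a" "a <= b" "b <= j" using ab aM(1)[OF ab(2)] unfolding S_def by auto
  have 1: "dE (p i) (p a) <= l + 1 + (l + 1) * real (a - i) / La"
  proof (cases "a = i")
   case False
   hence "dE (p i) (p (a - 1)) <= l + (l + 1) * real (a - 1 - i) / La"
    using abb ij aS by (intro nsd) auto
   moreover have "dE (p (a - 1)) (p a) <= 1" using step1[of "a - 1"] abb ij False by simp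
   moreover have "(l + 1) * real (a - 1 - i) / La <= (l + 1) * real (a - i) / La" by (rule mono) simp
   ultimately show ?thesis using dE_triangle[of "p i" "p a" "p (a - 1)"] by linarith
  qed (use l0 in simp)
  have 2: "dE (p b) (p j) <= l + 1 + (l + 1) * real (j - b) / La"
  proof (cases "b = j")
   case False
   hence "dE (p (Suc b)) (p j) <= l + (l + 1) * real (j - Suc b) / La"
    using abb ij bS by (intro nsd) auto
   moreover have "dE (p b) (p (Suc b)) <= 1" using step1[of b] abb ij False by simp
   moreover have "(l + 1) * real (j - Suc b) / La <= (l + 1) * real (j - b) / La" by (rule mono) simp
   ultimately show ?thesis using dE_triangle[of "p b" "p j" "p (Suc b)"] by linarith
  qed (use l0 in simp)
  have 3: "dE (p a) (p b) <= 16 * l" using cl ab unfolding S_def by blast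
  have 4: "(l + 1) * real (a - i) / La + (l + 1) * real (j - b) / La <= (l + 1) * real (j - i) / La"
  proof -
   have "(l + 1) * real (a - i) / La + (l + 1) * real (j - b) / La = (l + 1) * real (a - i + (j - b)) / La"
    by (simp add: distrib_left add_divide_distrib)
   also have "... <= (l + 1) * real (j - i) / La" by (rule mono) (use abb in simp)
   finally show ?thesis .
  qed
  show ?thesis using 1 2 3 4 l dE_triangle[of "p i" "p j" "p a"] dE_triangle[of "p a" "p j" "p b"] by linarith
 qed
qed

lemma bx_sep:
 assumes "2 * r + 1 < \<bar>fst x - fst y\<bar> \<or> 2 * r + 1 < \<bar>snd x - snd y\<bar>"
 shows "sep (bx x r) (bx y r)"
proof -
 have "~ adj a b & a ~= b" if "a : bx x r" "b : bx y r" for a b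
  using that assms unfolding bx_def adj_def mem_Collect_eq by (cases "a = b") (simp_all, linarith+)
 thus ?thesis unfolding sep_def by blast
qed

text \<open>A path from \<open>x\<close> to \<open>y\<close> confined to a thin ellipse.\<close>
definition St :: "int => int => site => site => site set => bool" where
 "St Ga l x y K \<longleftrightarrow> (\<exists>p n. spath p n & (\<forall>k\<le>n. p k : K & dE (p k) x + dE (p k) y <= of_int ((Ga + 47) * l)) & p 0 : bx x l & p n : bx y l)"

text \<open>The Aizenman-Burchard alternative: a short path on scale \<open>Ga * l\<close> either contains two distant short paths on scale \<open>l\<close>
 or is nearly straight.\<close>
lemma short_dichotomy:
 assumes G: "Ga >= 8" and l: "l >= Ga" and L: "La > 0" and S: "Sh (Ga * l) ((of_int Ga + 1) * La) x0 K"
 obtains (two) x x' where "x : gr l ` bx x0 (2 * Ga * l + 1)" "x' : gr l ` bx x0 (2 * Ga * l + 1)" "sep (bx x (3 * l)) (bx x' (3 * l))" "Sh l La x K" "Sh l La x' K"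
 | (straight) x y where "x : gr l ` bx x0 (Ga * l)" "y : gr l ` bx x0 (2 * Ga * l + 1)" "of_int ((Ga - 4) * l) <= dE x y" "dE x y <= of_int ((Ga + 5) * l)" "St Ga l x y K"
proof -
 from S obtain p n0 where p0: "spath p n0" "!!k. k <= n0 ==> p k : K" "p 0 : bx x0 (Ga * l)" "of_int (Ga * l) <= dE (p 0) (p n0)" "real n0 < (of_int Ga + 1) * La"
  unfolding Sh_def by blast
 have l0: "l > 0" and l1: "l >= 8" using G l by auto
 have Gl: "of_int (Ga * l) > (0::real)" using G l0 by simp
 obtain n where n: "0 < n" "n <= n0" "of_int (Ga * l) <= dE (p 0) (p n)" "!!k. 0 <= k ==> k <= n ==> dE (p 0) (p k) <= of_int (Ga * l) + 1"
  using first_exit[OF p0(1) _ order_refl p0(4) Gl] by auto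
 have p: "spath p n" "!!k. k <= n ==> p k : K" using p0 n unfolding spath_def by auto
 have nL: "real n < (of_int Ga + 1) * La" using p0(5) n(2) by linarith
 have inb: "p k : bx x0 (2 * Ga * l + 1)" if "k <= n" for k
 proof -
  have "real_of_int \<bar>fst (p 0) - fst (p k)\<bar> <= of_int (Ga * l + 1)" "real_of_int \<bar>snd (p 0) - snd (p k)\<bar> <= of_int (Ga * l + 1)"
   using dE_ge[of "p 0" "p k"] n(4)[of k] that by auto
  hence "\<bar>fst (p 0) - fst (p k)\<bar> <= Ga * l + 1" "\<bar>snd (p 0) - snd (p k)\<bar> <= Ga * l + 1" by linarith+
  thus ?thesis using p0(3) unfolding bx_def by auto
 qed
 define SI where "SI = {i. i <= n & (\<exists>j\<ge>i. j <= n & real (j - i) < La & of_int l <= dE (p i) (p j))}"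
 have sh: "Sh l La (gr l (p i)) K" if "i : SI" for i
  using that unfolding SI_def by (auto intro: short_start[OF p _ _ _ _ l0 gr_bx[OF l0]])
 show thesis
 proof (cases "EX i:SI. EX j:SI. sep (bx (gr l (p i)) (3 * l)) (bx (gr l (p j)) (3 * l))")
  case True
  then obtain i j where "i : SI" "j : SI" "sep (bx (gr l (p i)) (3 * l)) (bx (gr l (p j)) (3 * l))" by blast
  thus thesis using sh inb by (intro two[of "gr l (p i)" "gr l (p j)"]) (auto simp: SI_def)
 next
  case False
  have cl: "dE (p i) (p j) <= 16 * of_int l" if "i : SI" "j : SI" for i j
  proof -
   have "\<bar>fst (gr l (p i)) - fst (gr l (p j))\<bar> <= 6 * l + 1" "\<bar>snd (gr l (p i)) - snd (gr l (p j))\<bar> <= 6 * l + 1"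
    using False that bx_sep[of "3 * l" "gr l (p i)" "gr l (p j)"] by (simp_all, force+)
   hence "\<bar>fst (p i) - fst (p j)\<bar> + \<bar>snd (p i) - snd (p j)\<bar> <= 16 * l"
    using gr_bounds[OF l0, of "p i"] gr_bounds[OF l0, of "p j"] l1 by linarith
   hence "real_of_int (\<bar>fst (p i) - fst (p j)\<bar> + \<bar>snd (p i) - snd (p j)\<bar>) <= of_int (16 * l)" by (simp only: of_int_le_iff)
   thus ?thesis using dE_le[of "p i" "p j"] by simp
  qed
  have dist: "dE (p i) (p j) <= 20 * of_int l + (of_int l + 1) * real (j - i) / La" if "i <= j" "j <= n" for i j
   by (rule clustered_short_dist[OF p(1) _ L SI_def cl that]) (use l1 in auto)
  let ?x = "gr l (p 0)" and ?y = "gr l (p n)"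
  have gx: "dE (p 0) ?x <= 2 * of_int l" "dE (p n) ?y <= 2 * of_int l" by (rule gr_dE[OF l0])+
  \<comment> \<open>Two losses of 20 * l, one for each part of the path, and 3 * l from (l + 1) *
    (Ga + 1) make 43; rounding both ends to the grid adds 2 * l each and yields the 47 in
    \<open>St\<close>.\<close>
  have sum: "dE (p k) (p 0) + dE (p k) (p n) <= of_int (Ga * l) + 43 * of_int l" if k: "k <= n" for k
  proof -
   have "(of_int l + 1) * real (k - 0) / La + (of_int l + 1) * real (n - k) / La = (of_int l + 1) * (real n / La)"
    using k by (simp add: of_nat_diff algebra_simps add_divide_distrib[symmetric])
   also have "... <= (of_int l + 1) * (of_int Ga + 1)"
    using nL L l0 by (intro mult_left_mono) (auto simp: pos_divide_le_eq less_imp_le)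
   also have "... <= of_int (Ga * l) + 3 * of_int l" using l l1 by (simp add: algebra_simps)
   finally show ?thesis using dist[of 0 k] dist[of k n] k dE_sym[of "p k" "p 0"] by simp
  qed
  show thesis
  proof (rule straight[of ?x ?y])
   show "?x : gr l ` bx x0 (Ga * l)" "?y : gr l ` bx x0 (2 * Ga * l + 1)" using p0(3) inb by auto
   show "of_int ((Ga - 4) * l) <= dE ?x ?y"
    using n(3) gx dE_triangle[of "p 0" "p n" ?x] dE_triangle[of ?x "p n" ?y] dE_sym[of "p n" ?y] by (simp add: algebra_simps)
   have "dE ?x ?y <= 2 * of_int l + (of_int (Ga * l) + 1 + 2 * of_int l)"
    using n(4)[of n] gx dE_triangle[of ?x ?y "p 0"] dE_triangle[of "p 0" ?y "p n"] dE_sym[of "p 0" ?x] by linarith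
   also have "... <= of_int ((Ga + 5) * l)" using l1 by (simp add: algebra_simps)
   finally show "dE ?x ?y <= of_int ((Ga + 5) * l)" .
   show "St Ga l ?x ?y K" unfolding St_def
   proof (intro exI[of _ p] exI[of _ n] conjI allI impI)
    fix k assume k: "k <= n"
    show "p k : K" using p k by blast
    show "dE (p k) ?x + dE (p k) ?y <= of_int ((Ga + 47) * l)"
     using sum[OF k] gx dE_triangle[of "p k" ?x "p 0"] dE_triangle[of "p k" ?y "p n"] by (simp add: algebra_simps)
   qed (use p gr_bx[OF l0] in auto)
  qed
 qed
qed

lemma int_crossing:
 fixes y :: "nat => int"
 assumes st: "!!k. k < n ==> \<bar>y (Suc k) - y k\<bar> <= q" and y: "y 0 < - q" "8 * q < y n" and q: "0 <= q"
 obtains i j where "i <= j" "j <= n" "y i < - q" "8 * q < y j" "!!k. i <= k ==> k <= j ==> - 2 * q <= y k & y k <= 9 * q"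
proof -
 define j where "j = (LEAST k. 8 * q < y k)"
 have j: "8 * q < y j" "j <= n" unfolding j_def using y(2) by (auto intro: LeastI Least_le)
 have jl: "y k <= 8 * q" if "k < j" for k using not_less_Least[of k "%k. 8 * q < y k"] that unfolding j_def by simp
 define S where "S = {k. k <= j & y k < - q}"
 have S: "finite S" "0 : S" unfolding S_def using y by auto
 define i where "i = Max S"
 have i: "i : S" "!!k. k : S ==> k <= i" unfolding i_def using S Max_in[OF S(1)] by (blast, simp)
 have ii: "i <= j" "y i < - q" using i(1) unfolding S_def by auto
 have ij: "i < j" using ii j(1) q by (cases "i = j") auto
 have il: "- q <= y k" if "i < k" "k <= j" for k using i(2)[of k] that unfolding S_def by force
 show thesis
 proof (rule that[OF ii(1) j(2) ii(2) j(1)])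
  fix k assume k: "i <= k" "k <= j"
  have "- 2 * q <= y k"
  proof (cases "k = i")
   case True
   thus ?thesis using st[of i] il[of "Suc i"] ij j(2) by auto
  next
   case False
   thus ?thesis using il[of k] k q by auto
  qed
  moreover have "y k <= 9 * q"
  proof (cases "k = j")
   case True
   obtain m where "j = Suc m" using ij by (cases j) auto
   thus ?thesis using st[of m] jl[of m] j(2) True by auto
  next
   case False
   thus ?thesis using jl[of k] k q by auto
  qed
  ultimately show "- 2 * q <= y k & y k <= 9 * q" by simp
 qed
qed

text \<open>At right angles to (a, b), so that \<open>Yc\<close> runs along (a, b) and
  \<open>Xc\<close> measures the lateral deviation.\<close>

definition ff :: "int => int => int => site" where
 "ff c a b = (2 * c * b, - 2 * c * a)"

text \<open>Positions of disjoint tubes along the segment from \<open>x\<close> in direction \<open>(a, b)\<close>, all of which a nearly straight path crosses.\<close>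
definition tau :: "int => int => int => site => int => site" where
 "tau c a b x i = (fst x - c * b + (45 * i + 3) * (2 * c * a), snd x + c * a + (45 * i + 3) * (2 * c * b))"

lemma ff_qq: "qq (ff c a b) = 4 * c\<^sup>2 * (a\<^sup>2 + b\<^sup>2)"
 by (simp add: qq_def ff_def power2_eq_square algebra_simps)

lemma ff_Yc: "Yc (ff c a b) v = 2 * c * (a * fst v + b * snd v)"
 by (simp add: Yc_def ff_def algebra_simps)

text \<open>The sideways offset is half a side, which centres the tube on the segment. The offset 3
  puts the start of the path, known up to one side, below the tube; the spacing 45 exceeds twice the
  block radius 20.\<close>

lemma tau_XY:
 "Xc (ff c a b) (v - tau c a b x i) = Xc (ff c a b) (v - x) + 2 * c\<^sup>2 * (a\<^sup>2 + b\<^sup>2)"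
 "Yc (ff c a b) (v - tau c a b x i) = Yc (ff c a b) (v - x) - (45 * i + 3) * (4 * c\<^sup>2 * (a\<^sup>2 + b\<^sup>2))"
 by (simp_all add: Xc_def Yc_def ff_def tau_def power2_eq_square algebra_simps)

lemma trl_minus: "trl (- t) v = v - t" "trl t (v - t) = v" "trl t v - t = v"
 by (simp_all add: trl_def prod_eq_iff)

definition Qtau :: "int => int => int => site => int => site set => bool" where
 "Qtau c a b x i K \<longleftrightarrow> Ecr (ff c a b) (trl (- tau c a b x i) ` K)"

definition Btau :: "int => int => int => site => int => site set" where
 "Btau c a b x i = trl (tau c a b x i) ` Gf (ff c a b)"

lemma Btau_iff: "v : Btau c a b x i \<longleftrightarrow> v - tau c a b x i : Gf (ff c a b)"
proof
 assume "v - tau c a b x i : Gf (ff c a b)"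
 thus "v : Btau c a b x i" unfolding Btau_def by (intro image_eqI[of v _ "v - tau c a b x i"]) (simp_all only: trl_minus)
next
 assume "v : Btau c a b x i"
 then obtain w where "w : Gf (ff c a b)" "v = trl (tau c a b x i) w" unfolding Btau_def by blast
 thus "v - tau c a b x i : Gf (ff c a b)" by (simp only: trl_minus)
qed

text \<open>Why \<open>Ga\<close> is the square of \<open>g\<close>: points whose distances to both
  ends sum to Ga * l + O(l) deviate sideways by O(l * sqrt Ga) = O(l * g), so tubes of side about 40
  * l * g catch them. About g / 40 sides fit along the segment, and at spacing 45 this leaves room
  for g / 1800 tubes.\<close>

locale direction =
 fixes g l l' m Ga a b c :: int and x y :: site
 assumes g: "g >= 3000" and l: "l = g * l'" "l' >= g" and G: "Ga = g\<^sup>2" and m: "1800 * m <= g" and c: "c = 20 * l'"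
  and y: "y = (fst x + l * a, snd x + l * b)"
  and d1: "of_int ((Ga - 4) * l) <= dE x y" and d2: "dE x y <= of_int ((Ga + 5) * l)"
begin

abbreviation "f == ff c a b"
abbreviation "n2 == a\<^sup>2 + b\<^sup>2"

lemma l0: "l' > 0" "l > 0" using g l by auto

lemma G_big: "Ga >= 3000 * g" "Ga >= 9000000"
proof -
 show *: "Ga >= 3000 * g" unfolding G power2_eq_square using g by (intro mult_right_mono) auto
 show "Ga >= 9000000" using * g by linarith
qed

lemma dxy: "(dE x y)\<^sup>2 = of_int (l\<^sup>2 * n2)"
 unfolding dE_sq qq_def y by (simp add: power2_eq_square algebra_simps)

lemma n2_bounds: "(Ga - 4)\<^sup>2 <= n2" "n2 <= (Ga + 5)\<^sup>2"
proof -
 have "(of_int ((Ga - 4) * l))\<^sup>2 <= (dE x y)\<^sup>2" using d1 G_big l0 by (intro power_mono) auto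
 hence "real_of_int (((Ga - 4) * l)\<^sup>2) <= of_int (l\<^sup>2 * n2)" unfolding dxy by simp
 hence "((Ga - 4) * l)\<^sup>2 <= l\<^sup>2 * n2" by (simp only: of_int_le_iff)
 hence "l\<^sup>2 * (Ga - 4)\<^sup>2 <= l\<^sup>2 * n2" by (simp add: power_mult_distrib mult.commute)
 thus "(Ga - 4)\<^sup>2 <= n2" by (rule mult_left_le_imp_le) (use l0 in simp)
 have "(dE x y)\<^sup>2 <= (of_int ((Ga + 5) * l))\<^sup>2" using d2 by (intro power_mono) auto
 hence "real_of_int (l\<^sup>2 * n2) <= of_int (((Ga + 5) * l)\<^sup>2)" unfolding dxy by simp
 hence "l\<^sup>2 * n2 <= ((Ga + 5) * l)\<^sup>2" by (simp only: of_int_le_iff)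
 hence "l\<^sup>2 * n2 <= l\<^sup>2 * (Ga + 5)\<^sup>2" by (simp add: power_mult_distrib mult.commute)
 thus "n2 <= (Ga + 5)\<^sup>2" by (rule mult_left_le_imp_le) (use l0 in simp)
qed

lemma n2_half: "Ga\<^sup>2 <= 2 * n2"
proof -
 have "16 * Ga <= Ga * Ga" using G_big by (intro mult_right_mono) auto
 thus ?thesis using n2_bounds(1) by (simp add: power2_eq_square algebra_simps)
qed

lemma q: "qq f = 1600 * l'\<^sup>2 * n2" unfolding ff_qq c by (simp add: power2_eq_square)

lemma q_ge: "800 * (l\<^sup>2 * Ga) <= qq f" "16 <= qq f"
proof -
 have "800 * (l\<^sup>2 * Ga) = 800 * l'\<^sup>2 * Ga\<^sup>2" unfolding l(1) G by (simp add: power2_eq_square)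
 also have "... <= 800 * l'\<^sup>2 * (2 * n2)" using n2_half by (intro mult_left_mono) auto
 also have "... = qq f" unfolding q by algebra
 finally show "800 * (l\<^sup>2 * Ga) <= qq f" .
 hence "800 * (1 * 1) <= qq f"
  using mult_mono[of 1 "l\<^sup>2" 1 Ga] l0 G_big by (smt (verit) mult_left_mono one_le_power zero_less_one_class.zero_le_one)
 thus "16 <= qq f" by simp
qed

lemma f0: "f ~= (0, 0)" using q_ge(2) by (auto simp: qq_def)

lemma YD: "Yc f (y - x) = 2 * c * l * n2" "40 * Yc f (y - x) = g * qq f"
 unfolding y ff_qq ff_Yc c l(1) by (simp_all add: power2_eq_square algebra_simps)

lemma norm_f: "cmod (Complex (of_int (Xc f (u - v))) (of_int (Yc f (u - v)))) = sqrt (of_int (qq f)) * dE u v"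
proof -
 have "(cmod (Complex (of_int (Xc f (u - v))) (of_int (Yc f (u - v)))))\<^sup>2 = real_of_int ((Xc f (u - v))\<^sup>2 + (Yc f (u - v))\<^sup>2)"
  by (simp add: cmod_power2)
 also have "... = (sqrt (of_int (qq f)) * dE u v)\<^sup>2" unfolding XY_norm power_mult_distrib dE_sq using q_ge by simp
 finally show ?thesis by (rule power2_eq_imp_eq) (use q_ge in auto)
qed

lemma lateral:
 assumes s: "dE v x + dE v y <= of_int ((Ga + 47) * l)"
 shows "\<bar>Xc f (v - x)\<bar> < 2 * c\<^sup>2 * n2"
proof -
 let ?X = "Xc f (v - x)" and ?Y = "Yc f (v - x)" and ?D = "Yc f (y - x)" and ?q = "qq f"
 have Xy: "Xc f (y - x) = 0" unfolding y Xc_def ff_def by (simp add: algebra_simps)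
 have e: "Xc f (v - y) = ?X" "Yc f (v - y) = ?Y - ?D" using Xy by (simp_all add: Xc_def Yc_def algebra_simps)
 have q0: "real_of_int ?q > 0" using q_ge by simp
 \<comment> \<open>Reflecting the second leg turns the broken line from \<open>x\<close> over
   \<open>v\<close> to \<open>y\<close> into a sum of vectors with components 2 * ?X and ?D, whose
   length is at most the sum of the two distances, up to the scale of \<open>f\<close>.\<close>
 have "cmod (Complex (of_int (2 * ?X)) (of_int ?D)) = cmod (Complex (of_int ?X) (of_int ?Y) + Complex (of_int ?X) (of_int (?D - ?Y)))"
  by (rule arg_cong[of _ _ cmod]) (simp add: complex_eq_iff)
 also have "... <= cmod (Complex (of_int ?X) (of_int ?Y)) + cmod (Complex (of_int ?X) (of_int (?D - ?Y)))" by (rule norm_triangle_ineq)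
 also have "cmod (Complex (of_int ?X) (of_int (?D - ?Y))) = cmod (Complex (of_int ?X) (of_int (?Y - ?D)))" by (simp add: cmod_def power2_commute)
 also have "cmod (Complex (of_int ?X) (of_int ?Y)) + cmod (Complex (of_int ?X) (of_int (?Y - ?D))) = sqrt (of_int ?q) * (dE v x + dE v y)"
  using norm_f[of v x] norm_f[of v y] unfolding e by (simp add: distrib_left)
 also have "... <= sqrt (of_int ?q) * of_int ((Ga + 47) * l)" using s q0 by (intro mult_left_mono) auto
 finally have "(cmod (Complex (of_int (2 * ?X)) (of_int ?D)))\<^sup>2 <= (sqrt (of_int ?q) * of_int ((Ga + 47) * l))\<^sup>2" by (intro power_mono) auto
 hence "real_of_int ((2 * ?X)\<^sup>2 + ?D\<^sup>2) <= of_int (?q * ((Ga + 47) * l)\<^sup>2)"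
  unfolding power_mult_distrib using q0 by (simp add: cmod_power2 power_mult_distrib)
 hence I: "4 * ?X\<^sup>2 + ?D\<^sup>2 <= ?q * ((Ga + 47) * l)\<^sup>2" by (simp only: of_int_le_iff power_mult_distrib) simp
 have D2: "?D\<^sup>2 = ?q * (l\<^sup>2 * n2)" unfolding YD(1) ff_qq by (simp add: power2_eq_square)
 have "?q * (l\<^sup>2 * (Ga - 4)\<^sup>2) <= ?D\<^sup>2" unfolding D2 using n2_bounds q_ge by (intro mult_left_mono) auto
 with I have "4 * ?X\<^sup>2 <= ?q * ((Ga + 47) * l)\<^sup>2 - ?q * (l\<^sup>2 * (Ga - 4)\<^sup>2)" by linarith
 also have "... = ?q * (l\<^sup>2 * ((Ga + 47)\<^sup>2 - (Ga - 4)\<^sup>2))" unfolding power_mult_distrib right_diff_distrib by (simp only: mult_ac)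
 also have "(Ga + 47)\<^sup>2 - (Ga - 4)\<^sup>2 = 51 * (2 * Ga + 43)" by (simp add: power2_eq_square algebra_simps)
 also have "?q * (l\<^sup>2 * (51 * (2 * Ga + 43))) < ?q * (800 * (l\<^sup>2 * Ga))"
 proof (rule mult_strict_left_mono)
  have "l\<^sup>2 * (51 * (2 * Ga + 43)) < l\<^sup>2 * (800 * Ga)" using l0 G_big by (intro mult_strict_left_mono) auto
  thus "l\<^sup>2 * (51 * (2 * Ga + 43)) < 800 * (l\<^sup>2 * Ga)" by simp
 qed (use q_ge in simp)
 also have "... <= ?q * ?q" using q_ge by (intro mult_left_mono) auto
 finally have "(2 * ?X)\<^sup>2 < ?q\<^sup>2" by (simp add: power2_eq_square)
 hence "\<bar>2 * ?X\<bar> < \<bar>?q\<bar>" by (meson abs_le_square_iff not_less)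
 thus ?thesis unfolding ff_qq using q_ge by (auto simp: ff_qq)
qed

lemma longitudinal:
 assumes "u : bx z l"
 shows "\<bar>Yc f (u - z)\<bar> <= qq f"
proof -
 have "\<bar>fst u - fst z\<bar> <= \<bar>l\<bar>" "\<bar>snd u - snd z\<bar> <= \<bar>l\<bar>" using assms unfolding bx_def by auto
 hence "(fst u - fst z)\<^sup>2 <= l\<^sup>2" "(snd u - snd z)\<^sup>2 <= l\<^sup>2" by (simp_all only: abs_le_square_iff)
 hence "qq (u - z) <= 2 * l\<^sup>2" unfolding qq_def by simp
 also have "... <= 800 * (l\<^sup>2 * Ga)"
 proof -
  have "l\<^sup>2 * 1 <= l\<^sup>2 * Ga" using G_big by (intro mult_left_mono) auto
  thus ?thesis using zero_le_power2[of l] unfolding mult_1_right by linarith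
 qed
 also have "... <= qq f" by (rule q_ge)
 finally have "qq f * qq (u - z) <= qq f * qq f" using q_ge by (intro mult_left_mono) auto
 hence "(Yc f (u - z))\<^sup>2 <= (qq f)\<^sup>2" using XY_norm[of f "u - z"] zero_le_power2[of "Xc f (u - z)"] unfolding power2_eq_square[of "qq f"] by linarith
 hence "\<bar>Yc f (u - z)\<bar> <= \<bar>qq f\<bar>" by (simp only: abs_le_square_iff)
 thus ?thesis using q_ge by simp
qed

lemma St_tubes:
 assumes S: "St Ga l x y K" and i: "0 <= i" "i < m"
 shows "Qtau c a b x i (K Int Btau c a b x i)"
proof -
 let ?q = "qq f"
 from S obtain p n where p: "spath p n" "!!k. k <= n ==> p k : K" "!!k. k <= n ==> dE (p k) x + dE (p k) y <= of_int ((Ga + 47) * l)"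
  "p 0 : bx x l" "p n : bx y l" unfolding St_def by blast
 let ?t = "tau c a b x i"
 define w where "w k = p k - ?t" for k
 have ws: "spath w k" if "spath p k" for k using that unfolding w_def spath_def adj_def by simp
 have X: "0 < Xc f (w k) & Xc f (w k) < ?q" if "k <= n" for k
  using lateral[OF p(3)[OF that]] unfolding w_def tau_XY(1) ff_qq by (simp add: abs_less_iff)
 have Yw: "Yc f (w k) = Yc f (p k - x) - (45 * i + 3) * ?q" for k unfolding w_def tau_XY(2) ff_qq ..
 have q0: "?q > 0" using q_ge by simp
 have i0: "0 <= 45 * i * ?q" using i q0 by simp
 have Y0: "Yc f (w 0) < - ?q" using longitudinal[OF p(4)] i0 q0 unfolding Yw by (simp add: algebra_simps)
 have Yn: "8 * ?q < Yc f (w n)"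
 proof -
  have "Yc f (p n - x) = Yc f (p n - y) + Yc f (y - x)" by (simp add: Yc_def algebra_simps)
  moreover have "\<bar>Yc f (p n - y)\<bar> <= ?q" by (rule longitudinal[OF p(5)])
  moreover have "1800 * (i + 1) * ?q <= g * ?q" using i m q0 by (intro mult_right_mono) auto
  ultimately show ?thesis using YD(2) q0 unfolding Yw by (simp add: algebra_simps)
 qed
 have st: "\<bar>Yc f (w (Suc k)) - Yc f (w k)\<bar> <= ?q" if "k < n" for k
 proof -
  have "adj (w (Suc k)) (w k)" using ws[OF p(1)] that adj_sym unfolding spath_def by blast
  from step_XY(2)[OF this, of f] show ?thesis using mx_le_qq[of f] by linarith
 qed
 obtain i' j where ij: "i' <= j" "j <= n" "Yc f (w i') < - ?q" "8 * ?q < Yc f (w j)" "!!k. i' <= k ==> k <= j ==> - 2 * ?q <= Yc f (w k) & Yc f (w k) <= 9 * ?q"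
  using int_crossing[of n "%k. Yc f (w k)" ?q, OF st Y0 Yn] q0 by auto
 show ?thesis unfolding Qtau_def Ecr_def
 proof (intro exI[of _ "%k. w (i' + k)"] exI[of _ "j - i'"] conjI allI impI)
  show "spath (%k. w (i' + k)) (j - i')" by (rule spath_shift[OF ws[OF p(1)]]) (use ij in auto)
  fix k assume k: "k <= j - i'"
  have X': "0 < Xc f (w (i' + k)) & Xc f (w (i' + k)) < ?q" by (rule X) (use k ij in auto)
  have Y': "- 2 * ?q <= Yc f (w (i' + k)) & Yc f (w (i' + k)) <= 9 * ?q" by (rule ij(5)) (use k ij in auto)
  show "0 < Xc f (w (i' + k))" "Xc f (w (i' + k)) < ?q" "- 2 * ?q <= Yc f (w (i' + k))" "Yc f (w (i' + k)) <= 9 * ?q" using X' Y' by auto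
  have "w (i' + k) : Gf f" unfolding Gf_def using X' Y' q0 by auto
  hence "p (i' + k) : K Int Btau c a b x i" using p(2)[of "i' + k"] k ij(1,2) unfolding w_def by (simp add: Btau_iff)
  thus "w (i' + k) : trl (- ?t) ` (K Int Btau c a b x i)" unfolding w_def trl_minus(1)[symmetric] by blast
 qed (use ij in auto)
qed

lemma Btau_sep:
 assumes "i ~= j"
 shows "sep (Btau c a b x i) (Btau c a b x j)"
proof -
 let ?q = "qq f"
 have q0: "?q > 0" using q_ge by simp
 have no: "\<bar>Yc f u - Yc f v\<bar> > ?q" if u: "u : Btau c a b x i" and v: "v : Btau c a b x j" for u v
 proof -
  have "\<bar>Yc f (u - x) - (45 * i + 3) * ?q\<bar> <= 20 * ?q" "\<bar>Yc f (v - x) - (45 * j + 3) * ?q\<bar> <= 20 * ?q"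
   using u v unfolding Btau_iff Gf_def mem_Collect_eq tau_XY ff_qq by auto
  moreover have "Yc f (u - x) - Yc f (v - x) = Yc f u - Yc f v" by (simp add: Yc_def algebra_simps)
  moreover have "45 * ?q <= \<bar>(45 * i + 3) * ?q - (45 * j + 3) * ?q\<bar>"
  proof -
   have "(45 * i + 3) * ?q - (45 * j + 3) * ?q = 45 * (i - j) * ?q" by (simp add: algebra_simps)
   moreover have "1 * (45 * ?q) <= \<bar>i - j\<bar> * (45 * ?q)" using assms q0 by (intro mult_right_mono) auto
   ultimately show ?thesis using q0 by (simp add: abs_mult)
  qed
  ultimately show ?thesis using q0 by linarith
 qed
 show ?thesis unfolding sep_def
 proof (intro conjI ballI equals0I notI)
  fix u v assume uv: "u : Btau c a b x i" "v : Btau c a b x j" "adj u v"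
  show False using no[OF uv(1,2)] step_XY(2)[OF uv(3), of f] mx_le_qq[of f] by linarith
 next
  fix u assume "u : Btau c a b x i Int Btau c a b x j"
  thus False using no[of u u] q0 by simp
 qed
qed

lemma Btau_bx:
 assumes x0: "x : bx x0 (Ga * l + l)" and i: "0 <= i" "i < m"
 shows "Btau c a b x i \<subseteq> bx x0 (3 * (Ga * l))"
proof
 fix v assume v: "v : Btau c a b x i"
 let ?q = "qq f" and ?t = "tau c a b x i"
 define w where "w = v - ?t"
 have q0: "?q > 0" using q_ge by simp
 have XY: "\<bar>Xc f w\<bar> <= \<bar>20 * ?q\<bar>" "\<bar>Yc f w\<bar> <= \<bar>20 * ?q\<bar>" using v q0 unfolding Btau_iff Gf_def w_def by auto
 hence "(Xc f w)\<^sup>2 <= (20 * ?q)\<^sup>2" "(Yc f w)\<^sup>2 <= (20 * ?q)\<^sup>2" by (simp_all only: abs_le_square_iff)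
 hence "?q * qq w <= ?q * (800 * ?q)" unfolding XY_norm[symmetric] by (simp add: power2_eq_square)
 hence "qq w <= 800 * ?q" using q0 by simp
 also have "... <= 800 * (1600 * l'\<^sup>2 * (Ga + 5)\<^sup>2)" unfolding q using n2_bounds by (intro mult_left_mono) auto
 also have "... <= (1132 * l' * (Ga + 5))\<^sup>2" by (simp add: power_mult_distrib)
 finally have qw: "qq w <= (1132 * l' * (Ga + 5))\<^sup>2" .
 have nn: "0 <= 1132 * l' * (Ga + 5)" using l0 G_big by simp
 have "(fst w)\<^sup>2 <= (1132 * l' * (Ga + 5))\<^sup>2" "(snd w)\<^sup>2 <= (1132 * l' * (Ga + 5))\<^sup>2"
  using qw zero_le_power2[of "fst w"] zero_le_power2[of "snd w"] unfolding qq_def by linarith+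
 hence w: "\<bar>fst w\<bar> <= 1132 * l' * (Ga + 5)" "\<bar>snd w\<bar> <= 1132 * l' * (Ga + 5)"
  using nn by (metis abs_le_square_iff abs_of_nonneg)+
 have Gab: "0 <= Ga + 5" using G_big by simp
 have "a\<^sup>2 <= (Ga + 5)\<^sup>2" "b\<^sup>2 <= (Ga + 5)\<^sup>2" using n2_bounds zero_le_power2[of a] zero_le_power2[of b] by linarith+
 hence ab: "\<bar>a\<bar> <= Ga + 5" "\<bar>b\<bar> <= Ga + 5" using Gab by (metis abs_le_square_iff abs_of_nonneg)+
 have A: "\<bar>c * z\<bar> <= 20 * l' * (Ga + 5)" if "\<bar>z\<bar> <= Ga + 5" for z
  unfolding c abs_mult using that l0 by (auto intro!: mult_left_mono)
 have B: "\<bar>(45 * i + 3) * (2 * c * z)\<bar> <= (l + 120 * l') * (Ga + 5)" if "\<bar>z\<bar> <= Ga + 5" for z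
 proof -
  have "(45 * i + 3) * (2 * c * z) = ((1800 * i + 120) * l') * z" unfolding c by algebra
  moreover have "\<bar>((1800 * i + 120) * l') * z\<bar> = (1800 * i + 120) * l' * \<bar>z\<bar>" using i l0 by (simp add: abs_mult)
  ultimately have "\<bar>(45 * i + 3) * (2 * c * z)\<bar> = (1800 * i + 120) * l' * \<bar>z\<bar>" by (simp only:)
  also have "... <= (g + 120) * l' * (Ga + 5)" using that i m l0 g by (intro mult_mono) auto
  finally show ?thesis unfolding l(1) by (simp add: algebra_simps)
 qed
 have fin: "Ga * l + l + (l + 120 * l') * (Ga + 5) + 20 * l' * (Ga + 5) + 1132 * l' * (Ga + 5) <= 3 * (Ga * l)"
 proof -
  have 1: "3000 * (Ga * l') <= Ga * l"
  proof -
   have "(Ga * l') * 3000 <= (Ga * l') * g" using g l0 G_big by (intro mult_left_mono) auto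
   thus ?thesis unfolding l(1) by (simp only: mult_ac)
  qed
  have 2: "9000000 * l' <= Ga * l'" using l0 G_big by (intro mult_right_mono) auto
  have 3: "9000000 * l <= Ga * l" using l0 G_big by (intro mult_right_mono) auto
  have "Ga * l + l + (l + 120 * l') * (Ga + 5) + 20 * l' * (Ga + 5) + 1132 * l' * (Ga + 5) =
   2 * (Ga * l) + 6 * l + 1272 * (Ga * l') + 6360 * l'" by algebra
  thus ?thesis using 1 2 3 l0 by linarith
 qed
 have e: "fst v - fst x = fst w - c * b + (45 * i + 3) * (2 * c * a)" "snd v - snd x = snd w + c * a + (45 * i + 3) * (2 * c * b)"
  unfolding w_def tau_def by simp_all
 have "\<bar>fst v - fst x\<bar> <= 1132 * l' * (Ga + 5) + 20 * l' * (Ga + 5) + (l + 120 * l') * (Ga + 5)"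
  unfolding e using w(1) A[OF ab(2)] B[OF ab(1)] by linarith
 moreover have "\<bar>snd v - snd x\<bar> <= 1132 * l' * (Ga + 5) + 20 * l' * (Ga + 5) + (l + 120 * l') * (Ga + 5)"
  unfolding e using w(2) A[OF ab(1)] B[OF ab(2)] by linarith
 moreover have "\<bar>fst x - fst x0\<bar> <= Ga * l + l" "\<bar>snd x - snd x0\<bar> <= Ga * l + l" using x0 unfolding bx_def by auto
 ultimately show "v : bx x0 (3 * (Ga * l))" unfolding bx_def using fin by (simp add: abs_le_iff)
qed

end

lemma upred_Qtau: "upred (Qtau c a b x i)"
 unfolding upred_def Qtau_def
proof (intro allI impI)
 fix K K' :: "site set" assume "K \<subseteq> K'" "Ecr (ff c a b) (trl (- tau c a b x i) ` K)"
 thus "Ecr (ff c a b) (trl (- tau c a b x i) ` K')" using upred_Ecr[of "ff c a b"] image_mono[of K K'] unfolding upred_def by metis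
qed

lemma card_grid:
 assumes l: "l > 0" and r: "r >= 0"
 shows "finite (gr l ` bx x0 (r * l))" "card (gr l ` bx x0 (r * l)) <= nat ((2 * r + 1)\<^sup>2)"
proof -
 let ?R = "{fst x0 div l - r..fst x0 div l + r} \<times> {snd x0 div l - r..snd x0 div l + r}"
 show "finite (gr l ` bx x0 (r * l))" using finite_bx by simp
 have d: "u div l : {z div l - r..z div l + r}" if "\<bar>u - z\<bar> <= r * l" for u z
 proof -
  have "(z + (- r) * l) div l <= u div l" "u div l <= (z + r * l) div l" using that l by (intro zdiv_mono1; simp add: abs_le_iff)+
  thus ?thesis using l by (simp only: div_mult_self1[of l] atLeastAtMost_iff) auto
 qed
 have sub: "gr l ` bx x0 (r * l) \<subseteq> (%z. (l * fst z, l * snd z)) ` ?R"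
 proof
  fix w assume "w : gr l ` bx x0 (r * l)"
  then obtain v where v: "v : bx x0 (r * l)" "w = gr l v" by blast
  have "(fst v div l, snd v div l) : ?R" using v(1) d unfolding bx_def by (auto simp del: atLeastAtMost_iff)
  thus "w : (%z. (l * fst z, l * snd z)) ` ?R" unfolding v(2) gr_def by (intro image_eqI[of _ _ "(fst v div l, snd v div l)"]) simp_all
 qed
 have "card (gr l ` bx x0 (r * l)) <= card ((%z. (l * fst z, l * snd z)) ` ?R)" by (intro card_mono sub) auto
 also have "... <= card ?R" by (intro card_image_le) auto
 also have "... = nat ((2 * r + 1)\<^sup>2)" using r by (simp add: card_cartesian_product nat_mult_distrib[symmetric] power2_eq_square)
 finally show "card (gr l ` bx x0 (r * l)) <= nat ((2 * r + 1)\<^sup>2)" .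
qed

context gauss
begin

lemma ap_prod_le:
 assumes b: "be > 0" and L: "finite L" and I: "finite I" and Bs: "!!i. i : I ==> Bs i \<subseteq> L"
  and sp: "!!i j. i : I ==> j : I ==> i ~= j ==> sep (Bs i) (Bs j)" and Q: "!!i. i : I ==> upred (Q i)"
 shows "ap be L (%K. ALL i:I. Q i (K Int Bs i)) <= (\<Prod>i\<in>I. ap be (Bs i) (Q i))"
proof -
 have fB: "finite (Bs i)" if "i : I" for i using Bs[OF that] L finite_subset by blast
 have "ap be L (%K. ALL i:I. Q i (K Int Bs i)) <= (LINT h|Gm. (\<Prod>i\<in>I. kp be (Bs i) h (%v. - h v) (Q i)))"
  unfolding ap_def
 proof (rule integral_mono[OF kp_integrable[OF b L]])
  show "integrable Gm (%h. \<Prod>i\<in>I. kp be (Bs i) h (%v. - h v) (Q i))"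
  proof (rule integrable_bounded[where c = 1])
   fix h
   have "0 <= (\<Prod>i\<in>I. kp be (Bs i) h (%v. - h v) (Q i))" by (intro prod_nonneg ballI kp_ge0[OF b fB])
   moreover have "(\<Prod>i\<in>I. kp be (Bs i) h (%v. - h v) (Q i)) <= 1" by (intro prod_le_1 conjI kp_ge0[OF b fB] kp_le1[OF b fB])
   ultimately show "\<bar>\<Prod>i\<in>I. kp be (Bs i) h (%v. - h v) (Q i)\<bar> <= 1" by simp
  qed measurable
  show "kp be L h (%v. - h v) (%K. ALL i:I. Q i (K Int Bs i)) <= (\<Prod>i\<in>I. kp be (Bs i) h (%v. - h v) (Q i))" for h
   by (rule kp_prod[OF b L I Bs sp Q])
 qed
 also have "... = (\<Prod>i\<in>I. ap be (Bs i) (Q i))" by (rule ap_prod[OF b I fB sp])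
 finally show ?thesis .
qed

lemma ap_or_le:
 assumes "be > 0" "finite B"
 shows "ap be B (%K. P K \<or> Q K) <= ap be B P + ap be B Q"
 using ap_Ex_le[OF assms, of "UNIV :: bool set" "%i. if i then P else Q"] by (simp add: UNIV_bool ex_bool_eq disj_commute)

lemma ap_Qtau: "ap be (Btau c a b x i) (Qtau c a b x i) = ap be (Gf (ff c a b)) (Ecr (ff c a b))"
proof -
 have "trl (- t) ` trl t ` K = K" for t K unfolding image_image trl_minus by (simp add: trl_minus(1) trl_minus(3))
 thus ?thesis unfolding Btau_def ap_autom[OF trl_autom] Qtau_def by simp
qed

text \<open>A union bound over the alternatives of \<open>short_dichotomy\<close>. Two separated
  short paths cost q^2; a nearly straight path has to cross \<open>m\<close> separated tubes and
  costs rh ^ m. The prefactor counts pairs of grid cells.\<close>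

lemma short_recursion:
 assumes b: "be > 0" and rho: "!!f. 16 <= qq f ==> ap be (Gf f) (Ecr f) <= rh"
  and g: "g >= 3000" "1800 * int m <= g" and l: "l = g * l'" "l' >= g" and G: "Ga = g\<^sup>2" and L: "La > 0"
  and q: "!!x. ap be (bx x (3 * l)) (Sh l La x) <= q"
 shows "ap be (bx x0 (3 * (Ga * l))) (Sh (Ga * l) ((of_int Ga + 1) * La) x0) <= (of_int ((6 * Ga + 1)\<^sup>2))\<^sup>2 * (q\<^sup>2 + rh ^ m)"
proof -
 let ?L = "bx x0 (3 * (Ga * l))" and ?X = "gr l ` bx x0 (3 * Ga * l)"
 have g0: "g * g >= 3000 * g" using g by (intro mult_right_mono) auto
 have G0: "Ga >= 9000000" using g0 g unfolding G power2_eq_square by linarith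
 have lg: "l >= Ga" unfolding l(1) G power2_eq_square using g l(2) by (intro mult_left_mono) auto
 have l0: "l > 0" using lg G0 by linarith
 have Gl: "9000000 * l <= Ga * l" using G0 l0 by (intro mult_right_mono) auto
 have fL: "finite ?L" by (rule finite_bx)
 have fX: "finite ?X" "card ?X <= nat ((6 * Ga + 1)\<^sup>2)" using card_grid[OF l0, of "3 * Ga" x0] G0 by auto
 have q0: "0 <= q" using q ap_ge0[OF b finite_bx] order_trans by blast
 have mono_bx: "bx x r \<subseteq> bx x r'" if "r <= r'" for x r r' using that unfolding bx_def by auto
 have XS: "gr l ` bx x0 (Ga * l) \<subseteq> ?X" "gr l ` bx x0 (2 * Ga * l + 1) \<subseteq> ?X"
  using Gl l0 by (intro image_mono mono_bx; linarith)+
 have inL: "bx x (3 * l) \<subseteq> ?L" if "x : gr l ` bx x0 (2 * Ga * l + 1)" for x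
 proof
  fix v assume v: "v : bx x (3 * l)"
  from that obtain u where u: "u : bx x0 (2 * Ga * l + 1)" "x = gr l u" by blast
  have a: "\<bar>fst u - fst x0\<bar> <= 2 * Ga * l + 1" "\<bar>snd u - snd x0\<bar> <= 2 * Ga * l + 1" using u(1) unfolding bx_def by auto
  have c: "\<bar>fst v - fst x\<bar> <= 3 * l" "\<bar>snd v - snd x\<bar> <= 3 * l" using v unfolding bx_def by auto
  have d: "0 <= fst u - fst x" "fst u - fst x < l" "0 <= snd u - snd x" "snd u - snd x < l" unfolding u(2) using gr_bounds[OF l0, of u] by auto
  have "\<bar>fst v - fst x0\<bar> <= 3 * (Ga * l)" using a(1) c(1) d(1,2) Gl l0 by linarith
  moreover have "\<bar>snd v - snd x0\<bar> <= 3 * (Ga * l)" using a(2) c(2) d(3,4) Gl l0 by linarith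
  ultimately show "v : ?L" unfolding bx_def by simp
 qed
 define P where "P = {z : gr l ` bx x0 (2 * Ga * l + 1) \<times> gr l ` bx x0 (2 * Ga * l + 1). sep (bx (fst z) (3 * l)) (bx (snd z) (3 * l))}"
 define R where "R = {z : gr l ` bx x0 (Ga * l) \<times> gr l ` bx x0 (2 * Ga * l + 1). of_int ((Ga - 4) * l) <= dE (fst z) (snd z) & dE (fst z) (snd z) <= of_int ((Ga + 5) * l)}"
 have PR: "P \<subseteq> ?X \<times> ?X" "R \<subseteq> ?X \<times> ?X" unfolding P_def R_def using XS by auto
 have cb: "real (card Z) <= (of_int ((6 * Ga + 1)\<^sup>2))\<^sup>2" if "Z \<subseteq> ?X \<times> ?X" for Z
 proof -
  have "card Z <= card (?X \<times> ?X)" using fX that by (intro card_mono) auto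
  hence "real (card Z) <= real (card ?X) * real (card ?X)" by (simp add: card_cartesian_product flip: of_nat_mult)
  also have "... <= of_int ((6 * Ga + 1)\<^sup>2) * of_int ((6 * Ga + 1)\<^sup>2)"
  proof -
   have "int (card ?X) <= (6 * Ga + 1)\<^sup>2" using fX(2) by (simp add: le_nat_iff)
   hence "real (card ?X) <= of_int ((6 * Ga + 1)\<^sup>2)" by (metis of_int_le_iff of_int_of_nat_eq)
   thus ?thesis by (intro mult_mono) auto
  qed
  finally show ?thesis by (simp add: power2_eq_square)
 qed
 have fin: "finite P" "finite R" using PR fX finite_subset by blast+
 let ?A = "%z K. Sh l La (fst z) K & Sh l La (snd z) K" and ?S = "%z K. St Ga l (fst z) (snd z) K"
 have A: "ap be ?L (?A z) <= q\<^sup>2" if z: "z : P" for z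
 proof -
  have zm: "fst z : gr l ` bx x0 (2 * Ga * l + 1)" "snd z : gr l ` bx x0 (2 * Ga * l + 1)" "sep (bx (fst z) (3 * l)) (bx (snd z) (3 * l))"
   using z unfolding P_def by (simp_all add: mem_Times_iff)
  note zz = zm(3) inL[OF zm(1)] inL[OF zm(2)]
  have "fst z : bx (fst z) (3 * l)" using l0 unfolding bx_def by simp
  hence ne: "fst z ~= snd z" using zz(1) unfolding sep_def by auto
  have "ap be ?L (?A z) <= ap be ?L (%K. ALL x:{fst z, snd z}. Sh l La x (K Int bx x (3 * l)))"
  proof (rule ap_mono[OF b fL])
   have s: "Sh l La x K ==> Sh l La x (K Int bx x (3 * l))" for x K unfolding Sh_def by blast
   fix K assume "?A z K"
   thus "ALL x:{fst z, snd z}. Sh l La x (K Int bx x (3 * l))" using s by blast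
  qed
  also have "... <= (\<Prod>x\<in>{fst z, snd z}. ap be (bx x (3 * l)) (Sh l La x))"
  proof (rule ap_prod_le[OF b fL])
   show "finite {fst z, snd z}" by simp
  qed (use zz sep_sym upred_Sh in blast)+
  also have "... = ap be (bx (fst z) (3 * l)) (Sh l La (fst z)) * ap be (bx (snd z) (3 * l)) (Sh l La (snd z))" using ne by simp
  also have "... <= q * q" by (intro mult_mono q q0 ap_ge0[OF b finite_bx])
  finally show ?thesis by (simp add: power2_eq_square)
 qed
 have B: "ap be ?L (?S z) <= rh ^ m" if z: "z : R" for z
 proof -
  obtain u w where uw: "u : bx x0 (Ga * l)" "fst z = gr l u" "snd z = gr l w" using z unfolding R_def by auto
  define a' b' where "a' = fst w div l - fst u div l" and "b' = snd w div l - snd u div l"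
  interpret D: direction g l l' "int m" Ga a' b' "20 * l'" "fst z" "snd z"
   by unfold_locales (use g l G z in \<open>auto simp: R_def uw gr_def a'_def b'_def right_diff_distrib\<close>)
  let ?B = "%i. Btau (20 * l') a' b' (fst z) (int i)" and ?Q = "%i. Qtau (20 * l') a' b' (fst z) (int i)"
  have x0: "fst z : bx x0 (Ga * l + l)" using uw(1) gr_bounds[OF l0, of u] unfolding uw(2) bx_def by auto
  have "ap be ?L (?S z) <= ap be ?L (%K. ALL i:{..<m}. ?Q i (K Int ?B i))"
   by (rule ap_mono[OF b fL]) (use D.St_tubes in auto)
  also have "... <= (\<Prod>i\<in>{..<m}. ap be (?B i) (?Q i))"
   by (rule ap_prod_le[OF b fL]) (use D.Btau_bx[OF x0] D.Btau_sep upred_Qtau in auto)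
  also have "... <= (\<Prod>i\<in>{..<m}. rh)"
   unfolding ap_Qtau using rho[OF D.q_ge(2)] ap_ge0[OF b finite_Gf[OF D.f0]] by (intro prod_mono) auto
  finally show ?thesis by simp
 qed
 have "ap be ?L (Sh (Ga * l) ((of_int Ga + 1) * La) x0) <= ap be ?L (%K. (EX z:P. ?A z K) \<or> (EX z:R. ?S z K))"
 proof (rule ap_mono[OF b fL])
  fix K assume S: "Sh (Ga * l) ((of_int Ga + 1) * La) x0 K"
  have G8: "Ga >= 8" using G0 by simp
  show "(EX z:P. ?A z K) \<or> (EX z:R. ?S z K)"
  proof (cases rule: short_dichotomy[OF G8 lg L S])
   case (1 x x')
   hence "(x, x') : P" "?A (x, x') K" unfolding P_def by auto
   thus ?thesis by blast
  next
   case (2 x y)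
   hence "(x, y) : R" "?S (x, y) K" unfolding R_def by auto
   thus ?thesis by blast
  qed
 qed
 also have "... <= ap be ?L (%K. EX z:P. ?A z K) + ap be ?L (%K. EX z:R. ?S z K)" by (rule ap_or_le[OF b fL])
 also have "... <= (SUM z:P. ap be ?L (?A z)) + (SUM z:R. ap be ?L (?S z))" by (intro add_mono ap_Ex_le b fL fin)
 also have "... <= (SUM z:P. q\<^sup>2) + (SUM z:R. rh ^ m)" by (intro add_mono sum_mono A B)
 also have "... = real (card P) * q\<^sup>2 + real (card R) * rh ^ m" by simp
 also have "... <= (of_int ((6 * Ga + 1)\<^sup>2))\<^sup>2 * q\<^sup>2 + (of_int ((6 * Ga + 1)\<^sup>2))\<^sup>2 * rh ^ m"
 proof -
  have "0 <= rh"
  proof -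
   have "16 <= qq (4, 0)" by (simp add: qq_def)
   from rho[OF this] show ?thesis using ap_ge0[OF b finite_Gf, of "(4, 0)" "Ecr (4, 0)"] by simp
  qed
  thus ?thesis using cb[OF PR(1)] cb[OF PR(2)] by (intro add_mono mult_right_mono) auto
 qed
 finally show ?thesis by (simp add: distrib_left)
qed

end

context gauss
begin

lemma ap_False: "be > 0 ==> finite B ==> ap be B (%K. False) = 0"
 unfolding ap_def kp_def by (simp add: kexp_const)

text \<open>From one scale to the next the distance is multiplied by \<open>Ga\<close> and the
  allowed length by \<open>Ga + 1\<close>, which gives the superlinear exponent ln (Ga + 1) / ln Ga.
  The recursion keeps the probability below a fixed \<open>q\<close>, which is small because
  \<open>A\<close> grows only polynomially in \<open>m\<close>.\<close>

theorem short_rare: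
 assumes "ka > 0"
 shows "\<exists>Ga\<ge>2::int. \<forall>be>0. \<forall>k x. ap be (bx x (3 * Ga ^ Suc k)) (Sh (Ga ^ Suc k) (of_int Ga * (of_int Ga + 1) ^ k) x) <= ka"
proof -
 obtain rh where rh: "rh < 1" "!!be f. be > 0 ==> 16 <= qq f ==> ap be (Gf f) (Ecr f) <= rh" using tube_bound by blast
 have rho0: "0 <= rh"
 proof -
  have "16 <= qq (4, 0)" by (simp add: qq_def)
  from rh(2)[of 1, OF _ this] show ?thesis using ap_ge0[of 1 "Gf (4, 0)" "Ecr (4, 0)"] finite_Gf[of "(4, 0)"] by simp
 qed
 \<comment> \<open>\<open>A\<close> is of order m ^ 8, so A^2 * rh ^ m is at most a multiple of (m *
   r ^ m) ^ 16.\<close>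
 define r where "r = root 16 rh"
 have r: "0 <= r" "r < 1" "r ^ 16 = rh" unfolding r_def using rho0 rh(1) by (auto simp: real_root_pow_pos2)
 define C :: real where "C = 4 * (7 * 1800\<^sup>2) ^ 8"
 define te where "te = min 1 (min 1 ka / C)"
 have C: "C > 0" unfolding C_def by simp
 have th: "0 < te" "te <= 1" "C * te <= min 1 ka"
 proof -
  show "0 < te" "te <= 1" using assms C by (auto simp: te_def)
  have "C * te <= C * (min 1 ka / C)" using C by (intro mult_left_mono) (auto simp: te_def)
  thus "C * te <= min 1 ka" using C by simp
 qed
 have "(%n. real n * r ^ n) \<longlonglongrightarrow> 0" using powser_times_n_limit_0[of r] r by simp
 hence "eventually (%n. real n * r ^ n < te) sequentially" using th(1) by (rule order_tendstoD)
 then obtain m where m: "m >= 2" "real m * r ^ m < te"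
  unfolding eventually_sequentially by (meson max.cobounded1 max.cobounded2)
 define g where "g = 1800 * int m"
 define Ga where "Ga = g\<^sup>2"
 define A :: real where "A = (of_int ((6 * Ga + 1)\<^sup>2))\<^sup>2"
 have g: "g >= 3000" using m by (simp add: g_def)
 have gg: "3000 * 3000 <= g * g" using g by (intro mult_mono) auto
 have G2: "Ga >= 2" using gg unfolding Ga_def power2_eq_square by linarith
 have A1: "A >= 1"
 proof -
  have "(1::int) <= ((6 * Ga + 1)\<^sup>2)\<^sup>2" using G2 by (intro one_le_power) auto
  hence "real_of_int 1 <= real_of_int (((6 * Ga + 1)\<^sup>2)\<^sup>2)" by (simp only: of_int_le_iff)
  thus ?thesis unfolding A_def by simp
 qed
 have small: "4 * A\<^sup>2 * rh ^ m <= min 1 ka"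
 proof -
  have "A <= ((7 * 1800\<^sup>2 * (real m)\<^sup>2)\<^sup>2)\<^sup>2"
  proof -
   have "6 * Ga + 1 <= 7 * Ga" using G2 by simp
   hence "((6 * Ga + 1)\<^sup>2)\<^sup>2 <= ((7 * Ga)\<^sup>2)\<^sup>2" using G2 by (intro power_mono) auto
   hence "real_of_int (((6 * Ga + 1)\<^sup>2)\<^sup>2) <= real_of_int (((7 * Ga)\<^sup>2)\<^sup>2)" by (simp only: of_int_le_iff)
   also have "... = ((7 * 1800\<^sup>2 * (real m)\<^sup>2)\<^sup>2)\<^sup>2" unfolding Ga_def g_def by (simp add: power_mult_distrib)
   finally show ?thesis unfolding A_def by simp
  qed
  hence "A\<^sup>2 <= (((7 * 1800\<^sup>2 * (real m)\<^sup>2)\<^sup>2)\<^sup>2)\<^sup>2" using A1 by (intro power_mono) auto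
  also have "... = (7 * 1800\<^sup>2) ^ 8 * real m ^ 16" by (simp add: power_mult_distrib power_mult[symmetric])
  finally have "4 * A\<^sup>2 * rh ^ m <= 4 * ((7 * 1800\<^sup>2) ^ 8 * real m ^ 16) * rh ^ m"
   using rho0 by (intro mult_right_mono mult_left_mono) auto
  also have "... = C * (real m * r ^ m) ^ 16"
   unfolding C_def r(3)[symmetric] by (simp add: power_mult_distrib power_mult[symmetric] mult.commute)
  also have "... <= C * te ^ 16" using C m(2) r by (intro mult_left_mono power_mono) auto
  also have "... <= C * te" using C th power_decreasing[of 1 16 te] by (intro mult_left_mono) auto
  finally show ?thesis using th(3) by linarith
 qed
 \<comment> \<open>Balances the recursion: A * rh ^ m is half of \<open>q\<close>, and A * q <= 1/2
   makes the quadratic term at most the other half.\<close>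
 define q where "q = 2 * A * rh ^ m"
 have q0: "0 <= q" using A1 rho0 unfolding q_def by simp
 have Aq: "A * q <= 1 / 2"
 proof -
  have "4 * A\<^sup>2 * rh ^ m <= 1" using small by simp
  thus ?thesis unfolding q_def by (simp add: power2_eq_square mult_ac)
 qed
 have qk: "q <= ka"
 proof -
  have "1 * q <= 2 * A * q" using A1 q0 by (intro mult_right_mono) auto
  also have "... = 4 * A\<^sup>2 * rh ^ m" unfolding q_def by (simp add: power2_eq_square)
  finally show ?thesis using small by simp
 qed
 have rec: "A * (q\<^sup>2 + rh ^ m) <= q"
 proof -
  have "A * q * q <= 1 / 2 * q" using Aq q0 by (rule mult_right_mono)
  moreover have "A * rh ^ m = q / 2" unfolding q_def by simp
  ultimately show ?thesis by (simp add: power2_eq_square distrib_left)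
 qed
 have "ap be (bx x (3 * Ga ^ Suc k)) (Sh (Ga ^ Suc k) (of_int Ga * (of_int Ga + 1) ^ k) x) <= q" if b: "be > 0" for be k x
 proof (induction k arbitrary: x)
  \<comment> \<open>A path of fewer than \<open>Ga\<close> lattice steps cannot reach distance
    \<open>Ga\<close>, so the event is empty at the lowest scale.\<close>
  case 0
  have "ap be (bx x (3 * Ga ^ Suc 0)) (Sh (Ga ^ Suc 0) (of_int Ga * (of_int Ga + 1) ^ 0) x) <= ap be (bx x (3 * Ga ^ Suc 0)) (%K. False)"
  proof (rule ap_mono[OF b finite_bx])
   fix K assume "Sh (Ga ^ Suc 0) (of_int Ga * (of_int Ga + 1) ^ 0) x K"
   then obtain p n where "spath p n" "of_int Ga <= dE (p 0) (p n)" "real n < of_int Ga" unfolding Sh_def by auto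
   thus False using dE_spath[of p n 0 n] by simp
  qed
  thus ?case using ap_False[OF b finite_bx] q0 by simp
 next
  case (Suc k)
  define l' where "l' = g * Ga ^ k"
  have l: "Ga ^ Suc k = g * l'" unfolding l'_def Ga_def by (simp add: power2_eq_square)
  have "g * 1 <= g * Ga ^ k" using g G2 by (intro mult_left_mono one_le_power) auto
  hence l': "l' >= g" unfolding l'_def by simp
  have L: "0 < of_int Ga * (of_int Ga + 1 :: real) ^ k" using G2 by simp
  have g1: "1800 * int m <= g" unfolding g_def by simp
  have "ap be (bx x (3 * (Ga * Ga ^ Suc k))) (Sh (Ga * Ga ^ Suc k) ((of_int Ga + 1) * (of_int Ga * (of_int Ga + 1) ^ k)) x) <= A * (q\<^sup>2 + rh ^ m)"
   unfolding A_def by (rule short_recursion[OF b rh(2)[OF b] g g1 l l' Ga_def L Suc])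
  thus ?case using rec by (simp add: mult_ac)
 qed
 from order_trans[OF this qk] show ?thesis using G2 by blast
qed

end

section \<open>Chains of grid cells along a path\<close>

definition nb :: "int => site => site set" where
 "nb l x = (%z. (fst x + l * fst z, snd x + l * snd z)) ` ({-10..10} \<times> {-10..10})"

fun CH :: "int => site => nat => site list set" where
 "CH l x 0 = {[x]}"
| "CH l x (Suc n) = (\<Union>y\<in>nb l x. (#) x ` CH l y n)"

lemma nb_card: "finite (nb l x)" "card (nb l x) <= 441"
proof -
 show "finite (nb l x)" unfolding nb_def by simp
 have "card (nb l x) <= card ({-10..10::int} \<times> {-10..10::int})" unfolding nb_def by (rule card_image_le) simp
 thus "card (nb l x) <= 441" by (simp add: card_cartesian_product)
qed

lemma CH_card: "finite (CH l x n) & card (CH l x n) <= 441 ^ n"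
proof (induction n arbitrary: x)
 case (Suc n)
 have "card (CH l x (Suc n)) <= (SUM y:nb l x. card ((#) x ` CH l y n))" unfolding CH.simps by (rule card_UN_le[OF nb_card(1)])
 also have "... <= (SUM y:nb l x. 441 ^ n)" using Suc by (intro sum_mono) (meson card_image_le order_trans)
 also have "... <= 441 * 441 ^ n" using nb_card(2) by simp
 finally show ?case using nb_card(1) Suc by simp
qed simp

text \<open>Each new cell is the one entered after the last visit to the box of radius 8 * l around
  the previous cell. Last exits, unlike first exits, keep all later cells away from all earlier
  ones. A step moves by at most 10 * l, which accounts for the length of the chain and for the range
  in \<open>nb\<close>.\<close>

lemma last_exit_chain:
 assumes p: "spath p N" and l: "l >= 1" and i: "i <= N" and far: "p N ~: bx (p i) (10 * l * int n)"
 shows "EX xs:CH l (gr l (p i)) n. \<exists>t. t 0 = i & (\<forall>j\<le>n. xs ! j = gr l (p (t j)) & t j <= N) &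
  (\<forall>j<n. t j < t (Suc j) & (\<forall>k. t (Suc j) <= k --> k <= N --> p k ~: bx (xs ! j) (8 * l)))"
 using i far
proof (induction n arbitrary: i)
 case 0
 thus ?case by (intro bexI[of _ "[gr l (p i)]"] exI[of _ "%_. i"]) auto
next
 case (Suc n)
 let ?x = "gr l (p i)"
 have l0: "l > 0" using l by simp
 note gi = gr_bounds[OF l0, of "p i"]
 define S where "S = {k. k <= N & p k : bx ?x (8 * l)}"
 have iS: "i : S" unfolding S_def bx_def using Suc.prems(1) gi by auto
 have fS: "finite S" unfolding S_def by simp
 define i' where "i' = Suc (Max S)"
 have MS: "Max S : S" using iS fS Max_in by blast
 have nl: "0 <= 10 * l * int n" using l by simp
 have NS: "N ~: S"
 proof
  assume "N : S"
  hence a: "\<bar>fst (p N) - fst ?x\<bar> <= 8 * l" "\<bar>snd (p N) - snd ?x\<bar> <= 8 * l" unfolding S_def bx_def by auto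
  have "\<bar>fst (p N) - fst (p i)\<bar> <= 10 * l" "\<bar>snd (p N) - snd (p i)\<bar> <= 10 * l" using a gi l by linarith+
  moreover have "10 * l * int (Suc n) = 10 * l + 10 * l * int n" by (simp add: algebra_simps)
  ultimately have "p N : bx (p i) (10 * l * int (Suc n))" unfolding bx_def mem_Collect_eq using nl by (intro conjI) linarith+
  thus False using Suc.prems(2) by blast
 qed
 have MN: "Max S < N" using MS NS unfolding S_def by (metis (mono_tags, lifting) mem_Collect_eq order_le_imp_less_or_eq)
 have out: "p k ~: bx ?x (8 * l)" if "i' <= k" "k <= N" for k
 proof
  assume "p k : bx ?x (8 * l)"
  hence "k : S" using that unfolding S_def by simp
  from Max_ge[OF fS this] show False using that unfolding i'_def by simp
 qed
 have ad: "adj (p (Max S)) (p i')" using p MN unfolding spath_def i'_def by simp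
 have c: "\<bar>fst (p i') - fst ?x\<bar> <= 8 * l + 1" "\<bar>snd (p i') - snd ?x\<bar> <= 8 * l + 1"
 proof -
  have "\<bar>fst (p (Max S)) - fst ?x\<bar> <= 8 * l" "\<bar>snd (p (Max S)) - snd ?x\<bar> <= 8 * l" using MS[unfolded S_def] by (auto simp: bx_def S_def)
  thus "\<bar>fst (p i') - fst ?x\<bar> <= 8 * l + 1" "\<bar>snd (p i') - snd ?x\<bar> <= 8 * l + 1" using ad unfolding adj_def by linarith+
 qed
 have far': "p N ~: bx (p i') (10 * l * int n)"
 proof
  assume "p N : bx (p i') (10 * l * int n)"
  hence a: "\<bar>fst (p N) - fst (p i')\<bar> <= 10 * l * int n" "\<bar>snd (p N) - snd (p i')\<bar> <= 10 * l * int n" unfolding bx_def by auto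
  have "\<bar>fst (p N) - fst (p i)\<bar> <= 10 * l * int n + 10 * l" "\<bar>snd (p N) - snd (p i)\<bar> <= 10 * l * int n + 10 * l"
   using a c gi l by linarith+
  hence "p N : bx (p i) (10 * l * int (Suc n))" unfolding bx_def by (simp add: algebra_simps)
  thus False using Suc.prems(2) by blast
 qed
 have i'N: "i' <= N" using MN unfolding i'_def by simp
 from Suc.IH[OF i'N far'] obtain xs t where xt: "xs : CH l (gr l (p i')) n" "t 0 = i'" "!!j. j <= n ==> xs ! j = gr l (p (t j)) & t j <= N"
  "!!j. j < n ==> t j < t (Suc j) & (\<forall>k. t (Suc j) <= k --> k <= N --> p k ~: bx (xs ! j) (8 * l))" by blast
 have "gr l (p i') : nb l ?x"
 proof -
  note gi' = gr_bounds[OF l0, of "p i'"]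
  let ?a = "fst (p i') div l - fst (p i) div l" and ?b = "snd (p i') div l - snd (p i) div l"
  have e: "fst (gr l (p i')) - fst ?x = l * ?a" "snd (gr l (p i')) - snd ?x = l * ?b" by (simp_all add: gr_def right_diff_distrib)
  have "l * \<bar>?a\<bar> <= l * 10" "l * \<bar>?b\<bar> <= l * 10"
   using c gi' l arg_cong[OF e(1), of abs] arg_cong[OF e(2), of abs] by (simp_all only: abs_mult abs_of_pos[OF l0]) linarith+
  hence "\<bar>?a\<bar> <= 10" "\<bar>?b\<bar> <= 10" using l0 by simp_all
  hence "(?a, ?b) : {-10..10} \<times> {-10..10}" by (simp add: abs_le_iff)
  moreover have "gr l (p i') = (fst ?x + l * fst (?a, ?b), snd ?x + l * snd (?a, ?b))" using e by (simp add: prod_eq_iff algebra_simps)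
  ultimately show ?thesis unfolding nb_def by blast
 qed
 hence xs': "?x # xs : CH l ?x (Suc n)" using xt(1) by auto
 define t' where "t' j = (case j of 0 => i | Suc j => t j)" for j
 show ?case
 proof (intro bexI[OF _ xs'] exI[of _ t'] conjI allI impI)
  show "t' 0 = i" by (simp add: t'_def)
  fix j
  show "(?x # xs) ! j = gr l (p (t' j))" "t' j <= N" if "j <= Suc n"
   using that xt(3)[of "j - 1"] Suc.prems(1) by (cases j; simp add: t'_def)+
  show "t' j < t' (Suc j)" if "j < Suc n"
  proof (cases j)
   case 0
   thus ?thesis using Max_ge[OF fS iS] xt(2) by (simp add: t'_def i'_def)
  next
   case (Suc j')
   thus ?thesis using xt(4)[of j'] that by (simp add: t'_def)
  qed
  show "p k ~: bx ((?x # xs) ! j) (8 * l)" if "j < Suc n" "t' (Suc j) <= k" "k <= N" for k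
  proof (cases j)
   case 0
   thus ?thesis using out[of k] that xt(2) by (simp add: t'_def)
  next
   case (Suc j')
   thus ?thesis using xt(4)[of j'] that by (simp add: t'_def)
  qed
 qed
qed

definition chainev :: "int => site set => site set => nat => (site => site set => bool) => site set => bool" where
 "chainev l L X n Q K \<longleftrightarrow> (EX x:X. EX xs:CH l x n. \<exists>J\<subseteq>{..<n}. n <= 2 * card J & (ALL j:J. bx (xs ! j) (3 * l) \<subseteq> L & Q (xs ! j) (K Int bx (xs ! j) (3 * l))) &
   (ALL i:J. ALL j:J. i ~= j --> sep (bx (xs ! i) (3 * l)) (bx (xs ! j) (3 * l))))"

text \<open>\<open>R\<close> marks the steps of the chain that count. Unmarked steps take at least
  \<open>La\<close> steps of the path each, so a path with fewer than n / 2 * La steps has fewer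
  than n / 2 of them.\<close>

lemma path_chainev:
 assumes p: "spath p N" "!!k. k <= N ==> bx (gr l (p k)) (3 * l) \<subseteq> L" and l: "l >= 1"
  and far: "p N ~: bx (p 0) (10 * l * int n)" and X: "gr l (p 0) : X"
  and Q: "!!i j. i < j ==> j <= N ==> R (j - i) ==> p j ~: bx (gr l (p i)) (8 * l) ==> Q (gr l (p i)) (K Int bx (gr l (p i)) (3 * l))"
  and N: "!!d. ~ R d ==> La <= real d" "real N < real n / 2 * La" "La > 0"
 shows "chainev l L X n Q K"
proof -
 have l0: "l > 0" using l by simp
 from last_exit_chain[OF p(1) l _ far] obtain xs t where xt: "xs : CH l (gr l (p 0)) n" "t 0 = 0" "!!j. j <= n ==> xs ! j = gr l (p (t j))" "!!j. j <= n ==> t j <= N"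
  "!!j. j < n ==> t j < t (Suc j)" "!!j k. j < n ==> t (Suc j) <= k ==> k <= N ==> p k ~: bx (xs ! j) (8 * l)" by blast
 define J where "J = {j. j < n & R (t (Suc j) - t j)}"
 have tm: "t i <= t j" if "i <= j" "j <= n" for i j
  using that
 proof (induction j rule: dec_induct)
  case (step m)
  thus ?case using xt(5)[of m] by simp
 qed simp
 have sp: "sep (bx (xs ! i) (3 * l)) (bx (xs ! j) (3 * l))" if "i < j" "j < n" for i j
 proof (rule bx_sep)
  have "p (t j) ~: bx (xs ! i) (8 * l)" using that tm[of "Suc i" j] xt(4)[of j] by (intro xt(6)) auto
  hence "8 * l < \<bar>fst (p (t j)) - fst (xs ! i)\<bar> \<or> 8 * l < \<bar>snd (p (t j)) - snd (xs ! i)\<bar>" unfolding bx_def by auto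
  moreover have xj: "xs ! j = gr l (p (t j))" using xt(3) that by simp
  ultimately show "2 * (3 * l) + 1 < \<bar>fst (xs ! i) - fst (xs ! j)\<bar> \<or> 2 * (3 * l) + 1 < \<bar>snd (xs ! i) - snd (xs ! j)\<bar>"
   unfolding xj using gr_bounds[OF l0, of "p (t j)"] l by linarith
 qed
 have card: "n <= 2 * card J"
 proof (rule ccontr)
  assume a: "~ n <= 2 * card J"
  have "real n / 2 * La <= real (card ({..<n} - J)) * La"
  proof (rule mult_right_mono)
   have "J \<subseteq> {..<n}" unfolding J_def by auto
   hence "card ({..<n} - J) = n - card J" "card J <= n" using card_mono[of "{..<n}" J] by (simp_all add: card_Diff_subset finite_subset)
   thus "real n / 2 <= real (card ({..<n} - J))" using a by (simp add: of_nat_diff)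
  qed (use N in simp)
  also have "... = (SUM j:{..<n} - J. La)" by simp
  also have "... <= (SUM j:{..<n} - J. real (t (Suc j) - t j))" using N(1) unfolding J_def by (intro sum_mono) auto
  also have "... <= (\<Sum>j<n. real (t (Suc j) - t j))" by (intro sum_mono2) auto
  also have "... = (\<Sum>j<n. real (t (Suc j)) - real (t j))" using xt(5) by (intro sum.cong refl) (simp add: of_nat_diff less_imp_le)
  also have "... = real (t n) - real (t 0)" by (rule sum_lessThan_telescope)
  also have "... <= real N" using xt(2) xt(4)[of n] by simp
  finally show False using N(2) by simp
 qed
 show ?thesis unfolding chainev_def
 proof (intro bexI[OF _ X] bexI[OF _ xt(1)] exI[of _ J] conjI ballI impI)
  show "J \<subseteq> {..<n}" unfolding J_def by auto
  show "n <= 2 * card J" by (rule card)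
  fix j assume j: "j : J"
  hence jn: "j < n" "xs ! j = gr l (p (t j))" "t j < t (Suc j)" "t (Suc j) <= N" "R (t (Suc j) - t j)" using xt(3,4,5) unfolding J_def by auto
  show "bx (xs ! j) (3 * l) \<subseteq> L" unfolding jn(2) by (rule p(2)) (use jn in simp)
  show "Q (xs ! j) (K Int bx (xs ! j) (3 * l))" unfolding jn(2)
   by (rule Q[OF jn(3,4,5)]) (use xt(6)[OF jn(1) order_refl jn(4)] jn(2) in simp)
  fix i assume "i : J" "j ~= i"
  thus "sep (bx (xs ! j) (3 * l)) (bx (xs ! i) (3 * l))" using sp[of i j] sp[of j i] j sep_sym unfolding J_def by (cases "i < j") auto
 qed
qed

context gauss
begin

text \<open>At most 441 ^ n chains from each start and 2 ^ n choices of marked steps give 882 ^ n;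
  at least n / 2 separated events of probability at most \<open>q\<close> give sqrt q ^ n.\<close>

lemma chain_bound:
 assumes b: "be > 0" and L: "finite L" and X: "finite X" and up: "!!x. upred (Q x)" and q: "!!x. ap be (bx x (3 * l)) (Q x) <= q" "q <= 1"
 shows "ap be L (chainev l L X n Q) <= real (card X) * (882 * sqrt q) ^ n"
proof -
 have q0: "0 <= q" using q(1) ap_ge0[OF b finite_bx] order_trans by blast
 define Z where "Z = (\<Union>x\<in>X. CH l x n) \<times> Pow {..<n}"
 define Z' where "Z' = {z : Z. n <= 2 * card (snd z) & (ALL j:snd z. bx (fst z ! j) (3 * l) \<subseteq> L) & (ALL i:snd z. ALL j:snd z. i ~= j --> sep (bx (fst z ! i) (3 * l)) (bx (fst z ! j) (3 * l)))}"
 have fZ: "finite Z" unfolding Z_def using X CH_card by auto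
 have fZ': "finite Z'" unfolding Z'_def using fZ by simp
 have cZ: "real (card Z') <= real (card X) * 882 ^ n"
 proof -
  have "card Z' <= card Z" using fZ unfolding Z'_def by (intro card_mono) auto
  also have "... = card (\<Union>x\<in>X. CH l x n) * 2 ^ n" unfolding Z_def by (simp add: card_cartesian_product card_Pow)
  also have "... <= (SUM x:X. card (CH l x n)) * 2 ^ n" by (intro mult_right_mono card_UN_le X) simp
  also have "... <= (SUM x:X. 441 ^ n) * 2 ^ n" using CH_card by (intro mult_right_mono sum_mono) auto
  also have "... = card X * 882 ^ n" by (simp flip: power_mult_distrib)
  finally have "real (card Z') <= real (card X * 882 ^ n)" by (simp only: of_nat_le_iff)
  thus ?thesis by simp
 qed
 let ?E = "%z K. ALL j:snd z. Q (fst z ! j) (K Int bx (fst z ! j) (3 * l))"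
 have E: "ap be L (?E z) <= sqrt q ^ n" if z: "z : Z'" for z
 proof -
  have fz: "finite (snd z)" using z finite_subset[of "snd z" "{..<n}"] unfolding Z'_def Z_def by (auto simp: mem_Times_iff)
  have "ap be L (?E z) <= (\<Prod>j\<in>snd z. ap be (bx (fst z ! j) (3 * l)) (Q (fst z ! j)))"
   by (rule ap_prod_le[OF b L fz]) (use z up in \<open>unfold Z'_def, blast+\<close>)
  also have "... <= (\<Prod>j\<in>snd z. q)" using q ap_ge0[OF b finite_bx] by (intro prod_mono) auto
  also have "... = sqrt q ^ (2 * card (snd z))" using q0 by (simp add: power_mult)
  also have "... <= sqrt q ^ n" using z q q0 unfolding Z'_def by (intro power_decreasing) auto
  finally show ?thesis .
 qed
 have "ap be L (chainev l L X n Q) <= ap be L (%K. EX z:Z'. ?E z K)"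
 proof (rule ap_mono[OF b L])
  fix K assume "chainev l L X n Q K"
  then obtain x xs J where h: "x : X" "xs : CH l x n" "J \<subseteq> {..<n}" "n <= 2 * card J" "!!j. j : J ==> bx (xs ! j) (3 * l) \<subseteq> L"
   "!!j. j : J ==> Q (xs ! j) (K Int bx (xs ! j) (3 * l))" "!!i j. i : J ==> j : J ==> i ~= j ==> sep (bx (xs ! i) (3 * l)) (bx (xs ! j) (3 * l))"
   unfolding chainev_def by blast
  have "(xs, J) : Z'" using h(1-5,7) unfolding Z'_def Z_def by (simp add: mem_Times_iff) blast
  moreover have "?E (xs, J) K" using h(6) by simp
  ultimately show "EX z:Z'. ?E z K" by blast
 qed
 also have "... <= (SUM z:Z'. ap be L (?E z))" by (rule ap_Ex_le[OF b L fZ'])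
 also have "... <= (SUM z:Z'. sqrt q ^ n)" by (intro sum_mono E)
 also have "... = real (card Z') * sqrt q ^ n" by simp
 also have "... <= (real (card X) * 882 ^ n) * sqrt q ^ n" using cZ q0 by (intro mult_right_mono) auto
 finally show ?thesis by (simp add: power_mult_distrib)
qed

end

lemma Kc_path_in:
 assumes "v : Kc B Ob C"
 shows "\<exists>r n. r 0 = v & spath r n & (\<forall>k\<le>n. r k : Kc B Ob C) & (\<exists>w. w ~: B & adj (r n) w)"
 using assms
proof induction
 case (base v w)
 hence "v : Kc B Ob C" by (rule Kc.base)
 thus ?case using base by (intro exI[of _ "%_. v"] exI[of _ 0]) (auto simp: spath_def)
next
 case (step u v)
 then obtain r n where r: "r 0 = u" "spath r n" "!!k. k <= n ==> r k : Kc B Ob C" "\<exists>w. w ~: B & adj (r n) w" by blast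
 have vK: "v : Kc B Ob C" using step.hyps by (rule Kc.step)
 let ?r = "%i. case i of 0 => v | Suc j => r j"
 have "spath ?r (Suc n)" unfolding spath_def
 proof (intro allI impI)
  fix i assume "i < Suc n"
  thus "adj (?r i) (?r (Suc i))"
   using r(1,2) step.hyps adj_sym unfolding spath_def by (cases i) auto
 qed
 moreover have "\<forall>k\<le>Suc n. ?r k : Kc B Ob C" using r(3) vK by (auto split: nat.splits)
 ultimately show ?case using r(4) by (intro exI[of _ ?r] exI[of _ "Suc n"]) simp
qed

lemma bx_mono: "r <= r' ==> bx x r \<subseteq> bx x r'" unfolding bx_def by auto

lemma bx_nested: "v : bx x a ==> a + r <= R ==> bx v r \<subseteq> bx x R"
 unfolding bx_def by (auto simp: abs_le_iff)

lemma trl_bx: "trl x ` bx (0, 0) r = bx x r"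
proof (intro equalityI subsetI)
 fix v assume "v : bx x r"
 hence "v - x : bx (0, 0) r" unfolding bx_def by simp
 thus "v : trl x ` bx (0, 0) r" by (intro image_eqI[of _ _ "v - x"]) (simp_all only: trl_minus)
next
 fix v assume "v : trl x ` bx (0, 0) r"
 thus "v : bx x r" unfolding bx_def trl_def by auto
qed

lemma path_leaves_box:
 assumes r: "spath p n" "p 0 : bx x a" "p n ~: bx x a"
 obtains k where "k < n" "p k : bx x a" "p (Suc k) ~: bx x a" "!!j. j <= k ==> p j : bx x a"
proof -
 define m where "m = (LEAST k. p k ~: bx x a)"
 have m: "p m ~: bx x a" "m <= n" unfolding m_def using LeastI[of "%k. p k ~: bx x a", OF r(3)] Least_le[of "%k. p k ~: bx x a", OF r(3)] by auto
 have lt: "p j : bx x a" if "j < m" for j using not_less_Least[of j "%k. p k ~: bx x a"] that unfolding m_def by blast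
 have "m ~= 0" using m(1) r(2) by (cases m) auto
 then obtain k where "m = Suc k" by (cases m) auto
 thus thesis using that[of k] m lt by auto
qed

lemma card_bx: "0 <= r ==> real (card (bx x r)) = (of_int (2 * r + 1))\<^sup>2"
 unfolding bx_eq by (simp add: card_cartesian_product power2_eq_square)

section \<open>Order parameter, finite-size criterion and short crossings of annuli\<close>

context gauss
begin

text \<open>The annealed order parameter of the box of radius \<open>n\<close>.\<close>
definition mm :: "real => nat => real" where
 "mm be n = ap be (bx (0, 0) (int n)) (%K. (0, 0) : K)"

lemma upred_mem: "upred (%K. v : K)" unfolding upred_def by blast

lemma mm_trl: "ap be (bx v (int n)) (%K. v : K) = mm be n"
proof -
 have e: "v : trl v ` K \<longleftrightarrow> (0, 0) : K" for K
 proof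
  assume "v : trl v ` K"
  then obtain w where "w : K" "v = trl v w" by blast
  thus "(0, 0) : K" unfolding trl_def by (cases w) (auto simp: prod_eq_iff)
 next
  assume "(0, 0) : K"
  thus "v : trl v ` K" by (intro image_eqI[of _ _ "(0, 0)"]) (auto simp: trl_def)
 qed
 have "ap be (bx v (int n)) (%K. v : K) = ap be (trl v ` bx (0, 0) (int n)) (%K. v : K)" by (simp only: trl_bx)
 also have "... = mm be n" unfolding ap_autom[OF trl_autom] e mm_def ..
 finally show ?thesis .
qed

lemma mm_domain:
 assumes b: "be > 0" and B: "finite B" "bx v (int n) \<subseteq> B"
 shows "ap be B (%K. v : K) <= mm be n"
proof -
 have v: "v : bx v (int n)" unfolding bx_def by simp
 have "ap be B (%K. v : K) = ap be B (%K. v : K Int bx v (int n))" using v by simp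
 also have "... <= ap be (bx v (int n)) (%K. v : K)" by (rule ap_domain[OF b B upred_mem])
 finally show ?thesis unfolding mm_trl .
qed

lemma mm_domain_ge:
 assumes b: "be > 0" and B: "v : B" "B \<subseteq> bx v (int n)"
 shows "mm be n <= ap be B (%K. v : K)"
proof -
 have "mm be n = ap be (bx v (int n)) (%K. v : K Int B)" unfolding mm_trl[symmetric, of be n v] using B by simp
 also have "... <= ap be B (%K. v : K)" by (rule ap_domain[OF b finite_bx B(2) upred_mem])
 finally show ?thesis .
qed

lemma mm_mono: "be > 0 ==> m <= n ==> mm be n <= mm be m"
 unfolding mm_trl[symmetric, of be n "(0, 0)"] by (rule mm_domain[OF _ finite_bx bx_mono]) auto

lemma mm_01: "be > 0 ==> 0 <= mm be n" "be > 0 ==> mm be n <= 1"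
 unfolding mm_def by (rule ap_ge0[OF _ finite_bx], assumption) (rule ap_le1[OF _ finite_bx])

lemma ap_mono_Kc:
 assumes b: "be > 0" "finite B" and Q: "!!Ob C. Q (Kc B Ob C) ==> Q' (Kc B Ob C)"
 shows "ap be B Q <= ap be B Q'"
 unfolding ap_def kp_def
 using kp_integrable[OF b] unfolding kp_def by (intro integral_mono kexp_mono[OF b]) (use Q in auto)

text \<open>A cluster entering the inner box passes through one of at most 12 * l sites of its rim,
  and a box of radius \<open>l\<close> around such a site still fits into the large box.\<close>

lemma hit_bound:
 assumes b: "be > 0" and l: "l >= 1"
 shows "ap be (bx x (3 * int l)) (%K. K Int bx x (int l) ~= {}) <= 12 * real l * mm be l"
proof -
 let ?l = "int l" and ?B = "bx x (3 * int l)"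
 define S where "S = {fst x - ?l, fst x + ?l} \<times> {snd x - ?l..snd x + ?l} Un {fst x - ?l..fst x + ?l} \<times> {snd x - ?l, snd x + ?l}"
 have fS: "finite S" unfolding S_def by simp
 have cS: "real (card S) <= 12 * real l"
 proof -
  have "card S <= 2 * (2 * l + 1) + (2 * l + 1) * 2"
   unfolding S_def using card_Un_le[of "{fst x - ?l, fst x + ?l} \<times> {snd x - ?l..snd x + ?l}" "{fst x - ?l..fst x + ?l} \<times> {snd x - ?l, snd x + ?l}"] l
   by (simp add: card_cartesian_product card_insert_if nat_add_distrib nat_mult_distrib)
  moreover have "2 * (2 * l + 1) + (2 * l + 1) * 2 <= 12 * l" using l by simp
  ultimately have "card S <= 12 * l" by (rule order_trans)
  hence "real (card S) <= real (12 * l)" by (simp only: of_nat_le_iff)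
  thus ?thesis by simp
 qed
 have SB: "S \<subseteq> bx x ?l" unfolding S_def bx_eq by auto
 have "ap be ?B (%K. K Int bx x ?l ~= {}) <= ap be ?B (%K. EX v:S. v : K)"
 proof (rule ap_mono_Kc[OF b finite_bx])
  fix Ob C assume "Kc ?B Ob C Int bx x ?l ~= {}"
  then obtain v where v: "v : Kc ?B Ob C" "v : bx x ?l" by blast
  from Kc_path_in[OF v(1)] obtain r n w where r: "r 0 = v" "spath r n" "!!k. k <= n ==> r k : Kc ?B Ob C" "w ~: ?B" "adj (r n) w" by blast
  have out: "r n ~: bx x ?l"
  proof
   assume "r n : bx x ?l"
   hence "w : ?B" using r(5) l unfolding bx_def adj_def by auto
   thus False using r(4) by blast
  qed
  obtain k where k: "k < n" "r k : bx x ?l" "r (Suc k) ~: bx x ?l"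
   using path_leaves_box[OF r(2) _ out] v r(1) by metis
  have "adj (r k) (r (Suc k))" using r(2) k(1) unfolding spath_def by blast
  hence a: "\<bar>fst (r k) - fst (r (Suc k))\<bar> + \<bar>snd (r k) - snd (r (Suc k))\<bar> = 1" unfolding adj_def .
  have c: "\<bar>fst (r k) - fst x\<bar> <= ?l" "\<bar>snd (r k) - snd x\<bar> <= ?l" "?l < \<bar>fst (r (Suc k)) - fst x\<bar> \<or> ?l < \<bar>snd (r (Suc k)) - snd x\<bar>"
   using k(2,3) unfolding bx_def by auto
  have "\<bar>fst (r k) - fst x\<bar> = ?l \<or> \<bar>snd (r k) - snd x\<bar> = ?l" using a c by linarith
  hence "r k : S" using c(1,2) unfolding S_def by (auto simp: mem_Times_iff abs_le_iff abs_if split: if_splits)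
  thus "EX v:S. v : Kc ?B Ob C" using r(3)[of k] k(1) by auto
 qed
 also have "... <= (SUM v:S. ap be ?B (%K. v : K))" by (rule ap_Ex_le[OF b finite_bx fS])
 also have "... <= (SUM v:S. mm be l)"
 proof (rule sum_mono)
  fix v assume "v : S"
  hence "v : bx x ?l" using SB by blast
  thus "ap be ?B (%K. v : K) <= mm be l" by (intro mm_domain[OF b finite_bx] bx_nested) auto
 qed
 also have "... = real (card S) * mm be l" by simp
 also have "... <= 12 * real l * mm be l" using cS mm_01[OF b] by (intro mult_right_mono) auto
 finally show ?thesis .
qed

text \<open>Once \<open>r * mm be r\<close> is small on one scale, a connection to distance \<open>N\<close> has to produce order \<open>N / r\<close> separated unlikely events.\<close>
lemma finite_size_criterion:
 assumes l: "l >= 1" and q: "!!be. be > 0 ==> 12 * real l * mm be l <= q" "882 * sqrt q <= exp (- 1)"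
 shows "be > 0 ==> mm be N <= exp 2 * exp (- (real N / (10 * real l)))"
proof -
 assume b: "be > 0"
 \<comment> \<open>Within distance N - 5 * l of the centre, all boxes of radius 3 * l around grid
   points fit into the big box. For small \<open>N\<close> the truncated subtraction gives n = 0.
   Rounding loses at most 2, hence the prefactor exp 2.\<close>
 define n where "n = (N - 6 * l) div (10 * l)"
 have q0: "0 <= q" using q(1)[OF b] mm_01[OF b, of l] l by (smt (verit) mult_nonneg_nonneg of_nat_0_le_iff)
 have n: "real N / (10 * real l) <= real n + 2"
 proof -
  have "N - 6 * l = n * (10 * l) + (N - 6 * l) mod (10 * l)" unfolding n_def by (rule div_mult_mod_eq[symmetric])
  moreover have "(N - 6 * l) mod (10 * l) < 10 * l" using l by simp
  moreover have "(n + 2) * (10 * l) = n * (10 * l) + 20 * l" by (simp add: algebra_simps)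
  ultimately have "N <= (n + 2) * (10 * l)" by linarith
  hence "real N <= real ((n + 2) * (10 * l))" by (simp only: of_nat_le_iff)
  thus ?thesis using l by (simp add: pos_divide_le_eq algebra_simps)
 qed
 have main: "mm be N <= exp (- real n)"
 proof (cases "n = 0")
  case True
  thus ?thesis using mm_01[OF b, of N] by simp
 next
  case False
  have "n * (10 * l) <= N - 6 * l" unfolding n_def by simp
  moreover have "1 * (10 * l) <= n * (10 * l)" using False by (intro mult_right_mono) auto
  moreover have "10 * l * n = n * (10 * l)" by simp
  ultimately have nN: "10 * l * n + 6 * l <= N" using l by linarith
  let ?l = "int l" and ?L = "bx (0, 0) (int N)"
  let ?Q = "%x K. K Int bx x ?l ~= {}"
  have up: "upred (?Q x)" for x unfolding upred_def by blast
  have q1: "q <= 1"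
  proof -
   have "exp (- 1 :: real) <= 1" by simp
   hence "sqrt q <= 1" using q(2) real_sqrt_ge_zero[OF q0] by linarith
   thus ?thesis using q0 by (simp add: real_sqrt_le_1_iff)
  qed
  have qb: "ap be (bx x (3 * ?l)) (?Q x) <= q" for x using hit_bound[OF b l, of x] q(1)[OF b] by linarith
  have "mm be N <= ap be ?L (chainev ?l ?L {gr ?l (0, 0)} n ?Q)"
   unfolding mm_def
  proof (rule ap_mono_Kc[OF b finite_bx])
   fix Ob C assume "(0, 0) : Kc ?L Ob C"
   from Kc_path_in[OF this] obtain r m w where r: "r 0 = (0, 0)" "spath r m" "!!k. k <= m ==> r k : Kc ?L Ob C" "w ~: ?L" "adj (r m) w" by blast
   let ?a = "int N - 5 * ?l"
   have "r m ~: bx (0, 0) (int N - 1)" using r(4,5) unfolding bx_def adj_def by auto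
   hence out: "r m ~: bx (0, 0) ?a" using bx_mono[of ?a "int N - 1" "(0, 0)"] l by auto
   have "0 <= ?a" using nN by linarith
   hence r0: "r 0 : bx (0, 0) ?a" unfolding r(1) bx_def by simp
   obtain k where k: "k < m" "r k : bx (0, 0) ?a" "r (Suc k) ~: bx (0, 0) ?a" "!!j. j <= k ==> r j : bx (0, 0) ?a"
    using path_leaves_box[OF r(2) r0 out] by blast
   have sp: "spath r k" using r(2) k(1) unfolding spath_def by simp
   have nN': "10 * ?l * int n + 6 * ?l <= int N" using nN by (metis of_nat_add of_nat_le_iff of_nat_mult of_nat_numeral)
   \<comment> \<open>Every step of the chain is marked, since each cell on the way is hit by the
     cluster; with La = 2 * (k + 1) any path of \<open>k\<close> steps satisfies the length
     condition.\<close>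
   show "chainev ?l ?L {gr ?l (0, 0)} n ?Q (Kc ?L Ob C)"
   proof (rule path_chainev[where R = "%_. True" and La = "2 * (real k + 1)", OF sp])
    fix j assume "j <= k"
    hence "r j : bx (0, 0) ?a" by (rule k(4))
    thus "bx (gr ?l (r j)) (3 * ?l) \<subseteq> ?L"
     using gr_bounds[of ?l "r j"] l unfolding bx_def by (auto simp: abs_le_iff)
   next
    have "adj (r k) (r (Suc k))" using r(2) k(1) unfolding spath_def by blast
    hence "r k ~: bx (0, 0) (?a - 1)" using k(3) unfolding bx_def adj_def by auto
    moreover have "bx (0, 0) (10 * ?l * int n) \<subseteq> bx (0, 0) (?a - 1)" by (rule bx_mono) (use nN' l in linarith)
    ultimately show "r k ~: bx (r 0) (10 * ?l * int n)" unfolding r(1) by blast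
    show "real k < real n / 2 * (2 * (real k + 1))"
    proof -
     have "1 * (real k + 1) <= real n * (real k + 1)" using False by (intro mult_right_mono) auto
     hence "real k < real n * (real k + 1)" by (rule less_le_trans[rotated]) simp
     moreover have "real n / 2 * (2 * (real k + 1)) = real n * (real k + 1)" by simp
     ultimately show ?thesis by (simp only:)
    qed
    fix i j assume ij: "i < j" "j <= k"
    have "r i : Kc ?L Ob C" using r(3)[of i] ij k(1) by simp
    moreover have "r i : bx (gr ?l (r i)) ?l" using gr_bx[of ?l "r i"] l by simp
    moreover have "bx (gr ?l (r i)) ?l \<subseteq> bx (gr ?l (r i)) (3 * ?l)" by (rule bx_mono) simp
    ultimately show "?Q (gr ?l (r i)) (Kc ?L Ob C Int bx (gr ?l (r i)) (3 * ?l))" by blast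
   qed (use l r(1) in auto)
  qed
  also have "... <= real (card {gr ?l (0, 0)}) * (882 * sqrt q) ^ n" by (rule chain_bound[OF b finite_bx _ up qb q1]) simp
  also have "... = (882 * sqrt q) ^ n" by simp
  also have "... <= exp (- 1) ^ n" by (rule power_mono[OF q(2)]) (use q0 in simp)
  finally show ?thesis by (simp flip: exp_of_nat_mult)
 qed
 also have "exp (- real n) <= exp (2 + - (real N / (10 * real l)))" using n by simp
 finally show ?thesis by (simp only: exp_add)
qed

text \<open>The crossing need only start and end next to the two boundaries of the annulus, hence a
  displacement exceeding 2 * r - 2 instead of 2 * r.\<close>

definition SC :: "int => real => site set => bool" where
 "SC r \<mu> K \<longleftrightarrow> (\<exists>p m. spath p m & (\<forall>k\<le>m. p k : K & p k : bx (0, 0) (8 * r) - bx (0, 0) (6 * r)) & p m ~: bx (p 0) (2 * r - 2) & real m < \<mu>)"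

definition An :: "int => site set" where
 "An r = bx (0, 0) (12 * r) - bx (0, 0) (4 * r)"

lemma upred_SC: "upred (SC r \<mu>)" unfolding upred_def SC_def by blast

lemma SC_chain:
 assumes b: "be > 0" and l: "l >= 1" "4 * l <= r" and n: "10 * l * int n <= 2 * r - 2" and mu: "\<mu> <= real n / 2 * La" "La > 0"
  and q: "!!x. ap be (bx x (3 * l)) (Sh l La x) <= q" "q <= 1"
 shows "ap be (An r) (SC r \<mu>) <= (of_int (16 * r + 1))\<^sup>2 * (882 * sqrt q) ^ n"
proof -
 let ?X = "gr l ` bx (0, 0) (8 * r)"
 have q0: "0 <= q" using q(1) ap_ge0[OF b finite_bx] order_trans by blast
 have l0: "l > 0" using l by simp
 have fA: "finite (An r)" unfolding An_def using finite_bx by simp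
 have "ap be (An r) (SC r \<mu>) <= ap be (An r) (chainev l (An r) ?X n (Sh l La))"
 proof (rule ap_mono[OF b fA])
  fix K assume "SC r \<mu> K"
  then obtain p m where p: "spath p m" "!!k. k <= m ==> p k : K & p k : bx (0, 0) (8 * r) - bx (0, 0) (6 * r)" "p m ~: bx (p 0) (2 * r - 2)" "real m < \<mu>"
   unfolding SC_def by blast
  show "chainev l (An r) ?X n (Sh l La) K"
  proof (rule path_chainev[where R = "%d. real d < La", OF p(1) _ l(1)])
   fix k assume "k <= m"
   hence pk: "p k : bx (0, 0) (8 * r)" "p k ~: bx (0, 0) (6 * r)" using p(2) by auto
   show "bx (gr l (p k)) (3 * l) \<subseteq> An r"
   proof
    fix v assume v: "v : bx (gr l (p k)) (3 * l)"
    hence d: "\<bar>fst v - fst (p k)\<bar> <= 4 * l" "\<bar>snd v - snd (p k)\<bar> <= 4 * l"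
     using gr_bounds[OF l0, of "p k"] unfolding bx_def mem_Collect_eq by linarith+
    have 1: "v : bx (0, 0) (12 * r)" using d pk(1) l unfolding bx_def by auto
    have "v ~: bx (0, 0) (4 * r)"
    proof
     assume "v : bx (0, 0) (4 * r)"
     hence "p k : bx (0, 0) (6 * r)" using d l unfolding bx_def by auto
     thus False using pk(2) by blast
    qed
    thus "v : An r" using 1 unfolding An_def by simp
   qed
  next
   show "p m ~: bx (p 0) (10 * l * int n)" using p(3) bx_mono[OF n] by blast
   show "gr l (p 0) : ?X" using p(2)[of 0] by blast
   fix i j assume ij: "i < j" "j <= m" "real (j - i) < La" "p j ~: bx (gr l (p i)) (8 * l)"
   have "l <= \<bar>fst (p i) - fst (p j)\<bar> \<or> l <= \<bar>snd (p i) - snd (p j)\<bar>"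
    using ij(4) gr_bounds[OF l0, of "p i"] unfolding bx_def mem_Collect_eq by linarith
   hence "real_of_int l <= dE (p i) (p j)" using dE_ge[of "p i" "p j"] by (metis of_int_le_iff order_trans)
   hence "Sh l La (gr l (p i)) K" using ij p(2) by (intro short_start[OF p(1) _ _ _ _ _ l0 gr_bx[OF l0]]) auto
   thus "Sh l La (gr l (p i)) (K Int bx (gr l (p i)) (3 * l))" unfolding Sh_def by blast
  qed (use p(4) mu in auto)
 qed
 also have "... <= real (card ?X) * (882 * sqrt q) ^ n" by (rule chain_bound[OF b fA _ upred_Sh q]) (simp add: finite_bx)
 also have "... <= (of_int (16 * r + 1))\<^sup>2 * (882 * sqrt q) ^ n"
 proof (rule mult_right_mono)
  have "real (card ?X) <= real (card (bx (0, 0) (8 * r)))" using card_image_le[OF finite_bx] by simp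
  also have "... = (of_int (16 * r + 1))\<^sup>2" using l by (subst card_bx) auto
  finally show "real (card ?X) <= (of_int (16 * r + 1))\<^sup>2" .
 qed (use q0 in simp)
 finally show ?thesis .
qed

text \<open>Short paths are used at a scale \<open>L\<close> with L^2 <= r < (g * L)^2. Then of the
  order of sqrt r separated boxes have to carry short paths, which is more than polynomially
  unlikely, and the gain in length is still of order r powr (te / 2). Half of this exponent is given
  up to absorb constants.\<close>

lemma crossing_rare:
 "\<exists>af>0. af <= 1 & (\<exists>C\<ge>1. \<forall>be>0. \<forall>r\<ge>1. ap be (An (int r)) (SC (int r) (real r powr (1 + af))) <= C * real r powr (- 5))"
proof -
 define ka :: real where "ka = (exp (- 1) / 882)\<^sup>2"
 have k: "ka > 0" "882 * sqrt ka = exp (- 1)" unfolding ka_def by simp_all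
 have k1: "ka <= 1"
 proof -
  have "exp (- 1 :: real) <= 1" by simp
  hence "exp (- 1) / 882 <= (1 :: real)" by linarith
  thus ?thesis unfolding ka_def by (intro power_le_one) auto
 qed
 obtain Ga :: int where G: "Ga >= 2" "!!be k x. be > 0 ==> ap be (bx x (3 * Ga ^ Suc k)) (Sh (Ga ^ Suc k) (of_int Ga * (of_int Ga + 1) ^ k) x) <= ka"
  using short_rare[OF k(1)] by blast
 define g :: real where "g = of_int Ga"
 have g: "g >= 2" unfolding g_def using G(1) by simp
 define w where "w = 1 + 1 / g"
 have "1 < w" "w <= 2" unfolding w_def using g by (auto simp: field_simps)
 hence w: "1 < w" "w <= 2" "w <= g" using g by auto
 define te where "te = ln w / ln g"
 have lng: "ln g > 0" using g by simp
 have th: "0 < te" "te <= 1" unfolding te_def using w g lng by (auto simp: divide_le_eq_1)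
 have gw: "g powr te = w" unfolding te_def powr_def using lng g w by simp
 obtain r0 :: nat where r0: "real r0 >= max 200 (max (g\<^sup>2) (80 powr (4 / te)))" using real_arch_simple by blast
 define C :: real where "C = max (289 * 140 ^ 14) (real r0 ^ 5)"
 have C1: "C >= 1" unfolding C_def by simp
 have "ap be (An (int r)) (SC (int r) (real r powr (1 + te / 4))) <= C * real r powr (- 5)" if b: "be > 0" and r: "r >= 1" for be r
 proof (cases "r < r0")
  case True
  have fA: "finite (An (int r))" unfolding An_def using finite_bx by simp
  have "real r ^ 5 <= real r0 ^ 5" using True by (intro power_mono) auto
  also have "... <= C" unfolding C_def by (rule max.cobounded2)
  finally have "real r ^ 5 <= C" .
  hence "1 <= C * real r powr (- 5)" using r by (simp add: powr_minus powr_realpow divide_simps)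
  thus ?thesis using ap_le1[OF b fA, of "SC (int r) (real r powr (1 + te / 4))"] by linarith
 next
  case False
  define x where "x = real r"
  have x: "x >= 200" "x >= g\<^sup>2" "x >= 80 powr (4 / te)" using r0 False unfolding x_def by auto
  define G' where "G' = nat Ga"
  have G': "real G' = g" "int G' = Ga" "G' >= 2" unfolding G'_def g_def using G(1) by auto
  have "2 * 1 <= G' * G'" using G'(3) by (intro mult_mono) auto
  hence "2 <= G'\<^sup>2" by (simp add: power2_eq_square)
  from ex_power_ivl1[OF this r] obtain j where j: "(G'\<^sup>2) ^ j <= r" "r < (G'\<^sup>2) ^ (j + 1)" by blast
  have jx: "(g\<^sup>2) ^ j <= x" "x < (g\<^sup>2) ^ (j + 1)"
  proof -
   have "real ((G'\<^sup>2) ^ j) <= real r" "real r < real ((G'\<^sup>2) ^ (j + 1))" using j by (simp_all only: of_nat_le_iff of_nat_less_iff)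
   thus "(g\<^sup>2) ^ j <= x" "x < (g\<^sup>2) ^ (j + 1)" unfolding x_def by (simp_all add: G'(1))
  qed
  have "j ~= 0" using jx(2) x(2) by (cases j) auto
  then obtain k where jk: "j = Suc k" by (cases j) auto
  define l where "l = Ga ^ Suc k"
  define L where "L = g ^ j"
  have lL: "real_of_int l = L" unfolding l_def L_def g_def jk by simp
  have L1: "1 <= L" unfolding L_def using g by (intro one_le_power) auto
  have L2: "L\<^sup>2 <= x" using jx(1) unfolding L_def by (simp add: power_mult[symmetric] mult.commute)
  have Lx: "10 * L <= x - 2"
  proof (cases "L <= 14")
   case False
   hence "14 * L <= L * L" by (intro mult_right_mono) auto
   thus ?thesis using L2 x(1) unfolding power2_eq_square by linarith
  qed (use x(1) in linarith)
  have l1: "l >= 1" using L1 unfolding lL[symmetric] by simp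
  have l4: "4 * l <= int r"
  proof -
   have "real_of_int (4 * l) <= real_of_int (int r)" using Lx L1 lL unfolding x_def by simp
   thus ?thesis by (simp only: of_int_le_iff)
  qed
  define n where "n = nat ((2 * int r - 2) div (10 * l))"
  have nn: "int n = (2 * int r - 2) div (10 * l)" unfolding n_def using r l1 by (simp add: pos_imp_zdiv_nonneg_iff)
  have "10 * l * int n + (2 * int r - 2) mod (10 * l) = 2 * int r - 2" unfolding nn by simp
  moreover have "0 <= (2 * int r - 2) mod (10 * l)" "(2 * int r - 2) mod (10 * l) < 10 * l" using l1 by simp_all
  ultimately have n1: "10 * l * int n <= 2 * int r - 2" and n2: "2 * int r - 2 < 10 * l * int n + 10 * l" by linarith+
  have nx: "x / (10 * L) <= real n"
  proof -
   have "real_of_int (2 * int r - 2) < real_of_int (10 * l * int n + 10 * l)" using n2 by (simp only: of_int_less_iff)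
   hence "2 * x - 2 < 10 * L * real n + 10 * L" unfolding x_def by (simp add: lL)
   hence "x <= real n * (10 * L)" using Lx by (simp add: mult_ac)
   thus ?thesis using L1 by (simp add: pos_divide_le_eq)
  qed
  define La where "La = g * (g + 1) ^ k"
  have Lam: "La = L * w ^ k"
  proof -
   have "g * w = g + 1" unfolding w_def using g by (simp add: distrib_left)
   hence "(g + 1) ^ k = g ^ k * w ^ k" by (metis power_mult_distrib)
   thus ?thesis unfolding La_def L_def jk by simp
  qed
  have Lam0: "La > 0" unfolding La_def using g by simp
  have mu: "x powr (1 + te / 4) <= real n / 2 * La"
  proof -
   have "x powr (te / 2) <= ((g\<^sup>2) ^ (j + 1)) powr (te / 2)" using jx(2) x(1) th by (intro powr_mono2) auto
   also have "... = (g powr te) ^ (k + 2)"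
   proof -
    have "(g\<^sup>2) ^ (j + 1) = g ^ (2 * (k + 2))" unfolding jk power_mult[symmetric] by simp
    also have "... = g powr real (2 * (k + 2))" using g by (intro powr_realpow[symmetric]) simp
    finally have "((g\<^sup>2) ^ (j + 1)) powr (te / 2) = g powr (real (2 * (k + 2)) * (te / 2))" by (simp only: powr_powr)
    also have "real (2 * (k + 2)) * (te / 2) = te * real (k + 2)" by simp
    also have "g powr (te * real (k + 2)) = (g powr te) powr real (k + 2)" by (simp only: powr_powr)
    also have "... = (g powr te) ^ (k + 2)" using g by (intro powr_realpow) simp
    finally show ?thesis .
   qed
   also have "... = w ^ k * w\<^sup>2" unfolding gw by (rule power_add)
   also have "... <= w ^ k * 4" using w power_mono[of w 2 2] by (intro mult_left_mono) auto
   finally have 1: "x powr (te / 2) / 4 <= w ^ k" by simp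
   have "80 = (80 powr (4 / te)) powr (te / 4)" using th by (simp add: powr_powr)
   also have "... <= x powr (te / 4)" using x(3) th by (intro powr_mono2) auto
   finally have "80 * x powr (1 + te / 4) <= x powr (te / 4) * x powr (1 + te / 4)" by (intro mult_right_mono) auto
   also have "... = x * x powr (te / 2)" using x(1) by (simp add: powr_add[symmetric] powr_mult_base add.commute)
   also have "... <= x * (4 * w ^ k)" using 1 x(1) by (intro mult_left_mono) auto
   finally have "x powr (1 + te / 4) <= x / 20 * w ^ k" by simp
   also have "... = x / (10 * L) / 2 * La" unfolding Lam using L1 by simp
   also have "... <= real n / 2 * La" using nx Lam0 by (intro mult_right_mono divide_right_mono) auto
   finally show ?thesis .
  qed
  have sq: "ap be (bx z (3 * l)) (Sh l La z) <= ka" for z using G(2)[OF b, of z k] unfolding l_def La_def g_def .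
  have "ap be (An (int r)) (SC (int r) (real r powr (1 + te / 4))) <= (of_int (16 * int r + 1))\<^sup>2 * (882 * sqrt ka) ^ n"
   by (rule SC_chain[OF b l1 l4 n1 _ Lam0 sq k1]) (use mu in \<open>simp add: x_def\<close>)
  also have "(882 * sqrt ka) ^ n = exp (- real n)" unfolding k(2) by (simp flip: exp_of_nat_mult)
  also have "(of_int (16 * int r + 1))\<^sup>2 = (16 * x + 1)\<^sup>2" unfolding x_def by simp
  also have "(16 * x + 1)\<^sup>2 * exp (- real n) <= (17 * x)\<^sup>2 * (140 ^ 14 * x powr (- 7))"
  proof (rule mult_mono)
   show "(16 * x + 1)\<^sup>2 <= (17 * x)\<^sup>2" using x(1) by (intro power_mono) auto
   define y where "y = sqrt x / 10"
   have y0: "y > 0" unfolding y_def using x(1) by simp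
   have "L <= sqrt x" using L2 by (rule real_le_rsqrt)
   hence "sqrt x * L <= sqrt x * sqrt x" by (intro mult_left_mono) (use x(1) in auto)
   hence "sqrt x <= x / L" using L1 x(1) by (simp add: pos_le_divide_eq)
   hence yn: "y <= real n" using nx unfolding y_def by simp
   \<comment> \<open>Since \<open>y\<close> is of order sqrt x, the power 14 yields x powr (- 7),
     and the prefactor x^2 leaves the exponent -5.\<close>
   have "(y / 14) ^ 14 <= exp (y / 14) ^ 14"
   proof (rule power_mono)
    show "y / 14 <= exp (y / 14)" using exp_ge_add_one_self[of "y / 14"] by linarith
   qed (use y0 in simp)
   also have "... = exp y" by (simp flip: exp_of_nat_mult)
   also have "... <= exp (real n)" using yn by simp
   finally have e: "(y / 14) ^ 14 <= exp (real n)" .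
   have "(y / 14) ^ 14 = x ^ 7 / 140 ^ 14"
   proof -
    have "(sqrt x) ^ 14 = ((sqrt x)\<^sup>2) ^ 7" by (simp add: power_mult[symmetric])
    also have "... = x ^ 7" using x(1) by simp
    finally show ?thesis unfolding y_def by (simp add: power_divide)
   qed
   with e have "x ^ 7 / 140 ^ 14 <= exp (real n)" by simp
   hence "exp (- real n) <= inverse (x ^ 7 / 140 ^ 14)" unfolding exp_minus using x(1) by (intro le_imp_inverse_le) auto
   also have "inverse (x ^ 7 / 140 ^ 14) = 140 ^ 14 * inverse (x ^ 7)" by (subst inverse_divide) (rule divide_inverse)
   also have "inverse (x ^ 7) = x powr (- 7)"
   proof -
    have "x powr 7 = x ^ 7" using x(1) by (simp add: powr_numeral)
    thus ?thesis by (simp only: powr_minus)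
   qed
   finally show "exp (- real n) <= 140 ^ 14 * x powr (- 7)" .
  qed auto
  also have "... = 289 * 140 ^ 14 * (x\<^sup>2 * x powr (- 7))" by (simp add: power_mult_distrib)
  also have "x\<^sup>2 * x powr (- 7) = x powr (- 5)"
  proof -
   have "x\<^sup>2 = x powr 2" using x(1) by (simp add: powr_numeral)
   thus ?thesis by (simp only: powr_add[symmetric]) simp
  qed
  also have "289 * 140 ^ 14 * x powr (- 5) <= C * x powr (- 5)" unfolding C_def by (intro mult_right_mono) auto
  finally show ?thesis unfolding x_def .
 qed
 thus ?thesis using th C1 by (intro exI[of _ "te / 4"]) auto
qed

end

section \<open>Intrinsic layers and the recursion for the order parameter\<close>

text \<open>Only the last stretch of the connection inside \<open>W\<close> is kept; each of its
  sites was counted, so there are at most \<open>n\<close> of them. A site next to \<open>U\<close>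
  at a low level thus ends a short crossing of \<open>W\<close>.\<close>

lemma Lv_path:
 assumes "Lv B U W Ob C n v" "v : W" and UW: "U Un W \<subseteq> B"
 shows "\<exists>p m. spath p m & p m = v & (\<forall>k\<le>m. p k : W & p k : Kc B Ob C) & Suc m <= n & (\<exists>w. adj (p 0) w & w ~: U Un W)"
 using assms(1,2)
proof induction
 case (base v w)
 have "v : Kc B Ob C" using base by (intro Kc.base[of v B Ob w]) auto
 moreover have "w ~: U Un W" using base UW by blast
 ultimately show ?case using base by (intro exI[of _ "%_. v"] exI[of _ 0]) (auto simp: spath_def)
next
 case (step n u v)
 have uK: "u : Kc B Ob C" using step.hyps(1) by (rule Lv_Kc)
 hence vK: "v : Kc B Ob C" using step.hyps by (intro Kc.step[OF uK]) auto
 show ?case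
 proof (cases "u : W")
  case True
  from step.IH[OF this] obtain p m where p: "spath p m" "p m = u" "!!k. k <= m ==> p k : W & p k : Kc B Ob C" "Suc m <= n" "\<exists>w. adj (p 0) w & w ~: U Un W" by blast
  have "spath (p(Suc m := v)) (Suc m)" unfolding spath_def
  proof (intro allI impI)
   fix i assume i: "i < Suc m"
   show "adj ((p(Suc m := v)) i) ((p(Suc m := v)) (Suc i))"
    using i p(1,2) step.hyps unfolding spath_def by (cases "i = m") auto
  qed
  moreover have "(p(Suc m := v)) (Suc m) = v" "(p(Suc m := v)) 0 = p 0" by simp_all
  moreover have "\<forall>k\<le>Suc m. (p(Suc m := v)) k : W & (p(Suc m := v)) k : Kc B Ob C" using p(3) vK step.prems by (simp add: le_Suc_eq)
  moreover have "Suc (Suc m) <= n + of_bool (v : W)" using p(4) step.prems by simp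
  ultimately show ?thesis using p(5) by (intro exI[of _ "p(Suc m := v)"] exI[of _ "Suc m"]) (simp only:)
 next
  case False
  moreover have "u ~: U" using Lv_in[OF step.hyps(1)] by blast
  ultimately show ?thesis using vK step by (intro exI[of _ "%_. v"] exI[of _ 0]) (auto simp: spath_def adj_sym)
 qed
qed

text \<open>An edge of layer \<open>k\<close> into \<open>W\<close> starts at a site of minimal
  level exactly \<open>k\<close>, so different layers use different sites of the cluster, with at
  most 4 edges each. The exception is a neighbour of \<open>U\<close> reached at a level below
  \<open>nv\<close>; then every layer is bounded by the number of all edges.\<close>

lemma cutE_sum:
 fixes nv :: nat
 assumes fB: "finite B"
 defines "K == %Ob C. Kc B Ob C"
 shows "(\<Sum>k<nv. real (card (cutE B U W k Ob C))) <= 4 * (SUM x:{x : B - U. EX y:W. adj x y}. of_bool (x : K Ob C))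
  + real nv * real (card (eds B)) * of_bool (\<exists>n x y. Lv B U W Ob C n x & n < nv & adj x y & y : U)"
proof -
 let ?Lv = "Lv B U W Ob C" and ?sh = "\<exists>n x y. Lv B U W Ob C n x & n < nv & adj x y & y : U"
 let ?R = "{x : B - U. EX y:W. adj x y}"
 define S where "S k = {z. fst z : K Ob C Int ?R & adj (fst z) (snd z) & (\<exists>n\<le>k. ?Lv n (fst z)) & ~ (\<exists>n<k. ?Lv n (fst z))}" for k
 let ?T = "SIGMA x:K Ob C Int ?R. {y. adj x y}"
 have fR: "finite ?R" using fB by simp
 have fT: "finite ?T" using fR finite_nbr by blast
 have ST: "S k \<subseteq> ?T" for k unfolding S_def by auto
 have fS: "finite (S k)" for k using ST fT finite_subset by blast
 have dis: "S i Int S j = {}" if "i ~= j" for i j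
 proof -
  have False if "i < j" "z : S i" "z : S j" for i j z using that unfolding S_def by (auto dest: le_less_trans)
  thus ?thesis using that by (metis disjoint_iff nat_neq_iff)
 qed
 have "(\<Sum>k<nv. card (S k)) = card (\<Union>k\<in>{..<nv}. S k)" using fS dis by (intro card_UN_disjoint[symmetric]) auto
 also have "... <= card ?T" using ST by (intro card_mono fT) blast
 also have "... = (SUM x:K Ob C Int ?R. card {y. adj x y})" using fR finite_nbr by (intro card_SigmaI) auto
 also have "... <= (SUM x:K Ob C Int ?R. 4)" by (intro sum_mono card_nbr_le)
 finally have "(\<Sum>k<nv. card (S k)) <= 4 * card (K Ob C Int ?R)" by simp
 hence "real (\<Sum>k<nv. card (S k)) <= real (4 * card (K Ob C Int ?R))" by (simp only: of_nat_le_iff)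
 moreover have "real (card (K Ob C Int ?R)) = (SUM x:?R. of_bool (x : K Ob C))"
 proof -
  have "real (card (K Ob C Int ?R)) = (SUM x:?R. of_bool (x : K Ob C Int ?R))" by (rule card_eq_sum[OF fR]) blast
  also have "... = (SUM x:?R. of_bool (x : K Ob C))" by (rule sum.cong) auto
  finally show ?thesis .
 qed
 ultimately have sS: "(\<Sum>k<nv. real (card (S k))) <= 4 * (SUM x:?R. of_bool (x : K Ob C))" by simp
 have one: "real (card (cutE B U W k Ob C)) <= real (card (S k)) + real (card (eds B)) * of_bool ?sh" if k: "k < nv" for k
 proof (cases ?sh)
  case True
  have "card (cutE B U W k Ob C) <= card (eds B)" by (intro card_mono finite_eds[OF fB] cutE_subset)
  thus ?thesis using True by simp
 next
  case False
  have "cutE B U W k Ob C \<subseteq> (%z. {fst z, snd z}) ` S k"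
  proof
   fix e assume "e : cutE B U W k Ob C"
   then obtain x y where e: "e = {x, y}" "\<exists>n\<le>k. ?Lv n x" "adj x y" "y : U \<or> (y : W & ~ (\<exists>n<k. ?Lv n x))" unfolding cutE_def by blast
   have "y ~: U" using False e(2,3) k by (meson le_less_trans)
   hence y: "y : W" "~ (\<exists>n<k. ?Lv n x)" using e(4) by auto
   have "x : K Ob C" "x : B - U" using e(2) Lv_Kc Lv_in unfolding K_def by blast+
   hence "(x, y) : S k" unfolding S_def using e(2,3) y by auto
   thus "e : (%z. {fst z, snd z}) ` S k" unfolding e(1) by (intro image_eqI[of _ _ "(x, y)"]) simp_all
  qed
  hence "card (cutE B U W k Ob C) <= card ((%z. {fst z, snd z}) ` S k)" using fS by (intro card_mono) auto
  also have "... <= card (S k)" by (rule card_image_le[OF fS])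
  finally show ?thesis by simp
 qed
 have "(\<Sum>k<nv. real (card (cutE B U W k Ob C))) <= (\<Sum>k<nv. real (card (S k)) + real (card (eds B)) * of_bool ?sh)"
  by (rule sum_mono) (rule one, simp)
 also have "... = (\<Sum>k<nv. real (card (S k))) + real nv * real (card (eds B)) * of_bool ?sh" by (simp add: sum.distrib)
 finally show ?thesis using sS by linarith
qed

lemma pm_alt: "finite B ==> pm be B g v = 1 - avg B (wt be g) (%M. of_bool (v ~: M))"
 using avg_diff[of B "wt be g" "%_. 1" "%M. of_bool (v ~: M)"] avg_const[of B "wt be g" 1, OF _ wt_pos]
 unfolding pm_def by (simp add: of_bool_not_iff)

lemma pm_bounds: "finite B ==> 0 <= pm be B g v" "finite B ==> pm be B g v <= 1"
 unfolding pm_def by (intro avg_nonneg wt_pos; simp) (intro avg_le wt_pos; simp)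

lemma decr_notin: "decr X (%M. of_bool (v ~: M))" unfolding decr_def by auto

lemma pm_domain_mono:
 assumes "be > 0" "finite B'" "B \<subseteq> B'"
 shows "pm be B g v <= pm be B' g v"
 using avg_domain_mono[OF assms(2,3) wt_pos wt_logsup[OF assms(2,1)] decr_notin[of B' v]] finite_subset[OF assms(3,2)] assms(2)
 by (simp add: pm_alt)

lemma pm_field_mono:
 assumes b: "be > 0" and fB: "finite B" and g: "!!x. x : B ==> g x <= g' x"
 shows "pm be B g' v <= pm be B g v"
proof -
 have "avg B (wt be g) (%M. of_bool (v ~: M)) <= avg B (wt be g') (%M. of_bool (v ~: M))"
 proof (rule holley[OF fB])
  fix X Y assume XY: "X \<subseteq> B" "Y \<subseteq> B"
  have f: "finite X" "finite Y" using XY fB finite_subset by auto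
  have "sum g (X Un Y) = sum g Y + sum g (X - Y)" using f by (subst sum.union_disjoint[symmetric]) (auto simp: Un_commute)
  moreover have "sum g' X = sum g' (X Int Y) + sum g' (X - Y)" by (rule sum.Int_Diff[OF f(1)])
  moreover have "sum g (X - Y) <= sum g' (X - Y)" using XY g by (intro sum_mono) auto
  moreover have "real (card (bd (X Un Y))) + real (card (bd (X Int Y))) <= real (card (bd X)) + real (card (bd Y))"
   using bd_submodular[OF f] by (metis of_nat_add of_nat_le_iff)
  ultimately have "real (card (bd (X Un Y))) + sum g (X Un Y) + (real (card (bd (X Int Y))) + sum g' (X Int Y)) <= real (card (bd X)) + sum g' X + (real (card (bd Y)) + sum g Y)"
   by linarith
  hence "2 * be * (real (card (bd (X Un Y))) + sum g (X Un Y) + (real (card (bd (X Int Y))) + sum g' (X Int Y))) <= 2 * be * (real (card (bd X)) + sum g' X + (real (card (bd Y)) + sum g Y))"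
   using b by (intro mult_left_mono) auto
  thus "wt be g' X * wt be g Y <= wt be g (X Un Y) * wt be g' (X Int Y)"
   unfolding wt_def exp_add[symmetric] by (simp add: algebra_simps)
 qed (use sum_Pow_pos[OF fB wt_pos] decr_notin wt_pos in \<open>auto simp: less_imp_le\<close>)
 thus ?thesis using fB by (simp add: pm_alt)
qed

context gauss
begin

lemma E_dd: assumes "be > 0" "finite B" "v : B"
 shows "(LINT h|Gm. dd be B h v) = ap be B (%K. v : K)"
 unfolding ap_def dd_eq_kp[OF assms] ..

lemma pm_meas [measurable]:
 "(%h. pm be B h v) : borel_measurable Gm" "(%h. pm be B (%x. - h x) v) : borel_measurable Gm"
 "(%h. pm be B (%x. - (h x + c x)) v) : borel_measurable Gm"
 by (intro pm_measurable borel_measurable_uminus borel_measurable_add borel_measurable_const coord_measurable)+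

lemma pm_int:
 assumes "finite B"
 shows "integrable Gm (%h. pm be B h v)" "integrable Gm (%h. pm be B (%x. - h x) v)"
  "integrable Gm (%h. pm be B (%x. - (h x + c x)) v)"
 by (rule integrable_bounded[where c = 1, OF pm_meas(1)] integrable_bounded[where c = 1, OF pm_meas(2)] integrable_bounded[where c = 1, OF pm_meas(3)];
   use pm_bounds[OF assms] in \<open>simp add: abs_le_iff order_trans[of _ 0]\<close>)+

lemma E_dd_pm: assumes "be > 0" "finite B" "v : B"
 shows "ap be B (%K. v : K) = 1 - (LINT h|Gm. pm be B h v) - (LINT h|Gm. pm be B (%x. - h x) v)"
 unfolding E_dd[OF assms, symmetric] dd_def using pm_int[OF assms(2)] prob_space.prob_space[OF prob_iid[where ?'i = site]]
 by (simp add: integrable_bounded[of _ 1])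

text \<open>The minus probability is telescoped over growing boxes. An increment lies between 0 and
  1, sees only the field in the larger of its two boxes and has mean at most \<open>a j\<close>, so
  the relative error of \<open>shift_influence\<close> becomes 2 * A * ta j * a j and not just of
  order \<open>ta j\<close>.\<close>

lemma influence:
 fixes nv :: nat
 assumes b: "be > 0" and Bs: "!!j. finite (Bs j)" "!!j. j < nv ==> Bs j \<subseteq> Bs (Suc j)" "Bs 0 = {}"
  and t: "!!j. j < nv ==> 0 < ta j & ta j <= 1 & s\<^sup>2 * real (card (D Int Bs (Suc j))) / ep\<^sup>2 <= (ta j)\<^sup>2 & A * ta j <= 1" and A: "A >= 0"
  and a: "!!j. j < nv ==> (LINT h|Gm. pm be (Bs (Suc j)) (%x. - h x) v) - (LINT h|Gm. pm be (Bs j) (%x. - h x) v) <= a j"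
 shows "(LINT h|Gm. pm be (Bs nv) (%x. - (h x + s * of_bool (x : D))) v) <= (LINT h|Gm. pm be (Bs nv) (%x. - h x) v) + (\<Sum>j<nv. 2 * A * ta j * a j + exp (2 - A))"
proof -
 define F where "F j h = pm be (Bs j) (%x. - h x) v" for j and h :: "site => real"
 define F' where "F' j h = pm be (Bs j) (%x. - (h x + s * of_bool (x : D))) v" for j and h :: "site => real"
 have int: "integrable Gm (F j)" "integrable Gm (F' j)" for j unfolding F_def F'_def by (intro pm_int Bs(1))+
 have step: "(LINT h|Gm. F' (Suc j) h) - (LINT h|Gm. F' j h) <= ((LINT h|Gm. F (Suc j) h) - (LINT h|Gm. F j h)) + (2 * A * ta j * a j + exp (2 - A))" if j: "j < nv" for j
 proof -
  let ?I = "D Int Bs (Suc j)"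
  define G where "G h = F (Suc j) h - F j h" for h
  have G0: "0 <= G h" "G h <= 1" for h
   unfolding G_def F_def using pm_domain_mono[OF b Bs(1) Bs(2)[OF j], of "%x. - h x" v]
    pm_bounds(2)[OF Bs(1)[of "Suc j"], of be "%x. - h x" v] pm_bounds(1)[OF Bs(1)[of j], of be "%x. - h x" v] by linarith+
  have Gm: "G : borel_measurable Gm" unfolding G_def F_def by measurable
  have e: "F' i h = F i (%x. h x + (if x : ?I then s else 0))" if "i : {j, Suc j}" for i h
  proof -
   have ij: "Bs i \<subseteq> Bs (Suc j)" using that Bs(2)[OF j] by auto
   have eq: "- (h x + s * of_bool (x : D)) = - (h x + (if x : ?I then s else 0))" if "x : Bs i" for x using that ij by auto
   have "sum (%x. - (h x + s * of_bool (x : D))) M = sum (%x. - (h x + (if x : ?I then s else 0))) M" if "M \<subseteq> Bs i" for M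
    by (rule sum.cong[OF refl], rule eq) (use that in blast)
   thus ?thesis unfolding F'_def F_def pm_def by (intro avg_cong refl) (simp add: wt_def)
  qed
  have "(LINT h|Gm. G (%x. h x + (if x : ?I then (%_. s) x else 0))) <= (1 + 2 * A * ta j) * (LINT h|Gm. G h) + exp (2 - A)"
  proof (rule shift_influence[OF _ Gm G0])
   show "finite ?I" using Bs(1) by simp
   show "var ?I (%_. s) <= (ta j)\<^sup>2" unfolding var_def using t[OF j] by (simp add: mult.commute)
  qed (use t[OF j] A in auto)
  moreover have "(LINT h|Gm. G (%x. h x + (if x : ?I then (%_. s) x else 0))) = (LINT h|Gm. F' (Suc j) h) - (LINT h|Gm. F' j h)"
  proof -
   have e': "F' j h = F j (%x. h x + (if x : ?I then s else 0))" "F' (Suc j) h = F (Suc j) (%x. h x + (if x : ?I then s else 0))" for h by (rule e; simp)+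
   have "(LINT h|Gm. G (%x. h x + (if x : ?I then (%_. s) x else 0))) = (LINT h|Gm. F' (Suc j) h - F' j h)"
    by (rule Bochner_Integration.integral_cong[OF refl]) (simp only: G_def e')
   also have "... = (LINT h|Gm. F' (Suc j) h) - (LINT h|Gm. F' j h)" by (rule Bochner_Integration.integral_diff[OF int(2) int(2)])
   finally show ?thesis .
  qed
  moreover have "(LINT h|Gm. G h) = (LINT h|Gm. F (Suc j) h) - (LINT h|Gm. F j h)" unfolding G_def using int by simp
  moreover have "2 * A * ta j * (LINT h|Gm. G h) <= 2 * A * ta j * a j"
   using a[OF j] t[OF j] A calculation(3) unfolding F_def by (intro mult_left_mono) auto
  ultimately show ?thesis by (simp add: distrib_right)
 qed
 have pe: "pm be {} g v = 0" for g by (simp add: pm_def avg_def)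
 have "(LINT h|Gm. F' i h) <= (LINT h|Gm. F i h) + (\<Sum>j<i. 2 * A * ta j * a j + exp (2 - A))" if "i <= nv" for i
  using that
 proof (induction i)
  case 0
  thus ?case by (simp add: F_def F'_def Bs(3) pe)
 next
  case (Suc i)
  thus ?case using step[of i] by simp
 qed
 thus ?thesis unfolding F_def F'_def by blast
qed

text \<open>The integrand of \<open>energy\<close> is bounded below by taking each replica at the
  end of [0, s] where it disagrees most with its boundary condition, which removes the integral. The
  right-hand side is averaged over the layers k < nv; the sites counted there lie outside
  \<open>U\<close>, so their boxes of radius \<open>r\<close> miss \<open>D\<close> and do not feel
  the shift.\<close>

lemma energy_recursion:
 fixes nv r :: nat
 assumes b: "be > 0" and r: "r >= 1" and s: "s > 0"
 defines "D == bx (0, 0) (4 * int r)" and "L == bx (0, 0) (12 * int r)"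
 shows "real nv * s * (SUM v:D. 1 - (LINT h|Gm. pm be L h v) - (LINT h|Gm. pm be L (%x. - (h x + s * of_bool (x : D))) v))
  <= 8 * real (card L) * mm be r + 2 * real nv * real (card (eds L)) * ap be (An (int r)) (SC (int r) (real nv))"
proof -
 let ?o = "(0, 0) :: site" and ?r = "int r"
 define U where "U = bx ?o (6 * ?r)"
 define W where "W = bx ?o (8 * ?r) - U"
 define R where "R = {x : L - U. EX y:W. adj x y}"
 have fL: "finite L" and fD: "finite D" and fR: "finite R" unfolding L_def D_def R_def using finite_bx by auto
 have DU: "D \<subseteq> U" "U \<subseteq> L" unfolding D_def U_def L_def by (intro bx_mono; simp)+
 have UW: "U Un W = bx ?o (8 * ?r)" unfolding W_def U_def using bx_mono[of "6 * ?r" "8 * ?r" ?o] by auto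
 have UWL: "U Un W \<subseteq> L" unfolding UW L_def by (rule bx_mono) simp
 have nbL: "y : L" if "x : U Un W" "adj x y" for x y
  using that r unfolding UW L_def bx_def adj_def mem_Collect_eq by (simp add: abs_le_iff) linarith
 have fA: "finite (An ?r)" unfolding An_def using finite_bx by simp
 have AL: "An ?r \<subseteq> L" "An ?r Int D = {}" unfolding An_def L_def D_def by auto
 have short: "SC ?r (real nv) (Kc L Ob C)" if h: "Lv L U W Ob C n x" "n < nv" "adj x y" "y : U" for Ob C n x y
 proof -
  have xU: "x ~: U" using Lv_in[OF h(1)] by blast
  have x6: "\<bar>fst x\<bar> <= 6 * ?r + 1" "\<bar>snd x\<bar> <= 6 * ?r + 1" using h(3,4) unfolding U_def bx_def adj_def by auto
  hence xW: "x : W" unfolding W_def using xU r unfolding bx_def by auto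
  from Lv_path[OF h(1) xW UWL] obtain p m w where p: "spath p m" "p m = x" "!!k. k <= m ==> p k : W & p k : Kc L Ob C" "Suc m <= n" "adj (p 0) w" "w ~: U Un W" by blast
  have "8 * ?r <= \<bar>fst (p 0)\<bar> \<or> 8 * ?r <= \<bar>snd (p 0)\<bar>" using p(5,6) unfolding UW bx_def adj_def by auto
  hence "p m ~: bx (p 0) (2 * ?r - 2)" unfolding p(2) using x6 unfolding bx_def by auto
  moreover have "p k : Kc L Ob C & p k : bx ?o (8 * ?r) - bx ?o (6 * ?r)" if "k <= m" for k using p(3)[OF that] unfolding W_def U_def by blast
  ultimately show ?thesis unfolding SC_def using p(1,4) h(2) by (intro exI[of _ p] exI[of _ m]) auto
 qed
 have quenched: "real nv * s * (SUM v:D. 1 - pm be L h v - pm be L (%x. - (h x + s * of_bool (x : D))) v)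
  <= 8 * (SUM v:R. kp be (bx v ?r) h (%x. - h x) (%K. v : K)) + 2 * real nv * real (card (eds L)) * kp be (An ?r) h (%x. - h x) (SC ?r (real nv))" for h
 proof -
  let ?h1 = "%x. h x + s * of_bool (x : D)" and ?h2 = "%x. - h x"
  let ?f = "%u. SUM v:D. dd be L (%x. h x + u * of_bool (x : D)) v" and ?low = "SUM v:D. 1 - pm be L h v - pm be L (%x. - (h x + s * of_bool (x : D))) v"
  have DL: "D \<subseteq> L" using DU by blast
  have fint: "?f integrable_on {0..s}" using dd_integral[OF b fL DL, of s h] s by (auto intro: has_integral_integrable)
  have low: "?low <= ?f u" if "u : {0..s}" for u
  proof (rule sum_mono)
   fix v
   have "pm be L (%x. h x + u * of_bool (x : D)) v <= pm be L h v" using that by (intro pm_field_mono[OF b fL]) auto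
   moreover have "pm be L (%x. - (h x + u * of_bool (x : D))) v <= pm be L (%x. - (h x + s * of_bool (x : D))) v"
    using that by (intro pm_field_mono[OF b fL]) (auto simp: mult_right_mono)
   ultimately show "1 - pm be L h v - pm be L (%x. - (h x + s * of_bool (x : D))) v <= dd be L (%x. h x + u * of_bool (x : D)) v" unfolding dd_def by linarith
  qed
  have "integral {0..s} (%_. ?low) <= integral {0..s} ?f" by (rule integral_le[OF _ fint low]) auto
  hence i1: "s * ?low <= integral {0..s} ?f" using s by simp
  have i2: "integral {0..s} ?f <= 2 * kexp be L ?h1 ?h2 (%M M' C. real (card (cutE L U W k (M Un M') C)))" for k
   by (rule energy[OF b fL DU _ nbL]) (use s in auto)
  have "real nv * s * ?low <= (\<Sum>k<nv. integral {0..s} ?f)" using i1 by (simp add: mult.assoc mult_left_mono)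
  also have "... <= (\<Sum>k<nv. 2 * kexp be L ?h1 ?h2 (%M M' C. real (card (cutE L U W k (M Un M') C))))" by (rule sum_mono) (rule i2)
  also have "... = 2 * kexp be L ?h1 ?h2 (%M M' C. \<Sum>k<nv. real (card (cutE L U W k (M Un M') C)))" by (simp only: kexp_sum sum_distrib_left)
  also have "... <= 2 * kexp be L ?h1 ?h2 (%M M' C. 4 * (SUM x:R. of_bool (x : Kc L (M Un M') C)) + real nv * real (card (eds L)) * of_bool (SC ?r (real nv) (Kc L (M Un M') C)))"
  proof (intro mult_left_mono kexp_mono[OF b fL])
   fix M M' C
   have "(\<Sum>k<nv. real (card (cutE L U W k (M Un M') C))) <= 4 * (SUM x:R. of_bool (x : Kc L (M Un M') C))
    + real nv * real (card (eds L)) * of_bool (\<exists>n x y. Lv L U W (M Un M') C n x & n < nv & adj x y & y : U)"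
    unfolding R_def by (rule cutE_sum[OF fL])
   also have "... <= 4 * (SUM x:R. of_bool (x : Kc L (M Un M') C)) + real nv * real (card (eds L)) * of_bool (SC ?r (real nv) (Kc L (M Un M') C))"
    using short by (intro add_left_mono mult_left_mono) auto
   finally show "(\<Sum>k<nv. real (card (cutE L U W k (M Un M') C))) <= 4 * (SUM x:R. of_bool (x : Kc L (M Un M') C)) + real nv * real (card (eds L)) * of_bool (SC ?r (real nv) (Kc L (M Un M') C))" .
  qed simp
  also have "... = 8 * (SUM v:R. kp be L ?h1 ?h2 (%K. v : K)) + 2 * real nv * real (card (eds L)) * kp be L ?h1 ?h2 (SC ?r (real nv))"
   unfolding kexp_add kexp_cmult kexp_sum kp_def by simp
  also have "(SUM v:R. kp be L ?h1 ?h2 (%K. v : K)) <= (SUM v:R. kp be (bx v ?r) h ?h2 (%K. v : K))"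
  proof (rule sum_mono)
   fix v assume v: "v : R"
   then obtain y where y: "y : W" "adj v y" "v ~: U" unfolding R_def by blast
   have vb: "v : bx v ?r" unfolding bx_def by simp
   have sub: "bx v ?r \<subseteq> L" using y(1,2) r unfolding W_def L_def bx_def adj_def by (auto simp: abs_le_iff)
   have dis: "x ~: D" if "x : bx v ?r" for x
   proof
    assume "x : D"
    hence "v : U" using that unfolding D_def U_def bx_def by auto
    thus False using y(3) by blast
   qed
   have "kp be L ?h1 ?h2 (%K. v : K) = kp be L ?h1 ?h2 (%K. v : K Int bx v ?r)" using vb by simp
   also have "... <= kp be (bx v ?r) ?h1 ?h2 (%K. v : K)" by (rule kp_domain[OF b fL sub upred_mem])
   also have "... = kp be (bx v ?r) h ?h2 (%K. v : K)" by (rule kp_field_cong) (use dis in auto)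
   finally show "kp be L ?h1 ?h2 (%K. v : K) <= kp be (bx v ?r) h ?h2 (%K. v : K)" .
  qed
  also have "kp be L ?h1 ?h2 (SC ?r (real nv)) <= kp be (An ?r) h ?h2 (SC ?r (real nv))"
  proof -
   have SA: "bx ?o (8 * ?r) - bx ?o (6 * ?r) \<subseteq> An ?r" unfolding An_def using bx_mono[of "8 * ?r" "12 * ?r" ?o] bx_mono[of "4 * ?r" "6 * ?r" ?o] by auto
   have "kp be L ?h1 ?h2 (SC ?r (real nv)) <= kp be L ?h1 ?h2 (%K. SC ?r (real nv) (K Int An ?r))"
    by (rule kp_mono[OF b fL]) (unfold SC_def, use SA in blast)
   also have "... <= kp be (An ?r) ?h1 ?h2 (SC ?r (real nv))" by (rule kp_domain[OF b fL AL(1) upred_SC])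
   also have "... = kp be (An ?r) h ?h2 (SC ?r (real nv))"
   proof (rule kp_field_cong)
    fix v assume "v : An ?r"
    hence "v ~: D" using AL(2) by blast
    thus "?h1 v = h v" by simp
   qed simp
   finally show ?thesis .
  qed
  finally show ?thesis by (simp add: mult_left_mono)
 qed
 have p1: "integrable Gm (%h. 1 - pm be L h v - pm be L (%x. - (h x + s * of_bool (x : D))) v)" for v
 proof -
  have "integrable Gm (%h :: site => real. 1 :: real)" by (rule integrable_bounded[of _ 1]) auto
  thus ?thesis by (intro Bochner_Integration.integrable_diff pm_int[OF fL])
 qed
 have kpi: "integrable Gm (%h. kp be (bx v ?r) h (%x. - h x) (%K. v : K))" for v by (rule kp_integrable[OF b finite_bx])
 have "real nv * s * (SUM v:D. 1 - (LINT h|Gm. pm be L h v) - (LINT h|Gm. pm be L (%x. - (h x + s * of_bool (x : D))) v))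
  = (LINT h|Gm. real nv * s * (SUM v:D. 1 - pm be L h v - pm be L (%x. - (h x + s * of_bool (x : D))) v))"
 proof -
  have "(LINT h|Gm. 1 - pm be L h v - pm be L (%x. - (h x + s * of_bool (x : D))) v) =
   1 - (LINT h|Gm. pm be L h v) - (LINT h|Gm. pm be L (%x. - (h x + s * of_bool (x : D))) v)" for v
   using pm_int[OF fL] prob_space.prob_space[OF prob_iid[where ?'i = site]] by (simp add: integrable_bounded[of _ 1])
  thus ?thesis using p1 by (simp add: Bochner_Integration.integral_sum)
 qed
 also have "... <= (LINT h|Gm. 8 * (SUM v:R. kp be (bx v ?r) h (%x. - h x) (%K. v : K)) + 2 * real nv * real (card (eds L)) * kp be (An ?r) h (%x. - h x) (SC ?r (real nv)))"
  by (rule integral_mono[OF _ _ quenched]) (use p1 kpi kp_integrable[OF b fA] in auto)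
 also have "... = 8 * (SUM v:R. mm be r) + 2 * real nv * real (card (eds L)) * ap be (An ?r) (SC ?r (real nv))"
  using kpi kp_integrable[OF b fA] by (simp add: Bochner_Integration.integral_sum ap_def mm_trl[unfolded ap_def])
 also have "8 * (SUM v:R. mm be r) <= 8 * real (card L) * mm be r"
 proof -
  have "card R <= card L" unfolding R_def using fL by (intro card_mono) auto
  thus ?thesis using mm_01[OF b, of r] by (simp add: mult_right_mono)
 qed
 finally show ?thesis by simp
qed

end

lemma powr_inverse_powr: "0 < (y :: real) ==> 0 < e ==> y = (y powr (1 / e)) powr e"
 by (simp add: powr_powr)

lemma card_eds_le:
 assumes "finite B"
 shows "card (eds B) <= 4 * card B"
proof -
 let ?T = "SIGMA x:B. {y. adj x y}"
 have fT: "finite ?T" using assms finite_nbr by blast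
 have "eds B \<subseteq> (%z. {fst z, snd z}) ` ?T"
 proof
  fix e assume "e : eds B"
  then obtain u v where "e = {u, v}" "u : B" "adj u v" unfolding eds_def by blast
  thus "e : (%z. {fst z, snd z}) ` ?T" by (intro image_eqI[of _ _ "(u, v)"]) auto
 qed
 hence "card (eds B) <= card ((%z. {fst z, snd z}) ` ?T)" using fT by (intro card_mono) auto
 also have "... <= card ?T" by (rule card_image_le[OF fT])
 also have "... = (SUM x:B. card {y. adj x y})" using assms finite_nbr by (intro card_SigmaI) auto
 also have "... <= (SUM x:B. 4)" by (intro sum_mono card_nbr_le)
 finally show ?thesis by simp
qed

context gauss
begin

lemma pm_increment:
 assumes b: "be > 0" and B: "finite B'" "B \<subseteq> B'" "v : B"
 shows "(LINT h|Gm. pm be B' (%x. - h x) v) - (LINT h|Gm. pm be B (%x. - h x) v) <= ap be B (%K. v : K)"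
proof -
 have fB: "finite B" using B finite_subset by blast
 have vB: "v : B'" using B by blast
 have "(LINT h|Gm. pm be B h v) <= (LINT h|Gm. pm be B' h v)"
  by (intro integral_mono pm_int fB B pm_domain_mono b)
 thus ?thesis using E_dd_pm[OF b fB B(3)] E_dd_pm[OF b B(1) vB] ap_ge0[OF b B(1), of "%K. v : K"] by linarith
qed

text \<open>The effect of a shift of the field is telescoped over dyadic boxes around the origin; on each scale the Gaussian tilt controls it.\<close>
lemma mm_recursion:
 fixes nv i :: nat
 assumes b: "be > 0" and r: "r = 2 ^ i" and s: "s > 0" and nu: "nv >= 1" and A: "A >= 1" "A * (24 * s * real r / ep) <= 1"
 shows "mm be (16 * r) <= (\<Sum>j<i + 4. 2 * A * (3 * s * 2 ^ j / ep) * (if j = 0 then 1 else mm be (2 ^ (j - 1))) + exp (2 - A))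
  + 79 * mm be r / (real nv * s) + 79 * ap be (An (int r)) (SC (int r) (real nv)) / s"
proof -
 let ?r = "int r" and ?o = "(0, 0) :: site"
 define D where "D = bx ?o (4 * ?r)"
 define L where "L = bx ?o (12 * ?r)"
 define I where "I = (\<Sum>j<i + 4. 2 * A * (3 * s * 2 ^ j / ep) * (if j = 0 then 1 else mm be (2 ^ (j - 1))) + exp (2 - A))"
 define P where "P = ap be (An ?r) (SC ?r (real nv))"
 have r1: "r >= 1" unfolding r by simp
 have r2: "?r = 2 ^ i" unfolding r by simp
 have fL: "finite L" and fD: "finite D" unfolding L_def D_def by (rule finite_bx)+
 have fA: "finite (An ?r)" unfolding An_def using finite_bx by simp
 have P0: "0 <= P" unfolding P_def by (rule ap_ge0[OF b fA])
 have I0: "0 <= I" unfolding I_def using A s eps mm_01[OF b] by (intro sum_nonneg) auto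
 have cD: "real (card D) = (8 * real r + 1)\<^sup>2" unfolding D_def by (subst card_bx) auto
 have cL: "real (card L) <= 625 * (real r)\<^sup>2"
 proof -
  have "real (card L) = (24 * real r + 1)\<^sup>2" unfolding L_def by (subst card_bx) auto
  also have "... <= (25 * real r)\<^sup>2" using r1 by (intro power_mono) auto
  finally show ?thesis by (simp add: power_mult_distrib)
 qed
 have pt: "mm be (16 * r) - I <= 1 - (LINT h|Gm. pm be L h v) - (LINT h|Gm. pm be L (%x. - (h x + s * of_bool (x : D))) v)" if v: "v : D" for v
 proof -
  \<comment> \<open>Dyadic boxes around \<open>v\<close>, completed at both ends: by the empty box,
    where the minus probability is 0, and by \<open>L\<close>, which contains the box of radius 4 *
    r around \<open>v\<close> and lies in the one of radius 16 * r.\<close>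
  define Bs where "Bs j = (if j = 0 then {} else if j < i + 4 then bx v (2 ^ (j - 1)) else L)" for j
  have vL: "v : L" using v bx_mono[of "4 * ?r" "12 * ?r" ?o] unfolding D_def L_def by auto
  have Lv: "L \<subseteq> bx v (int (16 * r))" using v unfolding D_def L_def bx_def by auto
  have bL: "bx v (4 * ?r) \<subseteq> L" unfolding L_def by (rule bx_nested[OF v[unfolded D_def]]) simp
  have fin: "finite (Bs j)" for j unfolding Bs_def using finite_bx fL by auto
  have sub: "Bs j \<subseteq> Bs (Suc j)" if "j < i + 4" for j
  proof (cases "j = 0 \<or> Suc j < i + 4")
   case True
   have "(2 :: int) ^ (j - 1) <= 2 ^ j" by (intro power_increasing) auto
   thus ?thesis using True bx_mono[of "2 ^ (j - 1)" "2 ^ j" v] that unfolding Bs_def by auto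
  next
   case False
   hence j: "j = i + 3" using that by auto
   have e: "(2 :: int) ^ (j - 1) = 4 * ?r" unfolding j r2 by (simp add: power_add)
   have "Bs j = bx v (2 ^ (j - 1))" "Bs (Suc j) = L" using False that unfolding Bs_def by simp_all
   thus ?thesis using bL unfolding e by simp
  qed
  have cB: "real (card (D Int Bs (Suc j))) <= (3 * 2 ^ j)\<^sup>2" if "j < i + 4" for j
  proof (cases "Suc j < i + 4")
   case True
   have "real (card (D Int Bs (Suc j))) <= real (card (bx v (2 ^ j)))" using True finite_bx by (simp add: Bs_def card_mono)
   also have "... = (2 * 2 ^ j + 1)\<^sup>2" by (subst card_bx) auto
   also have "... <= (3 * 2 ^ j)\<^sup>2" by (intro power_mono) auto
   finally show ?thesis .
  next
   case False
   hence j: "j = i + 3" using that by auto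
   have "real (card (D Int Bs (Suc j))) <= real (card D)" using fD by (simp add: card_mono)
   also have "... <= (3 * 2 ^ j)\<^sup>2" unfolding cD
   proof (rule power_mono)
    have "real r = 2 ^ i" "(1 :: real) <= 2 ^ i" "(2 :: real) ^ j = 8 * 2 ^ i" unfolding r j by (simp_all add: power_add)
    thus "8 * real r + 1 <= 3 * 2 ^ j" by linarith
   qed simp
   finally show ?thesis .
  qed
  have inf: "(LINT h|Gm. pm be (Bs (i + 4)) (%x. - (h x + s * of_bool (x : D))) v) <= (LINT h|Gm. pm be (Bs (i + 4)) (%x. - h x) v) + I"
   unfolding I_def
  proof (rule influence[where Bs = Bs and nv = "i + 4" and ta = "%j. 3 * s * 2 ^ j / ep" and a = "%j. if j = 0 then 1 else mm be (2 ^ (j - 1))", OF b fin sub])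
   show "Bs 0 = {}" by (simp add: Bs_def)
   show "0 <= A" using A by simp
   fix j assume j: "j < i + 4"
   let ?t = "3 * s * 2 ^ j / ep"
   have t0: "0 < ?t" using s eps by simp
   have "(2 :: real) ^ j <= 2 ^ (i + 3)" using j by (intro power_increasing) auto
   hence "2 ^ j <= 8 * real r" unfolding r by (simp add: power_add)
   hence "?t <= 3 * s * (8 * real r) / ep" using s eps by (intro divide_right_mono mult_left_mono) auto
   hence t1: "?t <= 24 * s * real r / ep" by simp
   hence "A * ?t <= A * (24 * s * real r / ep)" using A by (intro mult_left_mono) auto
   hence t2: "A * ?t <= 1" using A(2) by linarith
   have "1 * ?t <= A * ?t" using A t0 by (intro mult_right_mono) auto
   hence t3: "?t <= 1" using t2 by linarith
   have "s\<^sup>2 * real (card (D Int Bs (Suc j))) / ep\<^sup>2 <= s\<^sup>2 * (3 * 2 ^ j)\<^sup>2 / ep\<^sup>2" using cB[OF j] by (intro divide_right_mono mult_left_mono) auto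
   also have "... = ?t\<^sup>2" by (simp add: power_mult_distrib power_divide)
   finally show "0 < ?t & ?t <= 1 & s\<^sup>2 * real (card (D Int Bs (Suc j))) / ep\<^sup>2 <= ?t\<^sup>2 & A * ?t <= 1" using t0 t2 t3 by blast
   show "(LINT h|Gm. pm be (Bs (Suc j)) (%x. - h x) v) - (LINT h|Gm. pm be (Bs j) (%x. - h x) v) <= (if j = 0 then 1 else mm be (2 ^ (j - 1)))"
   proof (cases "j = 0")
    case True
    have "(LINT h|Gm. pm be (Bs (Suc j)) (%x. - h x) v) <= (\<integral>h. 1 \<partial>(Gm :: (site => real) measure))"
     by (intro integral_mono pm_int fin pm_bounds integrable_bounded[of _ 1]) auto
    hence "(LINT h|Gm. pm be (Bs (Suc j)) (%x. - h x) v) <= 1" by (simp only: prob_iid_one)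
    moreover have "0 <= (LINT h|Gm. pm be (Bs j) (%x. - h x) v)" by (intro Bochner_Integration.integral_nonneg pm_bounds fin)
    ultimately show ?thesis using True by simp
   next
    case False
    have e: "Bs j = bx v (int (2 ^ (j - 1)))" using False j unfolding Bs_def by simp
    have vB: "v : Bs j" unfolding e bx_def by simp
    have "(LINT h|Gm. pm be (Bs (Suc j)) (%x. - h x) v) - (LINT h|Gm. pm be (Bs j) (%x. - h x) v) <= ap be (Bs j) (%K. v : K)"
     by (rule pm_increment[OF b fin sub[OF j] vB])
    also have "... = mm be (2 ^ (j - 1))" unfolding e by (rule mm_trl)
    finally show ?thesis using False by simp
   qed
  qed
  have BL: "Bs (i + 4) = L" unfolding Bs_def by simp
  have "mm be (16 * r) <= ap be L (%K. v : K)" by (rule mm_domain_ge[OF b vL Lv])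
  thus ?thesis using inf E_dd_pm[OF b fL vL] unfolding BL by linarith
 qed
 have main: "real nv * s * (real (card D) * (mm be (16 * r) - I)) <= 8 * real (card L) * mm be r + 2 * real nv * real (card (eds L)) * P"
 proof -
  have "real (card D) * (mm be (16 * r) - I) = (SUM v:D. mm be (16 * r) - I)" by simp
  also have "... <= (SUM v:D. 1 - (LINT h|Gm. pm be L h v) - (LINT h|Gm. pm be L (%x. - (h x + s * of_bool (x : D))) v))" by (intro sum_mono pt)
  finally have "real nv * s * (real (card D) * (mm be (16 * r) - I)) <= real nv * s * (SUM v:D. 1 - (LINT h|Gm. pm be L h v) - (LINT h|Gm. pm be L (%x. - (h x + s * of_bool (x : D))) v))"
   using s by (intro mult_left_mono) auto
  also have "... <= 8 * real (card L) * mm be r + 2 * real nv * real (card (eds L)) * P"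
   unfolding D_def L_def P_def by (rule energy_recursion[OF b r1 s])
  finally show ?thesis .
 qed
 have q: "0 < real nv * s" using nu s by simp
 have "mm be (16 * r) - I <= 79 * mm be r / (real nv * s) + 79 * P / s"
 proof (cases "mm be (16 * r) - I <= 0")
  case True
  have "0 <= 79 * mm be r / (real nv * s) + 79 * P / s" using q s P0 mm_01[OF b, of r] by simp
  thus ?thesis using True by linarith
 next
  case False
  let ?d = "mm be (16 * r) - I" and ?x = "(real r)\<^sup>2"
  have x: "?x > 0" using r1 by simp
  have "64 * ?x <= real (card D)"
  proof -
   have "(8 * real r)\<^sup>2 <= (8 * real r + 1)\<^sup>2" by (intro power_mono) auto
   thus ?thesis unfolding cD by (simp add: power_mult_distrib)
  qed
  hence "real nv * s * (64 * ?x * ?d) <= real nv * s * (real (card D) * ?d)" using False q by (intro mult_left_mono mult_right_mono) auto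
  also note main
  also have "8 * real (card L) * mm be r + 2 * real nv * real (card (eds L)) * P <= 8 * (625 * ?x) * mm be r + 2 * real nv * (4 * (625 * ?x)) * P"
  proof -
   have "real (card (eds L)) <= 4 * real (card L)" using card_eds_le[OF fL] by (metis of_nat_le_iff of_nat_mult of_nat_numeral)
   hence "real (card (eds L)) <= 4 * (625 * ?x)" using cL by linarith
   thus ?thesis using cL mm_01[OF b, of r] P0 by (intro add_mono mult_right_mono mult_left_mono) auto
  qed
  finally have "?x * (real nv * s * (64 * ?d)) <= ?x * (5000 * mm be r + 5000 * real nv * P)" by (simp add: algebra_simps)
  hence "real nv * s * (64 * ?d) <= 5000 * mm be r + 5000 * real nv * P" using x by simp
  \<comment> \<open>79 is 5000 / 64 rounded up: \<open>L\<close> has at most 625 * r^2 sites, 8 *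
    625 = 5000, and \<open>D\<close> has at least 64 * r^2 sites.\<close>
  also have "... <= 64 * (79 * mm be r + 79 * real nv * P)" using mm_01[OF b, of r] P0 by (simp add: mult_mono)
  finally have "real nv * s * (64 * ?d) <= 64 * (79 * mm be r + 79 * real nv * P)" .
  moreover have "real nv * s * (64 * ?d) = 64 * (real nv * s * ?d)" by (simp only: mult_ac)
  ultimately have "64 * (real nv * s * ?d) <= 64 * (79 * mm be r + 79 * real nv * P)" by (simp only:)
  hence "real nv * s * ?d <= 79 * mm be r + 79 * real nv * P" by (rule mult_left_le_imp_le) simp
  hence "?d <= (79 * mm be r + 79 * real nv * P) / (real nv * s)" using q by (simp add: pos_le_divide_eq mult.commute)
  also have "... = 79 * mm be r / (real nv * s) + 79 * P / s" using nu by (simp add: add_divide_distrib)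
  finally show ?thesis .
 qed
 thus ?thesis unfolding I_def P_def by linarith
qed

definition decay :: "real => bool" where
 "decay a \<longleftrightarrow> (\<exists>C\<ge>1. \<forall>be>0. \<forall>n\<ge>1. mm be n <= C * real n powr (- a))"

lemma SC_mono: "\<mu> <= \<mu>' ==> SC r \<mu> K ==> SC r \<mu>' K"
 unfolding SC_def by (meson order_less_le_trans)

text \<open>Paths of \<open>K\<close> across an annulus have superlinearly many sites, so the recursion gains a fixed amount in the exponent.\<close>
lemma bootstrap:
 assumes al: "0 < af" "af <= 1" and C0: "C0 >= 1"
  and cr: "!!be r. be > 0 ==> r >= 1 ==> ap be (An (int r)) (SC (int r) (real r powr (1 + af))) <= C0 * real r powr (- 5)"
  and a: "0 <= a" "a <= 1" and d: "decay a"
 shows "decay (a + af / 3)"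
proof -
 obtain C where C: "C >= 1" "!!be n. be > 0 ==> n >= 1 ==> mm be n <= C * real n powr (- a)" using d unfolding decay_def by blast
 define de where "de = af / 16"
 define K1 where "K1 = 2 + 4 / de"
 have dl: "de > 0" using al by (simp add: de_def)
 have K1: "K1 >= 2" using dl by (simp add: K1_def)
 define a' where "a' = a + af / 3"
 have a': "0 <= a'" "a' <= 4 / 3" using a al by (auto simp: a'_def)
 define C1 where "C1 = 192 * K1\<^sup>2 * C / ep + 2 * K1 + 158 * C + 79 * C0"
 have C1: "C1 >= 1" unfolding C1_def using C C0 K1 eps by (smt (verit) divide_nonneg_pos mult_nonneg_nonneg zero_le_power2)
 obtain x0 :: nat where x0: "real x0 >= max 1 ((24 * K1 / ep) powr (1 / (af / 2 - de)))" using real_arch_simple by blast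
 have main: "mm be (16 * r) <= C1 * real r powr (- a')" if b: "be > 0" and r: "r = 2 ^ i" and rx: "r >= x0" for be r i
 proof -
  define x where "x = real r"
  have x: "x >= 1" "x >= (24 * K1 / ep) powr (1 / (af / 2 - de))" using x0 rx unfolding x_def by auto
  have r1: "r >= 1" unfolding r by simp
  \<comment> \<open>A compromise: s * x decays like x powr (- af / 2), so the shift has little
    influence, while nv * s still grows like x powr (af / 2). Both errors gain af / 2 up to powers
    of \<open>A\<close>, and af / 3 of this is kept.\<close>
  define s where "s = x powr (- 1 - af / 2)"
  define nv where "nv = nat \<lfloor>x powr (1 + af)\<rfloor>"
  \<comment> \<open>Makes exp (2 - A) equal to x powr (- 4), and 2 * A bounds the number i + 4 of
    dyadic scales.\<close>
  define A where "A = 2 + 4 * ln x"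
  have s: "s > 0" unfolding s_def using x by simp
  have xp: "1 <= x powr (1 + af)" using x al by (simp add: ge_one_powr_ge_zero)
  have nu: "nv >= 1" "real nv <= x powr (1 + af)" "x powr (1 + af) / 2 <= real nv"
  proof -
   show "nv >= 1" unfolding nv_def using xp by (simp add: le_nat_iff le_floor_iff)
   show "real nv <= x powr (1 + af)" unfolding nv_def using xp by simp
   thus "x powr (1 + af) / 2 <= real nv" using \<open>nv >= 1\<close> unfolding nv_def by linarith
  qed
  have A: "A >= 2" unfolding A_def using x by simp
  have AK: "A <= K1 * x powr de"
  proof -
   have "1 <= x powr de" using x dl by (simp add: ge_one_powr_ge_zero)
   moreover have "ln x <= x powr de / de" by (rule ln_powr_bound[OF x(1) dl])
   ultimately have "A <= 2 * x powr de + 4 * (x powr de / de)" unfolding A_def by linarith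
   thus ?thesis unfolding K1_def by (simp add: distrib_right)
  qed
  have sx: "s * x = x powr (- af / 2)"
  proof -
   have "s * x powr 1 = x powr (- 1 - af / 2 + 1)" unfolding s_def by (simp only: powr_add)
   thus ?thesis using x by simp
  qed
  have cond: "A * (24 * s * real r / ep) <= 1"
  proof -
   have "A * (24 * s * real r / ep) = 24 / ep * (A * x powr (- af / 2))" using sx by (simp add: x_def[symmetric])
   also have "... <= 24 / ep * (K1 * x powr de * x powr (- af / 2))" using AK eps by (intro mult_left_mono mult_right_mono) auto
   also have "... = (24 * K1 / ep) * x powr (- (af / 2 - de))" by (simp add: mult.assoc powr_add[symmetric])
   also have "... <= 1"
   proof -
    have e: "af / 2 - de > 0" using al by (simp add: de_def)
    have k: "24 * K1 / ep > 0" using K1 eps by simp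
    have "24 * K1 / ep = ((24 * K1 / ep) powr (1 / (af / 2 - de))) powr (af / 2 - de)" by (rule powr_inverse_powr[OF k e])
    also have "... <= x powr (af / 2 - de)" using x(2) e by (intro powr_mono2) auto
    finally have "(24 * K1 / ep) * x powr (- (af / 2 - de)) <= x powr (af / 2 - de) * x powr (- (af / 2 - de))" by (intro mult_right_mono) auto
    also have "... = 1" using x by (simp add: powr_add[symmetric])
    finally show ?thesis .
   qed
   finally show ?thesis .
  qed
  define S where "S = (\<Sum>j<i + 4. 2 * A * (3 * s * 2 ^ j / ep) * (if j = 0 then 1 else mm be (2 ^ (j - 1))) + exp (2 - A))"
  have rec: "mm be (16 * r) <= S + 79 * mm be r / (real nv * s) + 79 * ap be (An (int r)) (SC (int r) (real nv)) / s"
   unfolding S_def by (rule mm_recursion[OF b r s nu(1) _ cond]) (use A in simp)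
  have pw: "x powr e <= x powr (- a')" if "e <= - a'" for e using that x(1) by (intro powr_mono) auto
  have T1: "S <= (192 * K1\<^sup>2 * C / ep + 2 * K1) * x powr (- a')"
  proof -
   have summand: "2 * A * (3 * s * 2 ^ j / ep) * (if j = 0 then 1 else mm be (2 ^ (j - 1))) + exp (2 - A) <= 96 * A * C / ep * x powr (- af / 2 - a) + x powr (- 4)" if j: "j < i + 4" for j
   proof -
    \<comment> \<open>As a <= 1, the product of 2 ^ j and the order parameter at that scale is
      controlled by the last scale, that is by x powr (1 - a). Beyond exponent 1 this fails, so the
      bootstrap stops there.\<close>
    have m: "2 ^ j * (if j = 0 then 1 else mm be (2 ^ (j - 1))) <= 16 * C * x powr (1 - a)"
    proof (cases "j = 0")
     case True
     have "1 <= x powr (1 - a)" using x a by (simp add: ge_one_powr_ge_zero)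
     hence "1 * 1 <= 16 * C * x powr (1 - a)" using C(1) by (intro mult_mono) auto
     thus ?thesis using True by simp
    next
     case False
     define y :: real where "y = 2 ^ (j - 1)"
     have y: "y > 0" unfolding y_def by simp
     have "mm be (2 ^ (j - 1)) <= C * y powr (- a)" using C(2)[OF b, of "2 ^ (j - 1)"] unfolding y_def by simp
     hence "2 ^ j * mm be (2 ^ (j - 1)) <= 2 * y * (C * y powr (- a))"
      using False unfolding y_def by (cases j) (auto intro!: mult_left_mono)
     also have "... = 2 * C * y powr (1 - a)" using y by (simp add: powr_diff powr_minus divide_inverse)
     also have "... <= 2 * C * (8 * x) powr (1 - a)"
     proof -
      have "y <= 2 ^ (i + 3)" unfolding y_def using j by (intro power_increasing) auto
      also have "... = 8 * x" unfolding x_def r by (simp add: power_add)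
      finally show ?thesis using C(1) y a by (intro mult_left_mono powr_mono2) auto
     qed
     also have "... = 2 * C * (8 powr (1 - a) * x powr (1 - a))" using x by (simp add: powr_mult)
     also have "... <= 2 * C * (8 * x powr (1 - a))"
     proof -
      have "8 powr (1 - a) <= 8 powr (1 :: real)" using a by (intro powr_mono) auto
      thus ?thesis using C(1) by (intro mult_left_mono mult_right_mono) auto
     qed
     finally show ?thesis using False by simp
    qed
    have "2 * A * (3 * s * 2 ^ j / ep) * (if j = 0 then 1 else mm be (2 ^ (j - 1))) = 6 * A * s / ep * (2 ^ j * (if j = 0 then 1 else mm be (2 ^ (j - 1))))" by simp
    also have "... <= 6 * A * s / ep * (16 * C * x powr (1 - a))" using m A s eps by (intro mult_left_mono) auto
    also have "... = 96 * A * C / ep * (s * x powr (1 - a))" by simp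
    also have "s * x powr (1 - a) = x powr (- af / 2 - a)"
    proof -
     have "- 1 - af / 2 + (1 - a) = - af / 2 - a" by simp
     thus ?thesis unfolding s_def by (simp only: powr_add[symmetric])
    qed
    finally have "2 * A * (3 * s * 2 ^ j / ep) * (if j = 0 then 1 else mm be (2 ^ (j - 1))) <= 96 * A * C / ep * x powr (- af / 2 - a)" .
    moreover have "exp (2 - A) = x powr (- 4)" unfolding A_def powr_def using x by simp
    ultimately show ?thesis by linarith
   qed
   have q1: "A\<^sup>2 * x powr (- af / 2 - a) <= K1\<^sup>2 * x powr (- a')"
   proof -
    have "A\<^sup>2 <= (K1 * x powr de)\<^sup>2" using AK A by (intro power_mono) auto
    also have "... = K1\<^sup>2 * x powr (af / 8)" by (simp add: power_mult_distrib power2_eq_square powr_add[symmetric] de_def)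
    finally have "A\<^sup>2 * x powr (- af / 2 - a) <= K1\<^sup>2 * x powr (af / 8) * x powr (- af / 2 - a)" by (rule mult_right_mono) simp
    also have "... = K1\<^sup>2 * x powr (af / 8 + (- af / 2 - a))" by (simp only: mult.assoc powr_add)
    also have "... <= K1\<^sup>2 * x powr (- a')" using al by (intro mult_left_mono pw) (auto simp: a'_def)
    finally show ?thesis .
   qed
   have q2: "A * x powr (- 4) <= K1 * x powr (- a')"
   proof -
    have "A * x powr (- 4) <= K1 * x powr de * x powr (- 4)" using AK by (rule mult_right_mono) simp
    also have "... = K1 * x powr (de + - 4)" by (simp only: mult.assoc powr_add)
    also have "... <= K1 * x powr (- a')" using al a' K1 by (intro mult_left_mono pw) (auto simp: de_def)
    finally show ?thesis .
   qed
   have "S <= (\<Sum>j<i + 4. 96 * A * C / ep * x powr (- af / 2 - a) + x powr (- 4))" unfolding S_def by (intro sum_mono summand) simp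
   also have "... = (real i + 4) * (96 * A * C / ep * x powr (- af / 2 - a) + x powr (- 4))" by simp
   also have "... <= 2 * A * (96 * A * C / ep * x powr (- af / 2 - a) + x powr (- 4))"
   proof (rule mult_right_mono)
    have "ln x = real i * ln 2" unfolding x_def r by (simp add: ln_realpow)
    moreover have "real i * (1 / 2) <= real i * ln 2" using ln_le_minus_one[of "1 / 2 :: real"] by (intro mult_left_mono) (auto simp: ln_div)
    ultimately show "real i + 4 <= 2 * A" unfolding A_def using x by simp
    show "0 <= 96 * A * C / ep * x powr (- af / 2 - a) + x powr (- 4)" using A C(1) eps by simp
   qed
   also have "... = 192 * C / ep * (A\<^sup>2 * x powr (- af / 2 - a)) + 2 * (A * x powr (- 4))" by (simp add: power2_eq_square distrib_left)
   also have "... <= 192 * C / ep * (K1\<^sup>2 * x powr (- a')) + 2 * (K1 * x powr (- a'))"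
    using q1 q2 C(1) eps by (intro add_mono mult_left_mono) auto
   finally show ?thesis by (simp add: algebra_simps)
  qed
  have T3: "79 * mm be r / (real nv * s) <= 158 * C * x powr (- a')"
  proof -
   have "x powr (af / 2) / 2 <= real nv * s"
   proof -
    have "x powr (1 + af) / 2 * s <= real nv * s" using nu(3) s by (intro mult_right_mono) auto
    moreover have "x powr (1 + af) * s = x powr (af / 2)" unfolding s_def by (simp add: powr_add[symmetric])
    ultimately show ?thesis by simp
   qed
   moreover have "0 < x powr (af / 2) / 2" using x by simp
   ultimately have "79 * mm be r / (real nv * s) <= 79 * (C * x powr (- a)) / (x powr (af / 2) / 2)"
    using C(2)[OF b r1] mm_01[OF b, of r] C(1) unfolding x_def by (intro frac_le) auto
   also have "... = 158 * C * (x powr (- a) / x powr (af / 2))" by simp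
   also have "x powr (- a) / x powr (af / 2) = x powr (- a - af / 2)" by (simp only: powr_diff)
   also have "158 * C * x powr (- a - af / 2) <= 158 * C * x powr (- a')" using C(1) al by (intro mult_left_mono pw) (auto simp: a'_def)
   finally show ?thesis .
  qed
  have T4: "79 * ap be (An (int r)) (SC (int r) (real nv)) / s <= 79 * C0 * x powr (- a')"
  proof -
   have fA: "finite (An (int r))" unfolding An_def using finite_bx by simp
   have "ap be (An (int r)) (SC (int r) (real nv)) <= ap be (An (int r)) (SC (int r) (real r powr (1 + af)))"
    by (rule ap_mono[OF b fA]) (rule SC_mono, use nu(2) in \<open>simp add: x_def\<close>)
   also have "... <= C0 * x powr (- 5)" unfolding x_def by (rule cr[OF b r1])
   finally have "79 * ap be (An (int r)) (SC (int r) (real nv)) / s <= 79 * (C0 * x powr (- 5)) / s" using s by (intro divide_right_mono) auto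
   also have "... = 79 * C0 * (x powr (- 5) / s)" by simp
   also have "x powr (- 5) / s = x powr (- 5 - (- 1 - af / 2))" unfolding s_def by (simp only: powr_diff)
   also have "79 * C0 * x powr (- 5 - (- 1 - af / 2)) <= 79 * C0 * x powr (- a')" using C0 al a' by (intro mult_left_mono pw) auto
   finally show ?thesis .
  qed
  show ?thesis using rec T1 T3 T4 unfolding C1_def x_def[symmetric] by (simp add: algebra_simps)
 qed
 define N0 where "N0 = 32 * (x0 + 1)"
 define C2 where "C2 = max (C1 * 32 powr a') (real N0 powr a')"
 have C21: "C2 >= 1"
 proof -
  have "1 <= real N0 powr a'" unfolding N0_def using a' by (intro ge_one_powr_ge_zero) auto
  thus ?thesis unfolding C2_def by simp
 qed
 have "mm be n <= C2 * real n powr (- a')" if b: "be > 0" and n: "n >= 1" for be n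
 proof (cases "n < N0")
  case True
  have "real n powr a' <= real N0 powr a'" using True a' by (intro powr_mono2) auto
  also have "... <= C2" unfolding C2_def by simp
  finally have "real n powr a' * real n powr (- a') <= C2 * real n powr (- a')" by (rule mult_right_mono) simp
  moreover have "real n powr a' * real n powr (- a') = 1" using n by (simp add: powr_add[symmetric])
  ultimately show ?thesis using mm_01[OF b, of n] by linarith
 next
  case False
  have "1 <= n div 16" using False unfolding N0_def by (simp add: less_eq_div_iff_mult_less_eq)
  from ex_power_ivl1[OF order_refl this] obtain i where i: "2 ^ i <= n div 16" "n div 16 < 2 ^ (i + 1)" by blast
  define r where "r = (2 :: nat) ^ i"
  have rn: "16 * r <= n" "n <= 32 * r" using i unfolding r_def by auto
  have rx: "x0 <= r" using rn(2) False unfolding N0_def by simp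
  have r0: "real r > 0" unfolding r_def by simp
  have "mm be n <= mm be (16 * r)" by (rule mm_mono[OF b rn(1)])
  also have "... <= C1 * real r powr (- a')" by (rule main[OF b r_def rx])
  also have "... <= C1 * (real n / 32) powr (- a')"
  proof (rule mult_left_mono)
   have "real n <= 32 * real r" using rn(2) by (metis of_nat_le_iff of_nat_mult of_nat_numeral)
   thus "real r powr (- a') <= (real n / 32) powr (- a')" using n a' by (intro powr_mono2') auto
  qed (use C1 in simp)
  also have "... = C1 * 32 powr a' * real n powr (- a')"
  proof -
   have e: "(32 :: real) powr (- a') = 1 / 32 powr a'" by (rule powr_minus_divide)
   have "(real n / 32) powr (- a') = real n powr (- a') / 32 powr (- a')" by (simp only: powr_divide)
   thus ?thesis unfolding e by simp
  qed
  also have "... <= C2 * real n powr (- a')" unfolding C2_def by (intro mult_right_mono) auto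
  finally show ?thesis .
 qed
 thus ?thesis unfolding decay_def a'_def[symmetric] using C21 by blast
qed

text \<open>From the trivial exponent 0, a fixed amount af / 3 is gained as long as the exponent is
  at most 1, so after finitely many rounds it exceeds 1. Then l * mm be l tends to 0 uniformly in
  \<open>be\<close>, and a single scale \<open>l\<close> serves the finite-size criterion at all
  temperatures.\<close>

theorem mm_exponential: "\<exists>C>0. \<exists>c>0. \<forall>be>0. \<forall>N. mm be N <= C * exp (- c * real N)"
proof -
 from crossing_rare obtain af C0 where al: "0 < af" "af <= 1" "C0 >= 1"
  and cr: "!!be r. be > 0 ==> r >= 1 ==> ap be (An (int r)) (SC (int r) (real r powr (1 + af))) <= C0 * real r powr (- 5)" by blast
 define et where "et = af / 3"
 have eta: "et > 0" using al by (simp add: et_def)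
 have it: "real k * et <= 1 + et ==> decay (real k * et)" for k
 proof (induction k)
  case 0
  thus ?case unfolding decay_def using mm_01 by (intro exI[of _ 1]) auto
 next
  case (Suc k)
  have e: "real (Suc k) * et = real k * et + af / 3" by (simp add: distrib_right et_def)
  have k1: "real k * et <= 1" using Suc.prems by (simp add: distrib_right)
  hence "decay (real k * et)" using Suc.IH eta by simp
  thus ?case unfolding e using al cr k1 eta by (intro bootstrap[of af C0]) auto
 qed
 define k where "k = nat \<lfloor>1 / et\<rfloor> + 1"
 have fl: "real (nat \<lfloor>1 / et\<rfloor>) = of_int \<lfloor>1 / et\<rfloor>" using eta by simp
 have k: "1 < real k * et" "real k * et <= 1 + et"
 proof -
  have "1 / et < real k" unfolding k_def using fl by simp linarith
  thus "1 < real k * et" using eta by (simp add: pos_divide_less_eq)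
  have "real k <= 1 / et + 1" unfolding k_def using fl by simp
  hence "real k * et <= (1 / et + 1) * et" using eta by (intro mult_right_mono) auto
  thus "real k * et <= 1 + et" using eta by (simp add: distrib_right)
 qed
 define a where "a = real k * et"
 have a: "a > 1" using k(1) unfolding a_def .
 obtain C where C: "C >= 1" "!!be n. be > 0 ==> n >= 1 ==> mm be n <= C * real n powr (- a)" using it[OF k(2)] unfolding decay_def a_def by blast
 define q :: real where "q = (exp (- 1) / 882)\<^sup>2"
 have q: "q > 0" "882 * sqrt q <= exp (- 1)" unfolding q_def by simp_all
 obtain l :: nat where l: "real l >= max 1 ((12 * C / q) powr (1 / (a - 1)))" using real_arch_simple by blast
 have l1: "l >= 1" using l by simp
 have small: "12 * real l * mm be l <= q" if b: "be > 0" for be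
 proof -
  have "12 * real l * mm be l <= 12 * real l * (C * real l powr (- a))" using C(2)[OF b l1] by (intro mult_left_mono) auto
  also have "... = 12 * C * real l powr (- (a - 1))" using l1 by (simp add: powr_diff powr_minus divide_inverse)
  also have "... <= q"
  proof -
   have p: "12 * C / q > 0" using C(1) q by simp
   have "12 * C / q = ((12 * C / q) powr (1 / (a - 1))) powr (a - 1)" by (rule powr_inverse_powr[OF p]) (use a in simp)
   also have "... <= real l powr (a - 1)" using l a by (intro powr_mono2) auto
   finally have "12 * C <= q * real l powr (a - 1)" using q by (simp add: pos_divide_le_eq mult.commute)
   hence "12 * C * real l powr (- (a - 1)) <= q * real l powr (a - 1) * real l powr (- (a - 1))" by (rule mult_right_mono) simp
   also have "... = q" using l1 by (simp add: mult.assoc powr_add[symmetric])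
   finally show ?thesis .
  qed
  finally show ?thesis .
 qed
 have "mm be N <= exp 2 * exp (- (1 / (10 * real l)) * real N)" if "be > 0" for be N
  using finite_size_criterion[OF l1 small q(2) that, of N] by simp
 thus ?thesis using l1 by (intro exI[of _ "exp 2"] conjI exI[of _ "1 / (10 * real l)"]) auto
qed

end

section \<open>Spin systems on the box\<close>

lemma card_bd: "card (bd M) = card {z. fst z : M & snd z ~: M & adj (fst z) (snd z)}"
proof -
 let ?Z = "{z :: site \<times> site. fst z : M & snd z ~: M & adj (fst z) (snd z)}"
 have "bij_betw (%z. {fst z, snd z}) ?Z (bd M)" unfolding bij_betw_def
 proof
  show "inj_on (%z. {fst z, snd z}) ?Z"
  proof (rule inj_onI)
   fix z w assume zw: "z : ?Z" "w : ?Z" "{fst z, snd z} = {fst w, snd w}"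
   hence "fst z = fst w" "snd z = snd w" by (auto simp: doubleton_eq_iff)
   thus "z = w" by (simp add: prod_eq_iff)
  qed
  show "(%z. {fst z, snd z}) ` ?Z = bd M"
  proof (intro equalityI subsetI)
   fix e assume "e : bd M"
   then obtain u v where "e = {u, v}" "u : M" "v ~: M" "adj u v" unfolding bd_def by blast
   thus "e : (%z. {fst z, snd z}) ` ?Z" by (intro image_eqI[of _ _ "(u, v)"]) auto
  next
   fix e assume "e : (%z. {fst z, snd z}) ` ?Z"
   then obtain z where "e = {fst z, snd z}" "fst z : M" "snd z ~: M" "adj (fst z) (snd z)" by blast
   thus "e : bd M" by (simp add: in_bd_iff)
  qed
 qed
 from bij_betw_same_card[OF this] show ?thesis by simp
qed

text \<open>The configuration whose spins opposite to the boundary condition \<open>b\<close> are exactly those in \<open>M\<close>.\<close>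
definition cfg :: "nat => real => site set => site => real" where
 "cfg N b M v = (if v : box N then b * (1 - 2 * of_bool (v : M)) else 0)"

lemma box_bx: "box N = bx (0, 0) (int N)" unfolding box_def bx_def by simp

lemma finite_box: "finite (box N)" unfolding box_bx by (rule finite_bx)

lemma configs_cfg:
 assumes "b = 1 \<or> b = -1"
 shows "configs N = cfg N b ` Pow (box N)" "inj_on (cfg N b) (Pow (box N))"
proof -
 show "inj_on (cfg N b) (Pow (box N))"
 proof (rule inj_onI)
  fix M M' assume M: "M : Pow (box N)" "M' : Pow (box N)" "cfg N b M = cfg N b M'"
  have "v : M \<longleftrightarrow> v : M'" if "v : box N" for v
   using fun_cong[OF M(3), of v] that assms unfolding cfg_def by (auto split: if_splits simp: of_bool_def)
  thus "M = M'" using M(1,2) by blast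
 qed
 show "configs N = cfg N b ` Pow (box N)"
 proof (intro equalityI subsetI)
  fix \<sigma> assume s: "\<sigma> : configs N"
  have "\<sigma> = cfg N b {v : box N. \<sigma> v = - b}"
  proof
   fix v
   show "\<sigma> v = cfg N b {v : box N. \<sigma> v = - b} v"
   proof (cases "v : box N")
    case True
    hence "\<sigma> v = 1 \<or> \<sigma> v = -1" using s unfolding configs_def by blast
    thus ?thesis using True assms unfolding cfg_def by auto
   next
    case False
    thus ?thesis using s unfolding configs_def cfg_def by simp
   qed
  qed
  thus "\<sigma> : cfg N b ` Pow (box N)" by blast
 next
  fix \<sigma> assume "\<sigma> : cfg N b ` Pow (box N)"
  then obtain M where M: "\<sigma> = cfg N b M" by blast
  show "\<sigma> : configs N" unfolding configs_def M cfg_def using assms by auto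
 qed
qed

text \<open>Relative to full agreement with the boundary, each disagreeing edge and each reversed
  spin changes its term by a factor -1, hence the 2. Pairs inside the box carry weight 1/2 but occur
  in both orders, pairs with the outer boundary occur once; together they count
  \<open>bd M\<close>.\<close>

lemma hamiltonian_cfg:
 assumes b: "b = 1 \<or> b = -1"
 shows "\<exists>K. \<forall>M\<subseteq>box N. hamiltonian N b h (cfg N b M) = 2 * (real (card (bd M)) + (SUM v:M. b * h v)) - K"
proof -
 let ?B = "box N"
 define P where "P = {z :: site \<times> site. fst z : ?B & snd z : ?B & adj (fst z) (snd z)}"
 define Q where "Q = {z :: site \<times> site. fst z : ?B & snd z : outer_boundary ?B & adj (fst z) (snd z)}"
 have fT: "finite (SIGMA x:?B. {y. adj x y})" using finite_box finite_nbr by blast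
 have fin: "finite P" "finite Q" by (rule finite_subset[OF _ fT]; force simp: P_def Q_def)+
 have bb: "b * b = 1" using b by auto
 have PQ: "{(u, v). u : ?B & v : ?B & adj u v} = P" "{(u, v). u : ?B & v : outer_boundary ?B & adj u v} = Q" unfolding P_def Q_def by auto
 define K where "K = real (card P) / 2 + real (card Q) + (SUM v:?B. b * h v)"
 have "hamiltonian N b h (cfg N b M) = 2 * (real (card (bd M)) + (SUM v:M. b * h v)) - K" if M: "M \<subseteq> ?B" for M
 proof -
  let ?e = "%v. 1 - 2 * of_bool (v : M) :: real"
  define X where "X = {z : P. fst z : M & snd z ~: M}"
  define Y where "Y = {z : Q. fst z : M}"
  have fM: "finite M" using M finite_box finite_subset by blast
  have s1: "(SUM z:P. cfg N b M (fst z) * cfg N b M (snd z)) = real (card P) - 4 * real (card X)"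
  proof -
   have sw: "(SUM z:P. of_bool (fst z ~: M & snd z : M)) = (SUM z:P. of_bool (fst z : M & snd z ~: M) :: real)"
    by (rule sum.reindex_bij_witness[where i = "%z. (snd z, fst z)" and j = "%z. (snd z, fst z)"]) (auto simp: P_def adj_sym)
   have cX: "(SUM z:P. of_bool (fst z : M & snd z ~: M)) = real (card X)"
   proof -
    have "real (card X) = (SUM z:P. of_bool (z : X))" by (rule card_eq_sum[OF fin(1)]) (auto simp: X_def)
    also have "... = (SUM z:P. of_bool (fst z : M & snd z ~: M))" by (rule sum.cong) (auto simp: X_def)
    finally show ?thesis by simp
   qed
   have "(SUM z:P. cfg N b M (fst z) * cfg N b M (snd z)) = (SUM z:P. 1 - 2 * of_bool (fst z : M & snd z ~: M) - 2 * of_bool (fst z ~: M & snd z : M))"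
   proof (rule sum.cong[OF refl])
    fix z assume "z : P"
    hence z: "fst z : ?B" "snd z : ?B" unfolding P_def by auto
    have "cfg N b M (fst z) * cfg N b M (snd z) = (b * b) * (?e (fst z) * ?e (snd z))" unfolding cfg_def using z by simp
    also have "... = 1 - 2 * of_bool (fst z : M & snd z ~: M) - 2 * of_bool (fst z ~: M & snd z : M)"
     unfolding bb by (cases "fst z : M"; cases "snd z : M") simp_all
    finally show "cfg N b M (fst z) * cfg N b M (snd z) = 1 - 2 * of_bool (fst z : M & snd z ~: M) - 2 * of_bool (fst z ~: M & snd z : M)" .
   qed
   also have "... = real (card P) - 2 * (SUM z:P. of_bool (fst z : M & snd z ~: M)) - 2 * (SUM z:P. of_bool (fst z ~: M & snd z : M))"
    by (simp add: sum_subtractf sum_distrib_left)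
   finally show ?thesis unfolding sw cX by simp
  qed
  have s2: "b * (SUM z:Q. cfg N b M (fst z)) = real (card Q) - 2 * real (card Y)"
  proof -
   have "real (card Y) = (SUM z:Q. of_bool (z : Y))" by (rule card_eq_sum[OF fin(2)]) (auto simp: Y_def)
   also have "... = (SUM z:Q. of_bool (fst z : M))" by (rule sum.cong) (auto simp: Y_def)
   finally have cY: "real (card Y) = (SUM z:Q. of_bool (fst z : M))" .
   have "b * (SUM z:Q. cfg N b M (fst z)) = (SUM z:Q. b * cfg N b M (fst z))" by (rule sum_distrib_left)
   also have "... = (SUM z:Q. 1 - 2 * of_bool (fst z : M))"
   proof (rule sum.cong[OF refl])
    fix z assume "z : Q"
    hence "cfg N b M (fst z) = b * ?e (fst z)" unfolding Q_def cfg_def by auto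
    thus "b * cfg N b M (fst z) = 1 - 2 * of_bool (fst z : M)" using bb by (simp add: mult.assoc[symmetric])
   qed
   also have "... = real (card Q) - 2 * real (card Y)" unfolding cY by (simp add: sum_subtractf sum_distrib_left)
   finally show ?thesis .
  qed
  have s3: "(SUM u:?B. cfg N b M u * h u) = (SUM v:?B. b * h v) - 2 * (SUM v:M. b * h v)"
  proof -
   have "(SUM u:?B. cfg N b M u * h u) = (SUM u:?B. b * h u - 2 * (if u : M then b * h u else 0))"
    by (rule sum.cong[OF refl]) (auto simp: cfg_def algebra_simps)
   also have "... = (SUM v:?B. b * h v) - 2 * (SUM v:?B. if v : M then b * h v else 0)" by (simp add: sum_subtractf sum_distrib_left)
   also have "(SUM v:?B. if v : M then b * h v else 0) = (SUM v:M. b * h v)" using M finite_box by (simp add: sum.inter_restrict[symmetric] Int_absorb1)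
   finally show ?thesis .
  qed
  have cb: "card (bd M) = card X + card Y"
  proof -
   have "{z. fst z : M & snd z ~: M & adj (fst z) (snd z)} = X Un Y"
   proof (intro equalityI subsetI)
    fix z assume z: "z : {z. fst z : M & snd z ~: M & adj (fst z) (snd z)}"
    hence "fst z : ?B" using M by blast
    thus "z : X Un Y" using z unfolding X_def Y_def P_def Q_def outer_boundary_def by (cases "snd z : ?B") auto
   next
    fix z assume "z : X Un Y"
    thus "z : {z. fst z : M & snd z ~: M & adj (fst z) (snd z)}"
     using M unfolding X_def Y_def P_def Q_def outer_boundary_def by blast
   qed
   moreover have "X Int Y = {}" unfolding X_def Y_def P_def Q_def outer_boundary_def by blast
   moreover have "finite X" "finite Y" unfolding X_def Y_def using fin by auto
   ultimately show ?thesis unfolding card_bd by (simp add: card_Un_disjoint)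
  qed
  show ?thesis unfolding hamiltonian_def PQ K_def cb using s1 s2 s3 by (simp add: split_beta field_simps)
 qed
 thus ?thesis by blast
qed

lemma spin_avg_pm:
 assumes T: "T > 0" and b: "b = 1 \<or> b = -1"
 shows "spin_avg T N b h = b * (1 - 2 * pm (1 / T) (box N) (%x. b * h x) origin)"
proof -
 obtain K where K: "!!M. M \<subseteq> box N ==> hamiltonian N b h (cfg N b M) = 2 * (real (card (bd M)) + (SUM v:M. b * h v)) - K"
  using hamiltonian_cfg[OF b] by blast
 let ?w = "wt (1 / T) (%x. b * h x)"
 have w: "exp (- (1 / T) * hamiltonian N b h (cfg N b M)) = exp (K / T) * ?w M" if "M : Pow (box N)" for M
  using that T unfolding wt_def exp_add[symmetric] by (simp add: K field_simps)
 have o: "origin : box N" unfolding origin_def box_def by simp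
 have S: "(\<Sum>\<sigma>\<in>configs N. F \<sigma>) = (SUM M:Pow (box N). F (cfg N b M))" for F :: "(site => real) => real"
  unfolding configs_cfg(1)[OF b] by (simp add: sum.reindex[OF configs_cfg(2)[OF b]])
 have "spin_avg T N b h = (SUM M:Pow (box N). cfg N b M origin * (exp (K / T) * ?w M)) / (SUM M:Pow (box N). exp (K / T) * ?w M)"
 proof -
  have "spin_avg T N b h = (SUM M:Pow (box N). cfg N b M origin * exp (- (1 / T) * hamiltonian N b h (cfg N b M))) / (SUM M:Pow (box N). exp (- (1 / T) * hamiltonian N b h (cfg N b M)))"
   unfolding spin_avg_def S using T by (simp only: if_True)
  also have "... = (SUM M:Pow (box N). cfg N b M origin * (exp (K / T) * ?w M)) / (SUM M:Pow (box N). exp (K / T) * ?w M)"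
   by (intro arg_cong2[where f = "(/)"] sum.cong refl) (simp_all only: w)
  finally show ?thesis .
 qed
 also have "(SUM M:Pow (box N). cfg N b M origin * (exp (K / T) * ?w M)) = exp (K / T) * (SUM M:Pow (box N). ?w M * cfg N b M origin)"
  by (simp add: sum_distrib_left mult_ac)
 also have "(SUM M:Pow (box N). exp (K / T) * ?w M) = exp (K / T) * (SUM M:Pow (box N). ?w M)" by (rule sum_distrib_left[symmetric])
 also have "exp (K / T) * (SUM M:Pow (box N). ?w M * cfg N b M origin) / (exp (K / T) * (SUM M:Pow (box N). ?w M)) = avg (box N) ?w (%M. cfg N b M origin)"
  unfolding avg_def by simp
 also have "... = avg (box N) ?w (%M. b * (1 - 2 * of_bool (origin : M)))" using o by (simp add: cfg_def)
 also have "... = b * (1 - 2 * pm (1 / T) (box N) (%x. b * h x) origin)"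
  unfolding avg_cmult avg_diff pm_def by (simp only: avg_const[OF finite_box wt_pos])
 finally show ?thesis .
qed

text \<open>After subtraction of the minimum the exponentials converge to the indicator of the
  minimisers. Ties are averaged uniformly, exactly as in \<open>spin_avg\<close> at temperature 0,
  so the limit is available for every field.\<close>

lemma laplace_limit:
 fixes E f :: "'a => real"
 assumes S: "finite S" "S ~= {}"
 defines "G == {x : S. ALL y:S. E x <= E y}"
 shows "(%n. (SUM x:S. f x * exp (- real (Suc n) * E x)) / (SUM x:S. exp (- real (Suc n) * E x))) \<longlonglongrightarrow> (SUM x:G. f x) / real (card G)"
proof -
 define m where "m = Min (E ` S)"
 have m: "m <= E x" if "x : S" for x unfolding m_def using S that by simp
 have "m : E ` S" unfolding m_def using S by (intro Min_in) auto
 then obtain z where z: "z : S" "E z = m" by blast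
 have G: "x : G \<longleftrightarrow> x : S & E x = m" for x
  unfolding G_def using m z by (auto intro!: antisym)
 have "G \<subseteq> S" "z : G" using G z by auto
 hence GS: "G \<subseteq> S" "finite G" "z : G" using finite_subset[OF _ S(1)] by auto
 have t: "(%n. exp (- real (Suc n) * (E x - m))) \<longlonglongrightarrow> of_bool (x : G)" if x: "x : S" for x
 proof (cases "x : G")
  case True
  thus ?thesis using G by simp
 next
  case False
  hence d: "E x - m > 0" using G x m[OF x] by force
  have l0: "(%n. exp (- (E x - m)) ^ Suc n) \<longlonglongrightarrow> 0" using d by (intro LIMSEQ_power_zero[THEN LIMSEQ_Suc]) simp
  have e0: "exp (- (E x - m)) ^ Suc n = exp (- real (Suc n) * (E x - m))" for n by (simp only: exp_of_nat_mult[symmetric]) (simp add: algebra_simps)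
  have "of_bool (x : G) = (0 :: real)" using False by simp
  thus ?thesis using l0 by (simp only: e0)
 qed
 have sG: "(SUM x:S. c x * of_bool (x : G)) = (SUM x:G. c x)" for c :: "'a => real"
 proof -
  have "(SUM x:S. c x * of_bool (x : G)) = (SUM x:S. if x : G then c x else 0)" by (rule sum.cong) auto
  thus ?thesis using GS S by (simp add: sum.inter_restrict[symmetric] Int_absorb1)
 qed
 have L: "(%n. (SUM x:S. f x * exp (- real (Suc n) * (E x - m))) / (SUM x:S. 1 * exp (- real (Suc n) * (E x - m)))) \<longlonglongrightarrow>
   (SUM x:S. f x * of_bool (x : G)) / (SUM x:S. 1 * of_bool (x : G))"
 proof (rule tendsto_divide)
  have "card G > 0" using GS card_gt_0_iff by blast
  thus "(SUM x:S. 1 * of_bool (x : G)) ~= (0 :: real)" unfolding sG by simp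
 qed (intro tendsto_sum tendsto_mult tendsto_const t; assumption)+
 have e: "exp (- real (Suc n) * (E x - m)) = exp (real (Suc n) * m) * exp (- real (Suc n) * E x)" for n x
  unfolding exp_add[symmetric] by (simp add: algebra_simps)
 have "(SUM x:S. f x * exp (- real (Suc n) * (E x - m))) / (SUM x:S. 1 * exp (- real (Suc n) * (E x - m))) =
  (SUM x:S. f x * exp (- real (Suc n) * E x)) / (SUM x:S. exp (- real (Suc n) * E x))" for n
 proof -
  have "(SUM x:S. f x * exp (- real (Suc n) * (E x - m))) = exp (real (Suc n) * m) * (SUM x:S. f x * exp (- real (Suc n) * E x))"
   unfolding e sum_distrib_left by (simp only: mult_ac)
  moreover have "(SUM x:S. 1 * exp (- real (Suc n) * (E x - m))) = exp (real (Suc n) * m) * (SUM x:S. exp (- real (Suc n) * E x))"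
   unfolding e sum_distrib_left by simp
  ultimately show ?thesis by simp
 qed
 thus ?thesis using L unfolding sG by simp
qed

lemma spin_avg_zero_limit:
 "(%n. spin_avg (1 / real (Suc n)) N b h) \<longlonglongrightarrow> spin_avg 0 N b h"
proof -
 have e: "configs N = cfg N 1 ` Pow (box N)" by (rule configs_cfg) simp
 have "finite (configs N)" "configs N ~= {}" unfolding e using finite_box by auto
 from laplace_limit[OF this, of "%\<sigma>. \<sigma> origin" "hamiltonian N b h"] show ?thesis
  unfolding spin_avg_def Let_def by simp
qed

context gauss
begin

lemma spin_gap:
 assumes T: "T > 0"
 shows "spin_avg T N 1 h - spin_avg T N (-1) h = 2 * dd (1 / T) (box N) h origin"
 unfolding spin_avg_pm[OF T disjI1[OF refl]] spin_avg_pm[OF T disjI2[OF refl]] dd_def by simp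

lemma spin_gap_integral:
 assumes T: "T > 0"
 shows "(LINT h|Gm. spin_avg T N 1 h - spin_avg T N (-1) h) = 2 * mm (1 / T) N"
proof -
 have "origin : box N" unfolding origin_def box_def by simp
 hence "(LINT h|Gm. dd (1 / T) (box N) h origin) = ap (1 / T) (box N) (%K. origin : K)" using T by (intro E_dd finite_box) auto
 thus ?thesis unfolding spin_gap[OF T] mm_def box_bx origin_def by simp
qed

text \<open>Dominated convergence along the temperatures 1 / (n + 1), the gap being at most 2 in
  modulus. Measurability at temperature 0 also comes from the limit.\<close>

lemma spin_gap_integral_zero:
 assumes bound: "!!T. T > 0 ==> (LINT h|Gm. spin_avg T N 1 h - spin_avg T N (-1) h) <= c"
 shows "(LINT h|Gm. spin_avg 0 N 1 h - spin_avg 0 N (-1) h) <= c"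
proof -
 define s where "s n h = spin_avg (1 / real (Suc n)) N 1 h - spin_avg (1 / real (Suc n)) N (-1) h" for n h
 define f where "f h = spin_avg 0 N 1 h - spin_avg 0 N (-1) h" for h
 have sd: "s n h = 2 * dd (real (Suc n)) (box N) h origin" for n h unfolding s_def by (subst spin_gap) simp_all
 have sm: "s n : borel_measurable Gm" for n unfolding sd by (intro borel_measurable_times borel_measurable_const dd_measurable coord_measurable)
 have lim: "(%n. s n h) \<longlonglongrightarrow> f h" for h unfolding s_def f_def by (intro tendsto_diff spin_avg_zero_limit)
 have fm: "f : borel_measurable Gm" by (rule borel_measurable_LIMSEQ_real[OF lim sm])
 have sb: "\<bar>s n h\<bar> <= 2" for n h
  unfolding sd dd_def using pm_bounds[OF finite_box, of "real (Suc n)" N h origin] pm_bounds[OF finite_box, of "real (Suc n)" N "%x. - h x" origin] by (simp add: abs_le_iff)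
 have "(%n. \<integral>h. s n h \<partial>Gm) \<longlonglongrightarrow> (LINT h|Gm. f h)"
 proof (rule integral_dominated_convergence[where w = "%_. 2"])
  show "integrable Gm (%_ :: site => real. 2 :: real)" by (rule integrable_bounded[of _ 2]) auto
 qed (use fm sm lim sb in auto)
 moreover have "(LINT h|Gm. s n h) <= c" for n unfolding s_def by (rule bound) simp
 ultimately show ?thesis unfolding f_def by (intro LIMSEQ_le_const2[of _ _ c]) auto
qed

end

theorem theorem1p1:
  fixes eps T :: real
  assumes "eps > 0" and "T \<ge> 0"
  shows "\<exists>c>0. \<forall>N::nat. N \<ge> 1 \<longrightarrow>
    (\<integral>h. (spin_avg T N 1 h - spin_avg T N (-1) h) \<partial>field_measure eps)
      \<le> (1/c) * exp (- c * real N)"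
proof -
  interpret gauss eps by unfold_locales (rule assms(1))
  obtain C c where C: "C > 0" "c > 0" "\<And>\<beta> N. \<beta> > 0 \<Longrightarrow> mm \<beta> N \<le> C * exp (- c * real N)" using mm_exponential by blast
  \<comment> \<open>One constant has to serve as rate and as inverse prefactor: \<open>d\<close>
    must not exceed the rate \<open>c\<close>, and 1 / d must be at least 2 * C.\<close>
  define d where "d = min c (1 / (2 * C))"
  have d: "d > 0" using C by (simp add: d_def)
  have dC: "2 * C \<le> 1 / d"
  proof -
    have "d * (2 * C) \<le> 1 / (2 * C) * (2 * C)" using C(1) by (intro mult_right_mono) (auto simp: d_def)
    then show ?thesis using C(1) d by (simp add: pos_le_divide_eq mult.commute)
  qed
  have pos: "(\<integral>h. spin_avg T N 1 h - spin_avg T N (-1) h \<partial>iid (gm eps)) \<le> (1 / d) * exp (- d * real N)" if "T > 0" for T N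
  proof -
    have "(\<integral>h. spin_avg T N 1 h - spin_avg T N (-1) h \<partial>iid (gm eps)) \<le> 2 * C * exp (- c * real N)"
      unfolding spin_gap_integral[OF that] using C(3)[of "1 / T" N] that by simp
    also have "\<dots> \<le> (1 / d) * exp (- d * real N)"
      using dC C(1) d by (intro mult_mono) (auto simp: d_def mult_right_mono)
    finally show ?thesis .
  qed
  have "(\<integral>h. spin_avg T N 1 h - spin_avg T N (-1) h \<partial>iid (gm eps)) \<le> (1 / d) * exp (- d * real N)" for N
    using pos[of T N] spin_gap_integral_zero[of N, OF pos] assms(2) by (cases "T = 0") auto
  then show ?thesis unfolding field_measure_iid using d by (intro exI[of _ d]) auto
qed

end
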